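(* Let $T>0$ and let $q=q_1+iq_2$ satisfy $q\in L^2_{|t|<T}L^2_{x,\mathrm{loc}}$ and $|q|^2\in L^2_{|t|<T}(H^{-1})$, and suppose that $q$ is a limit of smooth solutions of the nonlinear Schrödinger equation $\partial_tq=i(\partial_x^2q+\frac12|q|^2q)$, i.e. there exist smooth solutions $q_k$ of this equation such that $$q_k\to q\ \text{ in } L^2_{tx,\mathrm{loc}}\quad\text{and}\quad |q_k|^2\to|q|^2\ \text{ in } L^2_{t,\mathrm{loc}}H^{-1}.$$ Then there exist a weak solution $u\in L^2_{|t|<T}(H^1_{\mathrm{loc}})\cap C_{|t|<T}(L^2_{\mathrm{loc}})$ of $$\partial_tu=\partial_x(u\times u_x),\qquad u\in\mathbb{S}^2\subset\mathbb{R}^3,$$ and a frame $\{e,u\times e\}$ of $u^{-1}T\mathbb{S}^2$ with $e\in L^2_{|t|<T}(H^1_{\mathrm{loc}})\cap C_{|t|<T}(L^2_{\mathrm{loc}})$ such that, in the sense of distributions and with $p=p_1+ip_2=iq_x$, $$\begin{aligned}&\partial_tu=p_1e+p_2\,u\times e,\qquad &&\partial_xu=q_1e+q_2\,u\times e,\\ &\partial_te+p_1u=-\tfrac12|q|^2\,u\times e,\qquad &&\partial_xe+q_1u=0 .\end{aligned}$$ Moreover the solution is unique up to isometries of the sphere: if $(u,e)$ and $(\tilde u,\tilde e)$ are two such pairs for the same $q$, there is an isometry of $\mathbb{S}^2$, i.e. the restriction of some $R\in O(3)$, with $\tilde u=Ru$ and $\tilde e=Re$.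
   Context: The space dimension is one: $x\in\mathbb{R}$, $t\in(-T,T)$. $\mathbb{S}^2$ is the unit sphere in $\mathbb{R}^3$ and $\times$ is the cross product. A frame $\{e,u\times e\}$ of $u^{-1}T\mathbb{S}^2$ means $e(t,x)\in T_{u(t,x)}\mathbb{S}^2$, $|e|=1$ (a.e.). $L^2_{|t|<T}(X)$ and $C_{|t|<T}(X)$ denote $L^2((-T,T);X)$ and $C((-T,T);X)$, with $X$ a space of functions of $x$; the subscript $\mathrm{loc}$ denotes the local version. A weak solution is a solution in the sense of distributions. *)

theory Defs
  imports "HOL-Analysis.Analysis"
begin

text \<open>
  Functions of space-time are functions of the pair \<open>z = (t, x) :: real \<times> real\<close>; only their values
  on the strip \<open>|t| < T\<close> matter. Elements of Lebesgue spaces are represented by Borel functions.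
  The symbol \<open>\<times>\<close> in terms is the cross product of \<^theory>\<open>HOL-Analysis.Cross3\<close>.
\<close>

definition strip :: "real \<Rightarrow> (real \<times> real) set" where
  "strip T = {z. \<bar>fst z\<bar> < T}"


unbundle cross3_syntax

section \<open>Smooth functions, test functions, weak derivatives\<close>

definition dderiv :: "'a \<Rightarrow> ('a::euclidean_space \<Rightarrow> 'b::real_normed_vector) \<Rightarrow> 'a \<Rightarrow> 'b" where
  "dderiv v f z = frechet_derivative f (at z) v"

abbreviation dt :: "(real \<times> real \<Rightarrow> 'b::real_normed_vector) \<Rightarrow> real \<times> real \<Rightarrow> 'b" where
  "dt \<equiv> dderiv (1, 0)"

abbreviation dx :: "(real \<times> real \<Rightarrow> 'b::real_normed_vector) \<Rightarrow> real \<times> real \<Rightarrow> 'b" where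
  "dx \<equiv> dderiv (0, 1)"

primrec Ck_on :: "nat \<Rightarrow> 'a::euclidean_space set \<Rightarrow> ('a \<Rightarrow> 'b::real_normed_vector) \<Rightarrow> bool" where
  "Ck_on 0 S f \<longleftrightarrow> continuous_on S f"
| "Ck_on (Suc k) S f \<longleftrightarrow> (\<forall>x\<in>S. f differentiable at x) \<and> (\<forall>v. Ck_on k S (dderiv v f))"

text \<open>Meant for open \<open>S\<close>.\<close>

definition smooth_on :: "'a::euclidean_space set \<Rightarrow> ('a \<Rightarrow> 'b::real_normed_vector) \<Rightarrow> bool" where
  "smooth_on S f \<longleftrightarrow> (\<forall>k. Ck_on k S f)"

definition test_function :: "'a::euclidean_space set \<Rightarrow> ('a \<Rightarrow> real) \<Rightarrow> bool" where
  "test_function S \<phi> \<longleftrightarrow> smooth_on UNIV \<phi> \<and>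
     compact (closure {z. \<phi> z \<noteq> 0}) \<and> closure {z. \<phi> z \<noteq> 0} \<subseteq> S"

definition locally_integrable_on ::
  "'a::euclidean_space set \<Rightarrow> ('a \<Rightarrow> 'b::euclidean_space) \<Rightarrow> bool" where
  "locally_integrable_on S f \<longleftrightarrow> (\<forall>K. compact K \<and> K \<subseteq> S \<longrightarrow> set_integrable lborel K f)"

definition has_weak_dderiv_on ::
  "'a::euclidean_space set \<Rightarrow> 'a \<Rightarrow> ('a \<Rightarrow> 'b::euclidean_space) \<Rightarrow> ('a \<Rightarrow> 'b) \<Rightarrow> bool" where
  "has_weak_dderiv_on S v f g \<longleftrightarrow>
     locally_integrable_on S f \<and> locally_integrable_on S g \<and>
     (\<forall>\<phi>. test_function S \<phi> \<longrightarrow>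
        (LINT z:S|lborel. dderiv v \<phi> z *\<^sub>R f z) = - (LINT z:S|lborel. \<phi> z *\<^sub>R g z))"

text \<open>Unique up to null sets in the strip, if it exists.\<close>

definition weak_dx :: "real \<Rightarrow> (real \<times> real \<Rightarrow> 'b::euclidean_space) \<Rightarrow> real \<times> real \<Rightarrow> 'b" where
  "weak_dx T f = (SOME g. has_weak_dderiv_on (strip T) (0, 1) f g)"


section \<open>Squared norms of functions of \<open>x\<close>\<close>

definition L2_sq :: "'a::euclidean_space set \<Rightarrow> ('a \<Rightarrow> 'b::euclidean_space) \<Rightarrow> ennreal" where
  "L2_sq S f = (\<integral>\<^sup>+z\<in>S. ennreal ((norm (f z))\<^sup>2) \<partial>lborel)"

text \<open>
  The weak derivative being unique up to null sets, the infimum below is over a single value;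
  it is \<open>\<infinity>\<close> if there is no weak derivative.
\<close>

definition H1_sq :: "real set \<Rightarrow> (real \<Rightarrow> 'b::euclidean_space) \<Rightarrow> ennreal" where
  "H1_sq S f = (INF g\<in>{g. has_weak_dderiv_on S 1 f g}. L2_sq S f + L2_sq S g)"

text \<open>
  The norm of \<open>H\<^sup>-\<^sup>1(\<real>) = (H\<^sup>1(\<real>))'\<close> for a locally integrable function, regarded as a functional
  on the test functions, which are dense in \<open>H\<^sup>1(\<real>)\<close>.
\<close>

definition Hm1_sq :: "(real \<Rightarrow> real) \<Rightarrow> ennreal" where
  "Hm1_sq f =
     (if locally_integrable_on UNIV f
      then (SUP \<phi>\<in>{\<phi>. test_function UNIV \<phi> \<and> L2_sq UNIV \<phi> + L2_sq UNIV (dderiv 1 \<phi>) \<le> 1}.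
              ennreal \<bar>LINT x|lborel. f x * \<phi> x\<bar>)\<^sup>2
      else \<infinity>)"


section \<open>Space-time function spaces\<close>

text \<open>
  \<open>L2_time_sq J N f\<close> is the square of the norm of \<open>f\<close> in \<open>L\<^sup>2(J; X)\<close>, where \<open>N\<close> is the square
  of the norm of \<open>X\<close>.
\<close>

definition L2_time_sq ::
  "real set \<Rightarrow> ((real \<Rightarrow> 'b) \<Rightarrow> ennreal) \<Rightarrow> (real \<times> real \<Rightarrow> 'b) \<Rightarrow> ennreal" where
  "L2_time_sq J N f = (\<integral>\<^sup>+t\<in>J. N (\<lambda>x. f (t, x)) \<partial>lborel)"

definition measurable_on_strip :: "real \<Rightarrow> (real \<times> real \<Rightarrow> 'b::euclidean_space) \<Rightarrow> bool" where
  "measurable_on_strip T f \<longleftrightarrow> f \<in> borel_measurable (restrict_space borel (strip T))"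

definition L2_L2loc :: "real \<Rightarrow> (real \<times> real \<Rightarrow> 'b::euclidean_space) \<Rightarrow> bool" where
  "L2_L2loc T f \<longleftrightarrow> measurable_on_strip T f \<and>
     (\<forall>r>0. L2_time_sq {-T<..<T} (L2_sq {-r<..<r}) f < \<infinity>)"

definition L2_H1loc :: "real \<Rightarrow> (real \<times> real \<Rightarrow> 'b::euclidean_space) \<Rightarrow> bool" where
  "L2_H1loc T f \<longleftrightarrow> measurable_on_strip T f \<and>
     (\<forall>r>0. L2_time_sq {-T<..<T} (H1_sq {-r<..<r}) f < \<infinity>)"

definition L2_Hm1 :: "real \<Rightarrow> (real \<times> real \<Rightarrow> real) \<Rightarrow> bool" where
  "L2_Hm1 T f \<longleftrightarrow> measurable_on_strip T f \<and> L2_time_sq {-T<..<T} Hm1_sq f < \<infinity>"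

definition C_L2loc :: "real \<Rightarrow> (real \<times> real \<Rightarrow> 'b::euclidean_space) \<Rightarrow> bool" where
  "C_L2loc T f \<longleftrightarrow> measurable_on_strip T f \<and>
     (\<forall>r>0. \<forall>t\<in>{-T<..<T}.
        L2_sq {-r<..<r} (\<lambda>x. f (t, x)) < \<infinity> \<and>
        ((\<lambda>s. L2_sq {-r<..<r} (\<lambda>x. f (s, x) - f (t, x))) \<longlongrightarrow> 0) (at t within {-T<..<T}))"


section \<open>Distributions on the strip, as functionals on test functions\<close>

definition distr_of ::
  "real \<Rightarrow> (real \<times> real \<Rightarrow> 'b::euclidean_space) \<Rightarrow> (real \<times> real \<Rightarrow> real) \<Rightarrow> 'b" where
  "distr_of T f \<phi> = (LINT z:strip T|lborel. \<phi> z *\<^sub>R f z)"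

definition Dt ::
  "((real \<times> real \<Rightarrow> real) \<Rightarrow> 'b::real_vector) \<Rightarrow> (real \<times> real \<Rightarrow> real) \<Rightarrow> 'b" where
  "Dt F \<phi> = - F (dt \<phi>)"

definition Dx ::
  "((real \<times> real \<Rightarrow> real) \<Rightarrow> 'b::real_vector) \<Rightarrow> (real \<times> real \<Rightarrow> real) \<Rightarrow> 'b" where
  "Dx F \<phi> = - F (dx \<phi>)"

text \<open>
  The product of the distribution \<open>\<partial>\<^sub>x a\<close>, for \<open>a\<close> in \<open>L\<^sup>2L\<^sup>2\<^sub>l\<^sub>o\<^sub>c\<close>, with a function \<open>g\<close> in \<open>L\<^sup>2H\<^sup>1\<^sub>l\<^sub>o\<^sub>c\<close>:
  \<open>(\<partial>\<^sub>x a) g = \<partial>\<^sub>x (a g) - a \<partial>\<^sub>x g\<close>. Needed because \<open>p = i q\<^sub>x\<close> is not a function.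
\<close>

definition Dx_times ::
  "real \<Rightarrow> (real \<times> real \<Rightarrow> real) \<Rightarrow> (real \<times> real \<Rightarrow> 'b::euclidean_space)
     \<Rightarrow> (real \<times> real \<Rightarrow> real) \<Rightarrow> 'b" where
  "Dx_times T a g \<phi> =
     Dx (distr_of T (\<lambda>z. a z *\<^sub>R g z)) \<phi> - distr_of T (\<lambda>z. a z *\<^sub>R weak_dx T g z) \<phi>"


section \<open>The equations\<close>

definition smooth_NLS_solution :: "real \<Rightarrow> (real \<times> real \<Rightarrow> complex) \<Rightarrow> bool" where
  "smooth_NLS_solution T q \<longleftrightarrow> smooth_on (strip T) q \<and>
     (\<forall>z\<in>strip T. dt q z = \<i> * (dx (dx q) z + 1/2 * of_real ((cmod (q z))\<^sup>2) * q z))"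

definition limit_of_smooth_NLS_solutions :: "real \<Rightarrow> (real \<times> real \<Rightarrow> complex) \<Rightarrow> bool" where
  "limit_of_smooth_NLS_solutions T q \<longleftrightarrow>
     (\<exists>qk :: nat \<Rightarrow> real \<times> real \<Rightarrow> complex.
        (\<forall>k. smooth_NLS_solution T (qk k)) \<and>
        (\<forall>K. compact K \<and> K \<subseteq> strip T \<longrightarrow>
           (\<lambda>k. L2_sq K (\<lambda>z. qk k z - q z)) \<longlonglongrightarrow> 0) \<and>
        (\<forall>J. compact J \<and> J \<subseteq> {-T<..<T} \<longrightarrow>
           (\<lambda>k. L2_time_sq J Hm1_sq (\<lambda>z. (cmod (qk k z))\<^sup>2 - (cmod (q z))\<^sup>2)) \<longlonglongrightarrow> 0))"

definition weak_schroedinger_map :: "real \<Rightarrow> (real \<times> real \<Rightarrow> real^3) \<Rightarrow> bool" where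
  "weak_schroedinger_map T u \<longleftrightarrow>
     (AE z in lborel. z \<in> strip T \<longrightarrow> norm (u z) = 1) \<and>
     (\<forall>\<phi>. test_function (strip T) \<phi> \<longrightarrow>
        Dt (distr_of T u) \<phi> = Dx (distr_of T (\<lambda>z. u z \<times> weak_dx T u z)) \<phi>)"

text \<open>\<open>{e, u \<times> e}\<close> is an orthonormal frame of \<open>u\<^sup>-\<^sup>1 T\<S>\<^sup>2\<close>; \<open>e z\<close> is tangent at \<open>u z\<close> iff \<open>u z \<bullet> e z = 0\<close>.\<close>

definition pullback_frame ::
  "real \<Rightarrow> (real \<times> real \<Rightarrow> real^3) \<Rightarrow> (real \<times> real \<Rightarrow> real^3) \<Rightarrow> bool" where
  "pullback_frame T u e \<longleftrightarrow>
     (AE z in lborel. z \<in> strip T \<longrightarrow> u z \<bullet> e z = 0 \<and> norm (e z) = 1)"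

text \<open>Here \<open>p\<^sub>1 = \<partial>\<^sub>x Re (i q)\<close> and \<open>p\<^sub>2 = \<partial>\<^sub>x Im (i q)\<close>.\<close>

definition frame_system ::
  "real \<Rightarrow> (real \<times> real \<Rightarrow> complex) \<Rightarrow> (real \<times> real \<Rightarrow> real^3) \<Rightarrow> (real \<times> real \<Rightarrow> real^3) \<Rightarrow> bool"
  where
  "frame_system T q u e \<longleftrightarrow> (\<forall>\<phi>. test_function (strip T) \<phi> \<longrightarrow>
     Dt (distr_of T u) \<phi> =
       Dx_times T (\<lambda>z. Re (\<i> * q z)) e \<phi> + Dx_times T (\<lambda>z. Im (\<i> * q z)) (\<lambda>z. u z \<times> e z) \<phi> \<and>
     Dx (distr_of T u) \<phi> =
       distr_of T (\<lambda>z. Re (q z) *\<^sub>R e z + Im (q z) *\<^sub>R (u z \<times> e z)) \<phi> \<and>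
     Dt (distr_of T e) \<phi> + Dx_times T (\<lambda>z. Re (\<i> * q z)) u \<phi> =
       distr_of T (\<lambda>z. (- (1/2) * (cmod (q z))\<^sup>2) *\<^sub>R (u z \<times> e z)) \<phi> \<and>
     Dx (distr_of T e) \<phi> + distr_of T (\<lambda>z. Re (q z) *\<^sub>R u z) \<phi> = 0)"

definition solution_pair ::
  "real \<Rightarrow> (real \<times> real \<Rightarrow> complex) \<Rightarrow> (real \<times> real \<Rightarrow> real^3) \<Rightarrow> (real \<times> real \<Rightarrow> real^3) \<Rightarrow> bool"
  where
  "solution_pair T q u e \<longleftrightarrow>
     L2_H1loc T u \<and> C_L2loc T u \<and> weak_schroedinger_map T u \<and>
     L2_H1loc T e \<and> C_L2loc T e \<and> pullback_frame T u e \<and>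
     frame_system T q u e"

end

theory Submission
  imports Defs
begin

text \<open>
  The columns \<open>u\<close>, \<open>e\<close>, \<open>u \<times> e\<close> of a rotation-valued function satisfy the equations of the theorem iff its rows
  \<open>y\<close> satisfy \<open>y\<^sub>x = \<alpha> \<times> y\<close> and \<open>y\<^sub>t = \<beta> \<times> y\<close> with \<open>\<alpha> = (0, Im q, - Re q)\<close> and
  \<open>\<beta> = (|q|\<^sup>2 / 2, Re q\<^sub>x, Im q\<^sub>x)\<close>. These two linear equations are compatible, that is, the connection
  \<open>(\<alpha>, \<beta>)\<close> is flat, precisely if \<open>q\<close> solves the nonlinear Schroedinger equation.

  Existence. For a smooth solution \<open>q\<close> the rows are obtained by parallel transport
  (\<open>flat_connection_parallel_section\<close>). The passage to the limit must not use \<open>q\<^sub>x\<close>. Let \<open>y\<close> and \<open>y'\<close> be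
  parallel for \<open>q\<close> and \<open>q'\<close>. Up to an \<open>x\<close>-derivative of a flux bounded by \<open>|q - q'|\<close>, the time derivative
  of \<open>y \<bullet> y'\<close> is bounded by a multiple of \<open>|q - q'| (1 + |q| + |q'|)\<close>, and \<open>q\<^sub>x\<close> does not occur
  (\<open>parallel_sections_energy\<close>). As \<open>|y - y'|\<^sup>2 = 2 (1 - y \<bullet> y')\<close>, the frames of the approximating
  solutions are Cauchy in \<open>L\<^sup>2\<^sub>l\<^sub>o\<^sub>c\<close>, locally uniformly in time, once they agree at a point \<open>(t\<^sub>0, 0)\<close> of a
  slice on which the solutions converge (\<open>parallel_sections_cauchy\<close>). In divergence form the equations
  of the rows are linear in the row, with coefficients at most quadratic in \<open>q\<close>, so that they pass to the limit
  (\<open>weak_frame_exists\<close>).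

  Uniqueness. On almost every slice of constant time \<open>u\<close> and \<open>e\<close> are primitives of linear expressions in
  the frame, whence two frames for the same \<open>q\<close> differ there by a rotation \<open>G t\<close> (\<open>slice_rotation\<close>). The means of
  \<open>u\<close> and \<open>e\<close> against functions of \<open>x\<close> are absolutely continuous in \<open>t\<close>, and \<open>G t\<close> rotates both these means
  and their derivatives into those of the other frame. This forces \<open>G\<close> to be constant, although nothing
  is known about its regularity (\<open>rotating_curves_rigid\<close>). Continuity in time extends the conclusion
  to every time (\<open>weak_frame_unique\<close>).
\<close>

section \<open>Smooth functions and test functions\<close>

lemma dderiv_eqI: "(f has_derivative f') (at z) ==> dderiv v f z = f' v"
 unfolding dderiv_def using frechet_derivative_at by metis

lemma differentiable_frechet:
 "f differentiable (at x) ==> (f has_derivative (%v. dderiv v f x)) (at x)"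
 unfolding dderiv_def by (simp add: frechet_derivative_works)

lemma Ck_on_Suc_imp: "Ck_on (Suc k) S f ==> Ck_on k S f"
proof (induction k arbitrary: f)
 case 0
 then have "\<forall>x\<in>S. isCont f x" by (simp add: differentiable_imp_continuous_within)
 then show ?case by (simp add: continuous_at_imp_continuous_on)
next
 case (Suc k)
 then show ?case by (simp only: Ck_on.simps(2)) blast
qed

lemma smooth_on_dderiv: "smooth_on S f ==> smooth_on S (dderiv v f)"
 unfolding smooth_on_def by (metis Ck_on.simps(2))

lemma smooth_on_continuous: "smooth_on S f ==> continuous_on S f"
 unfolding smooth_on_def by (metis Ck_on.simps(1))

lemma smooth_on_has_derivative:
 assumes "smooth_on S f" "x \<in> S"
 shows "(f has_derivative (%v. dderiv v f x)) (at x)"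
 using assms unfolding smooth_on_def by (metis Ck_on.simps(2) differentiable_frechet)

lemma smooth_real_has_derivative:
 assumes "smooth_on UNIV (\<phi> :: real => 'b::real_normed_vector)"
 shows "(\<phi> has_vector_derivative dderiv 1 \<phi> x) (at x)"
proof -
 have d: "(\<phi> has_derivative (%v. dderiv v \<phi> x)) (at x)"
  using smooth_on_has_derivative[OF assms] by simp
 interpret bounded_linear "%v. dderiv v \<phi> x" using d by (rule has_derivative_bounded_linear)
 have "(%v. dderiv v \<phi> x) = (%v. v *\<^sub>R dderiv 1 \<phi> x)"
 proof
  fix v show "dderiv v \<phi> x = v *\<^sub>R dderiv 1 \<phi> x" using scaleR[of v 1] by simp
 qed
 then show ?thesis using d by (simp add: has_vector_derivative_def)
qed

lemma Ck_add:
 fixes f g :: "'a::euclidean_space => 'b::real_normed_vector"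
 shows "Ck_on k UNIV f ==> Ck_on k UNIV g ==> Ck_on k UNIV (%x. f x + g x)"
proof (induction k arbitrary: f g)
 case 0 then show ?case by (auto intro: continuous_on_add)
next
 case (Suc k)
 have eq: "dderiv v (%x. f x + g x) = (%x. dderiv v f x + dderiv v g x)" for v
 proof
  fix x
  have "f differentiable (at x)" "g differentiable (at x)" using Suc.prems by simp_all
  from dderiv_eqI[OF has_derivative_add[OF this[THEN differentiable_frechet]]]
  show "dderiv v (%x. f x + g x) x = dderiv v f x + dderiv v g x" .
 qed
 show ?case using Suc by (auto simp: eq)
qed

lemma Ck_mult:
 fixes f g :: "'a::euclidean_space => real"
 shows "Ck_on k UNIV f ==> Ck_on k UNIV g ==> Ck_on k UNIV (%x. f x * g x)"
proof (induction k arbitrary: f g)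
 case 0 then show ?case by (auto intro: continuous_on_mult)
next
 case (Suc k)
 have eq: "dderiv v (%x. f x * g x) = (%x. f x * dderiv v g x + dderiv v f x * g x)" for v
 proof
  fix x
  have "f differentiable (at x)" "g differentiable (at x)" using Suc.prems by simp_all
  from dderiv_eqI[OF has_derivative_mult[OF this[THEN differentiable_frechet]]]
  show "dderiv v (%x. f x * g x) x = f x * dderiv v g x + dderiv v f x * g x" .
 qed
 have "Ck_on k UNIV f" "Ck_on k UNIV g"
  using Ck_on_Suc_imp[OF Suc.prems(1)] Ck_on_Suc_imp[OF Suc.prems(2)] by simp_all
 then show ?case using Suc by (auto simp: eq intro!: Ck_add)
qed

lemma Ck_affine:
 fixes f :: "'b::euclidean_space => 'c::real_normed_vector" and l :: "'a::euclidean_space => 'b"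
 assumes l: "bounded_linear l"
 shows "Ck_on k UNIV f ==> Ck_on k UNIV (%x. f (l x + c))"
proof (induction k arbitrary: f)
 case 0
 have "continuous_on UNIV (%x. l x + c)"
  by (intro continuous_on_add linear_continuous_on l continuous_on_const)
 then show ?case using 0 by (auto intro: continuous_on_compose2[of UNIV f])
next
 case (Suc k)
 have der: "((%x. f (l x + c)) has_derivative (%v. dderiv (l v) f (l x + c))) (at x)" for x
 proof -
  have 1: "((%x. l x + c) has_derivative l) (at x)"
   by (auto intro!: derivative_eq_intros bounded_linear_imp_has_derivative l)
  have 2: "(f has_derivative (%v. dderiv v f (l x + c))) (at (l x + c))"
   by (rule differentiable_frechet) (use Suc.prems in auto)
  show ?thesis using has_derivative_compose[OF 1 2] by simp
 qed
 have eq: "dderiv v (%x. f (l x + c)) = (%x. dderiv (l v) f (l x + c))" for v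
  using dderiv_eqI[OF der] by auto
 show ?case using Suc der by (auto simp: eq differentiable_def)
qed

lemma Ck_const: "Ck_on k UNIV (%x::'a::euclidean_space. c::'b::real_normed_vector)"
proof (induction k arbitrary: c)
 case (Suc k)
 have "dderiv v (%x::'a. c::'b) = (%x. 0)" for v
  using dderiv_eqI[of "%x::'a. c" "%_. 0"] by auto
 then show ?case using Suc by auto
qed auto

lemma smooth_on_mult:
 "smooth_on UNIV f ==> smooth_on UNIV g ==> smooth_on UNIV (%x::'a::euclidean_space. f x * g x :: real)"
 unfolding smooth_on_def by (intro allI Ck_mult) auto

lemma smooth_on_add:
 "smooth_on UNIV f ==> smooth_on UNIV g ==>
  smooth_on UNIV (%x::'a::euclidean_space. f x + g x :: 'b::real_normed_vector)"
 unfolding smooth_on_def by (intro allI Ck_add) auto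

lemma smooth_on_const: "smooth_on UNIV (%x::'a::euclidean_space. c::'b::real_normed_vector)"
 unfolding smooth_on_def by (intro allI Ck_const)

lemma smooth_on_affine:
 "bounded_linear l ==> smooth_on UNIV f ==>
  smooth_on UNIV (%x::'a::euclidean_space. f (l x + c::'b::euclidean_space) :: 'c::real_normed_vector)"
 unfolding smooth_on_def by (intro allI Ck_affine) auto

lemma Ck_real_antiderivative:
 fixes f g :: "real => real"
 assumes "!!x. (f has_real_derivative g x) (at x)" "Ck_on k UNIV g"
 shows "Ck_on (Suc k) UNIV f"
proof -
 have "dderiv v f = (%x. v * g x)" for v
  using dderiv_eqI[OF assms(1)[unfolded has_field_derivative_def]] by (auto simp: mult.commute)
 moreover have "f differentiable (at x)" for x
  using assms(1) real_differentiable_def by blast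
 ultimately show ?thesis using Ck_mult[OF Ck_const assms(2)] by auto
qed

lemma smooth_on_real_antiderivative:
 fixes f g :: "real => real"
 assumes "!!x. (f has_real_derivative g x) (at x)" "smooth_on UNIV g"
 shows "smooth_on UNIV f"
 unfolding smooth_on_def
proof
 fix k
 have "Ck_on k UNIV g" using assms(2) unfolding smooth_on_def by simp
 from Ck_on_Suc_imp[OF Ck_real_antiderivative[OF assms(1) this]] show "Ck_on k UNIV f" .
qed

text \<open>The functions \<open>x\<^sup>-\<^sup>n exp (-1/x)\<close>, extended by zero, form a family that is closed under
  differentiation up to linear combinations; hence all of them are smooth.\<close>

definition flat_exp :: "nat => real => real" where
 "flat_exp n x = (if x > 0 then exp (- inverse x) * inverse x ^ n else 0)"

lemma flat_exp_tendsto_0: "((%x. exp (- inverse x) * inverse x ^ n) \<longlongrightarrow> 0) (at_right (0::real))"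
proof -
 have "((%y. y ^ n * exp (- y)) \<longlongrightarrow> 0) (at_top::real filter)"
  using tendsto_power_div_exp_0[of n] by (simp add: exp_minus divide_inverse)
 from filterlim_compose[OF this filterlim_inverse_at_top_right] show ?thesis
  by (simp add: mult.commute)
qed

lemma flat_exp_deriv:
 "(flat_exp n has_real_derivative (flat_exp (n+2) x - real n * flat_exp (n+1) x)) (at x)"
proof -
 consider "x > 0" | "x < 0" | "x = 0" by linarith
 then show ?thesis
 proof cases
  case 1
  have "((%x. exp (- inverse x) * inverse x ^ n) has_real_derivative
   (flat_exp (n+2) x - real n * flat_exp (n+1) x)) (at x)"
   using 1
   by (cases n; intro derivative_eq_intros refl)
    (auto simp: flat_exp_def algebra_simps power2_eq_square)
  then show ?thesis
   by (rule DERIV_cong_ev[THEN iffD1, rotated 3])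
    (use 1 in \<open>auto simp: flat_exp_def intro!: eventually_mono[OF eventually_gt_at_top]
     eventually_nhds_in_open[of "{0<..}", THEN eventually_mono]\<close>)
 next
  case 2
  have "((%x. 0) has_real_derivative (flat_exp (n+2) x - real n * flat_exp (n+1) x)) (at x)"
   using 2 by (auto simp: flat_exp_def)
  then show ?thesis
   by (rule has_field_derivative_transform_within_open[where S="{..<0}"])
    (use 2 in \<open>auto simp: flat_exp_def\<close>)
 next
  case 3
  have "((%h. (flat_exp n (0 + h) - flat_exp n 0) / h) \<longlongrightarrow> 0) (at 0)"
  proof (subst filterlim_at_split, intro conjI)
   show "((%h. (flat_exp n (0 + h) - flat_exp n 0) / h) \<longlongrightarrow> 0) (at_left 0)"
    by (rule tendsto_eventually)
     (auto simp: flat_exp_def eventually_at_filter intro!: always_eventually)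
   show "((%h. (flat_exp n (0 + h) - flat_exp n 0) / h) \<longlongrightarrow> 0) (at_right 0)"
    by (rule Lim_transform_eventually[OF flat_exp_tendsto_0[of "Suc n"]])
     (auto simp: flat_exp_def eventually_at_filter field_simps intro!: always_eventually)
  qed
  then show ?thesis using 3 by (simp add: DERIV_def flat_exp_def)
 qed
qed

lemma Ck_flat_exp: "Ck_on k UNIV (flat_exp n)"
proof (induction k arbitrary: n)
 case 0
 show ?case by (auto intro!: continuous_at_imp_continuous_on DERIV_isCont[OF flat_exp_deriv])
next
 case (Suc k)
 have "Ck_on k UNIV (%x. flat_exp (n+2) x + (- real n) * flat_exp (n+1) x)"
  by (intro Ck_add Ck_mult Ck_const Suc)
 then show ?case using flat_exp_deriv[of n] by (intro Ck_real_antiderivative) auto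
qed

text \<open>Smooth approximations of the indicator of an open interval, to which they converge as \<open>n\<close> tends to infinity.\<close>

definition plateau :: "nat => real => real => real => real" where
 "plateau n a b x = flat_exp 0 (real n * (x - a)) * flat_exp 0 (real n * (b - x))"

lemma smooth_plateau: "smooth_on UNIV (plateau n a b)"
proof -
 have "smooth_on UNIV (%x. flat_exp 0 (real n * x + (- real n * a)) * flat_exp 0 ((- real n) * x + real n * b))"
  by (intro smooth_on_mult smooth_on_affine bounded_linear_mult_right) (auto simp: smooth_on_def Ck_flat_exp)
 then show ?thesis by (simp add: plateau_def[abs_def] algebra_simps)
qed

lemma flat_exp_bounds: "0 <= flat_exp 0 x" "flat_exp 0 x <= 1"
 by (simp_all add: flat_exp_def)

lemma plateau_bounds: "0 <= plateau n a b x" "plateau n a b x <= 1"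
 unfolding plateau_def by (simp_all add: mult_le_one flat_exp_bounds)

lemma plateau_eq_0: "x <= a \<or> b <= x ==> plateau n a b x = 0"
 by (auto simp: plateau_def flat_exp_def zero_less_mult_iff)

lemma plateau_pos: "a < x ==> x < b ==> n > 0 ==> 0 < plateau n a b x"
 by (auto simp: plateau_def flat_exp_def)

lemma plateau_tendsto: "(%n. plateau n a b x) \<longlonglongrightarrow> indicator {a<..<b} x"
proof (cases "a < x \<and> x < b")
 case True
 have *: "(%n. exp (- inverse (real n * c))) \<longlonglongrightarrow> 1" if "c > 0" for c :: real
 proof -
  have "(%n. exp (- (inverse (real n) * inverse c))) \<longlonglongrightarrow> exp (- (0 * inverse c))"
   by (intro tendsto_intros lim_inverse_n)
  then show ?thesis by (simp add: mult.commute)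
 qed
 have "(%n. exp (- inverse (real n * (x - a))) * exp (- inverse (real n * (b - x)))) \<longlonglongrightarrow> 1 * 1"
  using True by (intro tendsto_mult *) auto
 then have "(%n. plateau n a b x) \<longlonglongrightarrow> 1 * 1"
  by (rule Lim_transform_eventually)
   (use True in \<open>auto simp: plateau_def flat_exp_def intro!: eventually_mono[OF eventually_gt_at_top[of 0]]\<close>)
 then show ?thesis using True by simp
next
 case False
 then show ?thesis using plateau_eq_0[of x a b] by (auto simp: indicator_def)
qed

lemma continuous_plateau: "continuous_on A (plateau n a b)"
 using smooth_on_continuous[OF smooth_plateau] continuous_on_subset by blast

lemma test_functionI:
 fixes \<phi> :: "'a::euclidean_space => real"
 assumes "smooth_on UNIV \<phi>" "compact K" "K <= S" "!!x. x \<notin> K ==> \<phi> x = 0"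
 shows "test_function S \<phi>"
proof -
 have "closure {z. \<phi> z \<noteq> 0} <= K"
  using assms by (intro closure_minimal compact_imp_closed) auto
 then show ?thesis using assms unfolding test_function_def
  by (metis closed_closure compact_Int_closed inf.absorb2 subset_trans)
qed

lemma test_function_tensor:
 assumes "smooth_on UNIV \<eta>" "!!t. t \<notin> {a..b} ==> \<eta> t = 0" "-T < a" "b < T"
  "smooth_on UNIV \<phi>" "!!x. x \<notin> {c..d} ==> \<phi> x = 0"
 shows "test_function (strip T) (%z. \<eta> (fst z) * \<phi> (snd z))"
proof (rule test_functionI[of _ "cbox (a, c) (b, d)"])
 show "smooth_on UNIV (%z. \<eta> (fst z) * \<phi> (snd z))"
  using smooth_on_mult[OF smooth_on_affine[OF bounded_linear_fst assms(1), of 0]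
    smooth_on_affine[OF bounded_linear_snd assms(5), of 0]] by simp
 show "compact (cbox (a, c) (b, d))" by (rule compact_cbox)
 show "cbox (a, c) (b, d) <= strip T"
  using assms(3,4) by (auto simp: strip_def cbox_Pair_eq)
 fix z assume "z \<notin> cbox (a, c) (b, d)"
 then show "\<eta> (fst z) * \<phi> (snd z) = 0"
  using assms(2,6) by (cases z) (auto simp: cbox_Pair_eq)
qed

lemma dt_dx_tensor:
 assumes "smooth_on UNIV \<eta>" "smooth_on UNIV \<phi>"
 shows "dt (%z. \<eta> (fst z) * \<phi> (snd z)) z = dderiv 1 \<eta> (fst z) * (\<phi> (snd z) :: real)"
  and "dx (%z. \<eta> (fst z) * \<phi> (snd z)) z = \<eta> (fst z) * dderiv 1 \<phi> (snd z)"
proof -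
 have "((%z. \<eta> (fst z) * \<phi> (snd z)) has_derivative
  (%v. \<eta> (fst z) * (snd v * dderiv 1 \<phi> (snd z)) + fst v * dderiv 1 \<eta> (fst z) * \<phi> (snd z))) (at z)"
  using has_derivative_mult[OF has_derivative_compose[OF has_derivative_fst[OF has_derivative_ident]
     smooth_real_has_derivative[OF assms(1), unfolded has_vector_derivative_def]]
    has_derivative_compose[OF has_derivative_snd[OF has_derivative_ident]
     smooth_real_has_derivative[OF assms(2), unfolded has_vector_derivative_def]]]
  by simp
 note d = dderiv_eqI[OF this]
 show "dt (%z. \<eta> (fst z) * \<phi> (snd z)) z = dderiv 1 \<eta> (fst z) * (\<phi> (snd z) :: real)"
  and "dx (%z. \<eta> (fst z) * \<phi> (snd z)) z = \<eta> (fst z) * dderiv 1 \<phi> (snd z)"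
  by (simp_all add: d)
qed

lemma dderiv_support:
 assumes "closed K" "!!x. x \<notin> K ==> f x = 0" "x \<notin> K"
 shows "dderiv v f x = 0"
proof -
 have "(f has_derivative (%_. 0)) (at x)"
  by (rule has_derivative_transform_within_open[of "%_. 0" _ _ UNIV "-K"])
   (use assms in auto)
 then show ?thesis using dderiv_eqI by blast
qed

text \<open>A test function of integral zero is the derivative of a test function with support in the
  same interval.\<close>

lemma smooth_primitive:
 fixes \<psi> :: "real => real"
 assumes s: "smooth_on UNIV \<psi>" and supp: "!!x. x \<notin> {a..b} ==> \<psi> x = 0" and "a <= b"
  and int: "integral {a..b} \<psi> = 0"
 obtains \<eta> where "smooth_on UNIV \<eta>" "!!x. x \<notin> {a..b} ==> \<eta> x = 0"
  "!!x. (\<eta> has_real_derivative \<psi> x) (at x)" "dderiv 1 \<eta> = \<psi>"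
proof -
 have c: "continuous_on UNIV \<psi>" using s smooth_on_continuous by blast
 have "\<exists>F. \<forall>x. -\<infinity> < ereal x --> ereal x < \<infinity> --> (F has_vector_derivative \<psi> x) (at x)"
  using einterval_antiderivative[of "-\<infinity>" "\<infinity>" \<psi>] c continuous_on_eq_continuous_at[of UNIV] by auto
 then obtain F where F: "!!x. (F has_real_derivative \<psi> x) (at x)"
  using has_real_derivative_iff_has_vector_derivative by auto
 define \<eta> where "\<eta> x = F x - F a" for x
 have d: "(\<eta> has_real_derivative \<psi> x) (at x)" for x
  unfolding \<eta>_def using F by (auto intro!: derivative_eq_intros)
 have "(\<psi> has_integral (F b - F a)) {a..b}"
  using fundamental_theorem_of_calculus[of a b F \<psi>] F \<open>a <= b\<close>
  by (meson has_field_derivative_at_within has_real_derivative_iff_has_vector_derivative)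
 then have ba: "\<eta> b = 0" using int by (simp add: \<eta>_def integral_unique)
 have const: "\<eta> y = \<eta> x" if "x < y" "!!s. x < s ==> s < y ==> \<psi> s = 0" for x y
 proof -
  have "continuous_on {x..y} \<eta>"
   by (auto intro!: continuous_at_imp_continuous_on DERIV_isCont d)
  moreover have "(\<eta> has_real_derivative 0) (at s)" if s: "x < s" "s < y" for s
   using d[of s] \<open>!!s. x < s ==> s < y ==> \<psi> s = 0\<close>[OF s] by simp
  ultimately show ?thesis using DERIV_isconst_end[of x y \<eta>] \<open>x < y\<close> by blast
 qed
 have "\<eta> x = 0" if "x \<notin> {a..b}" for x
 proof (cases "x < a")
  case True
  then show ?thesis using const[of x a] supp by (simp add: \<eta>_def)
 next
  case False
  then have xb: "b < x" using that by auto
  then show ?thesis using const[of b x] supp ba by simp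
 qed
 moreover have "dderiv 1 \<eta> = \<psi>"
  using dderiv_eqI[OF d[unfolded has_field_derivative_def]] by auto
 ultimately show ?thesis using that[of \<eta>] d smooth_on_real_antiderivative[OF d s] by blast
qed

section \<open>Functions that vanish, or are constant, in the sense of distributions\<close>

lemma integrable_weight:
 fixes h :: "'a::euclidean_space => 'b::euclidean_space"
 assumes h: "set_integrable lborel K h" and w: "w \<in> borel_measurable borel"
  and b: "!!x. \<bar>w x\<bar> <= (M::real)" and s: "!!x. x \<notin> K ==> w x = 0"
 shows "integrable lborel (%x. w x *\<^sub>R h x)"
proof -
 have eq: "(%x. w x *\<^sub>R h x) = (%x. w x *\<^sub>R (indicator K x *\<^sub>R h x))"
  by (rule ext) (use s in \<open>auto simp: indicator_def\<close>)
 have [measurable]: "(%x. indicator K x *\<^sub>R h x) \<in> borel_measurable lborel"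
  using h unfolding set_integrable_def by auto
 note w[measurable]
 show ?thesis unfolding eq
 proof (rule Bochner_Integration.integrable_bound)
  show "integrable lborel (%x. M *\<^sub>R (indicator K x *\<^sub>R h x))"
   using h unfolding set_integrable_def by (rule integrable_scaleR_right)
  have "norm (w x *\<^sub>R (indicator K x *\<^sub>R h x)) <= norm (M *\<^sub>R (indicator K x *\<^sub>R h x))" for x
   using mult_right_mono[of "\<bar>w x\<bar>" "\<bar>M\<bar>" "\<bar>indicator K x\<bar> * norm (h x)"]
    order_trans[OF b[of x] abs_ge_self] by (simp add: abs_mult mult.assoc)
  then show "AE x in lborel. norm (w x *\<^sub>R (indicator K x *\<^sub>R h x)) <= norm (M *\<^sub>R (indicator K x *\<^sub>R h x))"
   by simp
 qed measurable
qed

lemma continuous_compact_support_bounded: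
 fixes w :: "'a::euclidean_space => real"
 assumes "continuous_on UNIV w" "compact K" "!!x. x \<notin> K ==> w x = 0"
 obtains M where "!!x. \<bar>w x\<bar> <= M" "M > 0"
proof -
 have "bounded (w ` K)"
  by (intro compact_imp_bounded compact_continuous_image assms continuous_on_subset[OF assms(1)]) simp
 then obtain M where M: "M > 0" "!!x. x \<in> K ==> \<bar>w x\<bar> <= M"
  unfolding bounded_pos by auto
 show ?thesis
 proof (rule that)
  show "\<bar>w x\<bar> <= M" for x using M assms(3)[of x] by (cases "x \<in> K") auto
 qed (rule M)
qed

lemma integrable_continuous_weight:
 fixes h :: "'a::euclidean_space => 'b::euclidean_space"
 assumes h: "set_integrable lborel K h" and w: "continuous_on UNIV w"
  and K: "compact K" and s: "!!x. x \<notin> K ==> w x = (0::real)"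
 shows "integrable lborel (%x. w x *\<^sub>R h x)"
proof -
 obtain M where "!!x. \<bar>w x\<bar> <= M" using continuous_compact_support_bounded[OF w K s] by blast
 then show ?thesis
  using integrable_weight[OF h borel_measurable_continuous_onI[OF w] _ s] by blast
qed

lemma weights_tendsto_indicator:
 fixes h :: "'a::euclidean_space => 'b::euclidean_space"
 assumes h: "set_integrable lborel K h" and wm: "!!n. w n \<in> borel_measurable borel"
  and b: "!!n x. \<bar>w n x\<bar> <= (1::real)" and s: "!!n x. x \<notin> K ==> w n x = 0"
  and lim: "!!x. (%n. w n x) \<longlonglongrightarrow> indicator B x" and "B <= K" and B: "B \<in> sets borel"
 shows "(%n. LBINT x. w n x *\<^sub>R h x) \<longlonglongrightarrow> (LBINT x:B. h x)"
proof -
 have eq: "(%x. w n x *\<^sub>R h x) = (%x. w n x *\<^sub>R (indicator K x *\<^sub>R h x))" for n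
  by (rule ext) (use s in \<open>auto simp: indicator_def\<close>)
 have eqB: "(LBINT x:B. h x) = (LBINT x. indicator B x *\<^sub>R (indicator K x *\<^sub>R h x))"
  unfolding set_lebesgue_integral_def using \<open>B <= K\<close>
  by (intro Bochner_Integration.integral_cong) (auto simp: indicator_def)
 have [measurable]: "(%x. indicator K x *\<^sub>R h x) \<in> borel_measurable lborel"
  using h unfolding set_integrable_def by auto
 note wm[measurable] B[measurable]
 show ?thesis unfolding eq eqB
 proof (rule integral_dominated_convergence[where w="%x. norm (indicator K x *\<^sub>R h x)"])
  show "integrable lborel (%x. norm (indicator K x *\<^sub>R h x))"
   using h unfolding set_integrable_def by (rule integrable_norm)
  show "AE x in lborel. (%i. w i x *\<^sub>R indicat_real K x *\<^sub>R h x)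
    \<longlonglongrightarrow> indicat_real B x *\<^sub>R indicat_real K x *\<^sub>R h x"
   by (intro AE_I2 tendsto_scaleR lim tendsto_const)
  show "AE x in lborel. norm (w i x *\<^sub>R indicat_real K x *\<^sub>R h x)
     <= norm (indicat_real K x *\<^sub>R h x)" for i
   using mult_right_mono[OF b, of "\<bar>indicat_real K x\<bar> * norm (h x)" for x]
   by (intro AE_I2) (simp add: abs_mult mult.assoc)
 qed measurable
qed

lemma AE_zero_box:
 fixes h :: "'a::euclidean_space => 'b::euclidean_space"
 assumes int: "set_integrable lborel (box a b) h"
  and zero: "!!c d. box c d <= box a b ==> (LBINT x:box c d. h x) = 0"
 shows "AE x in lborel. x \<in> box a b --> h x = 0"
proof -
 define g where "g = (%x. indicator (box a b) x *\<^sub>R h x)"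
 have g: "integrable lborel g" using int unfolding g_def set_integrable_def .
 have gA: "set_integrable lborel A g" if "A \<in> sets borel" for A
  using g that unfolding set_integrable_def by (simp add: integrable_mult_indicator)
 have "(LBINT x:A. g x) = 0" if A: "A \<in> sets borel" for A
 proof -
  have "Int_stable (range (%(a, b). box a b :: 'a set))"
   by (auto simp: Int_stable_def box_Int_box)
  moreover have "(range (%(a, b). box a b)) <= Pow (UNIV :: 'a set)" by auto
  moreover have "A \<in> sigma_sets UNIV (range (%(a, b). box a b))"
   using A unfolding borel_eq_box by simp
  ultimately show ?thesis
  proof (induction rule: sigma_sets_induct_disjoint)
   case (basic A)
   then obtain c d where A: "A = box c d" by auto
   obtain c' d' where cd: "box c d \<inter> box a b = box c' d'" using box_Int_box[of c d a b] by blast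
   have "(LBINT x:A. g x) = (LBINT x:box c' d'. h x)"
    unfolding set_lebesgue_integral_def g_def A cd[symmetric]
    by (intro Bochner_Integration.integral_cong) (auto simp: indicator_def)
   also have "... = 0" using zero[of c' d'] cd by auto
   finally show ?case .
  next
   case empty then show ?case by (simp add: set_lebesgue_integral_def)
  next
   case (compl A)
   then have Am[measurable]: "A \<in> sets borel" by (simp add: borel_eq_box)
   have "(LBINT x:UNIV. g x) = (LBINT x:A. g x) + (LBINT x:UNIV - A. g x)"
    by (subst set_integral_Un[symmetric]) (auto intro!: gA)
   moreover have "(LBINT x:UNIV. g x) = (LBINT x:box a b. h x)"
    by (simp add: set_lebesgue_integral_def g_def)
   ultimately show ?case using compl zero[of a b] by simp
  next
   case (union F)
   then have "!!i. F i \<in> sets borel" by (simp add: borel_eq_box subset_eq)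
   then have "(LINT x:(\<Union>i. F i)|lborel. g x) = (\<Sum>i. (LBINT x:(F i). g x))"
    using union(1)
    by (intro lebesgue_integral_countable_add gA) (auto simp: disjoint_family_on_def)
   then show ?case using union.IH by simp
  qed
 qed
 then have "AE x in lborel. g x = 0" using sigma_finite_measure.density_zero[OF sigma_finite_lborel g] by simp
 then show ?thesis by (rule AE_mp) (auto simp: g_def)
qed

lemma AE_open_if_AE_box:
 fixes S :: "'a::euclidean_space set"
 assumes "open S" and box: "!!a b. cbox a b <= S ==> AE x in lborel. x \<in> box a b --> P x"
 shows "AE x in lborel. x \<in> S --> P x"
proof -
 define \<F> where "\<F> = {box a b | a b. cbox a b <= S}"
 obtain \<F>' where F': "\<F>' <= \<F>" "countable \<F>'" "\<Union>\<F>' = \<Union>\<F>"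
  using Lindelof[of \<F>] by (auto simp: \<F>_def)
 have "S <= \<Union>\<F>"
 proof
  fix x assume "x \<in> S"
  then obtain a b where "x \<in> box a b" "cbox a b <= S"
   using open_contains_cbox[OF \<open>open S\<close>] by metis
  then show "x \<in> \<Union>\<F>" unfolding \<F>_def by auto
 qed
 moreover have "AE x in lborel. \<forall>B\<in>\<F>'. x \<in> B --> P x"
  using F' box by (subst AE_ball_countable) (auto simp: \<F>_def)
 ultimately show ?thesis using F'(3) by (elim AE_mp) (auto intro!: AE_I2)
qed

lemma AE_zero_open:
 fixes h :: "'a::euclidean_space => 'b::euclidean_space"
 assumes "open S" and int: "!!a b. cbox a b <= S ==> set_integrable lborel (cbox a b) h"
  and zero: "!!a b. cbox a b <= S ==> (LBINT x:box a b. h x) = 0"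
 shows "AE x in lborel. x \<in> S --> h x = 0"
proof (rule AE_open_if_AE_box[OF \<open>open S\<close>])
 fix a b assume ab: "cbox a b <= S"
 show "AE x in lborel. x \<in> box a b --> h x = 0"
 proof (rule AE_zero_box)
  show "set_integrable lborel (box a b) h"
   using int[OF ab] by (rule set_integrable_subset) (auto intro: subsetD[OF box_subset_cbox])
  fix c d assume cd: "box c d <= box a b"
  show "(LBINT x:box c d. h x) = 0"
  proof (cases "box c d = {}")
   case False
   then have "cbox c d <= cbox a b" using cd by (metis closure_box closure_mono box_eq_empty(1) cd subset_empty)
   then show ?thesis using zero ab by blast
  qed (simp add: set_lebesgue_integral_def)
 qed
qed

lemma fundamental_lemma_real:
 fixes h :: "real => 'b::euclidean_space"
 assumes "open I" and int: "!!a b. {a..b} <= I ==> set_integrable lborel {a..b} h"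
  and zero: "!!\<psi> a b. smooth_on UNIV \<psi> ==> {a..b} <= I ==> (!!x. x \<notin> {a..b} ==> \<psi> x = 0) ==>
   (LBINT x. \<psi> x *\<^sub>R h x) = 0"
 shows "AE x in lborel. x \<in> I --> h x = 0"
proof (rule AE_zero_open[OF \<open>open I\<close>])
 fix a b assume ab: "cbox a b <= I"
 show i: "set_integrable lborel (cbox a b) h" using ab int[of a b] by simp
 have "(%n. LBINT x. plateau n a b x *\<^sub>R h x) \<longlonglongrightarrow> (LBINT x:box a b. h x)"
  using plateau_bounds by (intro weights_tendsto_indicator[OF i])
   (auto simp: plateau_eq_0 plateau_tendsto intro!: borel_measurable_continuous_onI continuous_plateau)
 moreover have "(LBINT x. plateau n a b x *\<^sub>R h x) = 0" for n
  using ab by (intro zero[of _ a b] smooth_plateau) (auto simp: plateau_eq_0)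
 ultimately show "(LBINT x:box a b. h x) = 0" using LIMSEQ_unique[OF _ tendsto_const] by simp
qed

lemma open_strip: "open (strip T)"
 unfolding strip_def by (intro open_Collect_less continuous_intros)

text \<open>Products of plateaus converge to indicators of open boxes. Hence \<open>h\<close> has integral zero over boxes, and these determine it.\<close>

lemma fundamental_lemma_strip:
 fixes h :: "real \<times> real => 'b::euclidean_space"
 assumes int: "!!a b. cbox a b <= strip T ==> set_integrable lborel (cbox a b) h"
  and zero: "!!\<eta> \<psi> a b c d. smooth_on UNIV \<eta> ==> smooth_on UNIV \<psi> ==> -T < a ==> b < T ==>
   (!!x. x \<notin> {a..b} ==> \<eta> x = 0) ==> (!!x. x \<notin> {c..d} ==> \<psi> x = 0) ==>
   (LBINT z. (\<eta> (fst z) * \<psi> (snd z)) *\<^sub>R h z) = 0"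
 shows "AE z in lborel. z \<in> strip T --> h z = 0"
proof (rule AE_zero_open[OF open_strip])
 fix p q :: "real \<times> real" assume ab: "cbox p q <= strip T"
 obtain a c where p: "p = (a, c)" by (cases p)
 obtain b d where q: "q = (b, d)" by (cases q)
 show i: "set_integrable lborel (cbox p q) h" using ab int by simp
 show "(LBINT x:box p q. h x) = 0"
 proof (cases "a < b \<and> c < d")
  case True
  then have "(a, c) \<in> cbox p q" "(b, c) \<in> cbox p q" by (auto simp: p q cbox_Pair_eq)
  then have "-T < a" "b < T" using ab by (auto simp: strip_def)
  define w where "w n z = plateau n a b (fst z) * plateau n c d (snd z)" for n z
  have c1: "continuous_on UNIV (w n)" for n
   unfolding w_def
   by (intro continuous_intros continuous_on_compose2[OF continuous_plateau[of UNIV]]) auto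
  have "(%n. LBINT z. w n z *\<^sub>R h z) \<longlonglongrightarrow> (LBINT z:box p q. h z)"
  proof (rule weights_tendsto_indicator[OF i])
   show "w n \<in> borel_measurable borel" for n by (rule borel_measurable_continuous_onI[OF c1])
   show "\<bar>w n x\<bar> <= 1" for n x
    unfolding w_def using plateau_bounds by (simp add: abs_mult mult_le_one)
   show "w n x = 0" if "x \<notin> cbox p q" for n x
    using that by (cases x) (auto simp: w_def p q cbox_Pair_eq plateau_eq_0)
   show "(%n. w n x) \<longlonglongrightarrow> indicat_real (box p q) x" for x
   proof -
    have "indicat_real (box p q) x = indicator {a<..<b} (fst x) * indicator {c<..<d} (snd x)"
     by (cases x) (auto simp: p q box_prod indicator_def)
    then show ?thesis unfolding w_def by (auto intro!: tendsto_mult plateau_tendsto)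
   qed
  qed (auto intro: subsetD[OF box_subset_cbox])
  moreover have "(LBINT z. w n z *\<^sub>R h z) = 0" for n
   unfolding w_def using \<open>-T < a\<close> \<open>b < T\<close>
   by (intro zero[of _ _ a b c d] smooth_plateau) (auto simp: plateau_eq_0)
  ultimately show ?thesis using LIMSEQ_unique[OF _ tendsto_const] by simp
 next
  case False
  then have "box p q = {}" by (auto simp: p q box_prod)
  then show ?thesis by (simp add: set_lebesgue_integral_def)
 qed
qed

lemma normalized_bump:
 assumes "c < (d::real)"
 obtains \<rho> :: "real => real" where "smooth_on UNIV \<rho>" "!!x. x \<notin> {c..d} ==> \<rho> x = 0"
  "integral\<^sup>L lborel \<rho> = 1"
proof -
 define m where "m = integral\<^sup>L lborel (plateau 1 c d)"
 have eq: "(%x. indicator {c..d} x *\<^sub>R plateau 1 c d x) = plateau 1 c d"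
 proof
  fix x show "indicator {c..d} x *\<^sub>R plateau 1 c d x = plateau 1 c d x"
   by (cases "x \<in> {c..d}") (use plateau_eq_0[of x c d] in auto)
 qed
 have int: "integrable lborel (plateau 1 c d)"
  using borel_integrable_compact[OF compact_Icc continuous_plateau, of c d 1 c d] eq by simp
 have "m \<noteq> 0"
 proof
  assume "m = 0"
  then have "AE x in lborel. plateau 1 c d x = 0"
   unfolding m_def using integral_nonneg_eq_0_iff_AE[OF int] plateau_bounds by auto
  then have "AE x in lborel. x \<notin> box c d"
   by (elim AE_mp) (intro AE_I2, use plateau_pos[of c _ d 1] in fastforce)
  then have "box c d \<in> null_sets lborel"
   by (subst (asm) AE_iff_null_sets[symmetric]) auto
  then show False using \<open>c < d\<close> by (simp add: null_sets_def emeasure_lborel_box_eq)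
 qed
 show ?thesis
 proof (rule that[of "%x. inverse m * plateau 1 c d x"])
  show "smooth_on UNIV (%x. inverse m * plateau 1 c d x)"
   by (intro smooth_on_mult smooth_on_const smooth_plateau)
  show "(LBINT x. inverse m * plateau 1 c d x) = 1"
   using \<open>m \<noteq> 0\<close> by (simp add: m_def)
  show "inverse m * plateau 1 c d x = 0" if "x \<notin> {c..d}" for x
   using plateau_eq_0[of x c d 1] that by auto
 qed
qed

lemma mean_zero_primitive:
 fixes \<psi> \<rho> :: "real => real"
 assumes "smooth_on UNIV \<psi>" "!!x. x \<notin> {a..b} ==> \<psi> x = 0"
  and "smooth_on UNIV \<rho>" "!!x. x \<notin> {a..b} ==> \<rho> x = 0" "integral\<^sup>L lborel \<rho> = 1" "a <= b"
 obtains \<phi> where "smooth_on UNIV \<phi>" "!!x. x \<notin> {a..b} ==> \<phi> x = 0"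
  "!!x. dderiv 1 \<phi> x = \<psi> x - integral\<^sup>L lborel \<psi> * \<rho> x"
proof -
 define m where "m = integral\<^sup>L lborel \<psi>"
 define \<theta> where "\<theta> x = \<psi> x + (- m) * \<rho> x" for x
 have s: "smooth_on UNIV \<theta>" unfolding \<theta>_def
  by (intro smooth_on_add smooth_on_mult smooth_on_const assms)
 have i: "integrable lborel f" if "smooth_on UNIV f" "!!x. x \<notin> {a..b} ==> f x = 0" for f :: "real => real"
 proof -
  have "(%x. indicator {a..b} x *\<^sub>R f x) = f"
   by (rule ext) (use that in \<open>auto simp: indicator_def\<close>)
  then show ?thesis
   using borel_integrable_compact[of "{a..b}" f] smooth_on_continuous[OF that(1)] continuous_on_subset
   by auto
 qed
 have supp: "\<theta> x = 0" if "x \<notin> {a..b}" for x using assms that by (simp add: \<theta>_def)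
 have "integral\<^sup>L lborel \<theta> = 0"
  unfolding \<theta>_def using assms i[of \<psi>] i[of \<rho>]
  by (subst Bochner_Integration.integral_add) (auto simp: m_def)
 moreover have "(LINT x:{a..b}|lborel. \<theta> x) = integral\<^sup>L lborel \<theta>"
  unfolding set_lebesgue_integral_def using supp by (intro Bochner_Integration.integral_cong) (auto simp: indicator_def)
 moreover have "(LINT x:{a..b}|lborel. \<theta> x) = integral {a..b} \<theta>"
  by (intro set_borel_integral_eq_integral borel_integrable_atLeastAtMost'
    continuous_on_subset[OF smooth_on_continuous[OF s]]) auto
 ultimately have "integral {a..b} \<theta> = 0" by simp
 from smooth_primitive[OF s supp \<open>a <= b\<close> this] obtain \<phi> where
  "smooth_on UNIV \<phi>" "!!x. x \<notin> {a..b} ==> \<phi> x = 0" "dderiv 1 \<phi> = \<theta>" by blast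
 then show ?thesis using that[of \<phi>] by (auto simp: \<theta>_def m_def)
qed

lemma set_integrable_const_Icc: "set_integrable lborel {a..b::real} (%_. c::'b::euclidean_space)"
 by (rule borel_integrable_atLeastAtMost') (rule continuous_on_const)

text \<open>The lemma of du Bois-Reymond: a function whose distributional derivative vanishes is
  constant.\<close>

lemma du_Bois_Reymond:
 fixes h :: "real => 'b::euclidean_space"
 assumes I: "open I" "is_interval I" "I \<noteq> {}"
  and int: "!!a b. {a..b} <= I ==> set_integrable lborel {a..b} h"
  and zero: "!!\<phi> a b. smooth_on UNIV \<phi> ==> {a..b} <= I ==> (!!x. x \<notin> {a..b} ==> \<phi> x = 0) ==>
   (LBINT x. dderiv 1 \<phi> x *\<^sub>R h x) = 0"
 obtains c where "AE x in lborel. x \<in> I --> h x = c"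
proof -
 obtain x where "x \<in> I" using I by auto
 then obtain l r where lr: "x \<in> box l r" "cbox l r <= I"
  using open_contains_cbox[OF \<open>open I\<close>] by metis
 then have "l < r" by auto
 obtain \<rho> where \<rho>: "smooth_on UNIV \<rho>" "!!x. x \<notin> {l..r} ==> \<rho> x = 0" "integral\<^sup>L lborel \<rho> = (1::real)"
  using normalized_bump[OF \<open>l < r\<close>] by metis
 define c where "c = (LBINT x. \<rho> x *\<^sub>R h x)"
 have "AE x in lborel. x \<in> I --> h x - c = 0"
 proof (rule fundamental_lemma_real[OF \<open>open I\<close>])
  show ic: "set_integrable lborel {a..b} (%x. h x - c)" if "{a..b} <= I" for a b
   using int[OF that] by (intro set_integral_diff) (auto simp: set_integrable_const_Icc)
  fix \<psi> :: "real => real" and a b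
  assume \<psi>: "smooth_on UNIV \<psi>" "{a..b} <= I" "!!x. x \<notin> {a..b} ==> \<psi> x = 0"
  show "(LBINT x. \<psi> x *\<^sub>R (h x - c)) = 0"
  proof (cases "a <= b")
   case False
   then have "\<psi> = (%_. 0)" using \<psi>(3) by auto
   then show ?thesis by simp
  next
   case True
   define A B where "A = min a l" and "B = max b r"
   have AB: "{A..B} <= I"
   proof -
    have "A \<in> I" "B \<in> I" using \<psi>(2) True lr(2) \<open>l < r\<close> by (auto simp: A_def B_def min_def max_def)
    then show ?thesis using I(2) by (meson atLeastAtMost_iff mem_is_interval_1_I subsetI)
   qed
   have le: "A <= B" using True by (auto simp: A_def B_def)
   have supp: "\<psi> x = 0" "\<rho> x = 0" if "x \<notin> {A..B}" for x
   proof -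
    have "x \<notin> {a..b}" "x \<notin> {l..r}" using that by (auto simp: A_def B_def)
    then show "\<psi> x = 0" "\<rho> x = 0" using \<psi>(3) \<rho>(2) by auto
   qed
   obtain \<phi> where \<phi>: "smooth_on UNIV \<phi>" "!!x. x \<notin> {A..B} ==> \<phi> x = 0"
    "!!x. dderiv 1 \<phi> x = \<psi> x - integral\<^sup>L lborel \<psi> * \<rho> x"
    using mean_zero_primitive[OF \<psi>(1) supp(1) \<rho>(1) supp(2) \<rho>(3) le] by metis
   have w: "integrable lborel (%x. f x *\<^sub>R k x)"
    if "smooth_on UNIV f" "!!x. x \<notin> {A..B} ==> f x = (0::real)" "set_integrable lborel {A..B} k"
    for f and k :: "real => 'b"
    using that smooth_on_continuous by (intro integrable_continuous_weight[of "{A..B}"]) auto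
   have i1: "integrable lborel (%x. \<psi> x *\<^sub>R h x)" "integrable lborel (%x. \<rho> x *\<^sub>R h x)"
    "integrable lborel (%x. \<psi> x *\<^sub>R c)"
    by (auto intro!: w supp \<psi>(1) \<rho>(1) int[OF AB] set_integrable_const_Icc)
   have "0 = (LBINT x. \<psi> x *\<^sub>R h x - integral\<^sup>L lborel \<psi> *\<^sub>R (\<rho> x *\<^sub>R h x))"
    using zero[OF \<phi>(1) AB \<phi>(2)] by (simp add: \<phi>(3) scaleR_diff_left)
   also have "... = (LBINT x. \<psi> x *\<^sub>R h x) - integral\<^sup>L lborel \<psi> *\<^sub>R c"
    using i1 by (subst Bochner_Integration.integral_diff) (auto simp: c_def simp del: scaleR_scaleR)
   also have "... = (LBINT x. \<psi> x *\<^sub>R h x) - (LBINT x. \<psi> x *\<^sub>R c)"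
   proof -
    have "integrable lborel (%x. \<psi> x *\<^sub>R (1::real))"
     using smooth_on_continuous[OF \<psi>(1)] supp(1)
     by (intro integrable_continuous_weight[of "{A..B}"] set_integrable_const_Icc) auto
    then have "integrable lborel \<psi>" by simp
    then show ?thesis by simp
   qed
   also have "... = (LBINT x. \<psi> x *\<^sub>R (h x - c))"
    using i1 by (subst Bochner_Integration.integral_diff[symmetric]) (auto simp: scaleR_diff_right)
   finally show ?thesis by simp
  qed
 qed
 then have "AE x in lborel. x \<in> I --> h x = c" by (elim AE_mp) auto
 then show ?thesis by (rule that)
qed

section \<open>Slices of functions on the plane\<close>

lemma plane_Fubini:
 fixes f :: "real \<times> real => 'b::euclidean_space"
 assumes f: "integrable lborel f"
 shows "(LBINT z. f z) = (LBINT t. LBINT x. f (t, x))"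
  and "(LBINT z. f z) = (LBINT x. LBINT t. f (t, x))"
  and "AE t in lborel. integrable lborel (%x. f (t, x))"
  and "integrable lborel (%t. LBINT x. f (t, x))"
proof -
 have f': "integrable (lborel \<Otimes>\<^sub>M lborel) f" "integrable (lborel \<Otimes>\<^sub>M lborel) (%(t, x). f (t, x))"
  using f by (simp_all add: lborel_prod)
 show "(LBINT z. f z) = (LBINT t. LBINT x. f (t, x))"
  using lborel_pair.integral_fst'[OF f'(1)] by (simp add: lborel_prod)
 show "(LBINT z. f z) = (LBINT x. LBINT t. f (t, x))"
  using lborel_pair.integral_snd[OF f'(2)] by (simp add: lborel_prod)
 show "AE t in lborel. integrable lborel (%x. f (t, x))"
  using lborel_pair.AE_integrable_fst'[OF f'(1)] .
 show "integrable lborel (%t. LBINT x. f (t, x))"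
  using lborel_pair.integrable_fst'[OF f'(1)] .
qed

lemma plane_AE_slices:
 assumes "AE z in (lborel :: (real \<times> real) measure). P z"
 shows "AE t in lborel. AE x in lborel. P (t, x)"
 by (rule lborel_pair.AE_pair) (use assms in \<open>simp only: lborel_prod\<close>)

lemma plane_AE_if_slices:
 assumes "{z. P z} \<in> sets borel" "AE t in lborel. AE x in lborel. P (t, x)"
 shows "AE z in (lborel :: (real \<times> real) measure). P z"
proof -
 have "{z \<in> space (lborel \<Otimes>\<^sub>M lborel). P z} \<in> sets (lborel \<Otimes>\<^sub>M lborel)"
  unfolding lborel_prod using assms(1) by simp
 from lborel_pair.AE_pair_measure[OF this assms(2)] show ?thesis unfolding lborel_prod .
qed

lemma integrable_tensor:
 fixes f :: "real => 'b::euclidean_space"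
 assumes f: "integrable lborel f" and g: "integrable lborel (g :: real => real)"
 shows "integrable lborel (%z. g (snd z) *\<^sub>R f (fst z))"
  and "(LBINT z. g (snd z) *\<^sub>R f (fst z)) = (LBINT x. g x) *\<^sub>R (LBINT t. f t)"
proof -
 note [measurable] = borel_measurable_integrable[OF f] borel_measurable_integrable[OF g]
 have "integrable (lborel \<Otimes>\<^sub>M lborel) (%z. g (snd z) *\<^sub>R f (fst z))"
 proof (rule lborel_pair.Fubini_integrable)
  show "integrable lborel (%t. LBINT x. norm (g (snd (t, x)) *\<^sub>R f (fst (t, x))))"
   using f by simp
  show "AE t in lborel. integrable lborel (%x. g (snd (t, x)) *\<^sub>R f (fst (t, x)))"
   using g by simp
 qed measurable
 then show i: "integrable lborel (%z. g (snd z) *\<^sub>R f (fst z))" by (simp add: lborel_prod)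
 show "(LBINT z. g (snd z) *\<^sub>R f (fst z)) = (LBINT x. g x) *\<^sub>R (LBINT t. f t)"
  unfolding plane_Fubini(1)[OF i] using f g by simp
qed

lemma integrable_indicator_Icc: "integrable lborel (indicat_real {a..b::real})"
 by (rule integrable_real_indicator) (auto simp: emeasure_lborel_Icc_eq)

lemma cbox_subset_strip: "-T < a ==> b < T ==> cbox (a, c) (b, d) <= strip T"
 by (auto simp: strip_def)

lemma continuous_tensor:
 fixes \<eta> \<phi> :: "real => real"
 assumes "continuous_on UNIV \<eta>" "continuous_on UNIV \<phi>"
 shows "continuous_on UNIV (%z. \<eta> (fst z) * \<phi> (snd z))"
 by (intro continuous_intros continuous_on_compose2[OF assms(1)] continuous_on_compose2[OF assms(2)]) auto

lemma integrable_tensor_weight: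
 fixes h :: "real \<times> real => 'b::euclidean_space" and \<eta> \<phi> :: "real => real"
 assumes h: "!!a b. cbox a b <= strip T ==> set_integrable lborel (cbox a b) h"
  and "continuous_on UNIV \<eta>" "continuous_on UNIV \<phi>" "-T < a" "b < T"
  and "!!t. t \<notin> {a..b} ==> \<eta> t = 0" "!!x. x \<notin> {c..d} ==> \<phi> x = 0"
 shows "integrable lborel (%z. (\<eta> (fst z) * \<phi> (snd z)) *\<^sub>R h z)"
proof (rule integrable_continuous_weight)
 show "set_integrable lborel (cbox (a, c) (b, d)) h"
  using assms by (intro h cbox_subset_strip)
 show "\<eta> (fst z) * \<phi> (snd z) = 0" if "z \<notin> cbox (a, c) (b, d)" for z
  using that assms(6,7) by (cases z) (auto simp: cbox_Pair_eq)
qed (use assms continuous_tensor in auto)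

lemma integrable_compact_support:
 fixes \<psi> :: "real => real"
 assumes "continuous_on UNIV \<psi>" "!!x. x \<notin> {a..b} ==> \<psi> x = 0"
 shows "integrable lborel \<psi>"
 using integrable_continuous_weight[OF set_integrable_const_Icc[of a b "1::real"] assms(1) compact_Icc assms(2)]
 by simp

lemma du_Bois_Reymond_strip:
 fixes h :: "real \<times> real => 'b::euclidean_space"
 assumes int: "!!a b. cbox a b <= strip T ==> set_integrable lborel (cbox a b) h"
  and zero: "!!\<eta> \<phi> a b c d. smooth_on UNIV \<eta> ==> smooth_on UNIV \<phi> ==> -T < a ==> b < T ==>
   (!!x. x \<notin> {a..b} ==> \<eta> x = 0) ==> (!!x. x \<notin> {c..d} ==> \<phi> x = 0) ==>
   (LBINT z. (\<eta> (fst z) * dderiv 1 \<phi> (snd z)) *\<^sub>R h z) = 0"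
 obtains c where "AE z in lborel. z \<in> strip T --> h z = c (fst z)"
proof -
 obtain \<rho> :: "real => real" where \<rho>: "smooth_on UNIV \<rho>" "!!x. x \<notin> {0..1} ==> \<rho> x = 0" "integral\<^sup>L lborel \<rho> = (1::real)"
  using normalized_bump[of 0 "1::real", OF zero_less_one] by metis
 define c where "c t = (LBINT x. \<rho> x *\<^sub>R h (t, x))" for t :: real
 have c_int: "integrable lborel (%t. \<theta> t *\<^sub>R c t)"
  "(LBINT t. \<theta> t *\<^sub>R c t) = (LBINT z. (\<theta> (fst z) * \<rho> (snd z)) *\<^sub>R h z)"
  if "\<theta> \<in> borel_measurable borel" "!!t. \<bar>\<theta> t\<bar> <= M" "-T < a" "b < T" "!!t. t \<notin> {a..b} ==> \<theta> t = (0::real)" for \<theta> a b M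
 proof -
  note c\<rho> = smooth_on_continuous[OF \<rho>(1)]
  obtain M' where M': "!!x. \<bar>\<rho> x\<bar> <= M'" "M' > 0"
   using continuous_compact_support_bounded[OF c\<rho> compact_Icc \<rho>(2)] by blast
  note [measurable] = that(1) borel_measurable_continuous_onI[OF c\<rho>]
  have i: "integrable lborel (%z. (\<theta> (fst z) * \<rho> (snd z)) *\<^sub>R h z)"
  proof (rule integrable_weight)
   show "set_integrable lborel (cbox (a, 0) (b, 1)) h"
    using that by (intro int cbox_subset_strip)
   show "\<bar>\<theta> (fst z) * \<rho> (snd z)\<bar> <= M * M'" for z
    unfolding abs_mult using that(2)[of "fst z"] M'
    by (intro mult_mono) (auto intro: order_trans[OF abs_ge_zero])
   show "\<theta> (fst z) * \<rho> (snd z) = 0" if "z \<notin> cbox (a, 0) (b, 1)" for z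
    using that \<open>!!t. t \<notin> {a..b} ==> \<theta> t = (0::real)\<close> \<rho>(2) by (cases z) (auto simp: cbox_Pair_eq)
   show "(%z. \<theta> (fst z) * \<rho> (snd z)) \<in> borel_measurable borel"
    unfolding borel_prod[symmetric] by measurable
  qed
  have eq: "(%t. LBINT x. (\<theta> (fst (t, x)) * \<rho> (snd (t, x))) *\<^sub>R h (t, x)) = (%t. \<theta> t *\<^sub>R c t)"
   unfolding c_def by (simp flip: scaleR_scaleR)
  show "integrable lborel (%t. \<theta> t *\<^sub>R c t)" using plane_Fubini(4)[OF i] unfolding eq .
  show "(LBINT t. \<theta> t *\<^sub>R c t) = (LBINT z. (\<theta> (fst z) * \<rho> (snd z)) *\<^sub>R h z)"
   using plane_Fubini(1)[OF i] unfolding eq by simp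
 qed
 have cz: "set_integrable lborel (cbox p q) (%z. c (fst z))" if pq: "cbox p q <= strip T" for p q
 proof -
  obtain a k b d where p: "p = (a, k)" "q = (b, d)" by (cases p, cases q)
  show ?thesis
  proof (cases "cbox p q = {}")
   case False
   then have "(a, k) \<in> cbox p q" "(b, k) \<in> cbox p q" by (auto simp: p cbox_Pair_eq)
   then have "-T < a" "b < T" using pq by (auto simp: strip_def)
   then have "integrable lborel (%t. indicator {a..b} t *\<^sub>R c t)"
    by (intro c_int(1)[of _ 1 a b]) auto
   from integrable_tensor(1)[OF this integrable_indicator_Icc[of k d]]
   have "integrable lborel (%z. indicator {k..d} (snd z) *\<^sub>R indicator {a..b} (fst z) *\<^sub>R c (fst z))"
    by simp
   moreover have "indicat_real (cbox p q) z *\<^sub>R c (fst z) = indicator {k..d} (snd z) *\<^sub>R indicator {a..b} (fst z) *\<^sub>R c (fst z)" for z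
    by (cases z) (auto simp: p cbox_Pair_eq indicator_def)
   ultimately show ?thesis unfolding set_integrable_def by presburger
  qed (simp add: set_integrable_def)
 qed
 have "AE z in lborel. z \<in> strip T --> h z - c (fst z) = 0"
 proof (rule fundamental_lemma_strip)
  show "set_integrable lborel (cbox p q) (%z. h z - c (fst z))" if "cbox p q <= strip T" for p q
   using int[OF that] cz[OF that] by (rule set_integral_diff)
  fix \<eta> \<psi> :: "real => real" and a b k d
  assume \<eta>: "smooth_on UNIV \<eta>" and \<psi>: "smooth_on UNIV \<psi>" and ab: "-T < a" "b < T"
   and s\<eta>: "!!x. x \<notin> {a..b} ==> \<eta> x = 0" and s\<psi>: "!!x. x \<notin> {k..d} ==> \<psi> x = 0"
  define A B where "A = min k 0" and "B = max d 1"
  have AB: "A <= B" by (simp add: A_def B_def)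
  have supp: "\<psi> x = 0" "\<rho> x = 0" if "x \<notin> {A..B}" for x
  proof -
   have "x \<notin> {k..d}" "x \<notin> {0..1}" using that by (auto simp: A_def B_def)
   then show "\<psi> x = 0" "\<rho> x = 0" using s\<psi> \<rho>(2) by auto
  qed
  define m where "m = integral\<^sup>L lborel \<psi>"
  obtain \<phi> where \<phi>: "smooth_on UNIV \<phi>" "!!x. x \<notin> {A..B} ==> \<phi> x = 0"
   "!!x. dderiv 1 \<phi> x = \<psi> x - m * \<rho> x"
   unfolding m_def
   using mean_zero_primitive[OF \<psi> supp(1) \<rho>(1) supp(2) \<rho>(3) AB] by metis
  note cont = smooth_on_continuous[OF \<eta>] smooth_on_continuous[OF \<psi>] smooth_on_continuous[OF \<rho>(1)]
  have i: "integrable lborel (%z. (\<eta> (fst z) * \<psi> (snd z)) *\<^sub>R h z)"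
   "integrable lborel (%z. (\<eta> (fst z) * \<rho> (snd z)) *\<^sub>R h z)"
   "integrable lborel (%z. (\<eta> (fst z) * \<psi> (snd z)) *\<^sub>R c (fst z))"
   using integrable_tensor_weight[OF int cont(1,2) ab s\<eta> supp(1)]
    integrable_tensor_weight[OF int cont(1,3) ab s\<eta> supp(2)]
    integrable_tensor_weight[OF cz cont(1,2) ab s\<eta> supp(1)] by auto
  obtain M where M: "!!x. \<bar>\<eta> x\<bar> <= M" "M > 0"
   using continuous_compact_support_bounded[OF cont(1) compact_Icc s\<eta>] by blast
  have ci: "integrable lborel (%t. \<eta> t *\<^sub>R c t)"
   "(LBINT t. \<eta> t *\<^sub>R c t) = (LBINT z. (\<eta> (fst z) * \<rho> (snd z)) *\<^sub>R h z)"
   by (rule c_int[of \<eta> M a b, OF borel_measurable_continuous_onI[OF cont(1)] M(1) ab s\<eta>]; assumption)+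
  have "0 = (LBINT z. (\<eta> (fst z) * \<psi> (snd z)) *\<^sub>R h z - m *\<^sub>R ((\<eta> (fst z) * \<rho> (snd z)) *\<^sub>R h z))"
   using zero[OF \<eta> \<phi>(1) ab s\<eta> \<phi>(2)] by (simp add: \<phi>(3) algebra_simps scaleR_diff_left)
  also have "... = (LBINT z. (\<eta> (fst z) * \<psi> (snd z)) *\<^sub>R h z) - m *\<^sub>R (LBINT t. \<eta> t *\<^sub>R c t)"
   unfolding ci(2) using i(1,2)
   by (subst Bochner_Integration.integral_diff) (auto simp del: scaleR_scaleR)
  also have "m *\<^sub>R (LBINT t. \<eta> t *\<^sub>R c t) = (LBINT z. \<psi> (snd z) *\<^sub>R (\<eta> (fst z) *\<^sub>R c (fst z)))"
   unfolding m_def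
   using integrable_tensor(2)[OF ci(1), of \<psi>] integrable_compact_support[OF cont(2) s\<psi>] by simp
  also have "... = (LBINT z. (\<eta> (fst z) * \<psi> (snd z)) *\<^sub>R c (fst z))"
   by (simp add: mult.commute)
  finally show "(LBINT z. (\<eta> (fst z) * \<psi> (snd z)) *\<^sub>R (h z - c (fst z))) = 0"
   using i by (simp add: scaleR_diff_right)
 qed
 then have "AE z in lborel. z \<in> strip T --> h z = c (fst z)" by (elim AE_mp) auto
 then show ?thesis by (rule that)
qed

text \<open>The signed indicator of the interval between \<open>0\<close> and \<open>x\<close>.\<close>

definition prim_kernel :: "real => real => real" where
 "prim_kernel x y = (if 0 < y \<and> y < x then 1 else 0) - (if x < y \<and> y < 0 then 1 else 0)"

text \<open>The primitive vanishing at \<open>0\<close>, written with a kernel so that it is jointly measurable in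
  parameters.\<close>

definition prim :: "(real => 'b::euclidean_space) => real => 'b" where
 "prim g x = (LBINT y. prim_kernel x y *\<^sub>R g y)"

lemma prim_kernel_le: "\<bar>prim_kernel x y\<bar> <= 1"
 by (simp add: prim_kernel_def)

lemma prim_kernel_measurable: "prim_kernel x \<in> borel_measurable borel"
 unfolding prim_kernel_def[abs_def] by measurable

lemma prim_kernel_supp: "\<bar>x\<bar> <= R ==> y \<notin> {-R..R} ==> prim_kernel x y = 0"
 by (auto simp: prim_kernel_def)

lemma prim_integrable:
 fixes g :: "real => 'b::euclidean_space"
 assumes "set_integrable lborel {-R..R} g" "\<bar>x\<bar> <= R"
 shows "integrable lborel (%y. prim_kernel x y *\<^sub>R g y)"
 by (rule integrable_weight[OF assms(1) prim_kernel_measurable, where M = 1])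
  (simp_all add: prim_kernel_le prim_kernel_supp[OF assms(2)])

lemma AE_neq3: "AE y in lborel. y \<noteq> (a::real) \<and> y \<noteq> b \<and> y \<noteq> c"
 by (intro AE_conjI AE_lborel_singleton)

lemma prim_diff:
 fixes g :: "real => 'b::euclidean_space"
 assumes g: "!!R. set_integrable lborel {-R..R} g" and "x <= x'"
 shows "prim g x' - prim g x = (LINT y:{x..x'}|lborel. g y)"
proof -
 define R where "R = max \<bar>x\<bar> \<bar>x'\<bar>"
 have R: "\<bar>x\<bar> <= R" "\<bar>x'\<bar> <= R" by (auto simp: R_def)
 note i = prim_integrable[OF g R(1)] prim_integrable[OF g R(2)]
 have "set_integrable lborel {x..x'} g"
  using g[of R] by (rule set_integrable_subset) (use R in auto)
 then have [measurable]: "(%y. indicator {x..x'} y *\<^sub>R g y) \<in> borel_measurable borel"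
  unfolding set_integrable_def by auto
 have "prim g x' - prim g x = (LBINT y. prim_kernel x' y *\<^sub>R g y - prim_kernel x y *\<^sub>R g y)"
  unfolding prim_def using i by simp
 also have "... = (LBINT y. indicator {x..x'} y *\<^sub>R g y)"
 proof (rule integral_cong_AE)
  show "AE y in lborel. prim_kernel x' y *\<^sub>R g y - prim_kernel x y *\<^sub>R g y = indicator {x..x'} y *\<^sub>R g y"
   using AE_neq3[of 0 x x']
   by (rule AE_mp) (use \<open>x <= x'\<close> in \<open>auto intro!: AE_I2 simp: prim_kernel_def indicator_def\<close>)
 qed (use i in \<open>auto intro!: borel_measurable_diff borel_measurable_integrable\<close>)
 finally show ?thesis unfolding set_lebesgue_integral_def .
qed

lemma continuous_prim:
 fixes g :: "real => 'b::euclidean_space"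
 assumes g: "!!R. set_integrable lborel {-R..R} g"
 shows "continuous_on UNIV (prim g)"
proof -
 have c: "continuous_on {-R..R} (prim g)" for R
 proof -
  have "continuous_on {-R..R} (%x. prim g (-R) + integral {-R..x} g)"
   using set_borel_integral_eq_integral(1)[OF g]
   by (intro continuous_intros indefinite_integral_continuous_1)
  moreover have "prim g (-R) + integral {-R..x} g = prim g x" if "x \<in> {-R..R}" for x
  proof -
   have "set_integrable lborel {-R..x} g"
    using g[of R] by (rule set_integrable_subset) (use that in auto)
   from set_borel_integral_eq_integral(2)[OF this] prim_diff[OF g, of "-R" x] that
   show ?thesis by (auto simp: algebra_simps)
  qed
  ultimately show ?thesis by (rule continuous_on_eq) simp
 qed
 have "isCont (prim g) x" for x
 proof -
  have "continuous_on {-(\<bar>x\<bar>+1)<..<\<bar>x\<bar>+1} (prim g)"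
   by (rule continuous_on_subset[OF c[of "\<bar>x\<bar>+1"]]) auto
  then show ?thesis by (rule continuous_on_interior) (auto simp: interior_open)
 qed
 then show ?thesis by (simp add: continuous_at_imp_continuous_on)
qed

lemma integral_smooth_derivative:
 fixes \<phi> :: "real => real"
 assumes "smooth_on UNIV \<phi>" "a <= b"
 shows "(LINT x:{a..b}|lborel. dderiv 1 \<phi> x) = \<phi> b - \<phi> a"
 unfolding set_lebesgue_integral_def
 using smooth_on_continuous[OF smooth_on_dderiv[OF assms(1)]]
  smooth_real_has_derivative[OF assms(1)] assms(2)
 by (intro integral_FTC_Icc) (auto intro: has_vector_derivative_at_within continuous_on_subset)

lemma integral_prim_kernel:
 fixes \<phi> :: "real => real"
 assumes \<phi>: "smooth_on UNIV \<phi>" "!!x. x \<notin> {-R<..<R} ==> \<phi> x = 0" and "y \<noteq> 0"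
 shows "(LBINT x. dderiv 1 \<phi> x * prim_kernel x y) = - \<phi> y"
proof -
 have d0: "dderiv 1 \<phi> x = 0" if "x \<notin> {-R..R}" for x
  by (rule dderiv_support[of "{-R..R}"]) (use \<phi>(2) that in auto)
 note [measurable] = borel_measurable_continuous_onI[OF smooth_on_continuous[OF smooth_on_dderiv[OF \<phi>(1)]]]
 consider "y > 0" | "y < 0" using \<open>y \<noteq> 0\<close> by linarith
 then show ?thesis
 proof cases
  case 1
  define B where "B = max y (R + 1)"
  have "(LBINT x. dderiv 1 \<phi> x * prim_kernel x y) = (LINT x:{y..B}|lborel. dderiv 1 \<phi> x)"
   unfolding set_lebesgue_integral_def
  proof (rule integral_cong_AE)
   show "AE x in lborel. dderiv 1 \<phi> x * prim_kernel x y = indicator {y..B} x *\<^sub>R dderiv 1 \<phi> x"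
    using AE_lborel_singleton[of y]
    by (rule AE_mp) (use 1 in \<open>auto intro!: AE_I2 d0 simp: B_def prim_kernel_def indicator_def\<close>)
   show "(%x. dderiv 1 \<phi> x * prim_kernel x y) \<in> borel_measurable lborel"
    unfolding prim_kernel_def by measurable
  qed measurable
  also have "... = \<phi> B - \<phi> y" by (rule integral_smooth_derivative[OF \<phi>(1)]) (simp add: B_def)
  also have "\<phi> B = 0" by (rule \<phi>(2)) (simp add: B_def)
  finally show ?thesis by simp
 next
  case 2
  define B where "B = min y (- R - 1)"
  have "(LBINT x. dderiv 1 \<phi> x * prim_kernel x y) = - (LINT x:{B..y}|lborel. dderiv 1 \<phi> x)"
   unfolding set_lebesgue_integral_def Bochner_Integration.integral_minus[symmetric]
  proof (rule integral_cong_AE)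
   show "AE x in lborel. dderiv 1 \<phi> x * prim_kernel x y = - (indicator {B..y} x *\<^sub>R dderiv 1 \<phi> x)"
    using AE_lborel_singleton[of y]
    by (rule AE_mp) (use 2 in \<open>auto intro!: AE_I2 d0 simp: B_def prim_kernel_def indicator_def\<close>)
   show "(%x. dderiv 1 \<phi> x * prim_kernel x y) \<in> borel_measurable lborel"
    unfolding prim_kernel_def by measurable
  qed measurable
  also have "... = - (\<phi> y - \<phi> B)" by (subst integral_smooth_derivative[OF \<phi>(1)]) (simp_all add: B_def)
  also have "\<phi> B = 0" by (rule \<phi>(2)) (simp add: B_def)
  finally show ?thesis by simp
 qed
qed

lemma weak_derivative_prim:
 fixes g :: "real => 'b::euclidean_space" and \<phi> :: "real => real"
 assumes g: "!!R. set_integrable lborel {-R..R} g"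
  and \<phi>: "smooth_on UNIV \<phi>" "!!x. x \<notin> {-R<..<R} ==> \<phi> x = 0"
 shows "(LBINT x. dderiv 1 \<phi> x *\<^sub>R prim g x) = - (LBINT x. \<phi> x *\<^sub>R g x)"
proof -
 note c = smooth_on_continuous[OF smooth_on_dderiv[OF \<phi>(1)], of 1]
 have d0: "dderiv 1 \<phi> x = 0" if "x \<notin> {-R..R}" for x
  by (rule dderiv_support[of "{-R..R}"]) (use \<phi>(2) that in auto)
 define G where "G = (%y. indicator {-R..R} y *\<^sub>R g y)"
 have G: "integrable lborel G" using g[of R] by (simp add: G_def set_integrable_def)
 note [measurable] = borel_measurable_continuous_onI[OF c] borel_measurable_integrable[OF G]
 have k: "dderiv 1 \<phi> x *\<^sub>R (prim_kernel x y *\<^sub>R g y) = (dderiv 1 \<phi> x * prim_kernel x y) *\<^sub>R G y" for x y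
 proof (cases "x \<in> {-R..R} \<and> y \<notin> {-R..R}")
  case True
  then have "prim_kernel x y = 0" by (intro prim_kernel_supp[of x R]) auto
  then show ?thesis by simp
 qed (use d0[of x] in \<open>auto simp: G_def\<close>)
 define f where "f = (%z. (dderiv 1 \<phi> (snd z) * prim_kernel (snd z) (fst z)) *\<^sub>R G (fst z))"
 have f: "integrable lborel f"
 proof (rule Bochner_Integration.integrable_bound)
  show "integrable lborel (%z. dderiv 1 \<phi> (snd z) *\<^sub>R G (fst z))"
   by (rule integrable_tensor(1)[OF G integrable_compact_support[OF c d0]])
  have "f \<in> borel_measurable (borel \<Otimes>\<^sub>M borel)"
   unfolding f_def prim_kernel_def by measurable
  then show "f \<in> borel_measurable lborel" by (simp add: borel_prod)
  have "norm (f z) <= norm (dderiv 1 \<phi> (snd z) *\<^sub>R G (fst z))" for z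
   using mult_right_mono[OF prim_kernel_le[of "snd z" "fst z"], of "\<bar>dderiv 1 \<phi> (snd z)\<bar> * norm (G (fst z))"]
   by (simp add: f_def abs_mult mult.assoc mult.left_commute)
  then show "AE z in lborel. norm (f z) <= norm (dderiv 1 \<phi> (snd z) *\<^sub>R G (fst z))" by simp
 qed
 have "(LBINT x. dderiv 1 \<phi> x *\<^sub>R prim g x) = (LBINT x. LBINT y. f (y, x))"
  unfolding prim_def integral_scaleR_right[symmetric] k f_def by simp
 also have "... = (LBINT y. LBINT x. f (y, x))"
  using plane_Fubini(1,2)[OF f] by simp
 also have "... = (LBINT y. - (\<phi> y *\<^sub>R g y))"
 proof (rule integral_cong_AE)
  have "\<phi> y *\<^sub>R g y = \<phi> y *\<^sub>R G y" for y
   using \<phi>(2)[of y] by (cases "y \<in> {-R<..<R}") (auto simp: G_def)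
  note eq = this
  note [measurable] = borel_measurable_continuous_onI[OF smooth_on_continuous[OF \<phi>(1)]]
  show "(%y. - (\<phi> y *\<^sub>R g y)) \<in> borel_measurable lborel" unfolding eq by measurable
  show "(%y. LBINT x. f (y, x)) \<in> borel_measurable lborel"
   using plane_Fubini(4)[OF f] by (rule borel_measurable_integrable)
  have *: "(LBINT x. f (y, x)) = - (\<phi> y *\<^sub>R g y)" if "y \<noteq> 0" for y
  proof -
   have "integrable lborel (%x. dderiv 1 \<phi> x * prim_kernel x y)"
   proof (rule Bochner_Integration.integrable_bound[OF integrable_compact_support[OF c d0]])
    show "(%x. dderiv 1 \<phi> x * prim_kernel x y) \<in> borel_measurable lborel"
     unfolding prim_kernel_def by measurable
   qed (auto simp: abs_mult intro!: AE_I2 mult_left_le prim_kernel_le)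
   then have "(LBINT x. f (y, x)) = (LBINT x. dderiv 1 \<phi> x * prim_kernel x y) *\<^sub>R G y"
    unfolding f_def by simp
   also have "... = - (\<phi> y *\<^sub>R G y)" using integral_prim_kernel[OF \<phi> that] by simp
   finally show ?thesis by (simp add: eq)
  qed
  show "AE y in lborel. (LBINT x. f (y, x)) = - (\<phi> y *\<^sub>R g y)"
   by (rule eventually_mono[OF AE_lborel_singleton[of 0] *])
 qed
 finally show ?thesis by simp
qed

lemma slices_locally_integrable:
 fixes g :: "real \<times> real => 'b::euclidean_space"
 assumes g: "!!a b. cbox a b <= strip T ==> set_integrable lborel (cbox a b) g"
 shows "AE t in lborel. t \<in> {-T<..<T} --> (\<forall>R. set_integrable lborel {-R..R} (%x. g (t, x)))"
proof -
 define K where "K n = cbox (-T + 1 / (real n + 1), - real n) (T - 1 / (real n + 1), real n)" for n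
 have "integrable lborel (%z. indicator (K n) z *\<^sub>R g z)" for n
  unfolding K_def set_integrable_def[symmetric] by (intro g cbox_subset_strip) auto
 from plane_Fubini(3)[OF this]
 have "AE t in lborel. \<forall>n. integrable lborel (%x. indicator (K n) (t, x) *\<^sub>R g (t, x))"
  by (simp add: AE_all_countable)
 then show ?thesis
 proof (rule AE_mp, intro AE_I2 impI allI)
  fix t R assume i: "\<forall>n. integrable lborel (%x. indicator (K n) (t, x) *\<^sub>R g (t, x))"
   and t: "t \<in> {-T<..<T}"
  obtain n1 :: nat where n1: "inverse (T - \<bar>t\<bar>) < real n1" using reals_Archimedean2 by blast
  obtain n2 :: nat where n2: "R < real n2" using reals_Archimedean2 by blast
  define n where "n = max n1 n2"
  have pos: "0 < T - \<bar>t\<bar>" using t by auto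
  have "inverse (T - \<bar>t\<bar>) < real n + 1" using n1 by (simp add: n_def)
  then have "inverse (real n + 1) < inverse (inverse (T - \<bar>t\<bar>))"
   using pos by (intro less_imp_inverse_less) auto
  then have "1 / (real n + 1) < T - \<bar>t\<bar>" by (simp add: divide_inverse)
  then have "indicator (K n) (t, x) = indicat_real {- real n..real n} x" for x
   by (auto simp: K_def indicator_def)
  with spec[OF i, of n] have "set_integrable lborel {- real n..real n} (%x. g (t, x))"
   unfolding set_integrable_def by simp
  then show "set_integrable lborel {-R..R} (%x. g (t, x))"
   by (rule set_integrable_subset) (use n2 in \<open>auto simp: n_def\<close>)
 qed
qed

lemma prim_norm_le:
 fixes g :: "real => 'b::euclidean_space"
 assumes g: "set_integrable lborel {-R..R} g" and x: "\<bar>x\<bar> <= R"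
 shows "norm (prim g x) <= (LBINT y. norm (indicator {-R..R} y *\<^sub>R g y))"
proof -
 have "norm (prim g x) <= (LBINT y. norm (prim_kernel x y *\<^sub>R g y))"
  unfolding prim_def by (rule integral_norm_bound)
 also have "... <= (LBINT y. norm (indicator {-R..R} y *\<^sub>R g y))"
 proof (rule integral_mono)
  show "integrable lborel (%y. norm (prim_kernel x y *\<^sub>R g y))"
   by (rule integrable_norm[OF prim_integrable[OF g x]])
  show "integrable lborel (%y. norm (indicator {-R..R} y *\<^sub>R g y))"
   using g unfolding set_integrable_def by (rule integrable_norm)
  show "norm (prim_kernel x y *\<^sub>R g y) <= norm (indicator {-R..R} y *\<^sub>R g y)" for y
   using mult_right_mono[OF prim_kernel_le[of x y] norm_ge_zero[of "g y"]] prim_kernel_supp[OF x, of y]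
   by (cases "y \<in> {-R..R}") auto
 qed
 finally show ?thesis .
qed

lemma prim_param_measurable:
 fixes g :: "real \<times> real => 'b::euclidean_space"
 assumes "g \<in> borel_measurable borel"
 shows "(%z. prim (%y. g (fst z, y)) (snd z)) \<in> borel_measurable borel"
proof -
 have [measurable]: "g \<in> borel_measurable (borel \<Otimes>\<^sub>M borel)" using assms by (simp add: borel_prod)
 have "(%z. LBINT y. prim_kernel (snd z) y *\<^sub>R g (fst z, y)) \<in> borel_measurable (borel \<Otimes>\<^sub>M borel)"
  unfolding prim_kernel_def by measurable
 then show ?thesis by (simp add: borel_prod prim_def)
qed

lemma prim_param_locally_integrable:
 fixes g :: "real \<times> real => 'b::euclidean_space"
 assumes g: "!!a b. cbox a b <= strip T ==> set_integrable lborel (cbox a b) g"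
  and gm: "g \<in> borel_measurable borel" and pq: "cbox p q <= strip T"
 shows "set_integrable lborel (cbox p q) (%z. prim (%y. g (fst z, y)) (snd z))"
proof -
 define F where "F z = prim (%y. g (fst z, y)) (snd z)" for z
 have sl: "AE t in lborel. t \<in> {-T<..<T} --> (\<forall>R. set_integrable lborel {-R..R} (%x. g (t, x)))"
  by (rule slices_locally_integrable) (rule g)
 obtain a c b d where p: "p = (a, c)" "q = (b, d)" by (cases p, cases q)
 show ?thesis
 proof (cases "cbox p q = {}")
  case False
  then have ab: "(a, c) \<in> cbox p q" "(b, c) \<in> cbox p q" by (auto simp: p cbox_Pair_eq)
  then have ab: "-T < a" "b < T" using pq by (auto simp: strip_def)
  define R where "R = max \<bar>c\<bar> \<bar>d\<bar>"
  have "integrable lborel (%z. norm (indicator (cbox (a, -R) (b, R)) z *\<^sub>R g z))"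
   using g[OF cbox_subset_strip[OF ab]] unfolding set_integrable_def by (rule integrable_norm)
  from plane_Fubini(4)[OF this]
  have m: "integrable lborel (%t. LBINT x. norm (indicator (cbox (a, -R) (b, R)) (t, x) *\<^sub>R g (t, x)))"
   (is "integrable lborel ?m") .
  have Fm[measurable]: "F \<in> borel_measurable borel"
   unfolding F_def[abs_def] by (rule prim_param_measurable[OF gm])
  have i: "integrable lborel (%z. indicator {c..d} (snd z) *\<^sub>R ?m (fst z))"
   by (rule integrable_tensor(1)[OF m integrable_indicator_Icc])
  have "integrable lborel (%z. indicator (cbox p q) z *\<^sub>R F z)"
  proof (rule Bochner_Integration.integrable_bound[OF i])
   show Fi: "(%z. indicator (cbox p q) z *\<^sub>R F z) \<in> borel_measurable lborel" by measurable
   show "AE z in lborel. norm (indicator (cbox p q) z *\<^sub>R F z) <= norm (indicator {c..d} (snd z) *\<^sub>R ?m (fst z))"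
   proof (rule plane_AE_if_slices)
    show "{z. norm (indicator (cbox p q) z *\<^sub>R F z) <= norm (indicator {c..d} (snd z) *\<^sub>R ?m (fst z))} \<in> sets borel"
     using Fi borel_measurable_integrable[OF i]
     by (intro borel_measurable_le[where M = borel, simplified]) auto
    show "AE t in lborel. AE x in lborel. norm (indicator (cbox p q) (t, x) *\<^sub>R F (t, x))
      <= norm (indicator {c..d} (snd (t, x)) *\<^sub>R ?m (fst (t, x)))"
    proof (rule AE_mp[OF sl]; (intro AE_I2 impI)?)
     fix t x assume t: "t \<in> {-T<..<T} --> (\<forall>R. set_integrable lborel {-R..R} (%x. g (t, x)))"
     show "norm (indicator (cbox p q) (t, x) *\<^sub>R F (t, x))
      <= norm (indicator {c..d} (snd (t, x)) *\<^sub>R ?m (fst (t, x)))"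
     proof (cases "t \<in> {a..b} \<and> x \<in> {c..d}")
      case True
      have eq: "indicator (cbox (a, -R) (b, R)) (t, y) = indicat_real {-R..R} y" for y
       using True by (auto simp: indicator_def)
      have "norm (F (t, x)) <= ?m t"
       unfolding F_def eq fst_conv snd_conv
       using True t ab by (intro prim_norm_le) (auto simp: R_def)
      then show ?thesis using True by (auto simp: p indicator_def)
     qed (auto simp: p indicator_def)
    qed
   qed
  qed
  then show ?thesis unfolding set_integrable_def F_def .
 qed (simp add: set_integrable_def)
qed

text \<open>A weak \<open>x\<close>-derivative on the strip gives, for almost every time, a slice that is the
  primitive of its derivative.\<close>

lemma weak_dx_slices:
 fixes u g :: "real \<times> real => 'b::euclidean_space"
 assumes u: "!!a b. cbox a b <= strip T ==> set_integrable lborel (cbox a b) u"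
  and g: "!!a b. cbox a b <= strip T ==> set_integrable lborel (cbox a b) g"
  and gm: "g \<in> borel_measurable borel"
  and weak: "!!\<eta> \<phi> a b c d. smooth_on UNIV \<eta> ==> smooth_on UNIV \<phi> ==> -T < a ==> b < T ==>
   (!!x. x \<notin> {a..b} ==> \<eta> x = 0) ==> (!!x. x \<notin> {c..d} ==> \<phi> x = 0) ==>
   (LBINT z. (\<eta> (fst z) * dderiv 1 \<phi> (snd z)) *\<^sub>R u z) =
   - (LBINT z. (\<eta> (fst z) * \<phi> (snd z)) *\<^sub>R g z)"
 obtains c where "AE t in lborel. t \<in> {-T<..<T} -->
  (\<forall>R. set_integrable lborel {-R..R} (%x. g (t, x))) \<and>
  (AE x in lborel. u (t, x) = c t + prim (%y. g (t, y)) x)"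
proof -
 define F where "F z = prim (%y. g (fst z, y)) (snd z)" for z
 have sl: "AE t in lborel. t \<in> {-T<..<T} --> (\<forall>R. set_integrable lborel {-R..R} (%x. g (t, x)))"
  by (rule slices_locally_integrable) (rule g)
 have F: "set_integrable lborel (cbox p q) F" if "cbox p q <= strip T" for p q
  unfolding F_def by (rule prim_param_locally_integrable[OF g gm that])
 obtain c where c: "AE z in lborel. z \<in> strip T --> u z - F z = c (fst z)"
 proof (rule du_Bois_Reymond_strip[where h = "%z. u z - F z" and T = T])
  show "set_integrable lborel (cbox p q) (%z. u z - F z)" if "cbox p q <= strip T" for p q
   using u[OF that] F[OF that] by (rule set_integral_diff)
  fix \<eta> \<phi> :: "real => real" and a b k d
  assume \<eta>: "smooth_on UNIV \<eta>" and \<phi>: "smooth_on UNIV \<phi>" and ab: "-T < a" "b < T"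
   and s\<eta>: "!!x. x \<notin> {a..b} ==> \<eta> x = 0" and s\<phi>: "!!x. x \<notin> {k..d} ==> \<phi> x = 0"
  have d0: "dderiv 1 \<phi> x = 0" if "x \<notin> {k..d}" for x
   by (rule dderiv_support[of "{k..d}"]) (use s\<phi> that in auto)
  note cont = smooth_on_continuous[OF \<eta>] smooth_on_continuous[OF \<phi>]
   smooth_on_continuous[OF smooth_on_dderiv[OF \<phi>], of 1]
  have i: "integrable lborel (%z. (\<eta> (fst z) * dderiv 1 \<phi> (snd z)) *\<^sub>R u z)"
   "integrable lborel (%z. (\<eta> (fst z) * dderiv 1 \<phi> (snd z)) *\<^sub>R F z)"
   "integrable lborel (%z. (\<eta> (fst z) * \<phi> (snd z)) *\<^sub>R g z)"
   using integrable_tensor_weight[OF u cont(1,3) ab s\<eta> d0]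
    integrable_tensor_weight[OF F cont(1,3) ab s\<eta> d0]
    integrable_tensor_weight[OF g cont(1,2) ab s\<eta> s\<phi>] by auto
  have "(LBINT z. (\<eta> (fst z) * dderiv 1 \<phi> (snd z)) *\<^sub>R F z) =
   (LBINT t. LBINT x. (\<eta> t * dderiv 1 \<phi> x) *\<^sub>R prim (%y. g (t, y)) x)"
   unfolding plane_Fubini(1)[OF i(2)] by (simp add: F_def)
  also have "... = (LBINT t. - (LBINT x. (\<eta> t * \<phi> x) *\<^sub>R g (t, x)))"
  proof (rule integral_cong_AE)
   show "(%t. LBINT x. (\<eta> t * dderiv 1 \<phi> x) *\<^sub>R prim (%y. g (t, y)) x) \<in> borel_measurable lborel"
    using borel_measurable_integrable[OF plane_Fubini(4)[OF i(2)]] by (simp add: F_def)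
   show "(%t. - (LBINT x. (\<eta> t * \<phi> x) *\<^sub>R g (t, x))) \<in> borel_measurable lborel"
    using borel_measurable_integrable[OF plane_Fubini(4)[OF i(3)]] by simp
   show "AE t in lborel. (LBINT x. (\<eta> t * dderiv 1 \<phi> x) *\<^sub>R prim (%y. g (t, y)) x) =
    - (LBINT x. (\<eta> t * \<phi> x) *\<^sub>R g (t, x))"
   proof (rule AE_mp[OF sl]; (intro AE_I2 impI)?)
    fix t assume t: "t \<in> {-T<..<T} --> (\<forall>R. set_integrable lborel {-R..R} (%x. g (t, x)))"
    show "(LBINT x. (\<eta> t * dderiv 1 \<phi> x) *\<^sub>R prim (%y. g (t, y)) x) =
     - (LBINT x. (\<eta> t * \<phi> x) *\<^sub>R g (t, x))"
    proof (cases "t \<in> {a..b}")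
     case True
     define R where "R = max \<bar>k\<bar> \<bar>d\<bar> + 1"
     have "(LBINT x. dderiv 1 \<phi> x *\<^sub>R prim (%y. g (t, y)) x) = - (LBINT x. \<phi> x *\<^sub>R g (t, x))"
     proof (rule weak_derivative_prim[OF _ \<phi>])
      show "\<phi> x = 0" if "x \<notin> {-R<..<R}" for x
       by (rule s\<phi>) (use that in \<open>auto simp: R_def\<close>)
     qed (use True t ab in auto)
     then show ?thesis by (simp flip: scaleR_scaleR)
    qed (use s\<eta>[of t] in simp)
   qed
  qed
  also have "... = - (LBINT z. (\<eta> (fst z) * \<phi> (snd z)) *\<^sub>R g z)"
   unfolding plane_Fubini(1)[OF i(3)] by simp
  finally show "(LBINT z. (\<eta> (fst z) * dderiv 1 \<phi> (snd z)) *\<^sub>R (u z - F z)) = 0"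
   using weak[OF \<eta> \<phi> ab s\<eta> s\<phi>] i by (simp add: scaleR_diff_right)
 qed
 show ?thesis
 proof (rule that)
  show "AE t in lborel. t \<in> {-T<..<T} -->
   (\<forall>R. set_integrable lborel {-R..R} (%x. g (t, x))) \<and>
   (AE x in lborel. u (t, x) = c t + prim (%y. g (t, y)) x)"
   using sl plane_AE_slices[OF c]
  proof eventually_elim
   case (elim t)
   show ?case
   proof (intro impI conjI)
    assume t: "t \<in> {-T<..<T}"
    then show "\<forall>R. set_integrable lborel {-R..R} (%x. g (t, x))" using elim by blast
    show "AE x in lborel. u (t, x) = c t + prim (%y. g (t, y)) x"
     using elim(2) by (rule AE_mp) (use t in \<open>auto intro!: AE_I2 simp: strip_def F_def algebra_simps\<close>)
   qed
  qed
 qed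
qed

section \<open>Rotations and orthonormal frames\<close>

lemma AE_ex_open:
 fixes S :: "'a::euclidean_space set"
 assumes "AE x in lborel. P x" "open S" "S \<noteq> {}"
 shows "\<exists>x\<in>S. P x"
proof (rule ccontr)
 assume n: "\<not> (\<exists>x\<in>S. P x)"
 obtain x where "x \<in> S" using assms by auto
 then obtain a b where ab: "x \<in> box a b" "cbox a b <= S" using open_contains_cbox[OF \<open>open S\<close>] by metis
 have "AE x in lborel. x \<notin> box a b"
  using assms(1)
 proof (rule AE_mp, intro AE_I2 impI notI)
  fix x assume "P x" "x \<in> box a b"
  moreover have "x \<in> S" using subsetD[OF box_subset_cbox \<open>x \<in> box a b\<close>] ab(2) by auto
  ultimately show False using n by blast
 qed
 then have "emeasure lborel (box a b) = 0"
  by (subst (asm) AE_iff_null_sets[symmetric]) auto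
 moreover have "\<forall>i\<in>Basis. a \<bullet> i < b \<bullet> i" using ab(1) unfolding mem_box by force
 then have "(\<Prod>i\<in>Basis. (b - a) \<bullet> i) > 0" by (intro prod_pos) (auto simp: inner_diff_left)
 moreover have "emeasure lborel (box a b) = ennreal (\<Prod>i\<in>Basis. (b - a) \<bullet> i)"
  using \<open>\<forall>i\<in>Basis. a \<bullet> i < b \<bullet> i\<close> by (intro emeasure_lborel_box) (auto simp: less_imp_le)
 ultimately show False by (metis ennreal_eq_0_iff not_le)
qed

lemma rotation_norm:
 fixes A :: "real^3^3"
 assumes "rotation_matrix A"
 shows "norm (A *v x) = norm x"
proof -
 have "orthogonal_transformation ((*v) A)"
  using assms by (simp add: rotation_matrix_def orthogonal_transformation_matrix)
 then show ?thesis using orthogonal_transformation by blast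
qed

lemma cross_basis_expansion:
 fixes a b v :: "real^3"
 shows "((a \<times> b) \<bullet> (a \<times> b)) *\<^sub>R v =
  ((v \<times> b) \<bullet> (a \<times> b)) *\<^sub>R a + ((a \<times> v) \<bullet> (a \<times> b)) *\<^sub>R b + (v \<bullet> (a \<times> b)) *\<^sub>R (a \<times> b)"
 by (simp add: vec_eq_iff forall_3 cross3_def inner_vec_def sum_3 vector_3 algebra_simps)

lemma norm_cross_le: "norm (x \<times> y) <= norm x * norm (y :: real^3)"
proof -
 have "(norm (x \<times> y))\<^sup>2 <= (norm x * norm y)\<^sup>2"
  using norm_cross_dot[of x y] by (smt (verit) zero_le_power2)
 then show ?thesis by (rule power2_le_imp_le) simp
qed

text \<open>Two rotations that almost agree on two linearly independent vectors almost agree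
  everywhere, because they also almost agree on the cross product of the two vectors.\<close>

lemma rotation_difference_bound:
 fixes A B :: "real^3^3" and a b v :: "real^3"
 assumes A: "rotation_matrix A" and B: "rotation_matrix B"
 shows "norm (a \<times> b) * norm (A *v v - B *v v) <=
  2 * norm v * (norm a + norm b) * (norm (A *v a - B *v a) + norm (A *v b - B *v b))"
proof -
 define D where "D = (%v. A *v v - B *v v)"
 define n where "n = a \<times> b"
 have D_lin: "D (x + y) = D x + D y" "D (c *\<^sub>R x) = c *\<^sub>R D x" for x y c
  by (simp_all add: D_def matrix_vector_right_distrib matrix_vector_mult_scaleR scaleR_diff_right)
 have "D n = (A *v a) \<times> (A *v b) - (B *v a) \<times> (B *v b)"
  by (simp add: D_def n_def cross_rotation_matrix A B)
 also have "... = D a \<times> (A *v b) + (B *v a) \<times> D b"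
  by (simp add: D_def Cross3.left_diff_distrib Cross3.right_diff_distrib)
 finally have Dn: "norm (D n) <= norm (D a) * norm b + norm a * norm (D b)"
  using norm_triangle_ineq[of "D a \<times> (A *v b)" "(B *v a) \<times> D b"]
   norm_cross_le[of "D a" "A *v b"] norm_cross_le[of "B *v a" "D b"]
  by (simp add: rotation_norm A B)
 have "(norm n)\<^sup>2 *\<^sub>R D v = D ((n \<bullet> n) *\<^sub>R v)" by (simp add: D_lin power2_norm_eq_inner)
 also have "(n \<bullet> n) *\<^sub>R v = ((v \<times> b) \<bullet> n) *\<^sub>R a + ((a \<times> v) \<bullet> n) *\<^sub>R b + (v \<bullet> n) *\<^sub>R n"
  unfolding n_def by (rule cross_basis_expansion)
 also have "D ... = ((v \<times> b) \<bullet> n) *\<^sub>R D a + ((a \<times> v) \<bullet> n) *\<^sub>R D b + (v \<bullet> n) *\<^sub>R D n"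
  by (simp add: D_lin)
 finally have "(norm n)\<^sup>2 * norm (D v) = norm (((v \<times> b) \<bullet> n) *\<^sub>R D a + ((a \<times> v) \<bullet> n) *\<^sub>R D b + (v \<bullet> n) *\<^sub>R D n)"
  by (metis abs_power2 norm_scaleR)
 also have "... <= \<bar>(v \<times> b) \<bullet> n\<bar> * norm (D a) + \<bar>(a \<times> v) \<bullet> n\<bar> * norm (D b) + \<bar>v \<bullet> n\<bar> * norm (D n)"
  by (intro order_trans[OF norm_triangle_ineq] add_mono) (auto intro: order_trans[OF norm_triangle_ineq])
 also have "... <= (norm v * norm b * norm n) * norm (D a) + (norm a * norm v * norm n) * norm (D b)
   + (norm v * norm n) * (norm (D a) * norm b + norm a * norm (D b))"
 proof (intro add_mono mult_mono Dn)
  show "\<bar>(v \<times> b) \<bullet> n\<bar> <= norm v * norm b * norm n"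
   using order_trans[OF Cauchy_Schwarz_ineq2 mult_right_mono[OF norm_cross_le norm_ge_zero]] .
  show "\<bar>(a \<times> v) \<bullet> n\<bar> <= norm a * norm v * norm n"
   using order_trans[OF Cauchy_Schwarz_ineq2 mult_right_mono[OF norm_cross_le norm_ge_zero]] .
 qed (auto intro: Cauchy_Schwarz_ineq2 add_nonneg_nonneg)
 also have "... = norm n * (norm v * 2 * (norm b * norm (D a) + norm a * norm (D b)))"
  by (simp add: algebra_simps)
 also have "... <= norm n * (norm v * 2 * ((norm a + norm b) * (norm (D a) + norm (D b))))"
  by (intro mult_left_mono) (auto simp: algebra_simps)
 finally have "norm n * (norm n * norm (D v)) <= norm n * (2 * norm v * (norm a + norm b) * (norm (D a) + norm (D b)))"
  by (simp add: power2_eq_square algebra_simps)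
 then show ?thesis
  unfolding D_def n_def by (cases "a \<times> b = 0") (auto simp: D_def n_def)
qed

definition orthonormal_pair :: "real^3 => real^3 => bool" where
 "orthonormal_pair u e \<longleftrightarrow> norm u = 1 \<and> norm e = 1 \<and> u \<bullet> e = 0"

lemma rotation_frame:
 assumes "orthonormal_pair u e"
 obtains A :: "real^3^3" where "rotation_matrix A" "A *v axis 1 1 = u" "A *v axis 2 1 = e"
proof -
 define N :: "real^3^3" where "N = vector [u, e, u \<times> e]"
 have ue: "u \<bullet> u = 1" "e \<bullet> e = 1" "u \<bullet> e = 0" "e \<bullet> u = 0"
  using assms by (auto simp: orthonormal_pair_def norm_eq_1 inner_commute)
 have c: "(u \<times> e) \<bullet> (u \<times> e) = 1"
  using norm_cross_dot[of u e] ue by (simp add: power2_norm_eq_inner power_mult_distrib)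
 have "orthogonal_matrix N"
  unfolding orthogonal_matrix_orthonormal_rows
  using ue c
  by (auto simp: row_def N_def vector_3 forall_3 norm_eq_1 orthogonal_def inner_commute dot_cross_self)
 moreover have "det N = 1"
  using ue c unfolding N_def by (simp add: dot_cross_det[symmetric] Lagrange)
 ultimately have "rotation_matrix (transpose N)"
  by (simp add: rotation_matrix_def orthogonal_matrix_transpose det_transpose)
 moreover have "transpose N *v axis 1 1 = u" "transpose N *v axis 2 1 = e"
  by (simp_all add: vec_eq_iff matrix_vector_mult_basis column_def transpose_def N_def vector_3)
 ultimately show ?thesis by (rule that)
qed

lemma rotation_mult:
 fixes A B :: "real^3^3"
 assumes "rotation_matrix A" "rotation_matrix B" shows "rotation_matrix (A ** B)"
 using assms orthogonal_matrix_mul[of A B] by (simp add: rotation_matrix_def det_mul)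

lemma rotation_transpose:
 assumes "rotation_matrix (A :: real^3^3)" shows "rotation_matrix (transpose A)" "transpose A *v (A *v x) = x"
 using assms by (simp_all add: rotation_matrix_def orthogonal_matrix_transpose det_transpose
   orthogonal_matrix_def matrix_vector_mul_assoc)

lemma rotation_between_frames:
 assumes "orthonormal_pair u e" "orthonormal_pair u' e'"
 obtains A :: "real^3^3" where "rotation_matrix A" "A *v u = u'" "A *v e = e'"
proof -
 obtain B :: "real^3^3" where B: "rotation_matrix B" "B *v axis 1 1 = u" "B *v axis 2 1 = e"
  by (rule rotation_frame[OF assms(1)])
 obtain B' :: "real^3^3" where B': "rotation_matrix B'" "B' *v axis 1 1 = u'" "B' *v axis 2 1 = e'"
  by (rule rotation_frame[OF assms(2)])
 note tB = rotation_transpose[OF B(1)]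
 show ?thesis
 proof (rule that[of "B' ** transpose B"])
  show "rotation_matrix (B' ** transpose B)" by (intro rotation_mult B'(1) tB(1))
  show "(B' ** transpose B) *v u = u'" "(B' ** transpose B) *v e = e'"
   using tB(2)[of "axis 1 1"] tB(2)[of "axis 2 1"] B B' by (simp_all flip: matrix_vector_mul_assoc)
 qed
qed

lemma orthonormal_pair_cross: "orthonormal_pair u e ==> u \<times> e \<noteq> 0"
 using norm_cross_dot[of u e] by (auto simp: orthonormal_pair_def)

section \<open>Rigidity of curves that are rotated by their derivatives\<close>

text \<open>Absolute continuity with derivative \<open>z\<close>, expressed by integrals.\<close>

definition indefinite_integral_on :: "real set => (real => 'b::euclidean_space) => (real => 'b) => bool" where
 "indefinite_integral_on I y z \<longleftrightarrow>
  (\<forall>a b. a <= b \<and> {a..b} <= I --> set_integrable lborel {a..b} z \<and> y b - y a = (LINT t:{a..b}|lborel. z t))"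

lemma small_integral:
 fixes k :: "real => real"
 assumes k: "set_integrable lborel {c..d} k" and t0: "c < t0" "t0 < d" and "\<epsilon> > 0" and nn: "!!t. k t \<ge> 0"
 obtains \<delta> where "\<delta> > 0" "c <= t0 - \<delta>" "t0 + \<delta> <= d" "(LINT t:{t0-\<delta>..t0+\<delta>}|lborel. k t) < \<epsilon>"
proof -
 define J where "J t = integral {c..t} k" for t
 have c: "continuous_on {c..d} J" unfolding J_def
  using set_borel_integral_eq_integral(1)[OF k] by (rule indefinite_integral_continuous_1)
 have "isCont J t0"
  using c t0 by (intro continuous_on_interior[of "{c..d}"]) auto
 then obtain s where s: "s > 0" "!!t. \<bar>t - t0\<bar> < s ==> \<bar>J t - J t0\<bar> < \<epsilon>/2"
  using half_gt_zero[OF \<open>\<epsilon> > 0\<close>] unfolding continuous_at_eps_delta dist_real_def by metis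
 define \<delta> where "\<delta> = min (s/2) (min (t0 - c) (d - t0))"
 have \<delta>: "\<delta> > 0" "c <= t0 - \<delta>" "t0 + \<delta> <= d" "\<delta> < s" using s t0 by (auto simp: \<delta>_def min_def)
 have sub: "set_integrable lborel {a..b} k" if "c <= a" "b <= d" for a b
  by (rule set_integrable_subset[OF k]) (use that in auto)
 have "(LINT t:{t0-\<delta>..t0+\<delta>}|lborel. k t) = integral {t0-\<delta>..t0+\<delta>} k"
  using \<delta> by (intro set_borel_integral_eq_integral(2) sub) auto
 also have "... = J (t0 + \<delta>) - J (t0 - \<delta>)"
  unfolding J_def using \<delta> set_borel_integral_eq_integral(1)[OF sub[of c "t0+\<delta>"]]
  by (subst Henstock_Kurzweil_Integration.integral_combine[symmetric, of c "t0-\<delta>" "t0+\<delta>"]) auto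
 also have "... < \<epsilon>"
 proof -
  have "\<bar>J (t0 + \<delta>) - J t0\<bar> < \<epsilon>/2" "\<bar>J (t0 - \<delta>) - J t0\<bar> < \<epsilon>/2"
   using \<delta> s(2)[of "t0 + \<delta>"] s(2)[of "t0 - \<delta>"] by auto
  then show ?thesis by linarith
 qed
 finally show ?thesis using that \<delta> by blast
qed

lemma indefinite_integral_difference:
 fixes A :: "real^3^3"
 assumes "indefinite_integral_on I y z" "indefinite_integral_on I y' z'" "{c..d} <= I"
  and "c <= a" "a <= b" "b <= d" "0 <= M"
  and le: "AE \<tau> in lborel. \<tau> \<in> {c..d} --> norm (z' \<tau> - A *v z \<tau>) <= M * norm (z \<tau>)"
 shows "norm ((y' b - A *v y b) - (y' a - A *v y a)) <= M * (LINT \<tau>:{c..d}|lborel. norm (z \<tau>))"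
proof -
 have ab: "{a..b} <= I" "{a..b} <= {c..d}" "c <= d" using assms by auto
 have z: "set_integrable lborel {a..b} z" "y b - y a = (LINT t:{a..b}|lborel. z t)"
  "set_integrable lborel {a..b} z'" "y' b - y' a = (LINT t:{a..b}|lborel. z' t)"
  "set_integrable lborel {c..d} z"
  using assms(1-3,5) ab(1,3) unfolding indefinite_integral_on_def by blast+
 have bl: "bounded_linear ((*v) A)" by (rule matrix_vector_mul_bounded_linear)
 have Az: "set_integrable lborel {a..b} (%t. A *v z t)"
  using integrable_bounded_linear[OF bl z(1)[unfolded set_integrable_def]]
  by (simp add: set_integrable_def matrix_vector_mult_scaleR)
 have Ay: "A *v (y b - y a) = (LINT t:{a..b}|lborel. A *v z t)"
  unfolding z(2) set_lebesgue_integral_def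
  using integral_bounded_linear[OF bl z(1)[unfolded set_integrable_def]]
  by (simp add: matrix_vector_mult_scaleR)
 have "(y' b - A *v y b) - (y' a - A *v y a) = (y' b - y' a) - A *v (y b - y a)"
  by (simp add: matrix_vector_mult_diff_distrib)
 also have "... = (LINT t:{a..b}|lborel. z' t - A *v z t)"
  unfolding Ay z(4) using z(3) Az by (rule set_integral_diff(2)[symmetric])
 finally have "norm ((y' b - A *v y b) - (y' a - A *v y a)) = norm (LINT t:{a..b}|lborel. z' t - A *v z t)"
  by simp
 also have "... <= (LBINT t. norm (indicator {a..b} t *\<^sub>R (z' t - A *v z t)))"
  unfolding set_lebesgue_integral_def by (rule integral_norm_bound)
 also have "... <= (LBINT t. M * norm (indicator {c..d} t *\<^sub>R z t))"
 proof (rule integral_mono_AE)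
  show "integrable lborel (%t. norm (indicator {a..b} t *\<^sub>R (z' t - A *v z t)))"
   using set_integral_diff(1)[OF z(3) Az] unfolding set_integrable_def by (rule integrable_norm)
  show "integrable lborel (%t. M * norm (indicator {c..d} t *\<^sub>R z t))"
   using z(5) unfolding set_integrable_def by (intro integrable_mult_right integrable_norm)
  show "AE t in lborel. norm (indicator {a..b} t *\<^sub>R (z' t - A *v z t)) <= M * norm (indicator {c..d} t *\<^sub>R z t)"
   using le by (rule AE_mp) (use ab \<open>0 <= M\<close> in \<open>auto intro!: AE_I2 simp: indicator_def\<close>)
 qed
 finally show ?thesis by (simp add: set_lebesgue_integral_def)
qed

text \<open>Let \<open>y' = G y\<close> and \<open>(y')' = G (y)'\<close> with rotations \<open>G t\<close>. The oscillation \<open>\<omega>\<close> of \<open>G\<close>, tested on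
  two independent values \<open>y t0\<close>, over a short interval is at most a small multiple of itself, so that
  \<open>G\<close> is locally constant, without any regularity of \<open>G\<close> in \<open>t\<close>.\<close>

lemma rotating_curves_rigid:
 fixes G :: "real => real^3^3"
 assumes I: "open I" "is_interval I"
  and good: "AE t in lborel. t \<in> I --> good t"
  and rot: "!!t. t \<in> I ==> good t ==> rotation_matrix (G t)"
  and Y: "!!y z y' z'. (y, z, y', z') \<in> Y ==> indefinite_integral_on I y z \<and> indefinite_integral_on I y' z' \<and>
   (\<forall>t\<in>I. good t --> y' t = G t *v y t \<and> z' t = G t *v z t)"
  and rich: "!!t. t \<in> I ==> \<exists>y1 z1 y1' z1' y2 z2 y2' z2'.
   (y1, z1, y1', z1') \<in> Y \<and> (y2, z2, y2', z2') \<in> Y \<and> y1 t \<times> y2 t \<noteq> 0"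
  and st: "s \<in> I" "t \<in> I" "good s" "good t"
 shows "G s = G t"
proof (rule connected_equivalence_relation_gen[where S=I and P=good and R="%s t. G s = G t"])
 show "connected I" using I by (simp add: is_interval_connected_1)
 show "\<exists>z. z \<in> T \<and> good z" if "openin (top_of_set I) T" "a \<in> T" for T a
 proof -
  have "open T" "T <= I" using that(1) I(1) by (auto simp: openin_open_eq)
  then have "\<exists>x\<in>T. x \<in> I --> good x" using that(2) by (intro AE_ex_open[OF good]) auto
  then show ?thesis using \<open>T <= I\<close> by auto
 qed
next
 fix t0 assume t0: "t0 \<in> I"
 obtain y1 z1 y1' z1' y2 z2 y2' z2' where Y12: "(y1, z1, y1', z1') \<in> Y" "(y2, z2, y2', z2') \<in> Y"
  and n: "y1 t0 \<times> y2 t0 \<noteq> 0" using rich[OF t0] by blast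
 note Y1 = Y[OF Y12(1)] and Y2 = Y[OF Y12(2)]
 define a b where "a = y1 t0" and "b = y2 t0"
 define C where "C = 2 * (norm a + norm b) / norm (a \<times> b)"
 have npos: "norm (a \<times> b) > 0" using n by (simp add: a_def b_def)
 have C: "C \<ge> 0" by (simp add: C_def)
 obtain c d where cd: "t0 \<in> box c d" "cbox c d <= I" using open_contains_cbox[OF I(1)] t0 by metis
 have cdI: "{c..d} <= I" "c < t0" "t0 < d" using cd by auto
 have zi: "set_integrable lborel {c..d} z1" "set_integrable lborel {c..d} z2"
  using Y1 Y2 cdI unfolding indefinite_integral_on_def by auto
 define k where "k t = norm (z1 t) + norm (z2 t)" for t
 have ki: "set_integrable lborel {c..d} k"
  unfolding k_def using zi by (intro set_integral_add set_integrable_norm)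
 have "1 / (4 * (C + 1)) > 0" using C by simp
 from small_integral[OF ki cdI(2,3) this] obtain \<delta> where \<delta>: "\<delta> > 0" "c <= t0 - \<delta>" "t0 + \<delta> <= d"
  "(LINT t:{t0-\<delta>..t0+\<delta>}|lborel. k t) < 1 / (4 * (C + 1))" by (auto simp: k_def)
 define J where "J = {t0-\<delta>..t0+\<delta>}"
 have J: "J <= I" "J <= {c..d}" using \<delta> cdI by (auto simp: J_def)
 have zJ: "set_integrable lborel J z1" "set_integrable lborel J z2"
  using zi J(2) by (auto intro: set_integrable_subset simp: J_def)
 define m1 m2 where "m1 = (LBINT t:J. norm (z1 t))" and "m2 = (LBINT t:J. norm (z2 t))"
 have m: "m1 \<ge> 0" "m2 \<ge> 0" "4 * (C + 1) * (m1 + m2) < 1"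
 proof -
  show "m1 \<ge> 0" "m2 \<ge> 0" unfolding m1_def m2_def set_lebesgue_integral_def by (auto intro!: integral_nonneg_AE)
  have "m1 + m2 = (LBINT t:J. k t)"
   unfolding m1_def m2_def k_def using zJ by (intro set_integral_add(2)[symmetric] set_integrable_norm)
  then show "4 * (C + 1) * (m1 + m2) < 1" using \<delta>(4) C by (simp add: J_def field_simps)
 qed
 define \<Delta> where "\<Delta> s t = norm (G s *v a - G t *v a) + norm (G s *v b - G t *v b)" for s t
 define W where "W = {\<Delta> s t | s t. s \<in> J \<and> t \<in> J \<and> good s \<and> good t}"
 define \<omega> where "\<omega> = Sup W"
 have \<Delta>le: "\<Delta> s t <= 2 * (norm a + norm b)" if "s \<in> J" "t \<in> J" "good s" "good t" for s t
 proof -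
  have "s \<in> I" "t \<in> I" using that J by auto
  then show ?thesis
   using norm_triangle_ineq4[of "G s *v a" "G t *v a"] norm_triangle_ineq4[of "G s *v b" "G t *v b"]
    rotation_norm[OF rot[of s]] rotation_norm[OF rot[of t]] that by (simp add: \<Delta>_def)
 qed
 have bdd: "bdd_above W" unfolding W_def bdd_above_def using \<Delta>le by blast
 have up: "\<Delta> s t <= \<omega>" if "s \<in> J" "t \<in> J" "good s" "good t" for s t
  unfolding \<omega>_def using bdd that by (intro cSup_upper) (auto simp: W_def)
 have act: "norm (G s *v v - G t *v v) <= C * \<omega> * norm v" if "s \<in> J" "t \<in> J" "good s" "good t" for s t v
 proof -
  have "norm (a \<times> b) * norm (G s *v v - G t *v v) <= 2 * norm v * (norm a + norm b) * \<Delta> s t"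
   unfolding \<Delta>_def using that J by (intro rotation_difference_bound rot) auto
  also have "... <= 2 * norm v * (norm a + norm b) * \<omega>"
   by (intro mult_left_mono up that) auto
  finally show ?thesis using npos by (simp add: C_def field_simps)
 qed
 have one: "norm (G t *v y t0 - y' t0) <= C * \<omega> * (LBINT \<tau>:J. norm (z \<tau>))"
  if t: "t \<in> J" "good t" and "(y, z, y', z') \<in> Y" for t y z y' z'
 proof -
  note Yy = Y[OF that(3)]
  have \<omega>0: "\<omega> \<ge> 0" using up[OF t(1) t(1) t(2) t(2)] by (simp add: \<Delta>_def)
  have le: "AE \<tau> in lborel. \<tau> \<in> {t0-\<delta>..t0+\<delta>} --> norm (z' \<tau> - G t *v z \<tau>) <= (C * \<omega>) * norm (z \<tau>)"
   using good
  proof (rule AE_mp, intro AE_I2 impI)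
   fix \<tau> assume g: "\<tau> \<in> I --> good \<tau>" and \<tau>: "\<tau> \<in> {t0-\<delta>..t0+\<delta>}"
   then have "\<tau> \<in> J" "good \<tau>" using J by (auto simp: J_def)
   then show "norm (z' \<tau> - G t *v z \<tau>) <= (C * \<omega>) * norm (z \<tau>)"
    using act[of \<tau> t "z \<tau>"] t Yy J by auto
  qed
  have d: "norm ((y' v - G t *v y v) - (y' u - G t *v y u)) <= C * \<omega> * (LBINT \<tau>:J. norm (z \<tau>))"
   if "u <= v" "u \<in> J" "v \<in> J" for u v
   unfolding J_def
   by (rule indefinite_integral_difference[OF _ _ _ _ that(1) _ _ le, of I])
    (use Yy J that C \<omega>0 in \<open>auto simp: J_def\<close>)
  have eq: "y' t = G t *v y t" using Yy t J by auto
  have "t0 \<in> J" using \<delta> by (simp add: J_def)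
  show ?thesis
  proof (cases "t0 <= t")
   case True
   then show ?thesis using d[OF True \<open>t0 \<in> J\<close> t(1)] eq by simp
  next
   case False
   then show ?thesis using d[of t t0] \<open>t0 \<in> J\<close> t(1) eq by (simp add: norm_minus_commute)
  qed
 qed
 have half: "\<Delta> s t <= \<omega> / 2" if "s \<in> J" "t \<in> J" "good s" "good t" for s t
 proof -
  have \<omega>0: "\<omega> \<ge> 0" using up[OF that(1) that(1) that(3) that(3)] by (simp add: \<Delta>_def)
  have "norm (G s *v a - G t *v a) <= norm (G s *v a - y1' t0) + norm (G t *v a - y1' t0)"
   by (metis dist_norm dist_triangle2)
  moreover have "norm (G s *v b - G t *v b) <= norm (G s *v b - y2' t0) + norm (G t *v b - y2' t0)"
   by (metis dist_norm dist_triangle2)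
  ultimately have "\<Delta> s t <= 2 * (C * \<omega> * m1) + 2 * (C * \<omega> * m2)"
   using one[OF that(1,3) Y12(1)] one[OF that(2,4) Y12(1)] one[OF that(1,3) Y12(2)] one[OF that(2,4) Y12(2)]
   unfolding \<Delta>_def a_def b_def m1_def m2_def by linarith
  also have "... = (4 * C * (m1 + m2)) * (\<omega> / 2)" by (simp add: algebra_simps)
  also have "... <= 1 * (\<omega> / 2)"
   using m C \<omega>0 by (intro mult_right_mono) (auto simp: algebra_simps intro: order_trans[of _ "4 * (C + 1) * (m1 + m2)"])
  finally show ?thesis by simp
 qed
 have "G s = G t" if st: "s \<in> J" "t \<in> J" "good s" "good t" for s t
 proof -
  have "W \<noteq> {}" using st by (auto simp: W_def)
  then have "Sup W <= \<omega> / 2" using half by (intro cSup_least) (auto simp: W_def)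
  then have "\<omega> <= \<omega> / 2" unfolding \<omega>_def[symmetric] .
  moreover have "\<omega> \<ge> 0" using up[OF st(1) st(1) st(3) st(3)] by (simp add: \<Delta>_def)
  ultimately have "\<omega> = 0" by simp
  then have "G s *v v = G t *v v" for v using act[OF st, of v] by simp
  then show ?thesis using matrix_eq by blast
 qed
 moreover have "openin (top_of_set I) (box (t0-\<delta>) (t0+\<delta>))"
  unfolding openin_open_eq[OF I(1)]
  using J(1) box_subset_cbox[of "t0-\<delta>" "t0+\<delta>"] by (auto simp: J_def)
 ultimately show "\<exists>T. openin (top_of_set I) T \<and> t0 \<in> T \<and> (\<forall>x\<in>T. \<forall>y\<in>T. good x \<and> good y --> G x = G y)"
  using \<delta>(1) by (intro exI[of _ "box (t0-\<delta>) (t0+\<delta>)"]) (auto simp: J_def)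
qed (use st in auto)

lemma indefinite_integral_prim:
 fixes g :: "real => 'b::euclidean_space"
 assumes "!!R. set_integrable lborel {-R..R} g"
 shows "indefinite_integral_on UNIV (%x. c + prim g x) g"
 unfolding indefinite_integral_on_def
proof safe
 fix a b :: real assume "a <= b"
 show "set_integrable lborel {a..b} g"
  by (rule set_integrable_subset[OF assms[of "max \<bar>a\<bar> \<bar>b\<bar>"]]) auto
 show "c + prim g b - (c + prim g a) = (LINT t:{a..b}|lborel. g t)"
  using prim_diff[OF assms \<open>a <= b\<close>] by simp
qed

lemma AE_eq_continuous:
 fixes f g :: "real => 'b::euclidean_space"
 assumes I: "open I" and c: "continuous_on I f" "continuous_on I g"
  and ae: "AE x in lborel. x \<in> I --> f x = g x" and "x \<in> I"
 shows "f x = g x"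
proof (rule ccontr)
 assume n: "f x \<noteq> g x"
 have "open (I \<inter> (%x. f x - g x) -` (- {0}))"
  using I c by (intro continuous_open_preimage continuous_intros) auto
 then have "\<exists>y\<in>I \<inter> (%x. f x - g x) -` (- {0}). y \<in> I --> f y = g y"
  by (rule AE_ex_open[OF ae]) (use n \<open>x \<in> I\<close> in auto)
 then show False by auto
qed

text \<open>One frame in a slice determines the other one up to a rotation.\<close>

lemma slice_rotation:
 fixes u e u' e' :: "real => real^3" and q1 q2 :: "real => real"
 assumes u: "!!R. set_integrable lborel {-R..R} (%x. q1 x *\<^sub>R e x + q2 x *\<^sub>R (u x \<times> e x))"
   "AE x in lborel. u x = c + prim (%x. q1 x *\<^sub>R e x + q2 x *\<^sub>R (u x \<times> e x)) x"
  and e: "!!R. set_integrable lborel {-R..R} (%x. - q1 x *\<^sub>R u x)"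
   "AE x in lborel. e x = d + prim (%x. - q1 x *\<^sub>R u x) x"
  and ue: "AE x in lborel. orthonormal_pair (u x) (e x)"
  and u': "!!R. set_integrable lborel {-R..R} (%x. q1 x *\<^sub>R e' x + q2 x *\<^sub>R (u' x \<times> e' x))"
   "AE x in lborel. u' x = c' + prim (%x. q1 x *\<^sub>R e' x + q2 x *\<^sub>R (u' x \<times> e' x)) x"
  and e': "!!R. set_integrable lborel {-R..R} (%x. - q1 x *\<^sub>R u' x)"
   "AE x in lborel. e' x = d' + prim (%x. - q1 x *\<^sub>R u' x) x"
  and ue': "AE x in lborel. orthonormal_pair (u' x) (e' x)"
 obtains A :: "real^3^3" where "rotation_matrix A"
  "AE x in lborel. u' x = A *v u x \<and> e' x = A *v e x"
proof -
 define U where "U x = c + prim (%x. q1 x *\<^sub>R e x + q2 x *\<^sub>R (u x \<times> e x)) x" for x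
 define E where "E x = d + prim (%x. - q1 x *\<^sub>R u x) x" for x
 define U' where "U' x = c' + prim (%x. q1 x *\<^sub>R e' x + q2 x *\<^sub>R (u' x \<times> e' x)) x" for x
 define E' where "E' x = d' + prim (%x. - q1 x *\<^sub>R u' x) x" for x
 have cont: "continuous_on UNIV U" "continuous_on UNIV E" "continuous_on UNIV U'" "continuous_on UNIV E'"
  unfolding U_def E_def U'_def E'_def
  by (intro continuous_on_add continuous_on_const continuous_prim u e u' e')+
 define good where "good x \<longleftrightarrow> u x = U x \<and> e x = E x \<and> u' x = U' x \<and> e' x = E' x" for x
 have good: "AE x in lborel. good x"
  using u(2) e(2) u'(2) e'(2) unfolding good_def U_def E_def U'_def E'_def by eventually_elim simp
 have onp: "orthonormal_pair (U x) (E x)" for x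
 proof -
  have "AE x in lborel. x \<in> UNIV --> (norm (U x), norm (E x), U x \<bullet> E x) = (1, 1, 0)"
   using good ue by eventually_elim (simp add: good_def orthonormal_pair_def)
  then have "(norm (U x), norm (E x), U x \<bullet> E x) = (1, 1, 0)"
   by (rule AE_eq_continuous[OF open_UNIV, rotated 2]) (intro continuous_intros cont UNIV_I)+
  then show ?thesis unfolding orthonormal_pair_def by simp
 qed
 have onp': "orthonormal_pair (U' x) (E' x)" for x
 proof -
  have "AE x in lborel. x \<in> UNIV --> (norm (U' x), norm (E' x), U' x \<bullet> E' x) = (1, 1, 0)"
   using good ue' by eventually_elim (simp add: good_def orthonormal_pair_def)
  then have "(norm (U' x), norm (E' x), U' x \<bullet> E' x) = (1, 1, 0)"
   by (rule AE_eq_continuous[OF open_UNIV, rotated 2]) (intro continuous_intros cont UNIV_I)+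
  then show ?thesis unfolding orthonormal_pair_def by simp
 qed
 have "\<exists>A :: real^3^3. rotation_matrix A \<and> A *v U x = U' x \<and> A *v E x = E' x" for x
  using rotation_between_frames[OF onp[of x] onp'[of x]] by blast
 then obtain G :: "real => real^3^3" where
  G: "!!x. rotation_matrix (G x)" "!!x. G x *v U x = U' x" "!!x. G x *v E x = E' x" by metis
 define Y where "Y = {(U, %x. q1 x *\<^sub>R e x + q2 x *\<^sub>R (u x \<times> e x), U', %x. q1 x *\<^sub>R e' x + q2 x *\<^sub>R (u' x \<times> e' x)),
  (E, %x. - q1 x *\<^sub>R u x, E', %x. - q1 x *\<^sub>R u' x)}"
 have ii: "indefinite_integral_on UNIV U (%x. q1 x *\<^sub>R e x + q2 x *\<^sub>R (u x \<times> e x))"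
  "indefinite_integral_on UNIV E (%x. - q1 x *\<^sub>R u x)"
  "indefinite_integral_on UNIV U' (%x. q1 x *\<^sub>R e' x + q2 x *\<^sub>R (u' x \<times> e' x))"
  "indefinite_integral_on UNIV E' (%x. - q1 x *\<^sub>R u' x)"
  unfolding U_def[abs_def] E_def[abs_def] U'_def[abs_def] E'_def[abs_def]
  by (intro indefinite_integral_prim u e u' e')+
 have eq: "G x = G y" if "good x" "good y" for x y
 proof (rule rotating_curves_rigid[where I=UNIV and good=good and G=G and Y=Y])
  show "AE t in lborel. t \<in> UNIV --> good t" using good by simp
  fix y z y' z' assume "(y, z, y', z') \<in> Y"
  then show "indefinite_integral_on UNIV y z \<and> indefinite_integral_on UNIV y' z' \<and>
   (\<forall>t\<in>UNIV. good t --> y' t = G t *v y t \<and> z' t = G t *v z t)"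
  proof -
   have "good t ==> q1 t *\<^sub>R e' t + q2 t *\<^sub>R (u' t \<times> e' t) = G t *v (q1 t *\<^sub>R e t + q2 t *\<^sub>R (u t \<times> e t))" for t
    by (simp add: good_def matrix_vector_right_distrib matrix_vector_mult_scaleR
      cross_rotation_matrix[OF G(1), symmetric] G(2,3))
   moreover have "good t ==> - q1 t *\<^sub>R u' t = G t *v (- q1 t *\<^sub>R u t)" for t
    by (simp only: good_def matrix_vector_mult_scaleR G(2))
   ultimately show ?thesis using \<open>(y, z, y', z') \<in> Y\<close> ii G by (auto simp: Y_def)
  qed
 next
  fix t
  show "\<exists>y1 z1 y1' z1' y2 z2 y2' z2'. (y1, z1, y1', z1') \<in> Y \<and> (y2, z2, y2', z2') \<in> Y \<and> y1 t \<times> y2 t \<noteq> 0"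
   using orthonormal_pair_cross[OF onp[of t]] unfolding Y_def by blast
 qed (use that G in auto)
 obtain x0 where "good x0" using AE_ex_open[OF good open_UNIV] by auto
 show ?thesis
 proof (rule that[of "G x0"])
  show "AE x in lborel. u' x = G x0 *v u x \<and> e' x = G x0 *v e x"
   using good by (rule eventually_mono) (use eq[OF _ \<open>good x0\<close>] G in \<open>metis good_def\<close>)
 qed (rule G)
qed

text \<open>A continuous function with a locally integrable distributional derivative is its
  indefinite integral.\<close>

lemma weak_derivative_imp_indefinite_integral:
 fixes y z :: "real => 'b::euclidean_space"
 assumes y: "continuous_on {-T<..<T} y"
  and z: "!!a b. -T < a ==> b < T ==> set_integrable lborel {a..b} z"
  and weak: "!!\<eta> a b. smooth_on UNIV \<eta> ==> -T < a ==> b < T ==> (!!t. t \<notin> {a..b} ==> \<eta> t = 0) ==>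
   (LBINT t. dderiv 1 \<eta> t *\<^sub>R y t) = - (LBINT t. \<eta> t *\<^sub>R z t)"
 shows "indefinite_integral_on {-T<..<T} y z"
 unfolding indefinite_integral_on_def
proof (intro allI impI conjI; elim conjE)
 fix a b :: real assume ab: "a <= b" "{a..b} <= {-T<..<T}"
 then have ab': "-T < a" "b < T" by auto
 show zab: "set_integrable lborel {a..b} z" using z ab' by blast
 obtain c where c: "\<bar>a\<bar> < c" "\<bar>b\<bar> < c" "c < T"
 proof -
  have "max \<bar>a\<bar> \<bar>b\<bar> < T" using ab(1) ab' by (auto simp: abs_less_iff)
  then show ?thesis using dense[of "max \<bar>a\<bar> \<bar>b\<bar>" T] that by auto
 qed
 define Z where "Z t = indicator {-c..c} t *\<^sub>R z t" for t
 have Zi: "integrable lborel Z" using z[of "-c" c] c by (simp add: Z_def[abs_def] set_integrable_def)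
 have ZR: "set_integrable lborel S Z" if "S \<in> sets borel" for S
  using Zi that unfolding set_integrable_def by (simp add: integrable_mult_indicator)
 have yi: "set_integrable lborel {r..s} y" if "{r..s} <= {-c<..<c}" for r s
  by (rule borel_integrable_atLeastAtMost', rule continuous_on_subset[OF y]) (use that c in auto)
 have cP: "continuous_on S (prim Z)" for S
  by (rule continuous_on_subset[OF continuous_prim]) (auto intro: ZR)
 obtain k where k: "AE t in lborel. t \<in> {-c<..<c} --> y t - prim Z t = k"
 proof (rule du_Bois_Reymond[of "{-c<..<c}" "%t. y t - prim Z t"])
  show "{-c<..<c} \<noteq> {}" using c by auto
  show "is_interval {-c<..<c}" by (rule is_interval_oo)
  show "set_integrable lborel {r..s} (%t. y t - prim Z t)" if "{r..s} <= {-c<..<c}" for r s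
   by (intro set_integral_diff yi that borel_integrable_atLeastAtMost' cP)
  fix \<phi> r s assume \<phi>: "smooth_on UNIV \<phi>" "{r..s} <= {-c<..<c}" "!!x. x \<notin> {r..s} ==> \<phi> x = (0::real)"
  show "(LBINT t. dderiv 1 \<phi> t *\<^sub>R (y t - prim Z t)) = 0"
  proof -
   note cd = smooth_on_continuous[OF smooth_on_dderiv[OF \<phi>(1)], of 1]
   have d0: "dderiv 1 \<phi> x = 0" if "x \<notin> {r..s}" for x
    by (rule dderiv_support[of "{r..s}"]) (use \<phi>(3) that in auto)
   have i1: "integrable lborel (%t. dderiv 1 \<phi> t *\<^sub>R y t)"
    by (rule integrable_continuous_weight[OF yi[OF \<phi>(2)] cd compact_Icc]) (rule d0)
   have i2: "integrable lborel (%t. dderiv 1 \<phi> t *\<^sub>R prim Z t)"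
    by (rule integrable_continuous_weight[OF borel_integrable_atLeastAtMost'[OF cP] cd compact_Icc]) (rule d0)
   have 1: "(LBINT t. dderiv 1 \<phi> t *\<^sub>R y t) = - (LBINT t. \<phi> t *\<^sub>R z t)"
   proof (rule weak[OF \<phi>(1), of "-c" c])
    show "\<phi> t = 0" if "t \<notin> {-c..c}" for t
    proof (rule \<phi>(3))
     show "t \<notin> {r..s}" using that \<phi>(2) by auto
    qed
   qed (use c in auto)
   have 2: "(LBINT t. dderiv 1 \<phi> t *\<^sub>R prim Z t) = - (LBINT t. \<phi> t *\<^sub>R Z t)"
   proof (rule weak_derivative_prim[OF _ \<phi>(1), of _ c])
    show "\<phi> t = 0" if "t \<notin> {-c<..<c}" for t
    proof (rule \<phi>(3))
     show "t \<notin> {r..s}" using that \<phi>(2) by auto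
    qed
   qed (auto intro: ZR)
   have 3: "\<phi> t *\<^sub>R Z t = \<phi> t *\<^sub>R z t" for t
   proof (cases "t \<in> {r..s}")
    case True
    then have "-c < t \<and> t < c" using \<phi>(2) by auto
    then show ?thesis by (simp add: Z_def)
   qed (simp add: \<phi>(3))
   show ?thesis using i1 i2 1 2 unfolding 3 by (simp add: scaleR_diff_right)
  qed
 qed auto
 have e: "y t - prim Z t = k" if "t \<in> {-c<..<c}" for t
  by (rule AE_eq_continuous[OF _ _ _ k that])
   (auto intro!: continuous_intros cP continuous_on_subset[OF y] simp: c(3) less_trans[OF _ c(3)],
   use c in linarith)
 have "y b - y a = prim Z b - prim Z a" using e[of a] e[of b] c by (auto simp: abs_less_iff algebra_simps)
 also have "... = (LINT t:{a..b}|lborel. Z t)" by (rule prim_diff[OF _ ab(1)]) (auto intro: ZR)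
 also have "... = (LINT t:{a..b}|lborel. z t)"
  using c by (intro set_lebesgue_integral_cong) (auto simp: Z_def abs_less_iff)
 finally show "y b - y a = (LINT t:{a..b}|lborel. z t)" .
qed

section \<open>Continuity in time with values in local square integrable functions\<close>

lemma L2_sq_real:
 fixes v :: "'a::euclidean_space => 'b::euclidean_space"
 assumes [measurable]: "v \<in> borel_measurable borel" "S \<in> sets borel" and "L2_sq S v < \<infinity>"
 shows "set_integrable lborel S (%x. (norm (v x))\<^sup>2)"
  and "L2_sq S v = ennreal (LBINT x:S. (norm (v x))\<^sup>2)"
proof -
 have eq: "L2_sq S v = (\<integral>\<^sup>+x. ennreal (indicator S x *\<^sub>R (norm (v x))\<^sup>2) \<partial>lborel)"
  unfolding L2_sq_def by (intro nn_integral_cong) (auto simp: indicator_def)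
 have "integrable lborel (%x. indicator S x *\<^sub>R (norm (v x))\<^sup>2)"
  using assms(3) unfolding eq by (intro integrableI_nonneg) auto
 then show "set_integrable lborel S (%x. (norm (v x))\<^sup>2)" unfolding set_integrable_def .
 with eq show "L2_sq S v = ennreal (LBINT x:S. (norm (v x))\<^sup>2)"
  unfolding set_lebesgue_integral_def set_integrable_def by (simp add: nn_integral_eq_integral)
qed

lemma L2_sq_of_integrable:
 fixes v :: "'a::euclidean_space => 'b::euclidean_space"
 assumes "set_integrable lborel S (%x. (norm (v x))\<^sup>2)"
 shows "L2_sq S v = ennreal (LBINT x:S. (norm (v x))\<^sup>2)"
proof -
 have eq: "L2_sq S v = (\<integral>\<^sup>+x. ennreal (indicator S x *\<^sub>R (norm (v x))\<^sup>2) \<partial>lborel)"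
  unfolding L2_sq_def by (intro nn_integral_cong) (auto simp: indicator_def)
 show ?thesis unfolding eq set_lebesgue_integral_def using assms unfolding set_integrable_def
  by (simp add: nn_integral_eq_integral)
qed

lemma L2_sq_mono_AE:
 assumes "AE x in lborel. x \<in> S --> norm (f x) <= norm (g x)"
 shows "L2_sq S f <= L2_sq S g"
 unfolding L2_sq_def
 by (rule nn_integral_mono_AE, rule eventually_mono[OF assms])
  (auto simp: indicator_def intro!: ennreal_leI power_mono)

lemma L2_sq_bound2:
 fixes g h :: "'a::euclidean_space => 'b::euclidean_space" and f :: "'a => 'c::euclidean_space"
 assumes [measurable]: "g \<in> borel_measurable borel" "h \<in> borel_measurable borel" "S \<in> sets borel"
  and le: "AE x in lborel. x \<in> S --> norm (f x) <= M * (norm (g x) + norm (h x))" and "M \<ge> 0"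
 shows "L2_sq S f <= ennreal (2 * M\<^sup>2) * (L2_sq S g + L2_sq S h)"
proof -
 have "L2_sq S f <= (\<integral>\<^sup>+x. ennreal (2 * M\<^sup>2) * (ennreal ((norm (g x))\<^sup>2) * indicator S x + ennreal ((norm (h x))\<^sup>2) * indicator S x) \<partial>lborel)"
  unfolding L2_sq_def
 proof (rule nn_integral_mono_AE, rule eventually_mono[OF le])
  fix x assume *: "x \<in> S --> norm (f x) <= M * (norm (g x) + norm (h x))"
  show "ennreal ((norm (f x))\<^sup>2) * indicator S x <= ennreal (2 * M\<^sup>2) * (ennreal ((norm (g x))\<^sup>2) * indicator S x + ennreal ((norm (h x))\<^sup>2) * indicator S x)"
  proof (cases "x \<in> S")
   case True
   then have "(norm (f x))\<^sup>2 <= (M * (norm (g x) + norm (h x)))\<^sup>2" using * by (intro power_mono) auto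
   also have "... <= 2 * M\<^sup>2 * ((norm (g x))\<^sup>2 + (norm (h x))\<^sup>2)"
   proof -
    have "(norm (g x) + norm (h x))\<^sup>2 <= 2 * ((norm (g x))\<^sup>2 + (norm (h x))\<^sup>2)"
     using sum_squares_bound[of "norm (g x)" "norm (h x)"] by (simp add: power2_sum)
    from mult_left_mono[OF this zero_le_power2[of M]] show ?thesis
     by (simp only: power_mult_distrib mult.assoc mult.left_commute[of 2])
   qed
   finally show ?thesis using True
    by (simp add: ennreal_mult'[symmetric] ennreal_plus[symmetric] ennreal_leI del: ennreal_plus)
  qed simp
 qed
 also have "... = ennreal (2 * M\<^sup>2) * (L2_sq S g + L2_sq S h)"
  unfolding L2_sq_def by (subst nn_integral_cmult) (auto intro!: arg_cong2[where f="(*)"] nn_integral_add)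
 finally show ?thesis .
qed

lemma L2_sq_0_AE:
 fixes f :: "'a::euclidean_space => 'b::euclidean_space"
 assumes [measurable]: "f \<in> borel_measurable borel" "S \<in> sets borel" and "L2_sq S f = 0"
 shows "AE x in lborel. x \<in> S --> f x = 0"
proof -
 have "AE x in lborel. ennreal ((norm (f x))\<^sup>2) * indicator S x = 0"
  using assms(3) unfolding L2_sq_def by (subst (asm) nn_integral_0_iff_AE) auto
 then show ?thesis by (rule eventually_mono) (auto simp: indicator_def split: if_splits)
qed

lemma borel_slice:
 fixes f :: "real \<times> real => 'b::euclidean_space"
 assumes "f \<in> borel_measurable borel" shows "(%x. f (t, x)) \<in> borel_measurable borel"
proof -
 have [measurable]: "f \<in> borel_measurable (borel \<Otimes>\<^sub>M borel)" using assms by (simp add: borel_prod)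
 show ?thesis by measurable
qed

text \<open>A property that holds at almost every time holds at every time, by continuity.\<close>

lemma C_L2loc_AE_all_times:
 fixes f :: "real \<times> real => 'c::euclidean_space" and u e :: "real \<times> real => 'b::euclidean_space"
 assumes fm: "f \<in> borel_measurable borel" and um: "u \<in> borel_measurable borel" and em: "e \<in> borel_measurable borel"
  and u: "C_L2loc T u" and e: "C_L2loc T e" and "M \<ge> 0"
  and le: "!!s t. s \<in> {-T<..<T} ==> t \<in> {-T<..<T} ==> AE x in lborel.
    norm (f (t, x) - f (s, x)) <= M * (norm (u (s, x) - u (t, x)) + norm (e (s, x) - e (t, x)))"
  and ae: "AE t in lborel. t \<in> {-T<..<T} --> (AE x in lborel. f (t, x) = 0)"
  and t: "t \<in> {-T<..<T}"
 shows "AE x in lborel. f (t, x) = 0"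
proof -
 have zero: "L2_sq {-r<..<r} (%x. f (t, x)) = 0" if "r > 0" for r
 proof (rule ccontr)
  assume n: "L2_sq {-r<..<r} (%x. f (t, x)) \<noteq> 0"
  define N where "N s = ennreal (2 * M\<^sup>2) * (L2_sq {-r<..<r} (%x. u (s, x) - u (t, x)) + L2_sq {-r<..<r} (%x. e (s, x) - e (t, x)))" for s
  have "(N \<longlongrightarrow> ennreal (2 * M\<^sup>2) * (0 + 0)) (at t within {-T<..<T})"
   unfolding N_def using u e t \<open>r > 0\<close> unfolding C_L2loc_def
   by (intro tendsto_mult_ennreal tendsto_add tendsto_const) auto
  then have "eventually (%s. N s < L2_sq {-r<..<r} (%x. f (t, x))) (at t within {-T<..<T})"
   using n by (intro order_tendstoD(2)[where y="ennreal (2 * M\<^sup>2) * (0 + 0)"]) (auto simp: zero_less_iff_neq_zero)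
  then obtain \<delta> where \<delta>: "\<delta> > 0" "!!s. s \<in> {-T<..<T} ==> s \<noteq> t ==> dist s t < \<delta> ==> N s < L2_sq {-r<..<r} (%x. f (t, x))"
   unfolding eventually_at by blast
  have "\<exists>s\<in>{t<..<min (t + \<delta>) T}. s \<in> {-T<..<T} --> (AE x in lborel. f (s, x) = 0)"
   by (rule AE_ex_open[OF ae]) (use \<delta> t in auto)
  then obtain s where s0: "s \<in> {t<..<min (t + \<delta>) T}" "s \<in> {-T<..<T} --> (AE x in lborel. f (s, x) = 0)"
   by blast
  have s: "s \<in> {-T<..<T}" "s \<noteq> t" "dist s t < \<delta>" using s0(1) t by (auto simp: dist_real_def)
  note s = s s0(2)[rule_format, OF s(1)]
  note [measurable] = borel_slice[OF um] borel_slice[OF em]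
  have "L2_sq {-r<..<r} (%x. f (t, x)) <= N s"
   unfolding N_def
  proof (rule L2_sq_bound2)
   show "AE x in lborel. x \<in> {-r<..<r} --> norm (f (t, x)) <= M * (norm (u (s, x) - u (t, x)) + norm (e (s, x) - e (t, x)))"
    using le[OF s(1) t] s(4) by eventually_elim simp
  qed (measurable, rule \<open>M \<ge> 0\<close>)
  then show False using \<delta>(2)[OF s(1-3)] by simp
 qed
 have "AE x in lborel. x \<in> {- real (Suc n)<..<real (Suc n)} --> f (t, x) = 0" for n
  by (rule L2_sq_0_AE[OF borel_slice[OF fm] _ zero]) auto
 then have "AE x in lborel. \<forall>n. x \<in> {- real (Suc n)<..<real (Suc n)} --> f (t, x) = 0"
  unfolding AE_all_countable by blast
 then show ?thesis
 proof (rule eventually_mono)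
  fix x assume *: "\<forall>n. x \<in> {- real (Suc n)<..<real (Suc n)} --> f (t, x) = 0"
  obtain n where "\<bar>x\<bar> < real n" using reals_Archimedean2 by blast
  then have "x \<in> {- real (Suc n)<..<real (Suc n)}" by auto
  then show "f (t, x) = 0" using * by blast
 qed
qed

lemma C_L2loc_continuous_pairing:
 fixes u :: "real \<times> real => 'b::euclidean_space" and \<phi> :: "real => real"
 assumes um: "u \<in> borel_measurable borel" and u: "C_L2loc T u"
  and c: "continuous_on UNIV \<phi>" and supp: "!!x. x \<notin> {c..d} ==> \<phi> x = 0"
 shows "continuous_on {-T<..<T} (%t. LBINT x. \<phi> x *\<^sub>R u (t, x))"
  and "t \<in> {-T<..<T} ==> integrable lborel (%x. \<phi> x *\<^sub>R u (t, x))"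
proof -
 define r where "r = max \<bar>c\<bar> \<bar>d\<bar> + 1"
 have r: "r > 0" "{c..d} <= {-r<..<r}" by (auto simp: r_def)
 obtain M where M: "!!x. \<bar>\<phi> x\<bar> <= M" "M > 0"
  using continuous_compact_support_bounded[OF c compact_Icc supp] by blast
 note \<phi>m[measurable] = borel_measurable_continuous_onI[OF c]
 note um1[measurable] = borel_slice[OF um]
 have le: "\<bar>v\<bar> <= \<delta> + v\<^sup>2 / \<delta>" if "\<delta> > 0" for v \<delta> :: real
 proof -
  have "\<bar>v\<bar> * \<delta> <= \<delta> * \<delta> + v\<^sup>2"
  proof -
   have "2 * \<bar>v\<bar> * \<delta> <= v\<^sup>2 + \<delta> * \<delta>"
    using sum_squares_bound[of "\<bar>v\<bar>" \<delta>] by (simp add: power2_eq_square)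
   moreover have "0 <= \<bar>v\<bar> * \<delta>" using that by simp
   ultimately show ?thesis by linarith
  qed
  then show ?thesis using that by (simp add: field_simps power2_eq_square)
 qed
 have key: "integrable lborel (%x. \<phi> x *\<^sub>R v x)"
  "norm (LBINT x. \<phi> x *\<^sub>R v x) <= M * (2 * r * \<delta> + (LINT x:{-r<..<r}|lborel. (norm (v x))\<^sup>2) / \<delta>)"
  if v[measurable]: "v \<in> borel_measurable borel" and fin: "L2_sq {-r<..<r} v < \<infinity>" and "\<delta> > 0" for v :: "real => 'b" and \<delta>
 proof -
  have i: "integrable lborel (%x. M * (\<delta> * indicator {-r..r} x + indicator {-r<..<r} x *\<^sub>R (norm (v x))\<^sup>2 / \<delta>))"
   using L2_sq_real(1)[OF v _ fin] integrable_indicator_Icc[of "-r" r] unfolding set_integrable_def by auto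
  have b: "norm (\<phi> x *\<^sub>R v x) <= M * (\<delta> * indicator {-r..r} x + indicator {-r<..<r} x *\<^sub>R (norm (v x))\<^sup>2 / \<delta>)" for x
  proof (cases "x \<in> {c..d}")
   case True
   then have x: "x \<in> {-r<..<r}" using r by blast
   then have "norm (\<phi> x *\<^sub>R v x) <= M * (\<delta> + (norm (v x))\<^sup>2 / \<delta>)"
    using M le[OF \<open>\<delta> > 0\<close>, of "norm (v x)"] by (auto intro!: mult_mono)
   then show ?thesis using x by (simp add: indicator_def)
  next
   case False
   then show ?thesis using supp[of x] M \<open>\<delta> > 0\<close> by (auto simp: indicator_def intro!: mult_nonneg_nonneg)
  qed
  show i2: "integrable lborel (%x. \<phi> x *\<^sub>R v x)"
   by (rule Bochner_Integration.integrable_bound[OF i]) (measurable, intro AE_I2, unfold real_norm_def, rule order_trans[OF b abs_ge_self])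
  have "norm (LBINT x. \<phi> x *\<^sub>R v x) <= (LBINT x. norm (\<phi> x *\<^sub>R v x))"
   by (rule integral_norm_bound)
  also have "... <= (LBINT x. M * (\<delta> * indicator {-r..r} x + indicator {-r<..<r} x *\<^sub>R (norm (v x))\<^sup>2 / \<delta>))"
   by (rule integral_mono[OF integrable_norm[OF i2] i b])
  also have "... = M * (\<delta> * (2 * r) + (LINT x:{-r<..<r}|lborel. (norm (v x))\<^sup>2) / \<delta>)"
   using L2_sq_real(1)[OF v _ fin] integrable_indicator_Icc[of "-r" r] r
   unfolding set_integrable_def set_lebesgue_integral_def by simp
  finally show "norm (LBINT x. \<phi> x *\<^sub>R v x) <= M * (2 * r * \<delta> + (LINT x:{-r<..<r}|lborel. (norm (v x))\<^sup>2) / \<delta>)"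
   by (simp add: mult.commute)
 qed
 show int: "integrable lborel (%x. \<phi> x *\<^sub>R u (t, x))" if "t \<in> {-T<..<T}" for t
  by (rule key(1)[OF um1 _ zero_less_one]) (use u that r in \<open>auto simp: C_L2loc_def\<close>)
 show "continuous_on {-T<..<T} (%t. LBINT x. \<phi> x *\<^sub>R u (t, x))"
  unfolding continuous_on_def
 proof
  fix t assume t: "t \<in> {-T<..<T}"
  show "((%t. LBINT x. \<phi> x *\<^sub>R u (t, x)) \<longlongrightarrow> (LBINT x. \<phi> x *\<^sub>R u (t, x))) (at t within {-T<..<T})"
  proof (rule tendstoI)
   fix \<epsilon> :: real assume "\<epsilon> > 0"
   define \<delta> where "\<delta> = \<epsilon> / (4 * M * r)"
   define \<gamma> where "\<gamma> = \<epsilon> * \<delta> / (2 * M)"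
   have pos: "\<delta> > 0" "\<gamma> > 0" using M r \<open>\<epsilon> > 0\<close> by (auto simp: \<delta>_def \<gamma>_def)
   have "((%s. L2_sq {-r<..<r} (%x. u (s, x) - u (t, x))) \<longlongrightarrow> 0) (at t within {-T<..<T})"
    using u t r unfolding C_L2loc_def by auto
   then have "eventually (%s. L2_sq {-r<..<r} (%x. u (s, x) - u (t, x)) < ennreal \<gamma>) (at t within {-T<..<T})"
    using pos by (intro order_tendstoD(2)) auto
   moreover have "eventually (%s. s \<in> {-T<..<T}) (at t within {-T<..<T})"
    by (simp add: eventually_at_filter)
   ultimately show "eventually (%s. dist (LBINT x. \<phi> x *\<^sub>R u (s, x)) (LBINT x. \<phi> x *\<^sub>R u (t, x)) < \<epsilon>) (at t within {-T<..<T})"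
   proof eventually_elim
    case (elim s)
    have vm: "(%x. u (s, x) - u (t, x)) \<in> borel_measurable borel" by measurable
    have fin: "L2_sq {-r<..<r} (%x. u (s, x) - u (t, x)) < \<infinity>"
     using elim(1) by (metis ennreal_less_top infinity_ennreal_def less_trans)
    have lt: "(LINT x:{-r<..<r}|lborel. (norm (u (s, x) - u (t, x)))\<^sup>2) < \<gamma>"
     using elim(1) L2_sq_real(2)[OF vm _ fin] pos by (simp add: ennreal_less_iff set_lebesgue_integral_def)
    have "dist (LBINT x. \<phi> x *\<^sub>R u (s, x)) (LBINT x. \<phi> x *\<^sub>R u (t, x)) = norm (LBINT x. \<phi> x *\<^sub>R (u (s, x) - u (t, x)))"
     using int[OF elim(2)] int[OF t] by (simp add: dist_norm scaleR_diff_right)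
    also have "... <= M * (2 * r * \<delta> + (LINT x:{-r<..<r}|lborel. (norm (u (s, x) - u (t, x)))\<^sup>2) / \<delta>)"
     by (rule key(2)[OF vm fin pos(1)])
    also have "... < M * (2 * r * \<delta> + \<gamma> / \<delta>)"
     using lt M pos by (simp add: divide_strict_right_mono)
    also have "... = \<epsilon>" using M r pos by (simp add: \<delta>_def \<gamma>_def field_simps)
    finally show ?case .
   qed
  qed
 qed
qed

section \<open>Weak frames and their uniqueness\<close>

text \<open>The four equations in divergence form, in which \<open>q\<close> is not differentiated. For instance
  \<open>p\<^sub>1 e + p\<^sub>2 u \<times> e\<close> is the \<open>x\<close>-derivative of \<open>Re q u \<times> e - Im q e\<close>, because the terms with the derivatives of
  \<open>e\<close> and of \<open>u \<times> e\<close> cancel.\<close>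

definition frame_equations ::
 "real => (real \<times> real => complex) => (real \<times> real => real^3) => (real \<times> real => real^3) => bool" where
 "frame_equations T q u e \<longleftrightarrow> (\<forall>\<phi>. test_function (strip T) \<phi> -->
  (LBINT z. dt \<phi> z *\<^sub>R u z) =
   (LBINT z. dx \<phi> z *\<^sub>R (Re (q z) *\<^sub>R (u z \<times> e z) - Im (q z) *\<^sub>R e z)) \<and>
  (LBINT z. dx \<phi> z *\<^sub>R u z) =
   - (LBINT z. \<phi> z *\<^sub>R (Re (q z) *\<^sub>R e z + Im (q z) *\<^sub>R (u z \<times> e z))) \<and>
  (LBINT z. dt \<phi> z *\<^sub>R e z) =
   (LBINT z. dx \<phi> z *\<^sub>R (Im (q z) *\<^sub>R u z)) +
   (LBINT z. \<phi> z *\<^sub>R (Im (q z) *\<^sub>R (Re (q z) *\<^sub>R e z + Im (q z) *\<^sub>R (u z \<times> e z))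
     + ((cmod (q z))\<^sup>2 / 2) *\<^sub>R (u z \<times> e z))) \<and>
  (LBINT z. dx \<phi> z *\<^sub>R e z) = - (LBINT z. \<phi> z *\<^sub>R (- Re (q z) *\<^sub>R u z)))"

lemma borel_measurable_cross:
 assumes "f \<in> borel_measurable M" "g \<in> borel_measurable M"
 shows "(%x. f x \<times> (g x :: real^3)) \<in> borel_measurable M"
proof -
 have "bounded_bilinear (\<times>)" using bilinear_cross bilinear_conv_bounded_bilinear by blast
 then have "continuous_on UNIV (%z::(real^3) \<times> (real^3). fst z \<times> snd z)"
  using bounded_bilinear.continuous_on[OF _ continuous_on_fst[OF continuous_on_id] continuous_on_snd[OF continuous_on_id]]
  by blast
 from borel_measurable_continuous_Pair[OF assms this] show ?thesis .
qed

lemma smooth_pairing: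
 fixes f :: "real \<times> real => 'b::euclidean_space" and \<phi> :: "real => real"
 assumes f: "!!a b. cbox a b <= strip T ==> set_integrable lborel (cbox a b) f"
  and c: "continuous_on UNIV \<phi>" and supp: "!!x. x \<notin> {c..d} ==> \<phi> x = 0" and ab: "-T < a" "b < T"
 shows "set_integrable lborel {a..b} (%t. LBINT x. \<phi> x *\<^sub>R f (t, x))"
  and "continuous_on UNIV \<eta> ==> (!!t. t \<notin> {a..b} ==> \<eta> t = 0) ==>
   (LBINT t. \<eta> t *\<^sub>R (LBINT x. \<phi> x *\<^sub>R f (t, x))) = (LBINT z. (\<eta> (fst z) * \<phi> (snd z)) *\<^sub>R f z)"
proof -
 obtain M where M: "!!x. \<bar>\<phi> x\<bar> <= M" "M > 0"
  using continuous_compact_support_bounded[OF c compact_Icc supp] by blast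
 note [measurable] = borel_measurable_continuous_onI[OF c]
 have "integrable lborel (%z. (indicator {a..b} (fst z) * \<phi> (snd z)) *\<^sub>R f z)"
 proof (rule integrable_weight[OF f[OF cbox_subset_strip[OF ab, of c d]]])
  show "\<bar>indicator {a..b} (fst z) * \<phi> (snd z)\<bar> <= M" for z
   using M by (auto simp: indicator_def less_imp_le)
  show "indicator {a..b} (fst z) * \<phi> (snd z) = 0" if "z \<notin> cbox (a, c) (b, d)" for z
   using that supp by (cases z) (auto simp: cbox_Pair_eq)
  have "(%z. indicator {a..b} (fst z) * \<phi> (snd z)) \<in> borel_measurable (borel \<Otimes>\<^sub>M borel)" by measurable
  then show "(%z. indicator {a..b} (fst z) * \<phi> (snd z)) \<in> borel_measurable borel" by (simp add: borel_prod)
 qed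
 from plane_Fubini(4)[OF this] show "set_integrable lborel {a..b} (%t. LBINT x. \<phi> x *\<^sub>R f (t, x))"
  unfolding set_integrable_def by (simp flip: scaleR_scaleR)
 assume \<eta>: "continuous_on UNIV \<eta>" "!!t. t \<notin> {a..b} ==> \<eta> t = 0"
 have "integrable lborel (%z. (\<eta> (fst z) * \<phi> (snd z)) *\<^sub>R f z)"
  by (rule integrable_tensor_weight[OF _ \<eta>(1) c ab, where c = c and d = d]) (use f \<eta>(2) supp in auto)
 from plane_Fubini(1)[OF this]
 show "(LBINT t. \<eta> t *\<^sub>R (LBINT x. \<phi> x *\<^sub>R f (t, x))) = (LBINT z. (\<eta> (fst z) * \<phi> (snd z)) *\<^sub>R f z)"
  by (simp flip: scaleR_scaleR)
qed

lemma rotation_integral: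
 fixes h :: "'a => real^3"
 assumes A: "rotation_matrix A"
 shows "(LINT x|M. A *v h x) = A *v (LINT x|M. h x)"
proof (cases "integrable M h")
 case True
 then show ?thesis by (rule integral_bounded_linear[OF matrix_vector_mul_bounded_linear])
next
 case False
 have "\<not> integrable M (%x. A *v h x)"
 proof
  assume "integrable M (%x. A *v h x)"
  from integrable_bounded_linear[OF matrix_vector_mul_bounded_linear[of "transpose A"] this]
  have "integrable M h" unfolding rotation_transpose(2)[OF A] .
  then show False using False by simp
 qed
 then show ?thesis using False by (simp add: not_integrable_integral_eq)
qed

locale frame_data =
 fixes T :: real and q :: "real \<times> real => complex" and u e :: "real \<times> real => real^3"
 assumes qm: "q \<in> borel_measurable borel" and um: "u \<in> borel_measurable borel" and em: "e \<in> borel_measurable borel"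
  and q_L2: "!!a b. cbox a b <= strip T ==> set_integrable lborel (cbox a b) (%z. (cmod (q z))\<^sup>2)"
  and orthonormal: "AE z in lborel. z \<in> strip T --> orthonormal_pair (u z) (e z)"
begin

text \<open>The equations read \<open>u\<^sub>t = (h1)\<^sub>x\<close>, \<open>u\<^sub>x = g1\<close>, \<open>e\<^sub>t = (h2)\<^sub>x - k2\<close> and \<open>e\<^sub>x = g2\<close>.\<close>

definition "g1 z = Re (q z) *\<^sub>R e z + Im (q z) *\<^sub>R (u z \<times> e z)"
definition "h1 z = Re (q z) *\<^sub>R (u z \<times> e z) - Im (q z) *\<^sub>R e z"
definition "g2 z = - Re (q z) *\<^sub>R u z"
definition "h2 z = Im (q z) *\<^sub>R u z"
definition "k2 z = Im (q z) *\<^sub>R g1 z + ((cmod (q z))\<^sup>2 / 2) *\<^sub>R (u z \<times> e z)"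

lemma measurable_coefficients:
 "g1 \<in> borel_measurable borel" "h1 \<in> borel_measurable borel" "g2 \<in> borel_measurable borel"
 "h2 \<in> borel_measurable borel" "k2 \<in> borel_measurable borel"
proof -
 note [measurable] = qm um em borel_measurable_cross
 show g1[measurable]: "g1 \<in> borel_measurable borel" "h1 \<in> borel_measurable borel" "g2 \<in> borel_measurable borel"
  "h2 \<in> borel_measurable borel"
  unfolding g1_def[abs_def] h1_def[abs_def] g2_def[abs_def] h2_def[abs_def] by measurable
 show "k2 \<in> borel_measurable borel" unfolding k2_def[abs_def] by measurable
qed

lemma locally_integrable:
 fixes f :: "real \<times> real => 'b::euclidean_space"
 assumes f: "f \<in> borel_measurable borel"
  and le: "!!z. orthonormal_pair (u z) (e z) ==> norm (f z) <= C * (1 + (cmod (q z))\<^sup>2)"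
  and ab: "cbox a b <= strip T"
 shows "set_integrable lborel (cbox a b) f"
 unfolding set_integrable_def
proof (rule Bochner_Integration.integrable_bound)
 have "set_integrable lborel (cbox a b) (%z. 1 :: real)"
  using borel_integrable_compact[OF compact_cbox continuous_on_const, of a b "1::real"] by (simp add: set_integrable_def)
 then show "integrable lborel (%z. indicator (cbox a b) z *\<^sub>R (C * (1 + (cmod (q z))\<^sup>2)))"
  using q_L2[OF ab] unfolding set_integrable_def[symmetric] by (intro set_integrable_mult_right set_integral_add)
 show "(%z. indicator (cbox a b) z *\<^sub>R f z) \<in> borel_measurable lborel" using f by measurable
 show "AE z in lborel. norm (indicator (cbox a b) z *\<^sub>R f z) <= norm (indicator (cbox a b) z *\<^sub>R (C * (1 + (cmod (q z))\<^sup>2)))"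
  using orthonormal by (rule eventually_mono)
   (use ab in \<open>auto simp: indicator_def dest!: le intro: order_trans[OF _ abs_ge_self]\<close>)
qed

lemma coefficient_bounds:
 assumes "orthonormal_pair (u z) (e z)"
 shows "norm (g1 z) <= 3 * (1 + (cmod (q z))\<^sup>2)" "norm (h1 z) <= 3 * (1 + (cmod (q z))\<^sup>2)"
  "norm (g2 z) <= 3 * (1 + (cmod (q z))\<^sup>2)" "norm (h2 z) <= 3 * (1 + (cmod (q z))\<^sup>2)"
  "norm (k2 z) <= 3 * (1 + (cmod (q z))\<^sup>2)" "norm (u z) <= 3 * (1 + (cmod (q z))\<^sup>2)" "norm (e z) <= 3 * (1 + (cmod (q z))\<^sup>2)"
proof -
 define m where "m = cmod (q z)"
 have m: "m \<ge> 0" "\<bar>Re (q z)\<bar> <= m" "\<bar>Im (q z)\<bar> <= m" "2 * m <= 1 + m\<^sup>2"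
  using sum_squares_bound[of 1 m] by (auto simp: m_def abs_Re_le_cmod abs_Im_le_cmod)
 have ue: "norm (u z) = 1" "norm (e z) = 1" using assms by (auto simp: orthonormal_pair_def)
 have c: "norm (u z \<times> e z) <= 1" using norm_cross_le[of "u z" "e z"] ue by simp
 have p: "\<bar>r\<bar> * norm v <= m" if "\<bar>r\<bar> <= m" "norm v <= 1" for r and v :: "real^3"
  using mult_mono[OF that m(1) norm_ge_zero] by simp
 have g: "norm (g1 z) <= 2 * m" unfolding g1_def
  using norm_triangle_ineq[of "Re (q z) *\<^sub>R e z" "Im (q z) *\<^sub>R (u z \<times> e z)"]
   p[OF m(2), of "e z"] p[OF m(3) c] ue by simp
 have h: "norm (h1 z) <= 2 * m" unfolding h1_def
  using norm_triangle_ineq4[of "Re (q z) *\<^sub>R (u z \<times> e z)" "Im (q z) *\<^sub>R e z"]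
   p[OF m(3), of "e z"] p[OF m(2) c] ue by simp
 have k: "norm (k2 z) <= m * (2 * m) + m\<^sup>2 / 2 * 1"
  unfolding k2_def m_def[symmetric]
  by (intro order_trans[OF norm_triangle_ineq] add_mono)
   (auto intro!: mult_mono m g c mult_right_le_one_le)
 have nn: "0 <= m\<^sup>2" by simp
 show "norm (g1 z) <= 3 * (1 + (cmod (q z))\<^sup>2)" "norm (h1 z) <= 3 * (1 + (cmod (q z))\<^sup>2)"
  "norm (g2 z) <= 3 * (1 + (cmod (q z))\<^sup>2)" "norm (h2 z) <= 3 * (1 + (cmod (q z))\<^sup>2)"
  "norm (k2 z) <= 3 * (1 + (cmod (q z))\<^sup>2)" "norm (u z) <= 3 * (1 + (cmod (q z))\<^sup>2)" "norm (e z) <= 3 * (1 + (cmod (q z))\<^sup>2)"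
  using g h k m ue nn unfolding m_def[symmetric] g2_def h2_def
  by (simp_all add: power2_eq_square)
qed

lemmas loc_int =
 locally_integrable[OF measurable_coefficients(1) coefficient_bounds(1)]
 locally_integrable[OF measurable_coefficients(2) coefficient_bounds(2)]
 locally_integrable[OF measurable_coefficients(3) coefficient_bounds(3)]
 locally_integrable[OF measurable_coefficients(4) coefficient_bounds(4)]
 locally_integrable[OF measurable_coefficients(5) coefficient_bounds(5)]
 locally_integrable[OF um coefficient_bounds(6)]
 locally_integrable[OF em coefficient_bounds(7)]

end

locale weak_frame = frame_data +
 assumes u_cont: "C_L2loc T u" and e_cont: "C_L2loc T e"
  and equations: "frame_equations T q u e"
begin

lemma equations_for:
 assumes "test_function (strip T) \<phi>"
 shows "(LBINT z. dt \<phi> z *\<^sub>R u z) = (LBINT z. dx \<phi> z *\<^sub>R h1 z)"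
  "(LBINT z. dx \<phi> z *\<^sub>R u z) = - (LBINT z. \<phi> z *\<^sub>R g1 z)"
  "(LBINT z. dt \<phi> z *\<^sub>R e z) = (LBINT z. dx \<phi> z *\<^sub>R h2 z) + (LBINT z. \<phi> z *\<^sub>R k2 z)"
  "(LBINT z. dx \<phi> z *\<^sub>R e z) = - (LBINT z. \<phi> z *\<^sub>R g2 z)"
 using equations assms unfolding frame_equations_def g1_def h1_def g2_def h2_def k2_def by blast+

lemma slices:
 obtains c d where "AE t in lborel. t \<in> {-T<..<T} -->
  (\<forall>R. set_integrable lborel {-R..R} (%x. g1 (t, x))) \<and> (AE x in lborel. u (t, x) = c t + prim (%y. g1 (t, y)) x) \<and>
  (\<forall>R. set_integrable lborel {-R..R} (%x. g2 (t, x))) \<and> (AE x in lborel. e (t, x) = d t + prim (%y. g2 (t, y)) x) \<and>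
  (AE x in lborel. orthonormal_pair (u (t, x)) (e (t, x)))"
proof -
 obtain c where c: "AE t in lborel. t \<in> {-T<..<T} -->
  (\<forall>R. set_integrable lborel {-R..R} (%x. g1 (t, x))) \<and> (AE x in lborel. u (t, x) = c t + prim (%y. g1 (t, y)) x)"
 proof (rule weak_dx_slices[OF loc_int(6) loc_int(1) measurable_coefficients(1)])
  fix \<eta> \<phi> :: "real => real" and a b c d
  assume *: "smooth_on UNIV \<eta>" "smooth_on UNIV \<phi>" "-T < a" "b < T"
   "!!x. x \<notin> {a..b} ==> \<eta> x = 0" "!!x. x \<notin> {c..d} ==> \<phi> x = 0"
  have "test_function (strip T) (%z. \<eta> (fst z) * \<phi> (snd z))"
   by (rule test_function_tensor[OF *(1) _ *(3,4,2)]) (use *(5,6) in auto)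
  from equations_for(2)[OF this, unfolded dt_dx_tensor[OF *(1,2)]]
  show "(LBINT z. (\<eta> (fst z) * dderiv 1 \<phi> (snd z)) *\<^sub>R u z) = - (LBINT z. (\<eta> (fst z) * \<phi> (snd z)) *\<^sub>R g1 z)" .
 qed auto
 obtain d where d: "AE t in lborel. t \<in> {-T<..<T} -->
  (\<forall>R. set_integrable lborel {-R..R} (%x. g2 (t, x))) \<and> (AE x in lborel. e (t, x) = d t + prim (%y. g2 (t, y)) x)"
 proof (rule weak_dx_slices[OF loc_int(7) loc_int(3) measurable_coefficients(3)])
  fix \<eta> \<phi> :: "real => real" and a b c d
  assume *: "smooth_on UNIV \<eta>" "smooth_on UNIV \<phi>" "-T < a" "b < T"
   "!!x. x \<notin> {a..b} ==> \<eta> x = 0" "!!x. x \<notin> {c..d} ==> \<phi> x = 0"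
  have "test_function (strip T) (%z. \<eta> (fst z) * \<phi> (snd z))"
   by (rule test_function_tensor[OF *(1) _ *(3,4,2)]) (use *(5,6) in auto)
  from equations_for(4)[OF this, unfolded dt_dx_tensor[OF *(1,2)]]
  show "(LBINT z. (\<eta> (fst z) * dderiv 1 \<phi> (snd z)) *\<^sub>R e z) = - (LBINT z. (\<eta> (fst z) * \<phi> (snd z)) *\<^sub>R g2 z)" .
 qed auto
 show ?thesis
 proof (rule that)
  show "AE t in lborel. t \<in> {-T<..<T} -->
  (\<forall>R. set_integrable lborel {-R..R} (%x. g1 (t, x))) \<and> (AE x in lborel. u (t, x) = c t + prim (%y. g1 (t, y)) x) \<and>
  (\<forall>R. set_integrable lborel {-R..R} (%x. g2 (t, x))) \<and> (AE x in lborel. e (t, x) = d t + prim (%y. g2 (t, y)) x) \<and>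
  (AE x in lborel. orthonormal_pair (u (t, x)) (e (t, x)))"
   using c d plane_AE_slices[OF orthonormal] by eventually_elim (auto simp: strip_def)
 qed
qed

definition "u_mean \<phi> t = (LBINT x. \<phi> x *\<^sub>R u (t, x))"
definition "e_mean \<phi> t = (LBINT x. \<phi> x *\<^sub>R e (t, x))"
definition "u_rate \<phi> t = - (LBINT x. dderiv 1 \<phi> x *\<^sub>R h1 (t, x))"
definition "e_rate \<phi> t = - ((LBINT x. dderiv 1 \<phi> x *\<^sub>R h2 (t, x)) + (LBINT x. \<phi> x *\<^sub>R k2 (t, x)))"

text \<open>Testing the evolution equations with products of a function of \<open>t\<close> and a function of \<open>x\<close> gives an integrable derivative of the means in time.\<close>

lemma means:
 assumes \<phi>: "smooth_on UNIV \<phi>" and supp: "!!x. x \<notin> {c..d} ==> \<phi> x = (0::real)"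
 shows "indefinite_integral_on {-T<..<T} (u_mean \<phi>) (u_rate \<phi>)"
  and "indefinite_integral_on {-T<..<T} (e_mean \<phi>) (e_rate \<phi>)"
proof -
 note cont = smooth_on_continuous[OF \<phi>] smooth_on_continuous[OF smooth_on_dderiv[OF \<phi>], of 1]
 have d0: "dderiv 1 \<phi> x = 0" if "x \<notin> {c..d}" for x
  by (rule dderiv_support[of "{c..d}"]) (use supp that in auto)
 have pair: "set_integrable lborel {a..b} (%t. LBINT x. w x *\<^sub>R f (t, x))"
  if "!!a b. cbox a b <= strip T ==> set_integrable lborel (cbox a b) f" "-T < a" "b < T"
   "continuous_on UNIV w" "!!x. x \<notin> {c..d} ==> w x = 0" for f :: "real \<times> real => real^3" and w a b
  by (rule smooth_pairing(1)[OF _ that(4) _ that(2,3), where c = c and d = d]) (use that in auto)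
 have pair2: "(LBINT t. \<eta> t *\<^sub>R (LBINT x. w x *\<^sub>R f (t, x))) = (LBINT z. (\<eta> (fst z) * w (snd z)) *\<^sub>R f z)"
  if "!!a b. cbox a b <= strip T ==> set_integrable lborel (cbox a b) f" "-T < a" "b < T"
   "continuous_on UNIV w" "!!x. x \<notin> {c..d} ==> w x = 0" "continuous_on UNIV \<eta>" "!!t. t \<notin> {a..b} ==> \<eta> t = 0"
  for f :: "real \<times> real => real^3" and w a b \<eta>
  by (rule smooth_pairing(2)[OF _ that(4) _ that(2,3), where c = c and d = d]) (use that in auto)
 note li = pair[OF loc_int(2) _ _ cont(2) d0] pair[OF loc_int(4) _ _ cont(2) d0] pair[OF loc_int(5) _ _ cont(1) supp]
 show "indefinite_integral_on {-T<..<T} (u_mean \<phi>) (u_rate \<phi>)"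
 proof (rule weak_derivative_imp_indefinite_integral)
  show "continuous_on {-T<..<T} (u_mean \<phi>)"
   unfolding u_mean_def[abs_def] by (rule C_L2loc_continuous_pairing(1)[OF um u_cont cont(1)]) (rule supp)
  show "set_integrable lborel {a..b} (u_rate \<phi>)" if "-T < a" "b < T" for a b
   unfolding u_rate_def using li(1)[OF _ _ that] by (simp add: set_integrable_def)
  fix \<eta> :: "real => real" and a b
  assume \<eta>: "smooth_on UNIV \<eta>" "-T < a" "b < T" "!!t. t \<notin> {a..b} ==> \<eta> t = 0"
  have e0: "dderiv 1 \<eta> t = 0" if "t \<notin> {a..b}" for t
   by (rule dderiv_support[of "{a..b}"]) (use \<eta>(4) that in auto)
  note ce = smooth_on_continuous[OF \<eta>(1)] smooth_on_continuous[OF smooth_on_dderiv[OF \<eta>(1)], of 1]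
  have tf: "test_function (strip T) (%z. \<eta> (fst z) * \<phi> (snd z))"
   by (rule test_function_tensor[OF \<eta>(1) _ \<eta>(2,3) \<phi>]) (use \<eta>(4) supp in auto)
  have "(LBINT t. dderiv 1 \<eta> t *\<^sub>R u_mean \<phi> t) = (LBINT z. (dderiv 1 \<eta> (fst z) * \<phi> (snd z)) *\<^sub>R u z)"
   unfolding u_mean_def by (rule pair2[OF loc_int(6) \<eta>(2,3) cont(1) supp ce(2) e0])
  also have "... = (LBINT z. (\<eta> (fst z) * dderiv 1 \<phi> (snd z)) *\<^sub>R h1 z)"
   by (rule equations_for(1)[OF tf, unfolded dt_dx_tensor[OF \<eta>(1) \<phi>]])
  also have "... = (LBINT t. \<eta> t *\<^sub>R (LBINT x. dderiv 1 \<phi> x *\<^sub>R h1 (t, x)))"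
   by (rule pair2[OF loc_int(2) \<eta>(2,3) cont(2) d0 ce(1) \<eta>(4), symmetric])
  finally show "(LBINT t. dderiv 1 \<eta> t *\<^sub>R u_mean \<phi> t) = - (LBINT t. \<eta> t *\<^sub>R u_rate \<phi> t)"
   unfolding u_rate_def by simp
 qed
 show "indefinite_integral_on {-T<..<T} (e_mean \<phi>) (e_rate \<phi>)"
 proof (rule weak_derivative_imp_indefinite_integral)
  show "continuous_on {-T<..<T} (e_mean \<phi>)"
   unfolding e_mean_def[abs_def] by (rule C_L2loc_continuous_pairing(1)[OF em e_cont cont(1)]) (rule supp)
  show "set_integrable lborel {a..b} (e_rate \<phi>)" if "-T < a" "b < T" for a b
   using set_integral_add(1)[OF li(2)[OF _ _ that] li(3)[OF _ _ that]]
   unfolding e_rate_def set_integrable_def scaleR_minus_right by (intro integrable_minus) auto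
  fix \<eta> :: "real => real" and a b
  assume \<eta>: "smooth_on UNIV \<eta>" "-T < a" "b < T" "!!t. t \<notin> {a..b} ==> \<eta> t = 0"
  have e0: "dderiv 1 \<eta> t = 0" if "t \<notin> {a..b}" for t
   by (rule dderiv_support[of "{a..b}"]) (use \<eta>(4) that in auto)
  note ce = smooth_on_continuous[OF \<eta>(1)] smooth_on_continuous[OF smooth_on_dderiv[OF \<eta>(1)], of 1]
  have tf: "test_function (strip T) (%z. \<eta> (fst z) * \<phi> (snd z))"
   by (rule test_function_tensor[OF \<eta>(1) _ \<eta>(2,3) \<phi>]) (use \<eta>(4) supp in auto)
  have "(LBINT t. dderiv 1 \<eta> t *\<^sub>R e_mean \<phi> t) = (LBINT z. (dderiv 1 \<eta> (fst z) * \<phi> (snd z)) *\<^sub>R e z)"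
   unfolding e_mean_def by (rule pair2[OF loc_int(7) \<eta>(2,3) cont(1) supp ce(2) e0])
  also have "... = (LBINT z. (\<eta> (fst z) * dderiv 1 \<phi> (snd z)) *\<^sub>R h2 z) + (LBINT z. (\<eta> (fst z) * \<phi> (snd z)) *\<^sub>R k2 z)"
   by (rule equations_for(3)[OF tf, unfolded dt_dx_tensor[OF \<eta>(1) \<phi>]])
  also have "... = (LBINT t. \<eta> t *\<^sub>R (LBINT x. dderiv 1 \<phi> x *\<^sub>R h2 (t, x))) + (LBINT t. \<eta> t *\<^sub>R (LBINT x. \<phi> x *\<^sub>R k2 (t, x)))"
   using pair2[OF loc_int(4) \<eta>(2,3) cont(2) d0 ce(1) \<eta>(4)] pair2[OF loc_int(5) \<eta>(2,3) cont(1) supp ce(1) \<eta>(4)] by simp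
  also have "... = (LBINT t. \<eta> t *\<^sub>R (LBINT x. dderiv 1 \<phi> x *\<^sub>R h2 (t, x)) + \<eta> t *\<^sub>R (LBINT x. \<phi> x *\<^sub>R k2 (t, x)))"
  proof (rule Bochner_Integration.integral_add[symmetric])
   show "integrable lborel (%t. \<eta> t *\<^sub>R (LBINT x. dderiv 1 \<phi> x *\<^sub>R h2 (t, x)))"
    by (rule integrable_continuous_weight[OF li(2)[OF _ _ \<eta>(2,3)] ce(1) compact_Icc]) (use \<eta>(4) in auto)
   show "integrable lborel (%t. \<eta> t *\<^sub>R (LBINT x. \<phi> x *\<^sub>R k2 (t, x)))"
    by (rule integrable_continuous_weight[OF li(3)[OF _ _ \<eta>(2,3)] ce(1) compact_Icc]) (use \<eta>(4) in auto)
  qed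
  finally show "(LBINT t. dderiv 1 \<eta> t *\<^sub>R e_mean \<phi> t) = - (LBINT t. \<eta> t *\<^sub>R e_rate \<phi> t)"
   unfolding e_rate_def scaleR_minus_right Bochner_Integration.integral_minus minus_minus scaleR_add_right .
 qed
qed

end

context weak_frame
begin

lemma orthonormal_all_times:
 assumes t: "t \<in> {-T<..<T}"
 shows "AE x in lborel. orthonormal_pair (u (t, x)) (e (t, x))"
proof -
 note [measurable] = um em
 have ae: "AE t in lborel. t \<in> {-T<..<T} --> (AE x in lborel. orthonormal_pair (u (t, x)) (e (t, x)))"
  using plane_AE_slices[OF orthonormal] by (rule eventually_mono) (auto simp: strip_def)
 have ae_u: "AE t in lborel. t \<in> {-T<..<T} --> (AE x in lborel. norm (u (t, x)) - 1 = 0)"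
  and ae_e: "AE t in lborel. t \<in> {-T<..<T} --> (AE x in lborel. norm (e (t, x)) - 1 = 0)"
  and ae_ue: "AE t in lborel. t \<in> {-T<..<T} --> (AE x in lborel. u (t, x) \<bullet> e (t, x) = 0)"
  by (rule eventually_mono[OF ae]; rule impI; drule mp, assumption; rule eventually_mono, assumption; simp add: orthonormal_pair_def)+
 have u1: "AE x in lborel. norm (u (t, x)) - 1 = 0" if "t \<in> {-T<..<T}" for t
  by (rule C_L2loc_AE_all_times[of "%z. norm (u z) - 1" u e T 1 t, OF _ um em u_cont e_cont _ _ ae_u that])
   (auto intro!: AE_I2 intro: order_trans[OF _ add_increasing2[OF norm_ge_zero order_refl]] order_trans[OF norm_triangle_ineq3] simp: norm_minus_commute)
 have e1: "AE x in lborel. norm (e (t, x)) - 1 = 0" if "t \<in> {-T<..<T}" for t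
  by (rule C_L2loc_AE_all_times[of "%z. norm (e z) - 1" u e T 1 t, OF _ um em u_cont e_cont _ _ ae_e that])
   (auto intro!: AE_I2 intro: order_trans[OF _ add_increasing[OF norm_ge_zero order_refl]] order_trans[OF norm_triangle_ineq3] simp: norm_minus_commute)
 have "AE x in lborel. u (t, x) \<bullet> e (t, x) = 0"
 proof (rule C_L2loc_AE_all_times[of "%z. u z \<bullet> e z" u e T 1 t, OF _ um em u_cont e_cont _ _ ae_ue t])
  fix s t assume st: "s \<in> {-T<..<T}" "t \<in> {-T<..<T}"
  show "AE x in lborel. norm (u (t, x) \<bullet> e (t, x) - u (s, x) \<bullet> e (s, x)) <=
   1 * (norm (u (s, x) - u (t, x)) + norm (e (s, x) - e (t, x)))"
   using u1[OF st(2)] e1[OF st(1)]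
  proof eventually_elim
   case (elim x)
   have "u (t, x) \<bullet> e (t, x) - u (s, x) \<bullet> e (s, x) = u (t, x) \<bullet> (e (t, x) - e (s, x)) + (u (t, x) - u (s, x)) \<bullet> e (s, x)"
    by (simp add: inner_diff_left inner_diff_right)
   moreover have "\<bar>u (t, x) \<bullet> (e (t, x) - e (s, x))\<bar> <= norm (e (s, x) - e (t, x))"
    using Cauchy_Schwarz_ineq2[of "u (t, x)" "e (t, x) - e (s, x)"] elim by (simp add: norm_minus_commute)
   moreover have "\<bar>(u (t, x) - u (s, x)) \<bullet> e (s, x)\<bar> <= norm (u (s, x) - u (t, x))"
    using Cauchy_Schwarz_ineq2[of "u (t, x) - u (s, x)" "e (s, x)"] elim by (simp add: norm_minus_commute)
   ultimately show ?case by simp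
  qed
 qed auto
 then show ?thesis using u1[OF t] e1[OF t] by eventually_elim (simp add: orthonormal_pair_def)
qed

definition "bump \<phi> \<longleftrightarrow> smooth_on UNIV \<phi> \<and> (\<exists>c d. \<forall>x::real. x \<notin> {c..d} --> \<phi> x = (0::real))"

text \<open>The local means of \<open>u\<close> and \<open>e\<close> cannot all be parallel to each other, as \<open>u\<close> and \<open>e\<close> are
  orthogonal.\<close>

lemma means_independent:
 assumes t: "t \<in> {-T<..<T}"
 shows "\<exists>y1\<in>{u_mean, e_mean}. \<exists>y2\<in>{u_mean, e_mean}. \<exists>\<phi>1 \<phi>2. bump \<phi>1 \<and> bump \<phi>2 \<and> y1 \<phi>1 t \<times> y2 \<phi>2 t \<noteq> 0"
proof (rule ccontr)
 assume "\<not> ?thesis"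
 then have par: "y1 \<phi>1 t \<times> y2 \<phi>2 t = 0"
  if "y1 \<in> {u_mean, e_mean}" "y2 \<in> {u_mean, e_mean}" "bump \<phi>1" "bump \<phi>2" for y1 y2 \<phi>1 \<phi>2
  using that by blast
 have int: "integrable lborel (%x. \<phi> x *\<^sub>R u (t, x))" "integrable lborel (%x. \<phi> x *\<^sub>R e (t, x))" if "bump \<phi>" for \<phi>
 proof -
  obtain c d where *: "smooth_on UNIV \<phi>" "!!x. x \<notin> {c..d} ==> \<phi> x = 0" using \<open>bump \<phi>\<close> unfolding bump_def by blast
  show "integrable lborel (%x. \<phi> x *\<^sub>R u (t, x))"
   by (rule C_L2loc_continuous_pairing(2)[OF um u_cont smooth_on_continuous[OF *(1)] _ t]) (rule *(2))
  show "integrable lborel (%x. \<phi> x *\<^sub>R e (t, x))"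
   by (rule C_L2loc_continuous_pairing(2)[OF em e_cont smooth_on_continuous[OF *(1)] _ t]) (rule *(2))
 qed
 have on: "AE x in lborel. orthonormal_pair (u (t, x)) (e (t, x))" by (rule orthonormal_all_times[OF t])
 have vanish: "AE x in lborel. w (t, x) = 0"
  if wm: "w \<in> borel_measurable borel" and wb: "AE x in lborel. norm (w (t, x)) <= B"
   and w0: "!!\<phi>. bump \<phi> ==> (LBINT x. \<phi> x *\<^sub>R w (t, x)) = 0" for w :: "real \<times> real => real^3" and B
 proof -
  note [measurable] = borel_slice[OF wm]
  have "AE x in lborel. x \<in> UNIV --> w (t, x) = 0"
  proof (rule fundamental_lemma_real[OF open_UNIV])
   show "set_integrable lborel {a..b} (%x. w (t, x))" for a b
    unfolding set_integrable_def
   proof (rule Bochner_Integration.integrable_bound)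
    show "integrable lborel (%x. B * indicat_real {a..b} x)" by (intro integrable_mult_right integrable_indicator_Icc)
    show "AE x in lborel. norm (indicator {a..b} x *\<^sub>R w (t, x)) <= norm (B * indicat_real {a..b} x)"
     using wb by eventually_elim (auto simp: indicator_def)
   qed measurable
   show "(LBINT x. \<psi> x *\<^sub>R w (t, x)) = 0"
    if "smooth_on UNIV \<psi>" "!!x. x \<notin> {a..b} ==> \<psi> x = 0" for \<psi> a b
    by (rule w0) (use that in \<open>auto simp: bump_def\<close>)
  qed
  then show ?thesis by simp
 qed
 have "\<exists>\<phi>. bump \<phi> \<and> u_mean \<phi> t \<noteq> 0"
 proof (rule ccontr)
  assume "\<not> ?thesis"
  then have "AE x in lborel. u (t, x) = 0"
   using on by (intro vanish[OF um, of 1]) (auto simp: u_mean_def orthonormal_pair_def elim: eventually_mono)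
  then have "AE x in lborel. u (t, x) = 0 \<and> orthonormal_pair (u (t, x)) (e (t, x))" using on by (rule AE_conjI)
  from AE_ex_open[OF this open_UNIV] show False by (auto simp: orthonormal_pair_def)
 qed
 then obtain \<phi>0 where \<phi>0: "bump \<phi>0" "u_mean \<phi>0 t \<noteq> 0" by blast
 define a where "a = u_mean \<phi>0 t"
 have bl: "bounded_linear (%v. a \<times> v)"
  using bounded_bilinear.bounded_linear_right bilinear_cross bilinear_conv_bounded_bilinear by blast
 have au: "AE x in lborel. a \<times> u (t, x) = 0"
 proof (rule vanish[where w = "%z. a \<times> u z" and B = "norm a"])
  show "(%z. a \<times> u z) \<in> borel_measurable borel" by (intro borel_measurable_cross um) simp
  show "AE x in lborel. norm (a \<times> u (t, x)) <= norm a"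
   using on
  proof eventually_elim
   case (elim x)
   then show ?case using norm_cross_le[of a "u (t, x)"] by (simp add: orthonormal_pair_def)
  qed
  show "(LBINT x. \<phi> x *\<^sub>R (a \<times> u (t, x))) = 0" if "bump \<phi>" for \<phi>
   using integral_bounded_linear[OF bl int(1)[OF that]] par[of u_mean u_mean \<phi>0 \<phi>] that \<phi>0
   by (simp add: a_def u_mean_def cross_mult_right)
 qed
 have ae: "AE x in lborel. a \<times> e (t, x) = 0"
 proof (rule vanish[where w = "%z. a \<times> e z" and B = "norm a"])
  show "(%z. a \<times> e z) \<in> borel_measurable borel" by (intro borel_measurable_cross em) simp
  show "AE x in lborel. norm (a \<times> e (t, x)) <= norm a"
   using on
  proof eventually_elim
   case (elim x)
   then show ?case using norm_cross_le[of a "e (t, x)"] by (simp add: orthonormal_pair_def)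
  qed
  show "(LBINT x. \<phi> x *\<^sub>R (a \<times> e (t, x))) = 0" if "bump \<phi>" for \<phi>
   using integral_bounded_linear[OF bl int(2)[OF that]] par[of u_mean e_mean \<phi>0 \<phi>] that \<phi>0
   by (simp add: a_def u_mean_def e_mean_def cross_mult_right)
 qed
 have "AE x in lborel. orthonormal_pair (u (t, x)) (e (t, x)) \<and> a \<times> u (t, x) = 0 \<and> a \<times> e (t, x) = 0"
  using on au ae by eventually_elim simp
 from AE_ex_open[OF this open_UNIV] obtain x where
  x: "orthonormal_pair (u (t, x)) (e (t, x))" "a \<times> u (t, x) = 0" "a \<times> e (t, x) = 0" by auto
 have ue: "u (t, x) \<bullet> u (t, x) = 1" "e (t, x) \<bullet> e (t, x) = 1" "u (t, x) \<bullet> e (t, x) = 0"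
  using x(1) by (auto simp: orthonormal_pair_def norm_eq_1)
 have "a = (u (t, x) \<bullet> a) *\<^sub>R u (t, x)" using Lagrange[of "u (t, x)" a "u (t, x)"] x(2) ue by simp
 moreover have "a = (e (t, x) \<bullet> a) *\<^sub>R e (t, x)" using Lagrange[of "e (t, x)" a "e (t, x)"] x(3) ue by simp
 ultimately have "a \<bullet> a = (u (t, x) \<bullet> a) * (e (t, x) \<bullet> a) * (u (t, x) \<bullet> e (t, x))"
  by (metis inner_scaleR_left inner_scaleR_right mult.assoc)
 then show False using ue \<phi>0(2) by (simp add: a_def)
qed

end

text \<open>On the slices where both frames are primitives, the rotation between them carries the means of one frame and their
  rates to those of the other one. By rigidity it does not depend on time.\<close>

theorem weak_frame_unique:
 assumes F: "weak_frame T q u e" and F': "weak_frame T q u' e'"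
 shows "\<exists>R :: real^3^3. rotation_matrix R \<and> (\<forall>t\<in>{-T<..<T}. AE x in lborel. u' (t, x) = R *v u (t, x) \<and> e' (t, x) = R *v e (t, x))"
proof (cases "T > 0")
 case False
 then show ?thesis by (intro exI[of _ "mat 1"]) (auto simp: rotation_matrix_def orthogonal_matrix_id)
next
 case True
 interpret F: weak_frame T q u e by (rule F)
 interpret F': weak_frame T q u' e' by (rule F')
 define I where "I = {-T<..<T}"
 define rotates where "rotates t A \<longleftrightarrow> rotation_matrix A \<and> (AE x in lborel. u' (t, x) = A *v u (t, x) \<and> e' (t, x) = A *v e (t, x))"
  for t and A :: "real^3^3"
 define good where "good t \<longleftrightarrow> (\<exists>A. rotates t A)" for t
 obtain c d where s: "AE t in lborel. t \<in> {-T<..<T} -->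
  (\<forall>R. set_integrable lborel {-R..R} (%x. F.g1 (t, x))) \<and> (AE x in lborel. u (t, x) = c t + prim (%y. F.g1 (t, y)) x) \<and>
  (\<forall>R. set_integrable lborel {-R..R} (%x. F.g2 (t, x))) \<and> (AE x in lborel. e (t, x) = d t + prim (%y. F.g2 (t, y)) x) \<and>
  (AE x in lborel. orthonormal_pair (u (t, x)) (e (t, x)))"
  by (rule F.slices)
 obtain c' d' where s': "AE t in lborel. t \<in> {-T<..<T} -->
  (\<forall>R. set_integrable lborel {-R..R} (%x. F'.g1 (t, x))) \<and> (AE x in lborel. u' (t, x) = c' t + prim (%y. F'.g1 (t, y)) x) \<and>
  (\<forall>R. set_integrable lborel {-R..R} (%x. F'.g2 (t, x))) \<and> (AE x in lborel. e' (t, x) = d' t + prim (%y. F'.g2 (t, y)) x) \<and>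
  (AE x in lborel. orthonormal_pair (u' (t, x)) (e' (t, x)))"
  by (rule F'.slices)
 have good: "AE t in lborel. t \<in> I --> good t"
  using s s'
 proof eventually_elim
  case (elim t)
  show ?case
  proof
   assume "t \<in> I"
   then have t: "t \<in> {-T<..<T}" by (simp add: I_def)
   note S = elim(1)[rule_format, OF t] and S' = elim(2)[rule_format, OF t]
   obtain A :: "real^3^3" where "rotation_matrix A" "AE x in lborel. u' (t, x) = A *v u (t, x) \<and> e' (t, x) = A *v e (t, x)"
   proof (rule slice_rotation[of "%x. Re (q (t, x))" "%x. e (t, x)" "%x. Im (q (t, x))" "%x. u (t, x)" "c t" "d t"
      "%x. e' (t, x)" "%x. u' (t, x)" "c' t" "d' t"])
    show "set_integrable lborel {-R..R} (%x. Re (q (t, x)) *\<^sub>R e (t, x) + Im (q (t, x)) *\<^sub>R (u (t, x) \<times> e (t, x)))" for R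
     using S unfolding F.g1_def by blast
    show "AE x in lborel. u (t, x) = c t + prim (%x. Re (q (t, x)) *\<^sub>R e (t, x) + Im (q (t, x)) *\<^sub>R (u (t, x) \<times> e (t, x))) x"
     using S unfolding F.g1_def by blast
    show "set_integrable lborel {-R..R} (%x. - Re (q (t, x)) *\<^sub>R u (t, x))" for R
     using S unfolding F.g2_def by blast
    show "AE x in lborel. e (t, x) = d t + prim (%x. - Re (q (t, x)) *\<^sub>R u (t, x)) x"
     using S unfolding F.g2_def by blast
    show "AE x in lborel. orthonormal_pair (u (t, x)) (e (t, x))" using S by blast
    show "set_integrable lborel {-R..R} (%x. Re (q (t, x)) *\<^sub>R e' (t, x) + Im (q (t, x)) *\<^sub>R (u' (t, x) \<times> e' (t, x)))" for R
     using S' unfolding F'.g1_def by blast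
    show "AE x in lborel. u' (t, x) = c' t + prim (%x. Re (q (t, x)) *\<^sub>R e' (t, x) + Im (q (t, x)) *\<^sub>R (u' (t, x) \<times> e' (t, x))) x"
     using S' unfolding F'.g1_def by blast
    show "set_integrable lborel {-R..R} (%x. - Re (q (t, x)) *\<^sub>R u' (t, x))" for R
     using S' unfolding F'.g2_def by blast
    show "AE x in lborel. e' (t, x) = d' t + prim (%x. - Re (q (t, x)) *\<^sub>R u' (t, x)) x"
     using S' unfolding F'.g2_def by blast
    show "AE x in lborel. orthonormal_pair (u' (t, x)) (e' (t, x))" using S' by blast
   qed
   then show "good t" unfolding good_def rotates_def by blast
  qed
 qed
 define G where "G t = (SOME A. rotates t A)" for t
 have G: "rotates t (G t)" if "good t" for t
  using that unfolding good_def G_def by (rule someI_ex)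
 define Y where "Y = {(F.u_mean \<phi>, F.u_rate \<phi>, F'.u_mean \<phi>, F'.u_rate \<phi>) | \<phi>. F.bump \<phi>} \<union>
  {(F.e_mean \<phi>, F.e_rate \<phi>, F'.e_mean \<phi>, F'.e_rate \<phi>) | \<phi>. F.bump \<phi>}"
 note [measurable] = borel_slice[OF F.um] borel_slice[OF F.em] borel_slice[OF F'.um] borel_slice[OF F'.em]
 have Yp: "indefinite_integral_on I y z \<and> indefinite_integral_on I y' z' \<and>
   (\<forall>t\<in>I. good t --> y' t = G t *v y t \<and> z' t = G t *v z t)" if Yy: "(y, z, y', z') \<in> Y" for y z y' z'
 proof -
  obtain \<phi> where b: "F.bump \<phi>" and c: "(y, z, y', z') = (F.u_mean \<phi>, F.u_rate \<phi>, F'.u_mean \<phi>, F'.u_rate \<phi>) \<or>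
   (y, z, y', z') = (F.e_mean \<phi>, F.e_rate \<phi>, F'.e_mean \<phi>, F'.e_rate \<phi>)"
   using Yy unfolding Y_def by blast
  obtain l r where \<phi>: "smooth_on UNIV \<phi>" "!!x. x \<notin> {l..r} ==> \<phi> x = 0" using b unfolding F.bump_def by blast
  note [measurable] = borel_measurable_continuous_onI[OF smooth_on_continuous[OF \<phi>(1)]]
   borel_measurable_continuous_onI[OF smooth_on_continuous[OF smooth_on_dderiv[OF \<phi>(1)]]]
  have ii: "indefinite_integral_on I (F.u_mean \<phi>) (F.u_rate \<phi>)" "indefinite_integral_on I (F.e_mean \<phi>) (F.e_rate \<phi>)"
   "indefinite_integral_on I (F'.u_mean \<phi>) (F'.u_rate \<phi>)" "indefinite_integral_on I (F'.e_mean \<phi>) (F'.e_rate \<phi>)"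
   unfolding I_def using F.means[OF \<phi>] F'.means[OF \<phi>] by auto
  have eq: "F'.u_mean \<phi> t = G t *v F.u_mean \<phi> t \<and> F'.u_rate \<phi> t = G t *v F.u_rate \<phi> t \<and>
   F'.e_mean \<phi> t = G t *v F.e_mean \<phi> t \<and> F'.e_rate \<phi> t = G t *v F.e_rate \<phi> t" if "good t" for t
  proof -
   have A: "rotation_matrix (G t)" and ae: "AE x in lborel. u' (t, x) = G t *v u (t, x) \<and> e' (t, x) = G t *v e (t, x)"
    using G[OF that] unfolding rotates_def by auto
   have int: "(LBINT x. w x *\<^sub>R f' (t, x)) = G t *v (LBINT x. w x *\<^sub>R f (t, x))"
    if "w \<in> borel_measurable borel" "f \<in> borel_measurable borel" "f' \<in> borel_measurable borel"
     "!!x. u' (t, x) = G t *v u (t, x) ==> e' (t, x) = G t *v e (t, x) ==> f' (t, x) = G t *v f (t, x)"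
    for w and f f' :: "real \<times> real => real^3"
   proof -
    note [measurable] = that(1) borel_slice[OF that(2)] borel_slice[OF that(3)]
    have Am: "(%x. G t *v f (t, x)) \<in> borel_measurable borel"
     by (rule borel_measurable_continuous_on[of "(*v) (G t)" "%x. f (t, x)", OF _ borel_slice[OF that(2)]])
      (rule linear_continuous_on[OF matrix_vector_mul_bounded_linear])
    note [measurable] = Am
    have "(LBINT x. w x *\<^sub>R f' (t, x)) = (LBINT x. w x *\<^sub>R (G t *v f (t, x)))"
     by (rule integral_cong_AE; (rule eventually_mono[OF ae])?) (use that(4) in auto)
    also have "... = (LBINT x. G t *v (w x *\<^sub>R f (t, x)))" by (simp add: matrix_vector_mult_scaleR)
    finally show ?thesis by (simp add: rotation_integral[OF A])
   qed
   note d1 = borel_measurable_continuous_onI[OF smooth_on_continuous[OF \<phi>(1)]]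
   note d2 = borel_measurable_continuous_onI[OF smooth_on_continuous[OF smooth_on_dderiv[OF \<phi>(1)]], of 1]
   note rules = matrix_vector_right_distrib matrix_vector_mult_diff_distrib matrix_vector_mult_scaleR
      cross_rotation_matrix[OF A, symmetric]
   have "(LBINT x. dderiv 1 \<phi> x *\<^sub>R F'.h1 (t, x)) = G t *v (LBINT x. dderiv 1 \<phi> x *\<^sub>R F.h1 (t, x))"
    by (rule int[OF d2 F.measurable_coefficients(2) F'.measurable_coefficients(2)]) (simp add: F.h1_def F'.h1_def rules)
   moreover have "(LBINT x. dderiv 1 \<phi> x *\<^sub>R F'.h2 (t, x)) = G t *v (LBINT x. dderiv 1 \<phi> x *\<^sub>R F.h2 (t, x))"
    by (rule int[OF d2 F.measurable_coefficients(4) F'.measurable_coefficients(4)]) (simp add: F.h2_def F'.h2_def rules)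
   moreover have "(LBINT x. \<phi> x *\<^sub>R F'.k2 (t, x)) = G t *v (LBINT x. \<phi> x *\<^sub>R F.k2 (t, x))"
    by (rule int[OF d1 F.measurable_coefficients(5) F'.measurable_coefficients(5)])
     (simp add: F.k2_def F'.k2_def F.g1_def F'.g1_def rules)
   moreover have "F'.u_mean \<phi> t = G t *v F.u_mean \<phi> t"
    unfolding F.u_mean_def F'.u_mean_def by (rule int[OF d1 F.um F'.um])
   moreover have "F'.e_mean \<phi> t = G t *v F.e_mean \<phi> t"
    unfolding F.e_mean_def F'.e_mean_def by (rule int[OF d1 F.em F'.em])
   moreover have "G t *v (- x) = - (G t *v x)" for x
    using matrix_vector_mult_scaleR[of "G t" "-1" x] by simp
   ultimately show ?thesis
    by (simp add: F.u_rate_def F'.u_rate_def F.e_rate_def F'.e_rate_def rules)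
  qed
  show ?thesis using c ii eq by auto
 qed
 have const: "G s = G t" if "s \<in> I" "t \<in> I" "good s" "good t" for s t
 proof (rule rotating_curves_rigid[OF _ _ good _ Yp _ that])
  show "open I" "is_interval I" by (simp_all add: I_def is_interval_oo)
  show "rotation_matrix (G t)" if "good t" for t using G[OF that] by (simp add: rotates_def)
  show "\<exists>y1 z1 y1' z1' y2 z2 y2' z2'. (y1, z1, y1', z1') \<in> Y \<and> (y2, z2, y2', z2') \<in> Y \<and> y1 t \<times> y2 t \<noteq> 0"
   if t: "t \<in> I" for t
  proof -
   have Yi: "\<exists>z y' z'. (y \<phi>, z, y', z') \<in> Y" if "y \<in> {F.u_mean, F.e_mean}" "F.bump \<phi>" for y \<phi>
    using that unfolding Y_def by blast
   show ?thesis using F.means_independent[of t] t Yi unfolding I_def by metis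
  qed
 qed
 have "\<exists>t0\<in>I. t0 \<in> I --> good t0" by (rule AE_ex_open[OF good]) (use True in \<open>auto simp: I_def\<close>)
 then obtain t0 where t0: "t0 \<in> I" "good t0" by blast
 define R where "R = G t0"
 have R: "rotation_matrix R" using G[OF t0(2)] by (simp add: R_def rotates_def)
 have aeR: "AE t in lborel. t \<in> I --> (AE x in lborel. u' (t, x) = R *v u (t, x) \<and> e' (t, x) = R *v e (t, x))"
  using good
 proof eventually_elim
  case (elim t)
  then show ?case using G[of t] const[OF _ t0(1) _ t0(2), of t] unfolding R_def rotates_def by auto
 qed
 have Rm: "(%z. R *v f z) \<in> borel_measurable borel" if "f \<in> borel_measurable borel" for f :: "real \<times> real => real^3"
  by (rule borel_measurable_continuous_on[of "(*v) R" f, OF _ that])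
   (rule linear_continuous_on[OF matrix_vector_mul_bounded_linear])
 have all: "AE x in lborel. f' (t, x) - R *v f (t, x) = 0"
  if t: "t \<in> I" and m: "f \<in> borel_measurable borel" "f' \<in> borel_measurable borel" and c: "C_L2loc T f" "C_L2loc T f'"
   and ae: "AE t in lborel. t \<in> I --> (AE x in lborel. f' (t, x) - R *v f (t, x) = 0)" for f f' and t
 proof (rule C_L2loc_AE_all_times[of "%z. f' z - R *v f z" f' f T 1 t, OF _ m(2,1) c(2,1) _ _ _ t[unfolded I_def]])
  show "(%z. f' z - R *v f z) \<in> borel_measurable borel" using m Rm by (intro borel_measurable_diff) auto
  show "AE t in lborel. t \<in> {-T<..<T} --> (AE x in lborel. f' (t, x) - R *v f (t, x) = 0)" using ae by (simp add: I_def)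
  fix s t
  have "norm (f' (t, x) - R *v f (t, x) - (f' (s, x) - R *v f (s, x))) <= norm (f' (s, x) - f' (t, x)) + norm (f (s, x) - f (t, x))" for x
  proof -
   have "f' (t, x) - R *v f (t, x) - (f' (s, x) - R *v f (s, x)) = (f' (t, x) - f' (s, x)) - R *v (f (t, x) - f (s, x))"
    by (simp add: matrix_vector_mult_diff_distrib)
   also have "norm ... <= norm (f' (t, x) - f' (s, x)) + norm (R *v (f (t, x) - f (s, x)))"
    by (rule norm_triangle_ineq4)
   finally show ?thesis
    by (simp only: rotation_norm[OF R] norm_minus_commute[of "f' (s, x)"] norm_minus_commute[of "f (s, x)"])
  qed
  then show "AE x in lborel. norm (f' (t, x) - R *v f (t, x) - (f' (s, x) - R *v f (s, x))) <= 1 * (norm (f' (s, x) - f' (t, x)) + norm (f (s, x) - f (t, x)))"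
   by simp
 qed simp
 have ae1: "AE t in lborel. t \<in> I --> (AE x in lborel. u' (t, x) - R *v u (t, x) = 0)"
  "AE t in lborel. t \<in> I --> (AE x in lborel. e' (t, x) - R *v e (t, x) = 0)"
  using aeR by (eventually_elim; auto elim: eventually_mono)+
 show ?thesis
 proof (intro exI[of _ R] conjI ballI R)
  fix t assume "t \<in> {-T<..<T}"
  then have t: "t \<in> I" by (simp add: I_def)
  show "AE x in lborel. u' (t, x) = R *v u (t, x) \<and> e' (t, x) = R *v e (t, x)"
   using all[OF t F.um F'.um F.u_cont F'.u_cont ae1(1)] all[OF t F.em F'.em F.e_cont F'.e_cont ae1(2)]
   by eventually_elim simp
 qed
qed

section \<open>Parallel transport\<close>

text \<open>This is the estimate for the Picard iteration in the norm with weight \<open>exp (c * \<bar>x - x0\<bar>)\<close>: integration gains a factor \<open>1 / c\<close>.\<close>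

lemma exp_growth_bound:
 fixes g :: "real => 'b::euclidean_space"
 assumes d: "!!s. s \<in> {a..b} ==> (g has_vector_derivative g' s) (at s)"
  and le: "!!s. s \<in> {a..b} ==> norm (g' s) <= B * c * exp (c * \<bar>s - x0\<bar>)"
  and x: "x0 \<in> {a..b}" "x \<in> {a..b}" and g0: "g x0 = 0" and "B \<ge> 0"
 shows "norm (g x) <= B * exp (c * \<bar>x - x0\<bar>)"
proof -
 have cont: "continuous_on {r..s} g" if "a <= r" "s <= b" for r s
 proof (intro continuous_at_imp_continuous_on ballI)
  fix x assume "x \<in> {r..s}"
  then show "isCont g x" using that d[of x] has_vector_derivative_continuous by auto
 qed
 consider "x0 < x" | "x0 = x" | "x < x0" by linarith
 then show ?thesis
 proof cases
  case 1
  have "norm (g x - g x0) <= B * exp (c * (x - x0)) - B * exp (c * (x0 - x0))"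
  proof (rule differentiable_bound_general[OF 1, where \<phi>' = "%s. B * (exp (c * (s - x0)) * c)" and f' = g'])
   show "continuous_on {x0..x} g" using x by (intro cont) auto
   fix s assume s: "x0 < s" "s < x"
   then show "(g has_vector_derivative g' s) (at s)" using d x by auto
   show "((%s. B * exp (c * (s - x0))) has_vector_derivative B * (exp (c * (s - x0)) * c)) (at s)"
    unfolding has_real_derivative_iff_has_vector_derivative[symmetric] by (auto intro!: derivative_eq_intros)
   show "norm (g' s) <= B * (exp (c * (s - x0)) * c)" using le[of s] s x by (simp add: algebra_simps)
  qed (intro continuous_intros)
  then show ?thesis using g0 1 \<open>B \<ge> 0\<close> by simp
 next
  case 2
  then show ?thesis using g0 \<open>B \<ge> 0\<close> by simp
 next
  case 3
  have "norm (g x0 - g x) <= - B * exp (c * (x0 - x0)) - (- B * exp (c * (x0 - x)))"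
  proof (rule differentiable_bound_general[OF 3, where \<phi>' = "%s. B * (exp (c * (x0 - s)) * c)" and f' = g'])
   show "continuous_on {x..x0} g" using x by (intro cont) auto
   fix s assume s: "x < s" "s < x0"
   then show "(g has_vector_derivative g' s) (at s)" using d x by auto
   show "((%s. - B * exp (c * (x0 - s))) has_vector_derivative B * (exp (c * (x0 - s)) * c)) (at s)"
    unfolding has_real_derivative_iff_has_vector_derivative[symmetric] by (auto intro!: derivative_eq_intros)
   show "norm (g' s) <= B * (exp (c * (x0 - s)) * c)" using le[of s] s x by (simp add: algebra_simps)
  qed (intro continuous_intros)
  then show ?thesis using g0 3 \<open>B \<ge> 0\<close> by simp
 qed
qed

lemma interval_cbox_around:
 fixes I :: "real set"
 assumes "open I" "is_interval I" "x \<in> I" "y \<in> I"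
 obtains a b where "{a..b} <= I" "a < x" "x < b" "a < y" "y < b"
proof -
 obtain a b where ab: "x \<in> box a b" "cbox a b <= I" using open_contains_cbox[OF assms(1)] assms(3) by metis
 obtain c d where cd: "y \<in> box c d" "cbox c d <= I" using open_contains_cbox[OF assms(1)] assms(4) by metis
 have m: "min a c \<in> I" "max b d \<in> I" using ab cd by (auto simp: min_def max_def)
 have "{min a c..max b d} <= I"
  using mem_is_interval_1_I[OF assms(2) m] by auto
 then show ?thesis using that[of "min a c" "max b d"] ab cd by auto
qed

lemma interval_antiderivative:
 fixes f :: "real => 'b::euclidean_space"
 assumes I: "open I" "is_interval I" "x0 \<in> I" and c: "continuous_on I f" and x: "x \<in> I"
 shows "((%u. LBINT y=x0..u. f y) has_vector_derivative f x) (at x)"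
proof -
 obtain a b where ab: "{a..b} <= I" "a < x0" "x0 < b" "a < x" "x < b"
  using interval_cbox_around[OF I x] by metis
 have "((%u. LBINT y=x0..u. f y) has_vector_derivative f x) (at x within {a..b})"
  using ab continuous_on_subset[OF c ab(1)] by (intro interval_integral_FTC2) auto
 moreover have "at x within {a..b} = at x" using ab by (intro at_within_interior) auto
 ultimately show ?thesis by simp
qed

lemma norm_cross_bound: "norm x <= L ==> norm (x \<times> (y::real^3)) <= L * norm y"
 by (rule order_trans[OF norm_cross_le mult_right_mono]) auto

lemma continuous_on_cross:
 "continuous_on S f ==> continuous_on S g ==> continuous_on S (%x. f x \<times> (g x :: real^3))"
 using bounded_bilinear.continuous_on[of "(\<times>)"] bilinear_cross bilinear_conv_bounded_bilinear by blast

lemma has_vector_derivative_cross: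
 assumes "(f has_vector_derivative f') (at x)" "(g has_vector_derivative g') (at x)"
 shows "((%x. f x \<times> (g x :: real^3)) has_vector_derivative (f x \<times> g' + f' \<times> g x)) (at x)"
 using bounded_bilinear.has_vector_derivative[of "(\<times>)", OF _ assms] bilinear_cross bilinear_conv_bounded_bilinear by blast

lemma has_real_derivative_inner:
 fixes f g :: "real => 'b::euclidean_space"
 assumes "(f has_vector_derivative f') (at x)" "(g has_vector_derivative g') (at x)"
 shows "((%x. f x \<bullet> g x) has_real_derivative (f x \<bullet> g' + f' \<bullet> g x)) (at x)"
 unfolding has_real_derivative_iff_has_vector_derivative
 using bounded_bilinear.has_vector_derivative[OF bounded_bilinear_inner assms] .

lemma cross_ode_exists:
 fixes \<omega> :: "real => real^3"
 assumes I: "open I" "is_interval I" "x0 \<in> I" and \<omega>: "continuous_on I \<omega>"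
 obtains y where "y x0 = y0" "!!x. x \<in> I ==> (y has_vector_derivative (\<omega> x \<times> y x)) (at x)"
proof -
 define Y where "Y = rec_nat (%_. y0) (%_ f x. y0 + (LBINT s=x0..x. \<omega> s \<times> f s))"
 have Y0: "Y 0 = (%_. y0)" and YS: "Y (Suc n) = (%x. y0 + (LBINT s=x0..x. \<omega> s \<times> Y n s))" for n
  by (simp_all add: Y_def)
 have Yc: "continuous_on I (Y n)" and Yd: "!!x. x \<in> I ==> (Y (Suc n) has_vector_derivative (\<omega> x \<times> Y n x)) (at x)" for n
 proof (induction n)
  case 0
  show "continuous_on I (Y 0)" by (simp add: Y0)
  fix x assume "x \<in> I"
  show "(Y (Suc 0) has_vector_derivative (\<omega> x \<times> Y 0 x)) (at x)"
   unfolding YS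
   by (auto intro!: derivative_eq_intros interval_antiderivative[OF I _ \<open>x \<in> I\<close>] continuous_on_cross \<omega> simp: Y0)
 next
  case (Suc n)
  show c: "continuous_on I (Y (Suc n))"
   using Suc(2) has_vector_derivative_continuous by (blast intro: continuous_at_imp_continuous_on)
  fix x assume "x \<in> I"
  show "(Y (Suc (Suc n)) has_vector_derivative (\<omega> x \<times> Y (Suc n) x)) (at x)"
   unfolding YS[of "Suc n"] using interval_antiderivative[OF I continuous_on_cross[OF \<omega> c] \<open>x \<in> I\<close>]
   by (auto intro!: derivative_eq_intros)
 qed
 have Yx0: "Y n x0 = y0" for n by (cases n) (simp_all add: Y0 YS)
 have local: "\<exists>g. \<forall>x\<in>{a..b}. (%n. Y n x) \<longlonglongrightarrow> g x \<and> (g has_vector_derivative (\<omega> x \<times> g x)) (at x within {a..b})"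
  if ab: "{a..b} <= I" "a < x0" "x0 < b" for a b
 proof -
  have "bounded (\<omega> ` {a..b})"
   by (intro compact_imp_bounded compact_continuous_image continuous_on_subset[OF \<omega> ab(1)] compact_Icc)
  then obtain L where L: "L > 0" "!!x. x \<in> {a..b} ==> norm (\<omega> x) <= L" unfolding bounded_pos by auto
  have "bounded ((%x. Y 1 x - Y 0 x) ` {a..b})"
   by (intro compact_imp_bounded compact_continuous_image continuous_intros continuous_on_subset[OF Yc ab(1)] compact_Icc)
  then obtain K where K: "K > 0" "!!x. x \<in> {a..b} ==> norm (Y 1 x - Y 0 x) <= K" unfolding bounded_pos by auto
  have D: "norm (Y (Suc n) x - Y n x) <= K * (1/2)^n * exp (2 * L * \<bar>x - x0\<bar>)" if "x \<in> {a..b}" for n x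
   using that
  proof (induction n arbitrary: x)
   case 0
   have "K * 1 <= K * exp (2 * L * \<bar>x - x0\<bar>)" using K L by (intro mult_left_mono) auto
   then show ?case using K(2)[OF 0] by simp
  next
   case (Suc n)
   show ?case
   proof (rule exp_growth_bound[where a = a and b = b and g' = "%x. \<omega> x \<times> Y (Suc n) x - \<omega> x \<times> Y n x"])
    fix s assume s: "s \<in> {a..b}"
    show "((%x. Y (Suc (Suc n)) x - Y (Suc n) x) has_vector_derivative (\<omega> s \<times> Y (Suc n) s - \<omega> s \<times> Y n s)) (at s)"
     using s ab by (intro has_vector_derivative_diff Yd) auto
    have "norm (\<omega> s \<times> Y (Suc n) s - \<omega> s \<times> Y n s) = norm (\<omega> s \<times> (Y (Suc n) s - Y n s))"
     by (simp add: Cross3.right_diff_distrib)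
    also have "... <= L * (K * (1/2)^n * exp (2 * L * \<bar>s - x0\<bar>))"
     using norm_cross_bound[OF L(2)[OF s]] mult_left_mono[OF Suc.IH[OF s], of L] L(1) by (meson less_imp_le order_trans)
    also have "... = K * (1/2)^Suc n * (2 * L) * exp (2 * L * \<bar>s - x0\<bar>)" by simp
    finally show "norm (\<omega> s \<times> Y (Suc n) s - \<omega> s \<times> Y n s) <= K * (1/2)^Suc n * (2 * L) * exp (2 * L * \<bar>s - x0\<bar>)" .
   qed (use Suc ab K in \<open>auto simp: Yx0\<close>)
  qed
  define E where "E = exp (2 * L * (b - a))"
  have E: "exp (2 * L * \<bar>x - x0\<bar>) <= E" if "x \<in> {a..b}" for x
   unfolding E_def using that ab L by (auto intro!: mult_left_mono)
  have DE: "norm (Y (Suc n) x - Y n x) <= K * E * (1/2)^n" if "x \<in> {a..b}" for n x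
  proof -
   have "K * (1/2)^n * exp (2 * L * \<bar>x - x0\<bar>) <= K * (1/2)^n * E"
    using E[OF that] K by (intro mult_left_mono) auto
   then show ?thesis using D[OF that, of n] by (simp only: mult.assoc mult.commute[of E])
  qed
  have "uniformly_convergent_on {a..b} (%n x. \<Sum>i<n. (Y (Suc i) x - Y i x))"
   by (rule Weierstrass_m_test'[where M = "%n. K * E * (1/2)^n"]) (use DE in \<open>auto intro!: summable_mult summable_geometric\<close>)
  then obtain s where s: "uniform_limit {a..b} (%n x. \<Sum>i<n. (Y (Suc i) x - Y i x)) s sequentially"
   unfolding uniformly_convergent_on_def by blast
  define g where "g x = y0 + s x" for x
  have u: "uniform_limit {a..b} Y g sequentially"
  proof -
   have "uniform_limit {a..b} (%n x. Y 0 x + (\<Sum>i<n. (Y (Suc i) x - Y i x))) (%x. Y 0 x + s x) sequentially"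
    by (intro uniform_limit_add s uniform_limit_const)
   moreover have "Y 0 x + (\<Sum>i<n. (Y (Suc i) x - Y i x)) = Y n x" for n x
    by (induction n) (auto simp: algebra_simps)
   ultimately show ?thesis by (simp add: g_def[abs_def] Y0)
  qed
  have "\<exists>g'. \<forall>x\<in>{a..b}. (%n. Y (Suc n) x) \<longlonglongrightarrow> g' x \<and> (g' has_derivative (%h. h *\<^sub>R (\<omega> x \<times> g x))) (at x within {a..b})"
  proof (rule has_derivative_sequence[where f' = "%n x h. h *\<^sub>R (\<omega> x \<times> Y n x)" and ?x0.0 = x0 and l = y0])
   show "(Y (Suc n) has_derivative (%h. h *\<^sub>R (\<omega> x \<times> Y n x))) (at x within {a..b})" if "x \<in> {a..b}" for n x
    using Yd[OF subsetD[OF ab(1) that], of n] unfolding has_vector_derivative_def by (rule has_derivative_at_withinI)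
   show "\<forall>\<^sub>F n in sequentially. \<forall>x\<in>{a..b}. \<forall>h. norm (h *\<^sub>R (\<omega> x \<times> Y n x) - h *\<^sub>R (\<omega> x \<times> g x)) <= \<epsilon> * norm h"
    if "\<epsilon> > 0" for \<epsilon>
   proof -
    have "\<epsilon> / L > 0" using that L by simp
    then have "\<forall>\<^sub>F n in sequentially. \<forall>x\<in>{a..b}. dist (Y n x) (g x) < \<epsilon> / L" using u unfolding uniform_limit_iff by blast
    then show ?thesis
    proof (rule eventually_mono; intro ballI allI)
     fix n x h assume *: "\<forall>x\<in>{a..b}. dist (Y n x) (g x) < \<epsilon> / L" and x: "x \<in> {a..b}"
     have "norm (\<omega> x \<times> (Y n x - g x)) <= L * norm (Y n x - g x)" by (rule norm_cross_bound[OF L(2)[OF x]])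
     also have "... <= L * (\<epsilon> / L)" using * x L by (intro mult_left_mono) (auto simp: dist_norm less_imp_le)
     also have "... = \<epsilon>" using L by simp
     finally have "norm (\<omega> x \<times> (Y n x - g x)) <= \<epsilon>" .
     moreover have "h *\<^sub>R (\<omega> x \<times> Y n x) - h *\<^sub>R (\<omega> x \<times> g x) = h *\<^sub>R (\<omega> x \<times> (Y n x - g x))"
      by (simp add: Cross3.right_diff_distrib scaleR_diff_right)
     ultimately show "norm (h *\<^sub>R (\<omega> x \<times> Y n x) - h *\<^sub>R (\<omega> x \<times> g x)) <= \<epsilon> * norm h"
      using mult_right_mono[of "norm (\<omega> x \<times> (Y n x - g x))" \<epsilon> "\<bar>h\<bar>"] by (simp add: mult.commute)
    qed
   qed
  qed (use ab in \<open>auto simp: Yx0\<close>)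
  then obtain g' where g': "!!x. x \<in> {a..b} ==> (%n. Y (Suc n) x) \<longlonglongrightarrow> g' x"
   "!!x. x \<in> {a..b} ==> (g' has_derivative (%h. h *\<^sub>R (\<omega> x \<times> g x))) (at x within {a..b})" by blast
  have lim: "(%n. Y n x) \<longlonglongrightarrow> g x" if "x \<in> {a..b}" for x
   using tendsto_uniform_limitI[OF u that] .
  have eq: "g' x = g x" if "x \<in> {a..b}" for x
   using LIMSEQ_unique[OF g'(1)[OF that] LIMSEQ_Suc[OF lim[OF that]]] .
  show ?thesis
   using g'(2) lim unfolding has_vector_derivative_def by (intro exI[of _ g'] ballI conjI) (simp_all add: eq)
 qed
 define y where "y x = lim (%n. Y n x)" for x
 show ?thesis
 proof (rule that[of y])
  show "y x0 = y0" by (simp add: y_def Yx0)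
  fix x assume x: "x \<in> I"
  obtain a b where ab: "{a..b} <= I" "a < x0" "x0 < b" "a < x" "x < b"
   using interval_cbox_around[OF I x] by metis
  obtain g where g: "\<forall>x\<in>{a..b}. (%n. Y n x) \<longlonglongrightarrow> g x \<and> (g has_vector_derivative (\<omega> x \<times> g x)) (at x within {a..b})"
   using local[OF ab(1-3)] by blast
  have yg: "y s = g s" if "s \<in> {a..b}" for s using g that unfolding y_def by (blast intro: limI)
  have "(g has_vector_derivative (\<omega> x \<times> g x)) (at x within {a..b})" using g ab by auto
  then have "(g has_vector_derivative (\<omega> x \<times> g x)) (at x)"
   using at_within_interior[of x "{a..b}"] ab by auto
  then have "(y has_vector_derivative (\<omega> x \<times> g x)) (at x)"
   by (rule has_vector_derivative_transform_within_open[where S = "{a<..<b}"]) (use ab yg in auto)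
  then show "(y has_vector_derivative (\<omega> x \<times> y x)) (at x)" using yg[of x] ab by simp
 qed
qed

lemma cross_ode_inner_const:
 fixes \<omega> :: "real => real^3"
 assumes I: "is_interval I" and y: "!!x. x \<in> I ==> (y has_vector_derivative (\<omega> x \<times> y x)) (at x)"
  and z: "!!x. x \<in> I ==> (z has_vector_derivative (\<omega> x \<times> z x)) (at x)" and ab: "a \<in> I" "b \<in> I"
 shows "y a \<bullet> z a = y b \<bullet> z b"
proof -
 have d: "((%x. y x \<bullet> z x) has_real_derivative 0) (at x)" if "x \<in> I" for x
 proof -
  have "y x \<bullet> (\<omega> x \<times> z x) + (\<omega> x \<times> y x) \<bullet> z x = 0" by (simp add: cross3_simps)
  then show ?thesis using has_real_derivative_inner[OF y[OF that] z[OF that]] by simp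
 qed
 have main: "y r \<bullet> z r = y s \<bullet> z s" if "r \<in> I" "s \<in> I" "r < s" for r s
 proof -
  have sub: "{r..s} <= I" using mem_is_interval_1_I[OF I that(1,2)] by auto
  have "continuous_on {r..s} (%x. y x \<bullet> z x)"
   using sub by (intro continuous_at_imp_continuous_on ballI DERIV_isCont[OF d]) auto
  then show ?thesis by (rule DERIV_isconst_end[OF that(3), symmetric]) (use sub in \<open>auto intro!: d\<close>)
 qed
 consider "a < b" | "a = b" | "b < a" by linarith
 then show ?thesis
 proof cases
  case 1 then show ?thesis by (rule main[OF ab])
 next
  case 2 then show ?thesis by simp
 next
  case 3 then show ?thesis by (rule main[OF ab(2,1), symmetric])
 qed
qed

lemma cross_ode_norm_const:
 fixes \<omega> :: "real => real^3"
 assumes I: "is_interval I" and y: "!!x. x \<in> I ==> (y has_vector_derivative (\<omega> x \<times> y x)) (at x)"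
  and ab: "a \<in> I" "b \<in> I"
 shows "norm (y a) = norm (y b)"
 using cross_ode_inner_const[OF I y y ab] by (simp add: norm_eq_sqrt_inner)

lemma abs_derivative_growth:
 fixes N :: "real => real"
 assumes d: "!!s. (N has_real_derivative N' s) (at s)" and le: "!!s. s \<in> {a..b} ==> \<bar>N' s\<bar> <= N s"
  and x: "x0 \<in> {a..b}" "x \<in> {a..b}"
 shows "N x <= N x0 * exp \<bar>x - x0\<bar>"
proof (cases "x0 <= x")
 case True
 have "N x * exp (- x) <= N x0 * exp (- x0)"
 proof (rule DERIV_nonpos_imp_nonincreasing[OF True, of "%s. N s * exp (- s)"])
  fix s assume s: "x0 <= s" "s <= x"
  have "((%s. N s * exp (- s)) has_real_derivative (N' s - N s) * exp (- s)) (at s)"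
   by (auto intro!: derivative_eq_intros d simp: algebra_simps)
  moreover have "(N' s - N s) * exp (- s) <= 0" using le[of s] s x by (auto simp: mult_le_0_iff)
  ultimately show "\<exists>y. ((%s. N s * exp (- s)) has_real_derivative y) (at s) \<and> y <= 0" by blast
 qed
 then show ?thesis using True by (simp add: exp_minus exp_diff field_simps)
next
 case False
 have "N x * exp x <= N x0 * exp x0"
 proof (rule DERIV_nonneg_imp_nondecreasing[of x x0 "%s. N s * exp s"])
  show "x <= x0" using False by simp
  fix s assume s: "x <= s" "s <= x0"
  have "((%s. N s * exp s) has_real_derivative (N' s + N s) * exp s) (at s)"
   by (auto intro!: derivative_eq_intros d simp: algebra_simps)
  moreover have "(N' s + N s) * exp s \<ge> 0" using le[of s] s x by auto
  ultimately show "\<exists>y. ((%s. N s * exp s) has_real_derivative y) (at s) \<and> y \<ge> 0" by blast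
 qed
 then show ?thesis using False by (simp add: exp_minus exp_diff field_simps)
qed

lemma vector_derivative_lipschitz:
 fixes f :: "real => 'b::euclidean_space"
 assumes d: "!!s. s \<in> {a..b} ==> (f has_vector_derivative f' s) (at s)"
  and le: "!!s. s \<in> {a..b} ==> norm (f' s) <= B" and x: "x \<in> {a..b}" "y \<in> {a..b}"
 shows "norm (f y - f x) <= B * \<bar>y - x\<bar>"
proof -
 have B: "B \<ge> 0" using le[OF x(1)] norm_ge_zero order_trans by blast
 have "norm (f y - f x) <= B * norm (y - x)"
 proof (rule differentiable_bound[of "{a..b}" f "%x h. h *\<^sub>R f' x"])
  fix s assume s: "s \<in> {a..b}"
  show "(f has_derivative (%h. h *\<^sub>R f' s)) (at s within {a..b})"
   using d[OF s] unfolding has_vector_derivative_def by (rule has_derivative_at_withinI)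
  show "onorm (%h. h *\<^sub>R f' s) <= B"
   by (rule onorm_bound[OF B]) (use mult_left_mono[OF le[OF s] abs_ge_zero] in \<open>simp add: mult.commute\<close>)
 qed (use x in auto)
 then show ?thesis by simp
qed

lemma strip_slices:
 assumes "continuous_on (strip T) f"
 shows "t \<in> {-T<..<T} ==> continuous_on UNIV (%x. f (t, x))" "continuous_on {-T<..<T} (%t. f (t, x))"
 using assms by (auto intro!: continuous_on_compose2[OF assms] continuous_intros simp: strip_def)

lemma bounded_on_cbox:
 fixes f :: "real \<times> real => 'b::real_normed_vector"
 assumes "continuous_on (strip T) f" "cbox p q <= strip T"
 obtains B where "B > 0" "!!z. z \<in> cbox p q ==> norm (f z) <= B"
proof -
 have "bounded (f ` cbox p q)"
  by (intro compact_imp_bounded compact_continuous_image compact_cbox continuous_on_subset[OF assms])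
 then show ?thesis using that unfolding bounded_pos by auto
qed

text \<open>A flat connection with values in \<open>so(3)\<close>, identified with \<open>\<real>\<^sup>3\<close> through the cross product,
  admits parallel sections. The section is built by parallel transport along the time axis and
  then along the lines of constant time. That it is parallel in the time direction as well is seen from
  the difference \<open>D\<close> between the section at two times and its expected first order expansion: by flatness
  \<open>D\<close> is itself transported up to a second order term, and transport does not change lengths.\<close>

lemma flat_connection_parallel_section:
 fixes \<alpha> \<beta> \<alpha>t :: "real \<times> real => real^3"
 assumes c: "continuous_on (strip T) \<alpha>" "continuous_on (strip T) \<beta>" "continuous_on (strip T) \<alpha>t"
  and d\<alpha>: "!!t x. t \<in> {-T<..<T} ==> ((%s. \<alpha> (s, x)) has_vector_derivative \<alpha>t (t, x)) (at t)"
  and d\<beta>: "!!t x. t \<in> {-T<..<T} ==> ((%x. \<beta> (t, x)) has_vector_derivative (\<alpha>t (t, x) + \<alpha> (t, x) \<times> \<beta> (t, x))) (at x)"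
  and t0: "t0 \<in> {-T<..<T}"
 obtains y where "y (t0, 0) = y0" "continuous_on (strip T) y"
  "!!t x. t \<in> {-T<..<T} ==> ((%x. y (t, x)) has_vector_derivative (\<alpha> (t, x) \<times> y (t, x))) (at x)"
  "!!t x. t \<in> {-T<..<T} ==> ((%t. y (t, x)) has_vector_derivative (\<beta> (t, x) \<times> y (t, x))) (at t)"
  "!!t x. t \<in> {-T<..<T} ==> norm (y (t, x)) = norm y0"
proof -
 define I where "I = {-T<..<T}"
 have I: "open I" "is_interval I" "t0 \<in> I" using t0 by (auto simp: I_def is_interval_oo)
 obtain m where m: "m t0 = y0" "!!t. t \<in> I ==> (m has_vector_derivative (\<beta> (t, 0) \<times> m t)) (at t)"
  using cross_ode_exists[OF I, of "%t. \<beta> (t, 0)" y0] strip_slices(2)[OF c(2)] unfolding I_def by metis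
 have "\<exists>Y. Y 0 = m t \<and> (\<forall>x. (Y has_vector_derivative (\<alpha> (t, x) \<times> Y x)) (at x))" if "t \<in> I" for t
  using cross_ode_exists[OF open_UNIV is_interval_univ UNIV_I strip_slices(1)[OF c(1) that[unfolded I_def]],
    where ?x0.0 = 0 and ?y0.0 = "m t"] by (metis UNIV_I)
 then obtain Y where Y: "!!t. t \<in> I ==> Y t 0 = m t"
  "!!t x. t \<in> I ==> (Y t has_vector_derivative (\<alpha> (t, x) \<times> Y t x)) (at x)" by metis
 define K where "K = norm y0"
 have mn: "norm (m t) = K" if "t \<in> I" for t
  using cross_ode_norm_const[OF I(2) m(2) that I(3)] m(1) by (simp add: K_def)
 have Yn: "norm (Y t x) = K" if "t \<in> I" for t x
  using cross_ode_norm_const[OF is_interval_univ Y(2)[OF that] UNIV_I UNIV_I, of x 0] Y(1)[OF that] mn[OF that] by simp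
 have K: "K \<ge> 0" by (simp add: K_def)
 have dt: "((%t. Y t x) has_vector_derivative (\<beta> (t, x) \<times> Y t x)) (at t)" if t: "t \<in> I" for t x
  unfolding has_vector_derivative_def has_derivative_at_alt
 proof (intro conjI allI impI)
  show "bounded_linear (%h. h *\<^sub>R (\<beta> (t, x) \<times> Y t x))" by (rule bounded_linear_scaleR_left)
  fix \<epsilon> :: real assume "\<epsilon> > 0"
  define R where "R = \<bar>x\<bar>"
  obtain r where r: "r > 0" "{t - r..t + r} <= I"
   using I(1) t by (auto simp: open_contains_cball cball_eq_atLeastAtMost)
  define Q where "Q = cbox (t - r, - R) (t + r, R)"
  have Q: "Q <= strip T"
  proof -
   have "t - r \<in> I" "t + r \<in> I" using r by auto
   then show ?thesis unfolding Q_def I_def by (intro cbox_subset_strip) auto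
  qed
  obtain A where A: "A > 0" "!!z. z \<in> Q ==> norm (\<alpha>t z) <= A" using bounded_on_cbox[OF c(3)] Q unfolding Q_def by metis
  obtain B where B: "B > 0" "!!z. z \<in> Q ==> norm (\<beta> z) <= B" using bounded_on_cbox[OF c(2)] Q unfolding Q_def by metis
  define C where "C = (2 * K + 1) * sqrt (2 * exp R)"
  have C: "C > 0" using K by (simp add: C_def)
  define \<kappa> where "\<kappa> = \<epsilon> / C"
  have \<kappa>: "\<kappa> > 0" using C \<open>\<epsilon> > 0\<close> by (simp add: \<kappa>_def)
  have "uniformly_continuous_on Q \<alpha>t"
   unfolding Q_def by (intro compact_uniformly_continuous compact_cbox continuous_on_subset[OF c(3)] Q[unfolded Q_def])
  then obtain \<delta>1 where \<delta>1: "\<delta>1 > 0" "!!z z'. z \<in> Q ==> z' \<in> Q ==> dist z' z < \<delta>1 ==> dist (\<alpha>t z') (\<alpha>t z) < \<kappa>"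
   unfolding uniformly_continuous_on_def using \<kappa> by metis
  obtain \<delta>2 where \<delta>2: "\<delta>2 > 0" "!!s. norm (s - t) < \<delta>2 ==> norm (m s - m t - (s - t) *\<^sub>R (\<beta> (t, 0) \<times> m t)) <= \<kappa> * norm (s - t)"
   using m(2)[OF t] \<kappa> unfolding has_vector_derivative_def has_derivative_at_alt by blast
  define \<delta> where "\<delta> = min (min r \<delta>1) (min \<delta>2 (\<kappa> / (A * B)))"
  show "\<exists>d>0. \<forall>s. norm (s - t) < d --> norm (Y s x - Y t x - (s - t) *\<^sub>R (\<beta> (t, x) \<times> Y t x)) <= \<epsilon> * norm (s - t)"
  proof (intro exI[of _ \<delta>] conjI allI impI)
   show "\<delta> > 0" using r \<delta>1 \<delta>2 \<kappa> A B by (simp add: \<delta>_def)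
   fix s assume s: "norm (s - t) < \<delta>"
   define h where "h = s - t"
   have h: "\<bar>h\<bar> < r" "\<bar>h\<bar> < \<delta>1" "\<bar>h\<bar> < \<delta>2" "\<bar>h\<bar> * (A * B) <= \<kappa>"
    using s A B by (auto simp: \<delta>_def h_def field_simps)
   have "s \<in> {t - r..t + r}" using h(1) unfolding h_def by (simp add: abs_less_iff)
   then have sI: "s \<in> I" using r(2) by blast
   define D where "D \<xi> = Y s \<xi> - Y t \<xi> - h *\<^sub>R (\<beta> (t, \<xi>) \<times> Y t \<xi>)" for \<xi>
   define E where "E \<xi> = \<alpha> (s, \<xi>) - \<alpha> (t, \<xi>) - h *\<^sub>R \<alpha>t (t, \<xi>)" for \<xi>
   define D' where "D' \<xi> = \<alpha> (s, \<xi>) \<times> Y s \<xi> - \<alpha> (t, \<xi>) \<times> Y t \<xi>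
    - h *\<^sub>R (\<beta> (t, \<xi>) \<times> (\<alpha> (t, \<xi>) \<times> Y t \<xi>) + (\<alpha>t (t, \<xi>) + \<alpha> (t, \<xi>) \<times> \<beta> (t, \<xi>)) \<times> Y t \<xi>)" for \<xi>
   define \<rho> where "\<rho> \<xi> = E \<xi> \<times> Y s \<xi> + (h * h) *\<^sub>R (\<alpha>t (t, \<xi>) \<times> (\<beta> (t, \<xi>) \<times> Y t \<xi>))" for \<xi>
   have dD: "(D has_vector_derivative D' \<xi>) (at \<xi>)" for \<xi>
   proof -
    have "((%\<xi>. \<beta> (t, \<xi>) \<times> Y t \<xi>) has_vector_derivative
     (\<beta> (t, \<xi>) \<times> (\<alpha> (t, \<xi>) \<times> Y t \<xi>) + (\<alpha>t (t, \<xi>) + \<alpha> (t, \<xi>) \<times> \<beta> (t, \<xi>)) \<times> Y t \<xi>)) (at \<xi>)"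
     using t unfolding I_def by (intro has_vector_derivative_cross d\<beta> Y(2)[unfolded I_def])
    from has_vector_derivative_diff[OF has_vector_derivative_diff[OF Y(2)[OF sI] Y(2)[OF t]]
      has_vector_derivative_scaleR[OF DERIV_const this, of h]]
    show ?thesis unfolding D_def[abs_def] D'_def by simp
   qed
   have DD': "D \<xi> \<bullet> D' \<xi> = D \<xi> \<bullet> \<rho> \<xi>" for \<xi>
   proof -
    have "D' \<xi> = \<alpha> (t, \<xi>) \<times> D \<xi> + h *\<^sub>R (\<alpha>t (t, \<xi>) \<times> D \<xi>) + \<rho> \<xi>"
     unfolding D'_def D_def \<rho>_def E_def
     by (simp add: vec_eq_iff forall_3 cross3_def vector_3 algebra_simps)
    then show ?thesis by (simp add: inner_add_right dot_cross_self)
   qed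
   have E: "norm (E \<xi>) <= \<kappa> * \<bar>h\<bar>" if \<xi>: "\<xi> \<in> {-R..R}" for \<xi>
   proof -
    define a b where "a = min s t" and "b = max s t"
    have "norm ((\<alpha> (s, \<xi>) - s *\<^sub>R \<alpha>t (t, \<xi>)) - (\<alpha> (t, \<xi>) - t *\<^sub>R \<alpha>t (t, \<xi>))) <= \<kappa> * \<bar>s - t\<bar>"
    proof (rule vector_derivative_lipschitz[of a b "%\<sigma>. \<alpha> (\<sigma>, \<xi>) - \<sigma> *\<^sub>R \<alpha>t (t, \<xi>)" "%\<sigma>. \<alpha>t (\<sigma>, \<xi>) - \<alpha>t (t, \<xi>)"])
     fix \<sigma> assume \<sigma>: "\<sigma> \<in> {a..b}"
     then have s1: "\<bar>\<sigma> - t\<bar> <= \<bar>h\<bar>" by (auto simp: a_def b_def h_def min_def max_def split: if_splits)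
     have "\<sigma> \<in> {t - r..t + r}" using s1 h(1) by (auto simp: abs_le_iff)
     then have \<sigma>I: "\<sigma> \<in> I" using r(2) by blast
     show "((%\<sigma>. \<alpha> (\<sigma>, \<xi>) - \<sigma> *\<^sub>R \<alpha>t (t, \<xi>)) has_vector_derivative \<alpha>t (\<sigma>, \<xi>) - \<alpha>t (t, \<xi>)) (at \<sigma>)"
      using has_vector_derivative_diff[OF d\<alpha>[OF \<sigma>I[unfolded I_def]]
        has_vector_derivative_scaleR[OF DERIV_ident has_vector_derivative_const]] by simp
     have "(\<sigma>, \<xi>) \<in> Q" "(t, \<xi>) \<in> Q" using s1 h(1) \<xi> r(1) by (auto simp: Q_def)
     moreover have "dist (\<sigma>, \<xi>) (t, \<xi>) < \<delta>1" using s1 h(2) by (simp add: dist_Pair_Pair dist_real_def)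
     ultimately show "norm (\<alpha>t (\<sigma>, \<xi>) - \<alpha>t (t, \<xi>)) <= \<kappa>" using \<delta>1(2) by (auto simp: dist_norm less_imp_le)
    qed (auto simp: a_def b_def)
    then show ?thesis by (simp add: E_def h_def algebra_simps)
   qed
   define e where "e = \<kappa> * \<bar>h\<bar> * (2 * K + 1)"
   have \<rho>: "norm (\<rho> \<xi>) <= e" if \<xi>: "\<xi> \<in> {-R..R}" for \<xi>
   proof -
    have z: "(t, \<xi>) \<in> Q" using \<xi> r(1) by (auto simp: Q_def)
    have "norm (\<alpha>t (t, \<xi>) \<times> (\<beta> (t, \<xi>) \<times> Y t \<xi>)) <= A * (B * K)"
    proof -
     have "norm (\<beta> (t, \<xi>) \<times> Y t \<xi>) <= B * K"
      using norm_cross_bound[OF B(2)[OF z], of "Y t \<xi>"] Yn[OF t] by simp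
     from order_trans[OF norm_cross_bound[OF A(2)[OF z]] mult_left_mono[OF this]] A(1) show ?thesis by simp
    qed
    then have "\<bar>h * h\<bar> * norm (\<alpha>t (t, \<xi>) \<times> (\<beta> (t, \<xi>) \<times> Y t \<xi>)) <= \<bar>h * h\<bar> * (A * (B * K))"
     by (intro mult_left_mono) auto
    also have "... = (\<bar>h\<bar> * (A * B)) * (\<bar>h\<bar> * K)" by (simp add: abs_mult)
    also have "... <= \<kappa> * (\<bar>h\<bar> * K)" using h(4) K by (intro mult_right_mono) auto
    finally have 1: "\<bar>h * h\<bar> * norm (\<alpha>t (t, \<xi>) \<times> (\<beta> (t, \<xi>) \<times> Y t \<xi>)) <= \<kappa> * (\<bar>h\<bar> * K)" .
    have 2: "norm (E \<xi> \<times> Y s \<xi>) <= \<kappa> * \<bar>h\<bar> * K" using norm_cross_bound[OF E[OF \<xi>], of "Y s \<xi>"] Yn[OF sI] by simp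
    have "norm (\<rho> \<xi>) <= \<kappa> * \<bar>h\<bar> * K + \<kappa> * (\<bar>h\<bar> * K)"
     unfolding \<rho>_def by (rule order_trans[OF norm_triangle_ineq add_mono[OF 2]]) (use 1 in simp)
    also have "... <= e" using \<kappa> by (simp add: e_def algebra_simps)
    finally show ?thesis .
   qed
   have e0: "e \<ge> 0" using \<kappa> K by (simp add: e_def)
   define N where "N \<xi> = D \<xi> \<bullet> D \<xi> + e\<^sup>2" for \<xi>
   have N: "N x <= N 0 * exp \<bar>x - 0\<bar>"
   proof (rule abs_derivative_growth[where N' = "%\<xi>. 2 * (D \<xi> \<bullet> \<rho> \<xi>)" and a = "-R" and b = R])
    show "(N has_real_derivative 2 * (D \<xi> \<bullet> \<rho> \<xi>)) (at \<xi>)" for \<xi>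
     unfolding N_def[abs_def] using has_real_derivative_inner[OF dD dD, of \<xi>] DD'[of \<xi>]
     by (auto intro!: derivative_eq_intros simp: inner_commute)
    show "\<bar>2 * (D \<xi> \<bullet> \<rho> \<xi>)\<bar> <= N \<xi>" if "\<xi> \<in> {-R..R}" for \<xi>
    proof -
     have "\<bar>D \<xi> \<bullet> \<rho> \<xi>\<bar> <= norm (D \<xi>) * e"
      by (rule order_trans[OF Cauchy_Schwarz_ineq2 mult_left_mono[OF \<rho>[OF that]]]) simp
     then show ?thesis using sum_squares_bound[of "norm (D \<xi>)" e] by (simp add: N_def power2_norm_eq_inner abs_mult)
    qed
   qed (auto simp: R_def)
   have "norm (D 0) <= \<kappa> * \<bar>h\<bar>" using \<delta>2(2)[of s] h(3) Y(1)[OF t] Y(1)[OF sI] by (simp add: D_def h_def)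
   also have "... <= e" using \<kappa> K by (simp add: e_def algebra_simps)
   finally have "D 0 \<bullet> D 0 <= e\<^sup>2" unfolding power2_norm_eq_inner[symmetric] by (intro power_mono) auto
   then have "N x <= (2 * e\<^sup>2) * exp R"
    using N unfolding R_def by (intro order_trans[OF N]) (auto simp: N_def intro!: mult_right_mono)
   moreover have "(norm (D x))\<^sup>2 <= N x" by (simp add: N_def power2_norm_eq_inner)
   moreover have "(2 * e\<^sup>2) * exp R = (e * sqrt (2 * exp R))\<^sup>2" by (simp add: power_mult_distrib)
   ultimately have "(norm (D x))\<^sup>2 <= (e * sqrt (2 * exp R))\<^sup>2" by linarith
   then have "norm (D x) <= e * sqrt (2 * exp R)" by (rule power2_le_imp_le) (use e0 in simp)
   also have "... = \<epsilon> * \<bar>h\<bar>" using C K by (simp add: e_def \<kappa>_def C_def)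
   finally show "norm (Y s x - Y t x - (s - t) *\<^sub>R (\<beta> (t, x) \<times> Y t x)) <= \<epsilon> * norm (s - t)"
    by (simp add: D_def h_def)
  qed
 qed
 define y where "y z = Y (fst z) (snd z)" for z
 have cy: "isCont y (t, x)" if t: "t \<in> I" for t x
 proof -
  obtain r where r: "r > 0" "{t - r..t + r} <= I"
   using I(1) t by (auto simp: open_contains_cball cball_eq_atLeastAtMost)
  define Q where "Q = cbox (t - r, x - 1) (t + r, x + 1)"
  have Q: "Q <= strip T"
  proof -
   have "t - r \<in> I" "t + r \<in> I" using r by auto
   then show ?thesis unfolding Q_def I_def by (intro cbox_subset_strip) auto
  qed
  obtain A where A: "A > 0" "!!z. z \<in> Q ==> norm (\<alpha> z) <= A" using bounded_on_cbox[OF c(1)] Q unfolding Q_def by metis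
  have le: "norm (Y (fst z) (snd z) - Y (fst z) x) <= A * K * \<bar>snd z - x\<bar>" if z: "z \<in> Q" for z
  proof (rule vector_derivative_lipschitz[of "x - 1" "x + 1" _ "%\<xi>. \<alpha> (fst z, \<xi>) \<times> Y (fst z) \<xi>"])
   have "fst z \<in> {t - r..t + r}" using z by (cases z) (auto simp: Q_def)
   then have zI: "fst z \<in> I" using r by blast
   fix \<xi> assume \<xi>: "\<xi> \<in> {x - 1..x + 1}"
   show "(Y (fst z) has_vector_derivative \<alpha> (fst z, \<xi>) \<times> Y (fst z) \<xi>) (at \<xi>)" by (rule Y(2)[OF zI])
   have "(fst z, \<xi>) \<in> Q" using z \<xi> by (cases z) (auto simp: Q_def)
   from norm_cross_bound[OF A(2)[OF this], of "Y (fst z) \<xi>"]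
   show "norm (\<alpha> (fst z, \<xi>) \<times> Y (fst z) \<xi>) <= A * K" using Yn[OF zI] by simp
  qed (use z in \<open>cases z; auto simp: Q_def\<close>)+
  have ev: "\<forall>\<^sub>F z in at (t, x). z \<in> Q"
  proof -
   have "(t, x) \<in> box (t - r, x - 1) (t + r, x + 1)" using r by (simp add: box_prod)
   then have "\<forall>\<^sub>F z in at (t, x). z \<in> box (t - r, x - 1) (t + r, x + 1)" by (intro eventually_at_in_open') auto
   then show ?thesis by (rule eventually_mono) (use box_subset_cbox in \<open>auto simp: Q_def\<close>)
  qed
  have "((%z. Y (fst z) (snd z) - Y (fst z) x) \<longlongrightarrow> 0) (at (t, x))"
  proof (rule Lim_null_comparison)
   show "\<forall>\<^sub>F z in at (t, x). norm (Y (fst z) (snd z) - Y (fst z) x) <= A * K * \<bar>snd z - x\<bar>"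
    using ev by (rule eventually_mono) (rule le)
   have "((%z::real \<times> real. A * K * \<bar>snd z - x\<bar>) \<longlongrightarrow> A * K * \<bar>snd (t, x) - x\<bar>) (at (t, x))"
    by (intro tendsto_intros)
   then show "((%z::real \<times> real. A * K * \<bar>snd z - x\<bar>) \<longlongrightarrow> 0) (at (t, x))" by simp
  qed
  moreover have "((%z::real \<times> real. Y (fst z) x) \<longlongrightarrow> Y t x) (at (t, x))"
  proof -
   have "isCont (%s. Y s x) t" using dt[OF t] by (rule has_vector_derivative_continuous)
   moreover have "((%z::real \<times> real. fst z) \<longlongrightarrow> t) (at (t, x))"
    using tendsto_fst[OF tendsto_ident_at, of "(t, x)" UNIV] by simp
   ultimately show ?thesis using isCont_tendsto_compose[of t "%s. Y s x" fst "at (t, x)"] by blast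
  qed
  ultimately have "((%z. (Y (fst z) (snd z) - Y (fst z) x) + Y (fst z) x) \<longlongrightarrow> 0 + Y t x) (at (t, x))"
   by (rule tendsto_add)
  then show ?thesis unfolding isCont_def y_def by simp
 qed
 show ?thesis
 proof (rule that[of y])
  show "y (t0, 0) = y0" using Y(1)[OF I(3)] m(1) by (simp add: y_def)
  show "continuous_on (strip T) y"
   by (intro continuous_at_imp_continuous_on ballI) (use cy in \<open>auto simp: strip_def I_def abs_less_iff\<close>)
  fix t x assume "t \<in> {-T<..<T}"
  then have t: "t \<in> I" by (simp add: I_def)
  show "((%x. y (t, x)) has_vector_derivative (\<alpha> (t, x) \<times> y (t, x))) (at x)" using Y(2)[OF t] by (simp add: y_def)
  show "((%t. y (t, x)) has_vector_derivative (\<beta> (t, x) \<times> y (t, x))) (at t)" using dt[OF t] by (simp add: y_def)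
  show "norm (y (t, x)) = norm y0" using Yn[OF t] by (simp add: y_def K_def)
 qed
qed

section \<open>Smooth solutions and their frames\<close>

definition vec3 :: "real => real => real => real^3" where
 "vec3 a b c = a *\<^sub>R axis 1 1 + b *\<^sub>R axis 2 1 + c *\<^sub>R axis 3 1"

lemma vec3_nth [simp]: "vec3 a b c $ 1 = a" "vec3 a b c $ 2 = b" "vec3 a b c $ 3 = c"
 by (simp_all add: vec3_def axis_def)

lemma vec3_eq_iff: "v = w \<longleftrightarrow> v $ 1 = w $ 1 \<and> v $ 2 = w $ 2 \<and> v $ 3 = (w :: real^3) $ 3"
 by (simp add: vec_eq_iff forall_3)

lemma cross_nth: "(v \<times> w) $ 1 = v $ 2 * w $ 3 - v $ 3 * w $ 2" "(v \<times> w) $ 2 = v $ 3 * w $ 1 - v $ 1 * w $ 3"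
 "(v \<times> w) $ 3 = v $ 1 * w $ 2 - v $ 2 * w $ 1"
 by (simp_all add: cross3_def)

lemma inner_vec3: "v \<bullet> w = v $ 1 * w $ 1 + v $ 2 * w $ 2 + v $ 3 * (w :: real^3) $ 3"
 by (simp add: inner_vec_def sum_3)

lemma has_vector_derivative_vec3:
 assumes "(a has_real_derivative a') (at x)" "(b has_real_derivative b') (at x)" "(c has_real_derivative c') (at x)"
 shows "((%x. vec3 (a x) (b x) (c x)) has_vector_derivative vec3 a' b' c') (at x)"
 unfolding vec3_def
 by (intro has_vector_derivative_add)
  (use has_vector_derivative_scaleR[OF assms(1) has_vector_derivative_const[of "axis 1 1"]]
   has_vector_derivative_scaleR[OF assms(2) has_vector_derivative_const[of "axis 2 1"]]
   has_vector_derivative_scaleR[OF assms(3) has_vector_derivative_const[of "axis 3 1"]] in simp_all)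

lemma continuous_on_vec3:
 assumes "continuous_on S a" "continuous_on S b" "continuous_on S c"
 shows "continuous_on S (%x. vec3 (a x) (b x) (c x))"
 unfolding vec3_def by (intro continuous_intros assms)

lemma smooth_slice_derivatives:
 fixes f :: "real \<times> real => 'b::real_normed_vector"
 assumes "smooth_on (strip T) f" "t \<in> {-T<..<T}"
 shows "((%x. f (t, x)) has_vector_derivative dx f (t, x)) (at x)"
  and "((%t. f (t, x)) has_vector_derivative dt f (t, x)) (at t)"
proof -
 have d: "(f has_derivative (%v. dderiv v f (t, x))) (at (t, x))"
  by (rule smooth_on_has_derivative[OF assms(1)]) (use assms(2) in \<open>auto simp: strip_def\<close>)
 interpret bounded_linear "%v. dderiv v f (t, x)" using d by (rule has_derivative_bounded_linear)
 have "((%x. (t, x)) has_derivative (%h. (0, h))) (at x)"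
  by (auto intro!: derivative_eq_intros)
 from has_derivative_compose[OF this d]
 have "((%x. f (t, x)) has_derivative (%h. dderiv (0, h) f (t, x))) (at x)" .
 moreover have "(%h. dderiv (0, h) f (t, x)) = (%h. h *\<^sub>R dx f (t, x))"
  proof
  fix h
  show "dderiv (0, h) f (t, x) = h *\<^sub>R dx f (t, x)" using scaleR[of h "(0, 1)"]
   by (simp only: scaleR_Pair scaleR_zero_right real_scaleR_def mult_1_right mult_zero_right)
 qed
 ultimately show "((%x. f (t, x)) has_vector_derivative dx f (t, x)) (at x)"
  unfolding has_vector_derivative_def by (simp only:)
 have "((%t. (t, x)) has_derivative (%h. (h, 0))) (at t)"
  by (auto intro!: derivative_eq_intros)
 from has_derivative_compose[OF this d]
 have "((%t. f (t, x)) has_derivative (%h. dderiv (h, 0) f (t, x))) (at t)" .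
 moreover have "(%h. dderiv (h, 0) f (t, x)) = (%h. h *\<^sub>R dt f (t, x))"
  proof
  fix h
  show "dderiv (h, 0) f (t, x) = h *\<^sub>R dt f (t, x)" using scaleR[of h "(1, 0)"]
   by (simp only: scaleR_Pair scaleR_zero_right real_scaleR_def mult_1_right mult_zero_right)
 qed
 ultimately show "((%t. f (t, x)) has_vector_derivative dt f (t, x)) (at t)"
  unfolding has_vector_derivative_def by (simp only:)
qed

lemma has_real_derivative_Re_Im:
 assumes "(f has_vector_derivative f') (at x)"
 shows "((%x. Re (f x)) has_real_derivative Re f') (at x)" "((%x. Im (f x)) has_real_derivative Im f') (at x)"
 unfolding has_real_derivative_iff_has_vector_derivative
 using bounded_linear.has_vector_derivative[OF bounded_linear_Re assms]
  bounded_linear.has_vector_derivative[OF bounded_linear_Im assms] .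

text \<open>For a solution \<open>q\<close> and the frame \<open>u, e, u \<times> e\<close>, the rows \<open>(u\<^sub>j, e\<^sub>j, (u \<times> e)\<^sub>j)\<close> are parallel for
  the connection with the components below. Its flatness is the Schroedinger equation.\<close>

definition conn_x :: "(real \<times> real => complex) => real \<times> real => real^3" where
 "conn_x q z = vec3 0 (Im (q z)) (- Re (q z))"

definition conn_t :: "(real \<times> real => complex) => real \<times> real => real^3" where
 "conn_t q z = vec3 ((cmod (q z))\<^sup>2 / 2) (Re (dx q z)) (Im (dx q z))"

definition parallel_section ::
 "real => (real \<times> real => complex) => (real \<times> real => real^3) => bool" where
 "parallel_section T q y \<longleftrightarrow> continuous_on (strip T) y \<and> (\<forall>t\<in>{-T<..<T}. \<forall>x.
  ((%x. y (t, x)) has_vector_derivative (conn_x q (t, x) \<times> y (t, x))) (at x) \<and>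
  ((%t. y (t, x)) has_vector_derivative (conn_t q (t, x) \<times> y (t, x))) (at t) \<and>
  norm (y (t, x)) = 1)"

lemma smooth_NLS_smooth: "smooth_NLS_solution T q ==> smooth_on (strip T) q"
 by (simp add: smooth_NLS_solution_def)

lemma continuous_conn:
 assumes "smooth_on (strip T) q"
 shows "continuous_on (strip T) (conn_x q)" "continuous_on (strip T) (conn_t q)"
 unfolding conn_x_def[abs_def] conn_t_def[abs_def]
 using smooth_on_continuous[OF assms] smooth_on_continuous[OF smooth_on_dderiv[OF assms]]
 by (auto intro!: continuous_on_vec3 continuous_intros)

lemma smooth_NLS_parallel_section:
 assumes q: "smooth_NLS_solution T q" and t0: "t0 \<in> {-T<..<T}" and y0: "norm y0 = 1"
 obtains y where "parallel_section T q y" "y (t0, 0) = y0"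
proof -
 note s = smooth_NLS_smooth[OF q]
 note sx = smooth_on_dderiv[OF s, of "(0, 1)"] and st = smooth_on_dderiv[OF s, of "(1, 0)"]
 define \<alpha>t where "\<alpha>t z = vec3 0 (Im (dt q z)) (- Re (dt q z))" for z
 have c: "continuous_on (strip T) \<alpha>t" unfolding \<alpha>t_def[abs_def] using smooth_on_continuous[OF st]
  by (auto intro!: continuous_on_vec3 continuous_intros)
 obtain y where y: "y (t0, 0) = y0" "continuous_on (strip T) y"
  "!!t x. t \<in> {-T<..<T} ==> ((%x. y (t, x)) has_vector_derivative (conn_x q (t, x) \<times> y (t, x))) (at x)"
  "!!t x. t \<in> {-T<..<T} ==> ((%t. y (t, x)) has_vector_derivative (conn_t q (t, x) \<times> y (t, x))) (at t)"
  "!!t x. t \<in> {-T<..<T} ==> norm (y (t, x)) = norm y0"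
 proof (rule flat_connection_parallel_section[OF continuous_conn[OF s] c _ _ t0])
  fix t x assume t: "t \<in> {-T<..<T}"
  note d = smooth_slice_derivatives[OF s t, of x] smooth_slice_derivatives[OF sx t, of x]
  note dRe = has_real_derivative_Re_Im[OF d(1)] and dRet = has_real_derivative_Re_Im[OF d(2)] and dRex = has_real_derivative_Re_Im[OF d(3)]
  show "((%s. conn_x q (s, x)) has_vector_derivative \<alpha>t (t, x)) (at t)"
   unfolding conn_x_def \<alpha>t_def
   by (intro has_vector_derivative_vec3 dRet DERIV_minus DERIV_const)
  define m where "m = Re (q (t, x)) * Re (dx q (t, x)) + Im (q (t, x)) * Im (dx q (t, x))"
  have m: "((%x. (cmod (q (t, x)))\<^sup>2 / 2) has_real_derivative m) (at x)"
  proof -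
   have "((%x. (Re (q (t, x)))\<^sup>2 + (Im (q (t, x)))\<^sup>2) has_real_derivative 2 * m) (at x)"
    using DERIV_add[OF DERIV_power[OF dRe(1), of 2] DERIV_power[OF dRe(2), of 2]] by (simp add: m_def algebra_simps)
   from DERIV_cdivide[OF this, of 2] show ?thesis by (simp add: cmod_power2)
  qed
  have "dt q (t, x) = \<i> * (dx (dx q) (t, x) + 1/2 * of_real ((cmod (q (t, x)))\<^sup>2) * q (t, x))"
   using q t unfolding smooth_NLS_solution_def by (auto simp: strip_def)
  then have nls: "Re (dt q (t, x)) = - (Im (dx (dx q) (t, x)) + (cmod (q (t, x)))\<^sup>2 / 2 * Im (q (t, x)))"
   "Im (dt q (t, x)) = Re (dx (dx q) (t, x)) + (cmod (q (t, x)))\<^sup>2 / 2 * Re (q (t, x))"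
   by simp_all
  have "((%x. conn_t q (t, x)) has_vector_derivative vec3 m (Re (dx (dx q) (t, x))) (Im (dx (dx q) (t, x)))) (at x)"
   unfolding conn_t_def by (intro has_vector_derivative_vec3 dRex m)
  moreover have "vec3 m (Re (dx (dx q) (t, x))) (Im (dx (dx q) (t, x))) = \<alpha>t (t, x) + conn_x q (t, x) \<times> conn_t q (t, x)"
   unfolding vec3_eq_iff by (simp add: \<alpha>t_def conn_x_def conn_t_def cross_nth nls m_def algebra_simps)
  ultimately show "((%x. conn_t q (t, x)) has_vector_derivative (\<alpha>t (t, x) + conn_x q (t, x) \<times> conn_t q (t, x))) (at x)"
   by simp
 qed auto
 show ?thesis
  by (rule that[of y]) (use y y0 in \<open>auto simp: parallel_section_def\<close>)
qed

section \<open>Integration by parts on boxes\<close>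

lemma box_FTC:
 fixes F G :: "real \<times> real => 'b::euclidean_space"
 assumes c: "continuous_on (cbox (a, c) (b, d)) F"
 shows box_FTC_t: "a <= b ==> (!!t x. t \<in> {a..b} ==> x \<in> {c..d} ==> ((%t. G (t, x)) has_vector_derivative F (t, x)) (at t)) ==>
   (LBINT z:cbox (a, c) (b, d). F z) = (LINT x:{c..d}|lborel. G (b, x) - G (a, x))"
  and box_FTC_x: "c <= d ==> (!!t x. t \<in> {a..b} ==> x \<in> {c..d} ==> ((%x. G (t, x)) has_vector_derivative F (t, x)) (at x)) ==>
   (LBINT z:cbox (a, c) (b, d). F z) = (LINT t:{a..b}|lborel. G (t, d) - G (t, c))"
proof -
 have i: "integrable lborel (%z. indicator (cbox (a, c) (b, d)) z *\<^sub>R F z)"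
  by (rule borel_integrable_compact[OF compact_cbox c])
 have ind: "indicat_real (cbox (a, c) (b, d)) (t, x) = indicator {a..b} t * indicator {c..d} x" for t x
  by (auto simp: indicator_def)
 have ct: "continuous_on {a..b} (%t. F (t, x))" if "x \<in> {c..d}" for x
  by (rule continuous_on_compose2[OF c]) (use that in \<open>auto intro!: continuous_intros\<close>)
 have cx: "continuous_on {c..d} (%x. F (t, x))" if "t \<in> {a..b}" for t
  by (rule continuous_on_compose2[OF c]) (use that in \<open>auto intro!: continuous_intros\<close>)
 {
  assume "a <= b" and d: "!!t x. t \<in> {a..b} ==> x \<in> {c..d} ==> ((%t. G (t, x)) has_vector_derivative F (t, x)) (at t)"
  have "(LBINT t. indicator {a..b} t *\<^sub>R F (t, x)) = G (b, x) - G (a, x)" if "x \<in> {c..d}" for x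
   by (rule integral_FTC_Icc[where F = "%t. G (t, x)", OF \<open>a <= b\<close> _ ct[OF that]]) (use d that in \<open>auto intro: has_vector_derivative_at_within\<close>)
  then have "(LBINT t. (indicator {a..b} t * indicator {c..d} x) *\<^sub>R F (t, x)) = indicator {c..d} x *\<^sub>R (G (b, x) - G (a, x))" for x
   by (cases "x \<in> {c..d}") auto
  then show "(LBINT z:cbox (a, c) (b, d). F z) = (LINT x:{c..d}|lborel. G (b, x) - G (a, x))"
   unfolding set_lebesgue_integral_def plane_Fubini(2)[OF i] ind by simp
 next
  assume "c <= d" and d: "!!t x. t \<in> {a..b} ==> x \<in> {c..d} ==> ((%x. G (t, x)) has_vector_derivative F (t, x)) (at x)"
  have "(LBINT x. indicator {c..d} x *\<^sub>R F (t, x)) = G (t, d) - G (t, c)" if "t \<in> {a..b}" for t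
   by (rule integral_FTC_Icc[where F = "%x. G (t, x)", OF \<open>c <= d\<close> _ cx[OF that]]) (use d that in \<open>auto intro: has_vector_derivative_at_within\<close>)
  then have "(LBINT x. (indicator {a..b} t * indicator {c..d} x) *\<^sub>R F (t, x)) = indicator {a..b} t *\<^sub>R (G (t, d) - G (t, c))" for t
   by (cases "t \<in> {a..b}") auto
  then show "(LBINT z:cbox (a, c) (b, d). F z) = (LINT t:{a..b}|lborel. G (t, d) - G (t, c))"
   unfolding set_lebesgue_integral_def plane_Fubini(1)[OF i] ind by simp
 }
qed

lemma compact_strip_box:
 assumes K: "compact K" "K <= strip T" and "T > 0"
 obtains c R where "0 < c" "c < T" "0 < R" "\<forall>z\<in>K. \<bar>fst z\<bar> < c \<and> \<bar>snd z\<bar> < R"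
proof -
 have "\<exists>c. 0 < c \<and> c < T \<and> (\<forall>z\<in>K. \<bar>fst z\<bar> < c)"
 proof (cases "K = {}")
  case True
  then show ?thesis using assms(3) by (intro exI[of _ "T/2"]) auto
 next
  case False
  have "\<exists>z0\<in>K. \<forall>z\<in>K. \<bar>fst z\<bar> <= \<bar>fst z0\<bar>"
   by (rule continuous_attains_sup[OF K(1) False]) (intro continuous_intros)
  then obtain z0 where z0: "z0 \<in> K" "!!z. z \<in> K ==> \<bar>fst z\<bar> <= \<bar>fst z0\<bar>" by blast
  have "\<bar>fst z0\<bar> < T" using K(2) z0(1) by (auto simp: strip_def)
  then obtain c where "\<bar>fst z0\<bar> < c" "c < T" using dense by blast
  then show ?thesis using z0(2) by (intro exI[of _ c]) (auto intro: le_less_trans)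
 qed
 then obtain c where c: "0 < c" "c < T" "!!z. z \<in> K ==> \<bar>fst z\<bar> < c" by blast
 obtain B where B: "B > 0" "!!z. z \<in> K ==> norm z <= B"
  using compact_imp_bounded[OF K(1)] unfolding bounded_pos by auto
 have R: "\<bar>snd z\<bar> < B + 1" if "z \<in> K" for z using B(2)[OF that] norm_snd_le[of "snd z" "fst z"] by simp
 show ?thesis by (rule that[of c "B + 1"]) (use c R B(1) in auto)
qed

lemma test_function_in_box:
 assumes "test_function (strip T) \<phi>" "T > 0"
 obtains c R where "0 < c" "c < T" "0 < R" "!!z. \<bar>fst z\<bar> \<ge> c \<or> \<bar>snd z\<bar> \<ge> R ==> \<phi> z = 0"
  "!!z v. z \<notin> cbox (-c, -R) (c, R) ==> dderiv v \<phi> z = 0" "smooth_on UNIV \<phi>"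
proof -
 define K where "K = closure {z. \<phi> z \<noteq> 0}"
 have K: "compact K" "K <= strip T" "smooth_on UNIV \<phi>" using assms by (auto simp: test_function_def K_def)
 obtain c R where c: "0 < c" "c < T" "0 < R" "\<forall>z\<in>K. \<bar>fst z\<bar> < c \<and> \<bar>snd z\<bar> < R"
  by (rule compact_strip_box[OF K(1,2) assms(2)])
 have 0: "\<phi> z = 0" if "z \<notin> K" for z using that closure_subset[of "{z. \<phi> z \<noteq> 0}"] by (auto simp: K_def)
 show ?thesis
 proof (rule that[OF c(1-3)])
  show "\<phi> z = 0" if "\<bar>fst z\<bar> \<ge> c \<or> \<bar>snd z\<bar> \<ge> R" for z
   by (rule 0) (use that c(4) in force)
  show "dderiv v \<phi> z = 0" if "z \<notin> cbox (-c, -R) (c, R)" for z v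
  proof (rule dderiv_support[of K])
   show "closed K" using K(1) by (rule compact_imp_closed)
   show "z \<notin> K" using that c(4) by (cases z) (force simp: abs_less_iff)
  qed (rule 0)
 qed (use K in auto)
qed

text \<open>Integration by parts over a box that contains the support of the test function.\<close>

lemma weak_conservation:
 fixes A B C :: "real \<times> real => real"
 assumes \<phi>: "test_function (strip T) \<phi>" and T: "T > 0"
  and cont: "continuous_on (strip T) A" "continuous_on (strip T) B" "continuous_on (strip T) A'" "continuous_on (strip T) B'"
  and dA: "!!t x. t \<in> {-T<..<T} ==> ((%t. A (t, x)) has_real_derivative A' (t, x)) (at t)"
  and dB: "!!t x. t \<in> {-T<..<T} ==> ((%x. B (t, x)) has_real_derivative B' (t, x)) (at x)"
  and eq: "!!z. z \<in> strip T ==> A' z + B' z = C z"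
 shows "(LBINT z. dt \<phi> z * A z + dx \<phi> z * B z + \<phi> z * C z) = 0"
proof -
 obtain c R where cR: "0 < c" "c < T" "0 < R" "!!z. \<bar>fst z\<bar> \<ge> c \<or> \<bar>snd z\<bar> \<ge> R ==> \<phi> z = 0"
  "!!z v. z \<notin> cbox (-c, -R) (c, R) ==> dderiv v \<phi> z = 0" and s: "smooth_on UNIV \<phi>"
  using test_function_in_box[OF \<phi> T] by metis
 define Q where "Q = cbox (-c, -R) (c, R)"
 have Q: "Q <= strip T" unfolding Q_def using cR by (intro cbox_subset_strip) auto
 have s': "smooth_on (strip T) \<phi>"
 proof -
  have "Ck_on k (strip T) f" if "Ck_on k UNIV f" for k and f :: "real \<times> real => real"
   using that by (induction k arbitrary: f) (auto intro: continuous_on_subset)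
  then show ?thesis using s by (auto simp: smooth_on_def)
 qed
 have c\<phi>: "continuous_on S \<phi>" "continuous_on S (dderiv v \<phi>)" for S v
  using smooth_on_continuous[OF s] smooth_on_continuous[OF smooth_on_dderiv[OF s]] continuous_on_subset by blast+
 note contQ = cont[THEN continuous_on_subset, OF Q]
 have dphi: "((%t. \<phi> (t, x)) has_real_derivative dt \<phi> (t, x)) (at t)" "((%x. \<phi> (t, x)) has_real_derivative dx \<phi> (t, x)) (at x)"
  if "t \<in> {-T<..<T}" for t x
  using smooth_slice_derivatives[OF s' that] by (simp_all add: has_real_derivative_iff_has_vector_derivative)
 have tI: "t \<in> {-T<..<T}" if "t \<in> {-c..c}" for t using that cR by auto
 have 1: "(LBINT z:Q. dt \<phi> z * A z + \<phi> z * A' z) = (LINT x:{-R..R}|lborel. \<phi> (c, x) * A (c, x) - \<phi> (-c, x) * A (-c, x))"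
  unfolding Q_def
  by (rule box_FTC_t[where G = "%z. \<phi> z * A z"])
   (use cR tI in \<open>auto intro!: continuous_intros c\<phi> contQ[unfolded Q_def] derivative_eq_intros dphi dA
    simp: has_real_derivative_iff_has_vector_derivative[symmetric]\<close>)
 have 2: "(LBINT z:Q. dx \<phi> z * B z + \<phi> z * B' z) = (LINT t:{-c..c}|lborel. \<phi> (t, R) * B (t, R) - \<phi> (t, -R) * B (t, -R))"
  unfolding Q_def
  by (rule box_FTC_x[where G = "%z. \<phi> z * B z"])
   (use cR tI in \<open>auto intro!: continuous_intros c\<phi> contQ[unfolded Q_def] derivative_eq_intros dphi dB
    simp: has_real_derivative_iff_has_vector_derivative[symmetric]\<close>)
 have i: "set_integrable lborel Q (%z. dt \<phi> z * A z + \<phi> z * A' z)" "set_integrable lborel Q (%z. dx \<phi> z * B z + \<phi> z * B' z)"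
  unfolding set_integrable_def Q_def
  by (intro borel_integrable_compact compact_cbox continuous_intros c\<phi> contQ[unfolded Q_def])+
 have "(LBINT z. dt \<phi> z * A z + dx \<phi> z * B z + \<phi> z * C z) = (LBINT z:Q. (dt \<phi> z * A z + \<phi> z * A' z) + (dx \<phi> z * B z + \<phi> z * B' z))"
  unfolding set_lebesgue_integral_def
 proof (rule Bochner_Integration.integral_cong[OF refl])
  fix z
  show "dt \<phi> z * A z + dx \<phi> z * B z + \<phi> z * C z = indicator Q z *\<^sub>R ((dt \<phi> z * A z + \<phi> z * A' z) + (dx \<phi> z * B z + \<phi> z * B' z))"
  proof (cases "z \<in> Q")
   case True
   then have "C z = A' z + B' z" using eq[OF subsetD[OF Q True]] by simp
   then show ?thesis using True by (simp add: algebra_simps)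
  next
   case False
   then have "\<phi> z = 0" by (intro cR(4)) (cases z, auto simp: Q_def)
   then show ?thesis using cR(5) False by (simp add: Q_def)
  qed
 qed
 also have "... = 0"
 proof -
  have "\<phi> (c, x) = 0" "\<phi> (-c, x) = 0" "\<phi> (t, R) = 0" "\<phi> (t, -R) = 0" for t x
   using cR(1-3) by (auto intro!: cR(4))
  then show ?thesis unfolding set_integral_add(2)[OF i] 1 2 by (simp add: set_lebesgue_integral_def)
 qed
 finally show ?thesis .
qed

section \<open>The energy estimate\<close>

lemma norm_vec3: "norm (vec3 0 a b) = sqrt (a\<^sup>2 + b\<^sup>2)"
 by (simp add: norm_eq_sqrt_inner inner_vec3 power2_eq_square)

lemma conn_x_diff_norm: "norm (conn_x q z - conn_x q' z) = cmod (q z - q' z)"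
proof -
 have "conn_x q z - conn_x q' z = vec3 0 (Im (q z - q' z)) (- Re (q z - q' z))"
  unfolding vec3_eq_iff by (simp add: conn_x_def)
 then show ?thesis by (simp add: norm_vec3 cmod_def add.commute power2_commute)
qed

lemma conn_x_norm: "norm (conn_x q z) = cmod (q z)"
 by (simp add: conn_x_def norm_vec3 cmod_def add.commute)

lemma set_integrable_continuous_cbox:
 fixes f :: "'a::euclidean_space => 'b::euclidean_space"
 shows "continuous_on (cbox a b) f ==> set_integrable lborel (cbox a b) f"
 unfolding set_integrable_def by (rule borel_integrable_compact[OF compact_cbox])

lemma set_integral_abs_le:
 fixes f g :: "'a::euclidean_space => real"
 assumes f: "set_integrable lborel S f" and g: "set_integrable lborel S' g" and "S <= S'"
  and le: "!!x. x \<in> S ==> \<bar>f x\<bar> <= g x" and nn: "!!x. x \<in> S' ==> 0 <= g x"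
 shows "\<bar>LBINT x:S. f x\<bar> <= (LBINT x:S'. g x)"
proof -
 have "\<bar>LBINT x:S. f x\<bar> <= (LBINT x. norm (indicator S x *\<^sub>R f x))"
  using integral_norm_bound[of lborel "%x. indicator S x *\<^sub>R f x"] by (simp add: set_lebesgue_integral_def)
 also have "... <= (LBINT x:S'. g x)"
  unfolding set_lebesgue_integral_def
  by (intro integral_mono integrable_norm f[unfolded set_integrable_def] g[unfolded set_integrable_def])
   (use le nn \<open>S <= S'\<close> in \<open>auto simp: indicator_def\<close>)
 finally show ?thesis .
qed

text \<open>The time derivative of the inner product of two parallel sections is, up to an \<open>x\<close>-derivative,
  bounded by the difference of the two potentials; the derivatives of the potentials drop out.\<close>

lemma parallel_sections_energy:
 assumes q: "smooth_on (strip T) q" and q': "smooth_on (strip T) q'"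
  and y: "parallel_section T q y" and y': "parallel_section T q' y'"
  and \<phi>: "smooth_on UNIV \<phi>" "!!x. x \<notin> {-R<..<R} ==> \<phi> x = 0" and R: "R > 0"
  and M: "!!x. \<bar>\<phi> x\<bar> <= M" "!!x. \<bar>dderiv 1 \<phi> x\<bar> <= (M::real)"
  and ab: "-T < a" "b < T" and st: "a <= s" "s <= t" "t <= b"
 shows "\<bar>(LINT x:{-R..R}|lborel. \<phi> x * (y (t, x) \<bullet> y' (t, x))) - (LINT x:{-R..R}|lborel. \<phi> x * (y (s, x) \<bullet> y' (s, x)))\<bar>
  <= 2 * M * (LBINT z:cbox (a, -R) (b, R). cmod (q z - q' z) * (1 + cmod (q z) + cmod (q' z)))"
proof -
 define w where "w z = y z \<times> y' z" for z
 define wx where "wx z = y z \<times> (conn_x q' z \<times> y' z) + (conn_x q z \<times> y z) \<times> y' z" for z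
 \<comment> \<open>The difference of the time components of the connections contains \<open>\<partial>\<^sub>x \<kappa>\<close>, so that \<open>\<kappa> \<bullet> w\<close> is the flux.\<close>
 define \<kappa> where "\<kappa> z = vec3 0 (Re (q z - q' z)) (Im (q z - q' z))" for z
 define \<kappa>x where "\<kappa>x z = vec3 0 (Re (dx q z - dx q' z)) (Im (dx q z - dx q' z))" for z
 define gt where "gt z = (conn_t q z - conn_t q' z) \<bullet> w z" for z
 define Zx where "Zx z = \<kappa>x z \<bullet> w z + \<kappa> z \<bullet> wx z" for z
 define \<rho> where "\<rho> z = ((cmod (q z))\<^sup>2 - (cmod (q' z))\<^sup>2) / 2 * (w z $ 1) - \<kappa> z \<bullet> wx z" for z
 define F where "F z = \<phi> (snd z) * gt z" for z :: "real \<times> real"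
 define H where "H z = dderiv 1 \<phi> (snd z) * (\<kappa> z \<bullet> w z) + \<phi> (snd z) * Zx z" for z :: "real \<times> real"
 define P where "P z = - dderiv 1 \<phi> (snd z) * (\<kappa> z \<bullet> w z) + \<phi> (snd z) * \<rho> z" for z :: "real \<times> real"
 define N where "N z = cmod (q z - q' z) * (1 + cmod (q z) + cmod (q' z))" for z
 have M0: "M \<ge> 0" using M(1)[of 0] by (meson abs_ge_zero order_trans)
 have "gt z = Zx z + \<rho> z" for z
  by (simp add: gt_def Zx_def \<rho>_def conn_t_def \<kappa>x_def inner_vec3 algebra_simps diff_divide_distrib)
 then have FHP: "F z = H z + P z" for z by (simp add: F_def H_def P_def algebra_simps)
 note yc = y[unfolded parallel_section_def, THEN conjunct1] y'[unfolded parallel_section_def, THEN conjunct1]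
 note qc = smooth_on_continuous[OF q] smooth_on_continuous[OF q']
  smooth_on_continuous[OF smooth_on_dderiv[OF q]] smooth_on_continuous[OF smooth_on_dderiv[OF q']]
 have c\<phi>: "continuous_on S (%z. \<phi> (snd z))" "continuous_on S (%z. dderiv 1 \<phi> (snd z))" for S :: "(real \<times> real) set"
  using smooth_on_continuous[OF \<phi>(1)] smooth_on_continuous[OF smooth_on_dderiv[OF \<phi>(1)], of 1]
  by (auto intro!: continuous_on_compose2[of UNIV _ S snd] continuous_intros)
 have cw: "continuous_on (strip T) w" "continuous_on (strip T) wx"
  unfolding w_def[abs_def] wx_def[abs_def]
  by (intro continuous_on_cross continuous_on_add yc continuous_conn(1)[OF q] continuous_conn(1)[OF q'])+
 have c\<kappa>: "continuous_on (strip T) \<kappa>" "continuous_on (strip T) \<kappa>x"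
  unfolding \<kappa>_def[abs_def] \<kappa>x_def[abs_def]
  by (intro continuous_on_vec3 continuous_intros qc)+
 have cgt: "continuous_on (strip T) gt" "continuous_on (strip T) Zx" "continuous_on (strip T) \<rho>"
  unfolding gt_def[abs_def] Zx_def[abs_def] \<rho>_def[abs_def]
  by (intro continuous_intros cw c\<kappa> qc continuous_conn(2)[OF q] continuous_conn(2)[OF q'] continuous_on_component; simp)+
 have cF: "continuous_on (strip T) F" "continuous_on (strip T) H" "continuous_on (strip T) P"
  unfolding F_def[abs_def] H_def[abs_def] P_def[abs_def]
  by (intro continuous_intros cw c\<kappa> cgt c\<phi>)+
 have cN: "continuous_on (strip T) N" unfolding N_def[abs_def] by (intro continuous_intros qc)
 have Q: "cbox (s, -R) (t, R) <= strip T" "cbox (a, -R) (b, R) <= strip T"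
  by (rule cbox_subset_strip; use ab st in linarith)+
 have sub: "cbox (s, -R) (t, R) <= cbox (a, -R) (b, R)" using st by auto
 have tI: "\<sigma> \<in> {-T<..<T}" if "\<sigma> \<in> {s..t}" for \<sigma> using that ab st by auto
 have yd: "((%x. y (\<sigma>, x)) has_vector_derivative (conn_x q (\<sigma>, x) \<times> y (\<sigma>, x))) (at x)"
  "((%t. y (t, x)) has_vector_derivative (conn_t q (\<sigma>, x) \<times> y (\<sigma>, x))) (at \<sigma>)"
  "((%x. y' (\<sigma>, x)) has_vector_derivative (conn_x q' (\<sigma>, x) \<times> y' (\<sigma>, x))) (at x)"
  "((%t. y' (t, x)) has_vector_derivative (conn_t q' (\<sigma>, x) \<times> y' (\<sigma>, x))) (at \<sigma>)"
  if "\<sigma> \<in> {s..t}" for \<sigma> x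
  using y y' tI[OF that] unfolding parallel_section_def by blast+
 have yn: "norm (y z) = 1" "norm (y' z) = 1" if "z \<in> strip T" for z
  using that y y' unfolding parallel_section_def by (cases z, auto simp: strip_def abs_less_iff)+
 have FF: "(LBINT z:cbox (s, -R) (t, R). F z) = (LINT x:{-R..R}|lborel. \<phi> x * (y (t, x) \<bullet> y' (t, x)) - \<phi> x * (y (s, x) \<bullet> y' (s, x)))"
 proof -
  have "(LBINT z:cbox (s, -R) (t, R). F z) = (LINT x:{-R..R}|lborel.
   (%z. \<phi> (snd z) * (y z \<bullet> y' z)) (t, x) - (%z. \<phi> (snd z) * (y z \<bullet> y' z)) (s, x))"
  proof (rule box_FTC_t[OF continuous_on_subset[OF cF(1) Q(1)] st(2)])
   fix \<sigma> x assume \<sigma>: "\<sigma> \<in> {s..t}"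
   have "y (\<sigma>, x) \<bullet> (conn_t q' (\<sigma>, x) \<times> y' (\<sigma>, x)) + (conn_t q (\<sigma>, x) \<times> y (\<sigma>, x)) \<bullet> y' (\<sigma>, x) = gt (\<sigma>, x)"
    unfolding gt_def w_def inner_vec3 cross_nth by (simp add: algebra_simps)
   then have "((%t. y (t, x) \<bullet> y' (t, x)) has_real_derivative gt (\<sigma>, x)) (at \<sigma>)"
    using has_real_derivative_inner[OF yd(2,4)[OF \<sigma>, of x]] by simp
   from DERIV_cmult[OF this, of "\<phi> x"]
   show "((%t. \<phi> (snd (t, x)) * (y (t, x) \<bullet> y' (t, x))) has_vector_derivative F (\<sigma>, x)) (at \<sigma>)"
    by (simp add: F_def has_real_derivative_iff_has_vector_derivative)
  qed
  then show ?thesis by simp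
 qed
 have HH: "(LBINT z:cbox (s, -R) (t, R). H z) = 0"
 proof -
  have "(LBINT z:cbox (s, -R) (t, R). H z) = (LINT \<sigma>:{s..t}|lborel.
   (%z. \<phi> (snd z) * (\<kappa> z \<bullet> w z)) (\<sigma>, R) - (%z. \<phi> (snd z) * (\<kappa> z \<bullet> w z)) (\<sigma>, -R))"
  proof (rule box_FTC_x[OF continuous_on_subset[OF cF(2) Q(1)]])
   fix \<sigma> x assume \<sigma>: "\<sigma> \<in> {s..t}"
   have d\<kappa>: "((%x. \<kappa> (\<sigma>, x)) has_vector_derivative \<kappa>x (\<sigma>, x)) (at x)"
    unfolding \<kappa>_def \<kappa>x_def
    by (intro has_vector_derivative_vec3 DERIV_const has_real_derivative_Re_Im has_vector_derivative_diff
      smooth_slice_derivatives(1)[OF q tI[OF \<sigma>]] smooth_slice_derivatives(1)[OF q' tI[OF \<sigma>]])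
   have dw: "((%x. w (\<sigma>, x)) has_vector_derivative wx (\<sigma>, x)) (at x)"
    unfolding w_def wx_def by (intro has_vector_derivative_cross yd[OF \<sigma>])
   have "((%x. \<kappa> (\<sigma>, x) \<bullet> w (\<sigma>, x)) has_real_derivative Zx (\<sigma>, x)) (at x)"
    using has_real_derivative_inner[OF d\<kappa> dw] by (simp add: Zx_def add.commute)
   moreover have "(\<phi> has_real_derivative dderiv 1 \<phi> x) (at x)"
    using smooth_real_has_derivative[OF \<phi>(1), of x] by (simp add: has_real_derivative_iff_has_vector_derivative)
   ultimately show "((%x. \<phi> (snd (\<sigma>, x)) * (\<kappa> (\<sigma>, x) \<bullet> w (\<sigma>, x))) has_vector_derivative H (\<sigma>, x)) (at x)"
    unfolding has_real_derivative_iff_has_vector_derivative[symmetric] H_def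
    by (auto intro!: derivative_eq_intros simp: algebra_simps)
  qed (use R in auto)
  then show ?thesis by (simp add: \<phi>(2) set_lebesgue_integral_def)
 qed
 have Pb: "\<bar>P z\<bar> <= 2 * M * N z" if z: "z \<in> strip T" for z
 proof -
  define d S where "d = cmod (q z - q' z)" and "S = cmod (q z) + cmod (q' z)"
  have nn: "d \<ge> 0" "S \<ge> 0" by (auto simp: d_def S_def)
  have w1: "norm (w z) <= 1" using norm_cross_le[of "y z" "y' z"] yn[OF z] by (simp add: w_def)
  have c1: "norm (conn_x q' z \<times> y' z) <= cmod (q' z)" "norm (conn_x q z \<times> y z) <= cmod (q z)"
   using norm_cross_le[of "conn_x q' z" "y' z"] norm_cross_le[of "conn_x q z" "y z"] yn[OF z] by (simp_all add: conn_x_norm)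
  have wx1: "norm (wx z) <= S"
   unfolding wx_def S_def
   using norm_triangle_ineq[of "y z \<times> (conn_x q' z \<times> y' z)" "(conn_x q z \<times> y z) \<times> y' z"]
    norm_cross_le[of "y z" "conn_x q' z \<times> y' z"] norm_cross_le[of "conn_x q z \<times> y z" "y' z"] c1 yn[OF z] by simp
  have \<kappa>1: "norm (\<kappa> z) = d" by (simp add: \<kappa>_def norm_vec3 d_def cmod_def)
  have 1: "\<bar>\<kappa> z \<bullet> w z\<bar> <= d"
   using Cauchy_Schwarz_ineq2[of "\<kappa> z" "w z"] mult_left_mono[OF w1, of d] nn \<kappa>1 by simp
  have 2: "\<bar>\<kappa> z \<bullet> wx z\<bar> <= d * S"
   using Cauchy_Schwarz_ineq2[of "\<kappa> z" "wx z"] mult_left_mono[OF wx1, of d] nn \<kappa>1 by simp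
  have "(cmod (q z))\<^sup>2 - (cmod (q' z))\<^sup>2 = (cmod (q z) - cmod (q' z)) * S"
   by (simp add: S_def power2_eq_square algebra_simps)
  then have "\<bar>(cmod (q z))\<^sup>2 - (cmod (q' z))\<^sup>2\<bar> <= d * S"
   using norm_triangle_ineq3[of "q z" "q' z"] nn by (simp add: abs_mult d_def mult_right_mono)
  moreover have "\<bar>w z $ 1\<bar> <= 1" using component_le_norm_cart[of "w z" 1] w1 by simp
  ultimately have "\<bar>(cmod (q z))\<^sup>2 - (cmod (q' z))\<^sup>2\<bar> * \<bar>w z $ 1\<bar> <= d * S * 1"
   by (intro mult_mono) (use nn in auto)
  then have 3: "\<bar>((cmod (q z))\<^sup>2 - (cmod (q' z))\<^sup>2) / 2 * (w z $ 1)\<bar> <= d * S"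
   using mult_nonneg_nonneg[OF nn] by (simp add: abs_mult)
  have \<rho>: "\<bar>\<rho> z\<bar> <= 2 * (d * S)" unfolding \<rho>_def using 2 3 by linarith
  have "\<bar>P z\<bar> <= \<bar>dderiv 1 \<phi> (snd z)\<bar> * \<bar>\<kappa> z \<bullet> w z\<bar> + \<bar>\<phi> (snd z)\<bar> * \<bar>\<rho> z\<bar>"
   unfolding P_def by (simp add: abs_mult[symmetric])
  also have "... <= M * d + M * (2 * (d * S))"
   by (intro add_mono mult_mono M 1 \<rho> M0) auto
  also have "... <= 2 * M * (d * (1 + S))" using M0 nn by (simp add: algebra_simps)
  finally show ?thesis by (simp add: N_def d_def S_def add.assoc)
 qed
 have i: "set_integrable lborel (cbox (s, -R) (t, R)) H" "set_integrable lborel (cbox (s, -R) (t, R)) P"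
  "set_integrable lborel (cbox (a, -R) (b, R)) N"
  by (intro set_integrable_continuous_cbox continuous_on_subset[OF cF(2) Q(1)] continuous_on_subset[OF cF(3) Q(1)]
    continuous_on_subset[OF cN Q(2)])+
 have ci: "set_integrable lborel {-R..R} (%x. \<phi> x * (y (\<sigma>, x) \<bullet> y' (\<sigma>, x)))" if "\<sigma> \<in> {s..t}" for \<sigma>
  using smooth_on_continuous[OF \<phi>(1)] strip_slices(1)[OF yc(1) tI[OF that]] strip_slices(1)[OF yc(2) tI[OF that]]
  by (intro borel_integrable_atLeastAtMost' continuous_intros) (auto intro: continuous_on_subset)
 have "(LINT x:{-R..R}|lborel. \<phi> x * (y (t, x) \<bullet> y' (t, x))) - (LINT x:{-R..R}|lborel. \<phi> x * (y (s, x) \<bullet> y' (s, x)))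
  = (LBINT z:cbox (s, -R) (t, R). H z + P z)"
  unfolding FHP[symmetric] FF using st by (intro set_integral_diff(2)[symmetric] ci) auto
 also have "... = (LBINT z:cbox (s, -R) (t, R). P z)" unfolding set_integral_add(2)[OF i(1,2)] HH by simp
 also have "\<bar>...\<bar> <= (LBINT z:cbox (a, -R) (b, R). 2 * M * N z)"
 proof (rule set_integral_abs_le[OF i(2) _ sub])
  show "set_integrable lborel (cbox (a, -R) (b, R)) (%z. 2 * M * N z)" by (intro set_integrable_mult_right i(3))
 qed (use Pb Q M0 in \<open>auto simp: N_def\<close>)
 also have "... = 2 * M * (LBINT z:cbox (a, -R) (b, R). N z)" by simp
 finally show ?thesis by (simp add: N_def)
qed

text \<open>Along a line of constant time the derivative of the inner product is at most \<open>|q - q'|\<close>, and the inner product is \<open>1\<close> at the origin.\<close>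

lemma parallel_sections_initial:
 assumes q: "smooth_on (strip T) q" and q': "smooth_on (strip T) q'"
  and y: "parallel_section T q y" and y': "parallel_section T q' y'"
  and t: "t \<in> {-T<..<T}" and eq: "y (t, 0) = y' (t, 0)" and x: "\<bar>x\<bar> <= R"
 shows "\<bar>1 - y (t, x) \<bullet> y' (t, x)\<bar> <= (LINT \<xi>:{-R..R}|lborel. cmod (q (t, \<xi>) - q' (t, \<xi>)))"
proof -
 define g where "g x = y (t, x) \<bullet> y' (t, x)" for x
 define g' where "g' x = (conn_x q (t, x) - conn_x q' (t, x)) \<bullet> (y (t, x) \<times> y' (t, x))" for x
 have yn: "norm (y (t, x)) = 1" "norm (y' (t, x)) = 1" for x
  using y y' t unfolding parallel_section_def by blast+
 have d: "(g has_real_derivative g' x) (at x)" for x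
 proof -
  have "y (t, x) \<bullet> (conn_x q' (t, x) \<times> y' (t, x)) + (conn_x q (t, x) \<times> y (t, x)) \<bullet> y' (t, x) = g' x"
   unfolding g'_def inner_vec3 cross_nth by (simp add: algebra_simps)
  moreover have d: "((%x. y (t, x)) has_vector_derivative (conn_x q (t, x) \<times> y (t, x))) (at x)"
   "((%x. y' (t, x)) has_vector_derivative (conn_x q' (t, x) \<times> y' (t, x))) (at x)"
   using y y' t unfolding parallel_section_def by blast+
  ultimately show ?thesis using has_real_derivative_inner[OF d] by (simp add: g_def[abs_def])
 qed
 have le: "\<bar>g' x\<bar> <= cmod (q (t, x) - q' (t, x))" for x
 proof -
  have "norm (y (t, x) \<times> y' (t, x)) <= 1" using norm_cross_le[of "y (t, x)" "y' (t, x)"] yn by simp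
  then show ?thesis
   unfolding g'_def conn_x_diff_norm[symmetric]
   by (rule order_trans[OF Cauchy_Schwarz_ineq2 mult_left_le]) simp
 qed
 note sl = strip_slices(1)[OF smooth_on_continuous[OF q] t] strip_slices(1)[OF smooth_on_continuous[OF q'] t]
  strip_slices(1)[OF continuous_conn(1)[OF q] t] strip_slices(1)[OF continuous_conn(1)[OF q'] t]
  strip_slices(1)[OF y[unfolded parallel_section_def, THEN conjunct1] t] strip_slices(1)[OF y'[unfolded parallel_section_def, THEN conjunct1] t]
 have cg': "continuous_on S g'" for S
  unfolding g'_def[abs_def]
  by (intro continuous_intros continuous_on_cross sl[THEN continuous_on_subset] subset_UNIV)
 have main: "\<bar>g b - g a\<bar> <= (LINT \<xi>:{-R..R}|lborel. cmod (q (t, \<xi>) - q' (t, \<xi>)))" if ab: "a <= b" "-R <= a" "b <= R" for a b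
 proof -
  have "(LINT x:{a..b}|lborel. g' x) = g b - g a"
   unfolding set_lebesgue_integral_def
   using d by (intro integral_FTC_Icc[OF ab(1) _ cg']) (auto simp: has_real_derivative_iff_has_vector_derivative intro: has_vector_derivative_at_within)
  moreover have "\<bar>LINT x:{a..b}|lborel. g' x\<bar> <= (LINT \<xi>:{-R..R}|lborel. cmod (q (t, \<xi>) - q' (t, \<xi>)))"
   by (rule set_integral_abs_le)
    (use ab le cg' in \<open>auto intro!: borel_integrable_atLeastAtMost' continuous_intros sl[THEN continuous_on_subset]\<close>)
  ultimately show ?thesis by simp
 qed
 have "g 0 = 1" using yn(1)[of 0] eq by (simp add: g_def norm_eq_1)
 moreover have "\<bar>g x - g 0\<bar> <= (LINT \<xi>:{-R..R}|lborel. cmod (q (t, \<xi>) - q' (t, \<xi>)))"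
  using main[of 0 x] main[of x 0] x by (cases "0 <= x") (auto simp: abs_minus_commute abs_le_iff)
 ultimately show ?thesis by (simp add: g_def abs_minus_commute)
qed

text \<open>As the sections are unit vectors, the two preceding estimates, tested with a cutoff that is positive on \<open>{-r..r}\<close>, control their distance.\<close>

lemma parallel_sections_close:
 assumes "r > 0"
 obtains C where "C > 0" "!!T q q' y y' a b t t0.
  [|smooth_on (strip T) q; smooth_on (strip T) q'; parallel_section T q y; parallel_section T q' y';
   -T < a; b < T; t \<in> {a..b}; t0 \<in> {a..b}; y (t0, 0) = y' (t0, 0)|] ==>
  (LINT x:{-r..r}|lborel. (norm (y (t, x) - y' (t, x)))\<^sup>2) <=
   C * ((LINT \<xi>:{-(r+1)..r+1}|lborel. cmod (q (t0, \<xi>) - q' (t0, \<xi>))) +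
    (LBINT z:cbox (a, -(r+1)) (b, r+1). cmod (q z - q' z) * (1 + cmod (q z) + cmod (q' z))))"
proof -
 define R where "R = r + 1"
 define \<phi> where "\<phi> = plateau 1 (-R) R"
 have R: "R > 0" "r < R" using assms by (auto simp: R_def)
 have \<phi>: "smooth_on UNIV \<phi>" "!!x. x \<notin> {-R<..<R} ==> \<phi> x = 0" "!!x. 0 <= \<phi> x" "!!x. \<phi> x <= 1"
  unfolding \<phi>_def using smooth_plateau plateau_bounds by (auto intro!: plateau_eq_0)
 note c\<phi> = smooth_on_continuous[OF \<phi>(1)]
 have "\<exists>x0\<in>{-r..r}. \<forall>x\<in>{-r..r}. \<phi> x0 <= \<phi> x"
  by (rule continuous_attains_inf[OF compact_Icc]) (use c\<phi> assms in \<open>auto intro: continuous_on_subset\<close>)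
 then obtain x0 where "!!x. x \<in> {-r..r} ==> \<phi> x0 <= \<phi> x" "x0 \<in> {-r..r}" by blast
 moreover have "\<phi> x0 > 0" if "x0 \<in> {-r..r}" unfolding \<phi>_def using that R by (intro plateau_pos) auto
 ultimately obtain \<mu> where \<mu>: "\<mu> > 0" "!!x. x \<in> {-r..r} ==> \<mu> <= \<phi> x" by blast
 have d0: "dderiv 1 \<phi> x = 0" if "x \<notin> {-R..R}" for x
  by (rule dderiv_support[of "{-R..R}"]) (use \<phi>(2) that in auto)
 obtain M0 where M0: "!!x. \<bar>dderiv 1 \<phi> x\<bar> <= M0" "M0 > 0"
  using continuous_compact_support_bounded[OF smooth_on_continuous[OF smooth_on_dderiv[OF \<phi>(1)]] compact_Icc d0] by blast
 define M where "M = max 1 M0"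
 have M: "!!x. \<bar>\<phi> x\<bar> <= M" "!!x. \<bar>dderiv 1 \<phi> x\<bar> <= M"
  using \<phi>(3,4) M0(1) by (auto simp: M_def le_max_iff_disj)
 define C where "C = (4 * R + 4 * M) / \<mu>"
 show ?thesis
 proof (rule that[of C])
  show "C > 0" using R \<mu> by (auto simp: C_def M_def intro!: divide_pos_pos add_pos_pos)
  fix T q q' y y' a b t t0
  assume q: "smooth_on (strip T) q" "smooth_on (strip T) q'" and y: "parallel_section T q y" "parallel_section T q' y'"
   and ab: "-T < a" "b < T" and t: "t \<in> {a..b}" "t0 \<in> {a..b}" and eq: "y (t0, 0) = y' (t0, 0)"
  define i0 where "i0 = (LINT \<xi>:{-R..R}|lborel. cmod (q (t0, \<xi>) - q' (t0, \<xi>)))"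
  define i1 where "i1 = (LBINT z:cbox (a, -R) (b, R). cmod (q z - q' z) * (1 + cmod (q z) + cmod (q' z)))"
  have nn: "i0 \<ge> 0" "i1 \<ge> 0" unfolding i0_def i1_def set_lebesgue_integral_def by (auto intro!: integral_nonneg_AE)
  define G where "G t = (LINT x:{-R..R}|lborel. \<phi> x * (y (t, x) \<bullet> y' (t, x)))" for t
  have tI: "t \<in> {-T<..<T}" "t0 \<in> {-T<..<T}" using t ab by auto
  note sl = strip_slices(1)[OF y(1)[unfolded parallel_section_def, THEN conjunct1]]
   strip_slices(1)[OF y(2)[unfolded parallel_section_def, THEN conjunct1]]
  have ci: "set_integrable lborel {c..d} (%x. \<phi> x * (y (\<sigma>, x) \<bullet> y' (\<sigma>, x)))" if "\<sigma> \<in> {-T<..<T}" for \<sigma> c d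
   using c\<phi> sl(1)[OF that] sl(2)[OF that]
   by (intro borel_integrable_atLeastAtMost' continuous_intros) (auto intro: continuous_on_subset)
  have ci2: "set_integrable lborel {c..d} \<phi>" for c d
   using c\<phi> by (intro borel_integrable_atLeastAtMost') (auto intro: continuous_on_subset)
  have ci3: "set_integrable lborel {-r..r} (%x. (norm (y (t, x) - y' (t, x)))\<^sup>2)"
   using sl(1)[OF tI(1)] sl(2)[OF tI(1)]
   by (intro borel_integrable_atLeastAtMost' continuous_intros) (auto intro: continuous_on_subset)
  have yn: "norm (y (\<sigma>, x)) = 1" "norm (y' (\<sigma>, x)) = 1" if "\<sigma> \<in> {-T<..<T}" for \<sigma> x
   using y that unfolding parallel_section_def by blast+
  have sq: "(norm (y (t, x) - y' (t, x)))\<^sup>2 = 2 * (1 - y (t, x) \<bullet> y' (t, x))" for x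
   using yn[OF tI(1), of x] by (simp add: power2_norm_eq_inner inner_diff_left inner_diff_right inner_commute norm_eq_1)
  have en: "\<bar>G t - G t0\<bar> <= 2 * M * i1"
  proof (cases "t0 <= t")
   case True
   then show ?thesis
    unfolding G_def i1_def using t by (intro parallel_sections_energy[OF q y \<phi>(1,2) R(1) M ab]) auto
  next
   case False
   then have "\<bar>G t0 - G t\<bar> <= 2 * M * i1"
    unfolding G_def i1_def using t by (intro parallel_sections_energy[OF q y \<phi>(1,2) R(1) M ab]) auto
   then show ?thesis by (simp add: abs_minus_commute)
  qed
  have init: "\<bar>LINT x:{-R..R}|lborel. \<phi> x - \<phi> x * (y (t0, x) \<bullet> y' (t0, x))\<bar> <= (LINT x:{-R..R}|lborel. i0)"
  proof (rule set_integral_abs_le)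
   fix x assume x: "x \<in> {-R..R}"
   have "\<bar>1 - y (t0, x) \<bullet> y' (t0, x)\<bar> <= i0"
    unfolding i0_def using x by (intro parallel_sections_initial[OF q y tI(2) eq]) auto
   then have "\<phi> x * \<bar>1 - y (t0, x) \<bullet> y' (t0, x)\<bar> <= 1 * i0" using \<phi>(3,4) nn by (intro mult_mono) auto
   moreover have "\<phi> x - \<phi> x * (y (t0, x) \<bullet> y' (t0, x)) = \<phi> x * (1 - y (t0, x) \<bullet> y' (t0, x))"
    by (simp add: right_diff_distrib)
   ultimately show "\<bar>\<phi> x - \<phi> x * (y (t0, x) \<bullet> y' (t0, x))\<bar> <= i0"
    using \<phi>(3)[of x] by (simp add: abs_mult)
  qed (auto intro!: set_integral_diff ci ci2 tI set_integrable_const_Icc nn)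
  have c0: "(LINT x:{-R..R}|lborel. i0) = 2 * R * i0"
   using R by (simp add: set_lebesgue_integral_def)
  have "\<mu> * (LINT x:{-r..r}|lborel. (norm (y (t, x) - y' (t, x)))\<^sup>2) = \<bar>LINT x:{-r..r}|lborel. \<mu> * (norm (y (t, x) - y' (t, x)))\<^sup>2\<bar>"
   using \<mu>(1) by (simp add: abs_mult) (simp add: set_lebesgue_integral_def integral_nonneg_AE)
  also have "... <= (LINT x:{-R..R}|lborel. 2 * (\<phi> x - \<phi> x * (y (t, x) \<bullet> y' (t, x))))"
  proof (rule set_integral_abs_le)
   fix x assume "x \<in> {-r..r}"
   then have "\<mu> * (norm (y (t, x) - y' (t, x)))\<^sup>2 <= \<phi> x * (norm (y (t, x) - y' (t, x)))\<^sup>2"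
    using \<mu> by (intro mult_right_mono) auto
   moreover have "\<bar>\<mu> * (norm (y (t, x) - y' (t, x)))\<^sup>2\<bar> = \<mu> * (norm (y (t, x) - y' (t, x)))\<^sup>2"
    using \<mu>(1) by (intro abs_of_nonneg) simp
   moreover have "\<phi> x * (norm (y (t, x) - y' (t, x)))\<^sup>2 = 2 * (\<phi> x - \<phi> x * (y (t, x) \<bullet> y' (t, x)))"
    unfolding sq by (simp add: algebra_simps)
   ultimately show "\<bar>\<mu> * (norm (y (t, x) - y' (t, x)))\<^sup>2\<bar> <= 2 * (\<phi> x - \<phi> x * (y (t, x) \<bullet> y' (t, x)))"
    by linarith
  next
   fix x
   have "0 <= \<phi> x * (norm (y (t, x) - y' (t, x)))\<^sup>2" using \<phi>(3) by simp
   then show "0 <= 2 * (\<phi> x - \<phi> x * (y (t, x) \<bullet> y' (t, x)))" unfolding sq by (simp add: algebra_simps)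
  qed (use R in \<open>auto intro!: set_integral_diff ci ci2 tI set_integrable_mult_right ci3\<close>)
  also have "... = 2 * ((LINT x:{-R..R}|lborel. \<phi> x) - G t)"
   by (simp only: G_def set_integral_mult_right set_integral_diff(2)[OF ci2 ci[OF tI(1)]])
  also have "... <= 2 * (((LINT x:{-R..R}|lborel. \<phi> x) - G t0) + 2 * M * i1)"
   using en by (intro mult_left_mono) (simp_all add: abs_le_iff)
  also have "(LINT x:{-R..R}|lborel. \<phi> x) - G t0 = (LINT x:{-R..R}|lborel. \<phi> x - \<phi> x * (y (t0, x) \<bullet> y' (t0, x)))"
   unfolding G_def by (simp add: set_integral_diff(2)[OF ci2 ci[OF tI(2)]])
  also have "2 * (... + 2 * M * i1) <= 2 * (2 * R * i0 + 2 * M * i1)" using init unfolding c0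
   by (intro mult_left_mono add_right_mono) (simp_all add: abs_le_iff)
  also have "... <= (4 * R + 4 * M) * (i0 + i1)" using R nn by (simp add: algebra_simps M_def)
  finally have "(LINT x:{-r..r}|lborel. (norm (y (t, x) - y' (t, x)))\<^sup>2) <= C * (i0 + i1)"
   using \<mu>(1) by (simp add: C_def field_simps)
  then show "(LINT x:{-r..r}|lborel. (norm (y (t, x) - y' (t, x)))\<^sup>2) <=
   C * ((LINT \<xi>:{-(r+1)..r+1}|lborel. cmod (q (t0, \<xi>) - q' (t0, \<xi>))) +
    (LBINT z:cbox (a, -(r+1)) (b, r+1). cmod (q z - q' z) * (1 + cmod (q z) + cmod (q' z))))"
   unfolding i0_def i1_def R_def .
 qed
qed

section \<open>Limits in local square integrable functions\<close>

lemma amgm_scaled: "0 < \<eta> ==> d * X <= d\<^sup>2 / \<eta> + \<eta> * X\<^sup>2" for d X \<eta> :: real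
proof -
 assume \<eta>: "0 < \<eta>"
 have "2 * (d * (\<eta> * X)) <= d\<^sup>2 + (\<eta> * X)\<^sup>2" using sum_squares_bound[of d "\<eta> * X"] by simp
 moreover have "0 <= d\<^sup>2 + (\<eta> * X)\<^sup>2" by simp
 ultimately have "d * (\<eta> * X) <= d\<^sup>2 + (\<eta> * X)\<^sup>2" by linarith
 then have "\<eta> * (d * X) <= \<eta> * (d\<^sup>2 / \<eta> + \<eta> * X\<^sup>2)"
  using \<eta> by (simp add: algebra_simps power2_eq_square)
 then show ?thesis using \<eta> by (simp only: mult_le_cancel_left_pos)
qed

text \<open>Young's inequality, in which first \<open>\<eta>\<close> is taken small and then \<open>k\<close> large.\<close>

lemma L2_null_weighted_L1_null:
 fixes d :: "nat => 'a::euclidean_space => 'b::euclidean_space" and P :: "'a => real"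
 assumes K: "K \<in> sets borel" "set_integrable lborel K (%_. 1::real)"
  and dm: "!!k. d k \<in> borel_measurable borel" and Pm: "P \<in> borel_measurable borel" and P0: "!!x. 0 <= P x"
  and d2: "!!k. set_integrable lborel K (%x. (norm (d k x))\<^sup>2)" and P2: "set_integrable lborel K (%x. (P x)\<^sup>2)"
  and lim: "(%k. L2_sq K (d k)) \<longlonglongrightarrow> 0"
 shows "set_integrable lborel K (%x. norm (d k x) * (1 + P x + norm (d k x)))"
  and "(%k. LBINT x:K. norm (d k x) * (1 + P x + norm (d k x))) \<longlonglongrightarrow> 0"
proof -
 note [measurable] = K(1) dm Pm
 have X2: "set_integrable lborel K (%x. (1 + P x)\<^sup>2)"
  unfolding set_integrable_def
 proof (rule Bochner_Integration.integrable_bound)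
  show "integrable lborel (%x. indicator K x *\<^sub>R (2 * 1 + 2 * (P x)\<^sup>2))"
   unfolding set_integrable_def[symmetric] by (intro set_integral_add set_integrable_mult_right K(2) P2)
  have "(1 + P x)\<^sup>2 <= 2 * 1 + 2 * (P x)\<^sup>2" for x
   using sum_squares_bound[of 1 "P x"] by (simp add: power2_sum)
  then show "AE x in lborel. norm (indicator K x *\<^sub>R (1 + P x)\<^sup>2) <= norm (indicator K x *\<^sub>R (2 * 1 + 2 * (P x)\<^sup>2))"
   by (intro AE_I2) (auto simp: indicator_def)
 qed measurable
 define J where "J \<eta> k = (LBINT x:K. (1 + 1 / \<eta>) * (norm (d k x))\<^sup>2 + \<eta> * (1 + P x)\<^sup>2)" for \<eta> k
 have ib: "set_integrable lborel K (%x. (1 + 1 / \<eta>) * (norm (d k x))\<^sup>2 + \<eta> * (1 + P x)\<^sup>2)" for \<eta> k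
  by (intro set_integral_add set_integrable_mult_right d2 X2)
 have le: "norm (d k x) * (1 + P x + norm (d k x)) <= (1 + 1 / \<eta>) * (norm (d k x))\<^sup>2 + \<eta> * (1 + P x)\<^sup>2" if "\<eta> > 0" for \<eta> k x
  using amgm_scaled[OF that, of "norm (d k x)" "1 + P x"] by (simp add: algebra_simps power2_eq_square)
 show int: "set_integrable lborel K (%x. norm (d k x) * (1 + P x + norm (d k x)))" for k
  unfolding set_integrable_def
 proof (rule Bochner_Integration.integrable_bound[OF ib[unfolded set_integrable_def, of 1 k]])
  show "AE x in lborel. norm (indicator K x *\<^sub>R (norm (d k x) * (1 + P x + norm (d k x))))
   <= norm (indicator K x *\<^sub>R ((1 + 1 / 1) * (norm (d k x))\<^sup>2 + 1 * (1 + P x)\<^sup>2))"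
   using le[of 1 k] P0 by (intro AE_I2) (auto simp: indicator_def abs_mult)
 qed measurable
 define n2 where "n2 k = (LBINT x:K. (norm (d k x))\<^sup>2)" for k
 have "(%k. ennreal (n2 k)) \<longlonglongrightarrow> ennreal 0" using lim unfolding L2_sq_of_integrable[OF d2] n2_def by simp
 moreover have n20: "0 <= n2 k" for k unfolding n2_def set_lebesgue_integral_def by (intro integral_nonneg_AE) auto
 ultimately have n2: "n2 \<longlonglongrightarrow> 0" by (subst (asm) tendsto_ennreal_iff) auto
 define S where "S = (LBINT x:K. (1 + P x)\<^sup>2) + 1"
 have S: "S > 0" unfolding S_def set_lebesgue_integral_def by (intro add_nonneg_pos integral_nonneg_AE) auto
 show "(%k. LBINT x:K. norm (d k x) * (1 + P x + norm (d k x))) \<longlonglongrightarrow> 0"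
 proof (rule tendstoI)
  fix \<epsilon> :: real assume "\<epsilon> > 0"
  define \<eta> where "\<eta> = \<epsilon> / (2 * S)"
  have \<eta>: "\<eta> > 0" "1 + 1 / \<eta> > 0" using S \<open>\<epsilon> > 0\<close> by (auto simp: \<eta>_def intro!: add_pos_pos)
  have "(%k. (1 + 1 / \<eta>) * n2 k) \<longlonglongrightarrow> (1 + 1 / \<eta>) * 0" by (intro tendsto_intros n2)
  then have "\<forall>\<^sub>F k in sequentially. (1 + 1 / \<eta>) * n2 k < \<epsilon> / 2" using \<open>\<epsilon> > 0\<close> by (intro order_tendstoD(2)) auto
  then show "\<forall>\<^sub>F k in sequentially. dist (LBINT x:K. norm (d k x) * (1 + P x + norm (d k x))) 0 < \<epsilon>"
  proof (rule eventually_mono)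
   fix k assume k: "(1 + 1 / \<eta>) * n2 k < \<epsilon> / 2"
   have "0 <= (LBINT x:K. norm (d k x) * (1 + P x + norm (d k x)))"
    unfolding set_lebesgue_integral_def by (intro integral_nonneg_AE) (use P0 in auto)
   moreover have "(LBINT x:K. norm (d k x) * (1 + P x + norm (d k x))) <= J \<eta> k"
    unfolding J_def by (rule set_integral_mono[OF int ib]) (rule le[OF \<eta>(1)])
   moreover have "J \<eta> k = (1 + 1 / \<eta>) * n2 k + \<eta> * (S - 1)"
    unfolding J_def n2_def S_def by (subst set_integral_add(2)) (auto intro!: set_integrable_mult_right d2 X2)
   moreover have "\<eta> * (S - 1) < \<epsilon> / 2" using S \<open>\<epsilon> > 0\<close> by (simp add: \<eta>_def field_simps)
   ultimately show "dist (LBINT x:K. norm (d k x) * (1 + P x + norm (d k x))) 0 < \<epsilon>"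
    using k unfolding dist_real_def abs_less_iff by (intro conjI; linarith)
  qed
 qed
qed

text \<open>The coefficients converge in \<open>L\<^sup>1\<close> and the other factors are bounded and converge almost everywhere. So the
  coefficients can be replaced by their limit, uniformly in the other factor, and dominated convergence does the rest.\<close>

lemma weak_limit_product:
 fixes \<theta> c0 w0 :: "'a::euclidean_space => real" and c w :: "nat => 'a => real"
 assumes \<theta>: "continuous_on UNIV \<theta>" "!!z. z \<notin> cbox p q ==> \<theta> z = 0"
  and c: "!!k. set_integrable lborel (cbox p q) (c k)" "set_integrable lborel (cbox p q) c0"
  and clim: "(%k. LBINT z:cbox p q. \<bar>c k z - c0 z\<bar>) \<longlonglongrightarrow> 0"
  and w: "!!k. w k \<in> borel_measurable borel" "!!k z. \<bar>w k z\<bar> <= 1" "w0 \<in> borel_measurable borel"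
  and wlim: "AE z in lborel. z \<in> cbox p q --> (%k. w k z) \<longlonglongrightarrow> w0 z"
 shows "(%k. LBINT z. \<theta> z * (c k z * w k z)) \<longlonglongrightarrow> (LBINT z. \<theta> z * (c0 z * w0 z))"
  and "integrable lborel (%z. \<theta> z * (c k z * w k z))" and "integrable lborel (%z. \<theta> z * (c0 z * w0 z))"
proof -
 define Q where "Q = cbox p q"
 obtain M where M: "!!z. \<bar>\<theta> z\<bar> <= M" "M > 0"
  using continuous_compact_support_bounded[OF \<theta>(1) compact_cbox \<theta>(2)] by blast
 note \<theta>m[measurable] = borel_measurable_continuous_onI[OF \<theta>(1)]
 note w(1,3)[measurable]
 have i1: "integrable lborel (%z. (\<theta> z * v z) *\<^sub>R f z)"
  if f: "set_integrable lborel Q f" and v: "v \<in> borel_measurable borel" "!!z. \<bar>v z\<bar> <= 1" for v f :: "'a => real"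
 proof (rule integrable_weight[OF f])
  show "(%z. \<theta> z * v z) \<in> borel_measurable borel" using v(1) by measurable
  show "\<bar>\<theta> z * v z\<bar> <= M" for z
   using mult_mono[OF M(1)[of z] v(2)[of z]] M(2) by (simp add: abs_mult)
 qed (use \<theta>(2) in \<open>simp add: Q_def\<close>)
 show ik: "integrable lborel (%z. \<theta> z * (c k z * w k z))" for k
  using i1[OF c(1)[folded Q_def] w(1,2)] by (simp add: algebra_simps)
 have i0k: "integrable lborel (%z. \<theta> z * (c0 z * w k z))" for k
  using i1[OF c(2)[folded Q_def] w(1,2)] by (simp add: algebra_simps)
 have dom: "integrable lborel (%z. M * \<bar>indicator Q z * c0 z\<bar>)"
  using integrable_norm[OF c(2)[folded Q_def, unfolded set_integrable_def]] by (intro integrable_mult_right) simp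
 have [measurable]: "(%z. indicator Q z * c0 z) \<in> borel_measurable borel"
  using c(2)[folded Q_def, unfolded set_integrable_def] by (auto dest: borel_measurable_integrable)
 have eq: "\<theta> z * (c0 z * v) = \<theta> z * ((indicator Q z * c0 z) * v)" for z v
  using \<theta>(2)[of z] by (cases "z \<in> Q") (auto simp: Q_def)
 have A: "AE z in lborel. (%k. \<theta> z * (c0 z * w k z)) \<longlonglongrightarrow> \<theta> z * (c0 z * w0 z)"
  using wlim
 proof (rule eventually_mono)
  fix z assume z: "z \<in> cbox p q --> (%k. w k z) \<longlonglongrightarrow> w0 z"
  show "(%k. \<theta> z * (c0 z * w k z)) \<longlonglongrightarrow> \<theta> z * (c0 z * w0 z)"
   using z \<theta>(2)[of z] by (cases "z \<in> cbox p q") (auto intro!: tendsto_intros)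
 qed
 have B: "AE z in lborel. norm (\<theta> z * (c0 z * w k z)) <= M * \<bar>indicator Q z * c0 z\<bar>" for k
 proof (rule AE_I2)
  fix z
  have "\<bar>\<theta> z\<bar> * (\<bar>c0 z\<bar> * \<bar>w k z\<bar>) <= M * (\<bar>c0 z\<bar> * 1)" by (intro mult_mono M w) (use M(2) in auto)
  then show "norm (\<theta> z * (c0 z * w k z)) <= M * \<bar>indicator Q z * c0 z\<bar>"
   using \<theta>(2)[of z] by (cases "z \<in> Q") (auto simp: abs_mult Q_def)
 qed
 have m0: "(%z. \<theta> z * (c0 z * w0 z)) \<in> borel_measurable lborel" unfolding eq by measurable
 have mk: "(%z. \<theta> z * (c0 z * w k z)) \<in> borel_measurable lborel" for k unfolding eq by measurable
 show "integrable lborel (%z. \<theta> z * (c0 z * w0 z))" by (rule integrable_dominated_convergence[OF m0 mk dom A B])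
 have l1: "(%k. LBINT z. \<theta> z * (c0 z * w k z)) \<longlonglongrightarrow> (LBINT z. \<theta> z * (c0 z * w0 z))"
  by (rule integral_dominated_convergence[OF m0 mk dom A B])
 have "(%k. (LBINT z. \<theta> z * (c k z * w k z)) - (LBINT z. \<theta> z * (c0 z * w k z))) \<longlonglongrightarrow> 0"
 proof (rule Lim_null_comparison)
  show "(%k. M * (LBINT z:cbox p q. \<bar>c k z - c0 z\<bar>)) \<longlonglongrightarrow> 0"
   using tendsto_mult[OF tendsto_const clim, of M] by simp
  have "norm ((LBINT z. \<theta> z * (c k z * w k z)) - (LBINT z. \<theta> z * (c0 z * w k z))) <= M * (LBINT z:cbox p q. \<bar>c k z - c0 z\<bar>)" for k
  proof -
   have "(LBINT z. \<theta> z * (c k z * w k z)) - (LBINT z. \<theta> z * (c0 z * w k z)) = (LBINT z. \<theta> z * (c k z * w k z) - \<theta> z * (c0 z * w k z))"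
    by (rule Bochner_Integration.integral_diff[OF ik i0k, symmetric])
   also have "norm ... <= (LBINT z. norm (\<theta> z * (c k z * w k z) - \<theta> z * (c0 z * w k z)))" by (rule integral_norm_bound)
   also have "... <= (LBINT z. M * norm (indicator Q z *\<^sub>R (c k z - c0 z)))"
   proof (rule integral_mono)
    show "integrable lborel (%z. norm (\<theta> z * (c k z * w k z) - \<theta> z * (c0 z * w k z)))"
     by (intro integrable_norm Bochner_Integration.integrable_diff ik i0k)
    show "integrable lborel (%z. M * norm (indicator Q z *\<^sub>R (c k z - c0 z)))"
     using set_integral_diff(1)[OF c(1)[of k] c(2)] unfolding Q_def set_integrable_def by (intro integrable_mult_right integrable_norm)
    fix z
    have "\<theta> z * (c k z * w k z) - \<theta> z * (c0 z * w k z) = \<theta> z * ((c k z - c0 z) * w k z)" by (simp add: algebra_simps)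
    moreover have "\<bar>\<theta> z\<bar> * (\<bar>c k z - c0 z\<bar> * \<bar>w k z\<bar>) <= M * (\<bar>c k z - c0 z\<bar> * 1)" by (intro mult_mono M w) (use M(2) in auto)
    ultimately show "norm (\<theta> z * (c k z * w k z) - \<theta> z * (c0 z * w k z)) <= M * norm (indicator Q z *\<^sub>R (c k z - c0 z))"
     using \<theta>(2)[of z] by (cases "z \<in> Q") (auto simp: abs_mult Q_def)
   qed
   also have "... = M * (LBINT z:cbox p q. \<bar>c k z - c0 z\<bar>)"
    by (simp add: set_lebesgue_integral_def Q_def abs_mult)
   finally show ?thesis .
  qed
  then show "\<forall>\<^sub>F k in sequentially. norm ((LBINT z. \<theta> z * (c k z * w k z)) - (LBINT z. \<theta> z * (c0 z * w k z))) <= M * (LBINT z:cbox p q. \<bar>c k z - c0 z\<bar>)"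
   by simp
 qed
 from tendsto_add[OF this l1] show "(%k. LBINT z. \<theta> z * (c k z * w k z)) \<longlonglongrightarrow> (LBINT z. \<theta> z * (c0 z * w0 z))" by simp
qed

lemma strict_subsequence:
 fixes P :: "nat => nat => bool"
 assumes "!!n N. \<exists>m>N. P n m"
 obtains r :: "nat => nat" where "strict_mono r" "!!n. P n (r n)"
proof -
 have "\<exists>f. \<forall>n. P n (f n) \<and> f n < f (Suc n)"
  by (rule dependent_nat_choice) (use assms in blast)+
 then show ?thesis using that by (auto simp: strict_mono_Suc_iff)
qed

lemma exhaustion_of_interval:
 assumes "T > (0::real)"
 defines "c \<equiv> %n::nat. T - T / (real n + 2)"
 shows "0 < c n" "c n < T" "\<bar>t\<bar> < T ==> \<forall>\<^sub>F n in sequentially. \<bar>t\<bar> <= c n"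
proof -
 show "0 < c n" "c n < T" using assms(1) by (auto simp: c_def field_simps intro!: add_pos_nonneg)
 have "(%n. T - T / (real n + 2)) \<longlonglongrightarrow> T - 0"
  by (intro tendsto_diff tendsto_const tendsto_divide_0[OF tendsto_const] filterlim_at_top_imp_at_infinity
    filterlim_tendsto_add_at_top[OF _ filterlim_real_sequentially, of "%_. 2", simplified add.commute]) auto
 then show "\<forall>\<^sub>F n in sequentially. \<bar>t\<bar> <= c n" if "\<bar>t\<bar> < T"
  using order_tendstoD(1)[of c T sequentially "\<bar>t\<bar>"] that unfolding c_def by (auto elim: eventually_mono)
qed

text \<open>Convergence in \<open>L\<^sup>2\<close> on compact subsets of the strip gives, along a subsequence, convergence on
  a slice of constant time.\<close>

lemma L2_null_good_slice:
 fixes d :: "nat => real \<times> real => 'b::euclidean_space"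
 assumes T: "T > 0" and dm: "!!k. d k \<in> borel_measurable borel"
  and lim: "!!p q. cbox p q <= strip T ==> (%k. L2_sq (cbox p q) (d k)) \<longlonglongrightarrow> 0"
 obtains r :: "nat => nat" and t0 where "strict_mono r" "t0 \<in> {-T<..<T}"
  "!!R. (%k. L2_sq {-R..R} (%x. d (r k) (t0, x))) \<longlonglongrightarrow> 0"
proof -
 define c where "c n = T - T / (real n + 2)" for n :: nat
 note ex = exhaustion_of_interval[OF T, folded c_def]
 define K where "K n = cbox (- c n, - real n) (c n, real n)" for n
 have KT: "K n <= strip T" for n unfolding K_def using ex(1,2)[of n] by (intro cbox_subset_strip) auto
 have "\<exists>m>N. L2_sq (K n) (d m) < ennreal ((1/2)^n)" for n N
 proof -
  have "\<forall>\<^sub>F k in sequentially. L2_sq (K n) (d k) < ennreal ((1/2)^n)"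
   using lim[of "(- c n, - real n)" "(c n, real n)"] KT[of n] unfolding K_def by (intro order_tendstoD(2)) auto
  then have "\<forall>\<^sub>F k in sequentially. L2_sq (K n) (d k) < ennreal ((1/2)^n) \<and> N < k"
   using eventually_gt_at_top by (rule eventually_conj)
  from eventually_happens'[OF sequentially_bot this] show ?thesis by blast
 qed
 then obtain r where r: "strict_mono r" "!!n. L2_sq (K n) (d (r n)) < ennreal ((1/2)^n)"
  using strict_subsequence[of "%n m. L2_sq (K n) (d m) < ennreal ((1/2)^n)"] by metis
 define \<phi> where "\<phi> n t = indicator {- c n..c n} t * L2_sq {- real n..real n} (%x. d (r n) (t, x))" for n t
 have int: "(\<integral>\<^sup>+t. \<phi> n t \<partial>lborel) = L2_sq (K n) (d (r n))" and \<phi>m: "\<phi> n \<in> borel_measurable lborel" for n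
 proof -
  have [measurable]: "d (r n) \<in> borel_measurable (borel \<Otimes>\<^sub>M borel)" using dm by (simp add: borel_prod)
  define f where "f z = ennreal ((norm (d (r n) z))\<^sup>2) * indicator {- c n..c n} (fst z) * indicator {- real n..real n} (snd z)" for z
  have [measurable]: "f \<in> borel_measurable (lborel \<Otimes>\<^sub>M lborel)" unfolding f_def by measurable
  have eq: "\<phi> n t = (\<integral>\<^sup>+x. f (t, x) \<partial>lborel)" for t
   unfolding \<phi>_def L2_sq_def f_def by (cases "t \<in> {- c n..c n}") (auto simp: indicator_def)
  show "\<phi> n \<in> borel_measurable lborel" unfolding eq[abs_def] by measurable
  have "(\<integral>\<^sup>+t. \<phi> n t \<partial>lborel) = (\<integral>\<^sup>+z. f z \<partial>(lborel \<Otimes>\<^sub>M lborel))"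
   unfolding eq by (rule lborel.nn_integral_fst) measurable
  also have "... = L2_sq (K n) (d (r n))"
   unfolding lborel_prod L2_sq_def f_def K_def by (intro nn_integral_cong) (auto simp: indicator_def)
  finally show "(\<integral>\<^sup>+t. \<phi> n t \<partial>lborel) = L2_sq (K n) (d (r n))" .
 qed
 have "(\<integral>\<^sup>+t. (\<Sum>n. \<phi> n t) \<partial>lborel) = (\<Sum>n. (\<integral>\<^sup>+t. \<phi> n t \<partial>lborel))"
  by (rule nn_integral_suminf) (rule \<phi>m)
 also have "... <= (\<Sum>n. ennreal ((1/2)^n))"
  by (intro suminf_le) (use r(2) int in \<open>auto simp: less_imp_le\<close>)
 also have "... < \<infinity>"
  by (subst suminf_ennreal2) (auto intro!: summable_geometric)
 finally have "AE t in lborel. (\<Sum>n. \<phi> n t) \<noteq> \<infinity>"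
  using \<phi>m by (intro nn_integral_PInf_AE) auto
 then have "\<exists>t0\<in>{-T<..<T}. (\<Sum>n. \<phi> n t0) \<noteq> \<infinity>" by (rule AE_ex_open) (use T in auto)
 then obtain t0 where t0: "t0 \<in> {-T<..<T}" "(\<Sum>n. \<phi> n t0) \<noteq> \<infinity>" by blast
 have fin: "\<phi> n t0 \<noteq> \<infinity>" for n
  using t0(2) sum_le_suminf[of "%n. \<phi> n t0" "{n}"] by (auto simp: top_unique)
 define g where "g n = enn2real (\<phi> n t0)" for n
 have g: "\<phi> n t0 = ennreal (g n)" for n using fin[of n] by (simp add: g_def less_top)
 have "summable g" using t0(2) unfolding g by (intro summable_suminf_not_top) (auto simp: g_def)
 then have "(%n. ennreal (g n)) \<longlonglongrightarrow> ennreal 0" by (intro tendsto_ennrealI summable_LIMSEQ_zero)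
 then have \<phi>0: "(%n. \<phi> n t0) \<longlonglongrightarrow> 0" by (simp add: g)
 show ?thesis
 proof (rule that[OF r(1) t0(1)])
  fix R :: real
  show "(%k. L2_sq {-R..R} (%x. d (r k) (t0, x))) \<longlonglongrightarrow> 0"
  proof (rule tendsto_sandwich[OF _ _ tendsto_const \<phi>0])
   have "\<bar>t0\<bar> < T" using t0(1) by auto
   from ex(3)[OF this] have "\<forall>\<^sub>F n in sequentially. \<bar>t0\<bar> <= c n \<and> R <= real n"
    by (intro eventually_conj) (auto simp: eventually_sequentially intro: order_trans[OF real_nat_ceiling_ge] exI[of _ "nat \<lceil>R\<rceil>"])
   then show "\<forall>\<^sub>F n in sequentially. L2_sq {-R..R} (%x. d (r n) (t0, x)) <= \<phi> n t0"
   proof (rule eventually_mono)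
    fix n assume "\<bar>t0\<bar> <= c n \<and> R <= real n"
    then have "indicator {- c n..c n} t0 = (1::ennreal)" "{-R..R} <= {- real n..real n}" by (auto simp: indicator_def)
    then show "L2_sq {-R..R} (%x. d (r n) (t0, x)) <= \<phi> n t0"
     unfolding \<phi>_def L2_sq_def by (auto intro!: nn_integral_mono mult_left_mono simp: indicator_def)
   qed
  qed simp
 qed
qed

lemma L2_sq_triangle:
 fixes f g h :: "'a::euclidean_space => 'b::euclidean_space"
 assumes "f \<in> borel_measurable borel" "g \<in> borel_measurable borel" "h \<in> borel_measurable borel" "S \<in> sets borel"
 shows "L2_sq S (%x. f x - h x) <= 2 * (L2_sq S (%x. f x - g x) + L2_sq S (%x. g x - h x))"
proof -
 have "L2_sq S (%x. f x - h x) <= ennreal (2 * 1\<^sup>2) * (L2_sq S (%x. f x - g x) + L2_sq S (%x. g x - h x))"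
 proof (rule L2_sq_bound2)
  show "AE x in lborel. x \<in> S --> norm (f x - h x) <= 1 * (norm (f x - g x) + norm (g x - h x))"
  proof (intro AE_I2 impI)
   fix x show "norm (f x - h x) <= 1 * (norm (f x - g x) + norm (g x - h x))"
    using norm_triangle_ineq[of "f x - g x" "g x - h x"] by simp
  qed
 qed (use assms in auto)
 then show ?thesis by simp
qed

text \<open>A sequence that is Cauchy in \<open>L\<^sup>2\<^sub>l\<^sub>o\<^sub>c\<close>, locally uniformly in time, has a limit there, and a
  subsequence that converges at every time almost everywhere in \<open>x\<close>.\<close>

lemma C_L2loc_complete:
 fixes Y :: "nat => real \<times> real => 'b::euclidean_space"
 assumes T: "T > 0" and Ym: "!!k. Y k \<in> borel_measurable borel" and cont: "!!k. C_L2loc T (Y k)"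
  and cauchy: "!!c \<rho> \<epsilon>. 0 < c ==> c < T ==> 0 < \<rho> ==> 0 < \<epsilon> ==>
   \<exists>N. \<forall>k\<ge>N. \<forall>l\<ge>N. \<forall>t\<in>{-c..c}. L2_sq {-\<rho><..<\<rho>} (%x. Y k (t, x) - Y l (t, x)) <= ennreal \<epsilon>"
 obtains r :: "nat => nat" and y where "strict_mono r" "y \<in> borel_measurable borel" "C_L2loc T y"
  "!!t. t \<in> {-T<..<T} ==> AE x in lborel. (%k. Y (r k) (t, x)) \<longlonglongrightarrow> y (t, x)"
  "AE z in lborel. z \<in> strip T --> (%k. Y (r k) z) \<longlonglongrightarrow> y z"
proof -
 define c where "c n = T - T / (real n + 2)" for n :: nat
 note ex = exhaustion_of_interval[OF T, folded c_def]
 define S where "S n = {- (real n + 1)<..<real n + 1}" for n :: nat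
 define P where "P n N \<longleftrightarrow> (\<forall>k\<ge>N. \<forall>l\<ge>N. \<forall>t\<in>{- c n..c n}. L2_sq (S n) (%x. Y k (t, x) - Y l (t, x)) <= ennreal ((1/8)^n))" for n N
 have "\<exists>m>N. P n m" for n N
 proof -
  obtain N' where "P n N'"
   using cauchy[OF ex(1,2), of "real n + 1" "(1/8)^n" n] unfolding P_def S_def by auto
  then have "P n (max N' (Suc N))" unfolding P_def by auto
  then show ?thesis by (intro exI[of _ "max N' (Suc N)"]) auto
 qed
 then obtain r where r: "strict_mono r" "!!n. P n (r n)" using strict_subsequence[of P] by metis
 define y where "y z = lim (%n. Y (r n) z)" for z
 have ym: "y \<in> borel_measurable borel" unfolding y_def[abs_def] using Ym by measurable
 note sl[measurable] = borel_slice[OF Ym] and ysl[measurable] = borel_slice[OF ym]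
 have conv: "AE x in lborel. convergent (%n. Y (r n) (t, x))" if t: "t \<in> {-T<..<T}" for t
 proof -
  define \<Delta> where "\<Delta> n x = Y (r (Suc n)) (t, x) - Y (r n) (t, x)" for n x
  have \<Delta>m[measurable]: "\<Delta> n \<in> borel_measurable borel" for n unfolding \<Delta>_def[abs_def] by measurable
  define A where "A n = (if \<bar>t\<bar> <= c n then {x \<in> S n. (1/2)^n < norm (\<Delta> n x)} else {})" for n
  have S_sets[measurable]: "S n \<in> sets borel" for n by (simp add: S_def)
  have Am: "A n \<in> sets lborel" for n
  proof -
   have "{x \<in> S n. (1/2)^n < norm (\<Delta> n x)} = S n \<inter> {x \<in> space borel. (1/2)^n < norm (\<Delta> n x)}" by auto
   also have "... \<in> sets borel" by measurable
   finally show ?thesis by (simp add: A_def)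
  qed
  have Ab: "emeasure lborel (A n) <= ennreal ((1/2)^n)" for n
  proof (cases "\<bar>t\<bar> <= c n")
   case True
   have "emeasure lborel (A n) = (\<integral>\<^sup>+x. indicator (A n) x \<partial>lborel)" using Am by simp
   also have "... <= (\<integral>\<^sup>+x. ennreal (4^n) * (ennreal ((norm (\<Delta> n x))\<^sup>2) * indicator (S n) x) \<partial>lborel)"
   proof (rule nn_integral_mono)
    fix x
    show "indicator (A n) x <= ennreal (4^n) * (ennreal ((norm (\<Delta> n x))\<^sup>2) * indicator (S n) x)"
    proof (cases "x \<in> A n")
     case True
     then have x: "x \<in> S n" "(1/2)^n <= norm (\<Delta> n x)" by (auto simp: A_def split: if_splits)
     have "(1::real) = 4^n * ((1/2)^n)\<^sup>2" by (simp add: power2_eq_square power_mult_distrib[symmetric])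
     also have "... <= 4^n * (norm (\<Delta> n x))\<^sup>2" using x(2) by (intro mult_left_mono power_mono) auto
     finally have "ennreal 1 <= ennreal (4^n * (norm (\<Delta> n x))\<^sup>2)" by (rule ennreal_leI)
     then show ?thesis using x True by (simp add: ennreal_mult)
    qed simp
   qed
   also have "... = ennreal (4^n) * L2_sq (S n) (\<Delta> n)"
    unfolding L2_sq_def by (rule nn_integral_cmult) measurable
   also have "... <= ennreal (4^n) * ennreal ((1/8)^n)"
   proof (rule mult_left_mono)
    have "r (Suc n) \<ge> r n" using r(1) by (simp add: strict_mono_less_eq)
    then show "L2_sq (S n) (\<Delta> n) <= ennreal ((1/8)^n)"
     using r(2)[of n] True unfolding P_def \<Delta>_def by (auto simp: abs_le_iff)
   qed simp
   also have "... = ennreal ((1/2)^n)" by (simp add: ennreal_mult[symmetric] power_mult_distrib[symmetric])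
   finally show ?thesis .
  qed (simp add: A_def)
  have "AE x in lborel. eventually (%n. x \<in> space lborel - A n) sequentially"
  proof (rule borel_cantelli_AE1[OF Am])
   show fin: "emeasure lborel (A n) < \<infinity>" for n using Ab[of n] by (auto intro: le_less_trans)
   show "summable (%n. measure lborel (A n))"
   proof (rule summable_comparison_test'[where N = 0])
    show "summable (%n. (1/2::real)^n)" by (simp add: summable_geometric)
    show "norm (measure lborel (A n)) <= (1/2)^n" for n
     using Ab[of n] fin[of n] by (simp add: emeasure_eq_ennreal_measure less_top[symmetric])
   qed
  qed
  then show ?thesis
  proof (rule eventually_mono)
   fix x assume x: "eventually (%n. x \<in> space lborel - A n) sequentially"
   have "\<bar>t\<bar> < T" using t by auto
   note ev1 = ex(3)[OF this]
   obtain m :: nat where m: "\<bar>x\<bar> < real m" using reals_Archimedean2 by blast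
   have "\<forall>\<^sub>F n in sequentially. norm (\<Delta> n x) <= (1/2)^n"
    using x ev1 eventually_ge_at_top[of m]
   proof eventually_elim
    case (elim n)
    have "x \<in> S n" using elim(3) m by (auto simp: S_def abs_less_iff)
    then show ?case using elim(1,2) by (auto simp: A_def not_less)
   qed
   then have "summable (%n. \<Delta> n x)"
    by (rule summable_comparison_test_ev) (simp add: summable_geometric)
   then have "convergent (%n. Y (r 0) (t, x) + (\<Sum>i<n. \<Delta> i x))"
    unfolding summable_iff_convergent by (rule convergent_add[OF convergent_const])
   moreover have "Y (r 0) (t, x) + (\<Sum>i<n. \<Delta> i x) = Y (r n) (t, x)" for n
    by (induction n) (simp_all add: \<Delta>_def add.assoc[symmetric])
   ultimately show "convergent (%n. Y (r n) (t, x))" by (simp only:)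
  qed
 qed
 have lim: "AE x in lborel. (%n. Y (r n) (t, x)) \<longlonglongrightarrow> y (t, x)" if t: "t \<in> {-T<..<T}" for t
  using conv[OF t] by (rule eventually_mono) (simp add: y_def convergent_LIMSEQ_iff)
 have lim2: "AE z in lborel. z \<in> strip T --> (%k. Y (r k) z) \<longlonglongrightarrow> y z"
 proof (rule plane_AE_if_slices)
  have "{z \<in> space borel. Cauchy (%k. Y (r k) z)} \<in> sets borel" using Ym by measurable
  then have m: "{z. Cauchy (%k. Y (r k) z)} \<in> sets borel" by simp
  have "strip T \<in> sets borel" using open_strip by simp
  moreover have "{z. z \<in> strip T --> (%k. Y (r k) z) \<longlonglongrightarrow> y z} = - strip T \<union> {z. Cauchy (%k. Y (r k) z)}"
   by (auto simp: y_def Cauchy_convergent_iff convergent_LIMSEQ_iff[symmetric] intro: LIMSEQ_imp_Cauchy)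
  ultimately show "{z. z \<in> strip T --> (%k. Y (r k) z) \<longlonglongrightarrow> y z} \<in> sets borel" using m by auto
  show "AE t in lborel. AE x in lborel. (t, x) \<in> strip T --> (%k. Y (r k) (t, x)) \<longlonglongrightarrow> y (t, x)"
  proof (rule AE_I2)
   fix t
   show "AE x in lborel. (t, x) \<in> strip T --> (%k. Y (r k) (t, x)) \<longlonglongrightarrow> y (t, x)"
   proof (cases "t \<in> {-T<..<T}")
    case True
    then show ?thesis using lim[OF True] by (auto elim: eventually_mono)
   qed (auto simp: strip_def abs_less_iff)
  qed
 qed
 have close: "\<exists>k. \<forall>t\<in>{-c..c}. L2_sq {-\<rho><..<\<rho>} (%x. Y k (t, x) - y (t, x)) <= ennreal \<epsilon>"
  if c: "0 < c" "c < T" and pos: "0 < \<rho>" "0 < \<epsilon>" for c \<rho> \<epsilon>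
 proof -
  obtain N where N: "\<forall>k\<ge>N. \<forall>l\<ge>N. \<forall>t\<in>{-c..c}. L2_sq {-\<rho><..<\<rho>} (%x. Y k (t, x) - Y l (t, x)) <= ennreal \<epsilon>"
   using cauchy[OF c pos] by blast
  have "L2_sq {-\<rho><..<\<rho>} (%x. Y N (t, x) - y (t, x)) <= ennreal \<epsilon>" if t: "t \<in> {-c..c}" for t
  proof -
   define u where "u n x = ennreal ((norm (Y N (t, x) - Y (r n) (t, x)))\<^sup>2) * indicator {-\<rho><..<\<rho>} x" for n x
   have [measurable]: "u n \<in> borel_measurable lborel" for n unfolding u_def by measurable
   have tT: "t \<in> {-T<..<T}" using t c by auto
   have "L2_sq {-\<rho><..<\<rho>} (%x. Y N (t, x) - y (t, x)) = (\<integral>\<^sup>+x. liminf (%n. u n x) \<partial>lborel)"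
    unfolding L2_sq_def
   proof (rule nn_integral_cong_AE, rule eventually_mono[OF lim[OF tT]])
    fix x assume x: "(%n. Y (r n) (t, x)) \<longlonglongrightarrow> y (t, x)"
    have "(%n. u n x) \<longlonglongrightarrow> ennreal ((norm (Y N (t, x) - y (t, x)))\<^sup>2) * indicator {-\<rho><..<\<rho>} x"
     unfolding u_def by (cases "x \<in> {-\<rho><..<\<rho>}") (auto intro!: tendsto_intros tendsto_ennrealI x)
    then show "ennreal ((norm (Y N (t, x) - y (t, x)))\<^sup>2) * indicator {-\<rho><..<\<rho>} x = liminf (%n. u n x)"
     by (rule lim_imp_Liminf[OF sequentially_bot, symmetric])
   qed
   also have "... <= liminf (%n. \<integral>\<^sup>+x. u n x \<partial>lborel)" by (rule nn_integral_liminf) measurable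
   also have "... <= ennreal \<epsilon>"
   proof (rule Liminf_le[OF sequentially_bot])
    show "\<forall>\<^sub>F n in sequentially. (\<integral>\<^sup>+x. u n x \<partial>lborel) <= ennreal \<epsilon>"
     using eventually_ge_at_top[of N]
    proof (rule eventually_mono)
     fix n assume "N <= n"
     then have "N <= r n" using seq_suble[OF r(1), of n] by simp
     then show "(\<integral>\<^sup>+x. u n x \<partial>lborel) <= ennreal \<epsilon>"
      using N t unfolding L2_sq_def u_def by auto
    qed
   qed
   finally show ?thesis .
  qed
  then show ?thesis by blast
 qed
 have "C_L2loc T y"
  unfolding C_L2loc_def
 proof (intro conjI allI impI ballI)
  show "measurable_on_strip T y" unfolding measurable_on_strip_def using ym by (rule measurable_restrict_space1)
  fix \<rho> t :: real assume \<rho>: "\<rho> > 0" and t: "t \<in> {-T<..<T}"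
  have "max \<bar>t\<bar> 0 < T" using t T by auto
  then obtain c where c: "max \<bar>t\<bar> 0 < c" "c < T" using dense by blast
  have tc: "t \<in> {-c<..<c}" "0 < c" using c by auto
  let ?S = "{-\<rho><..<\<rho>}"
  show "L2_sq ?S (%x. y (t, x)) < \<infinity>"
  proof -
   obtain k where k: "\<forall>t\<in>{-c..c}. L2_sq ?S (%x. Y k (t, x) - y (t, x)) <= ennreal 1"
    using close[OF tc(2) c(2) \<rho> zero_less_one] by blast
   have "L2_sq ?S (%x. y (t, x)) <= ennreal (2 * 1\<^sup>2) * (L2_sq ?S (%x. Y k (t, x)) + L2_sq ?S (%x. Y k (t, x) - y (t, x)))"
   proof (rule L2_sq_bound2)
    have "norm (y (t, x)) <= norm (Y k (t, x)) + norm (Y k (t, x) - y (t, x))" for x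
     using norm_triangle_ineq4[of "Y k (t, x)" "Y k (t, x) - y (t, x)"] by simp
    then show "AE x in lborel. x \<in> ?S --> norm (y (t, x)) <= 1 * (norm (Y k (t, x)) + norm (Y k (t, x) - y (t, x)))" by simp
   qed (auto intro!: borel_measurable_diff borel_slice Ym ym)
   also have "... < \<infinity>"
   proof -
    have "L2_sq ?S (%x. Y k (t, x)) < \<infinity>" using cont[of k] \<rho> t unfolding C_L2loc_def by blast
    moreover have "L2_sq ?S (%x. Y k (t, x) - y (t, x)) <= ennreal 1" using k tc by auto
    then have "L2_sq ?S (%x. Y k (t, x) - y (t, x)) < \<infinity>" by (rule le_less_trans) simp
    ultimately show ?thesis by (simp add: ennreal_mult_less_top)
   qed
   finally show ?thesis .
  qed
  show "((%s. L2_sq ?S (%x. y (s, x) - y (t, x))) \<longlongrightarrow> 0) (at t within {-T<..<T})"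
  proof (rule order_tendstoI)
   fix a :: ennreal assume "0 < a"
   then obtain b where b: "0 < b" "b < a" using dense by blast
   \<comment> \<open>The two triangle inequalities below cost a factor \<open>2 + 4 + 4\<close>.\<close>
   define \<epsilon> where "\<epsilon> = enn2real b / 10"
   have be: "b = ennreal (10 * \<epsilon>)" using b by (simp add: \<epsilon>_def less_top[symmetric]) (metis ennreal_enn2real less_top_ennreal order_less_trans top.not_eq_extremum)
   have \<epsilon>: "\<epsilon> > 0" using b be by (cases "\<epsilon> > 0") (auto simp: ennreal_neg)
   obtain k where k: "\<forall>t\<in>{-c..c}. L2_sq ?S (%x. Y k (t, x) - y (t, x)) <= ennreal \<epsilon>"
    using close[OF tc(2) c(2) \<rho> \<epsilon>] by blast
   have "((%s. L2_sq ?S (%x. Y k (s, x) - Y k (t, x))) \<longlongrightarrow> 0) (at t within {-T<..<T})"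
    using cont[of k] \<rho> t unfolding C_L2loc_def by blast
   then have "\<forall>\<^sub>F s in at t within {-T<..<T}. L2_sq ?S (%x. Y k (s, x) - Y k (t, x)) < ennreal \<epsilon>"
    using \<epsilon> by (intro order_tendstoD(2)) auto
   moreover have "\<forall>\<^sub>F s in at t within {-T<..<T}. s \<in> {-c<..<c}"
    by (rule topological_tendstoD[OF tendsto_ident_at open_greaterThanLessThan tc(1)])
   ultimately show "\<forall>\<^sub>F s in at t within {-T<..<T}. L2_sq ?S (%x. y (s, x) - y (t, x)) < a"
   proof eventually_elim
    case (elim s)
    have comm: "L2_sq ?S (%x. y (s, x) - Y k (s, x)) = L2_sq ?S (%x. Y k (s, x) - y (s, x))"
     unfolding L2_sq_def by (simp add: norm_minus_commute)
    have t1: "L2_sq ?S (%x. y (s, x) - y (t, x)) <= 2 * (L2_sq ?S (%x. y (s, x) - Y k (s, x)) + L2_sq ?S (%x. Y k (s, x) - y (t, x)))"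
     by (rule L2_sq_triangle) measurable
    have t2: "L2_sq ?S (%x. Y k (s, x) - y (t, x)) <= 2 * (L2_sq ?S (%x. Y k (s, x) - Y k (t, x)) + L2_sq ?S (%x. Y k (t, x) - y (t, x)))"
     by (rule L2_sq_triangle) measurable
    have "L2_sq ?S (%x. y (s, x) - y (t, x)) <= 2 * (L2_sq ?S (%x. Y k (s, x) - y (s, x)) +
      2 * (L2_sq ?S (%x. Y k (s, x) - Y k (t, x)) + L2_sq ?S (%x. Y k (t, x) - y (t, x))))"
     by (rule order_trans[OF t1]) (unfold comm, intro mult_left_mono add_left_mono t2, simp)
    also have "... <= 2 * (ennreal \<epsilon> + 2 * (ennreal \<epsilon> + ennreal \<epsilon>))"
     using k elim tc by (intro mult_left_mono add_mono) auto
    also have "... = ennreal (10 * \<epsilon>)"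
    proof -
     have "ennreal \<epsilon> + ennreal \<epsilon> = ennreal (\<epsilon> + \<epsilon>)"
      "ennreal \<epsilon> + ennreal (2 * (\<epsilon> + \<epsilon>)) = ennreal (\<epsilon> + 2 * (\<epsilon> + \<epsilon>))"
      using \<epsilon> by (intro ennreal_plus[symmetric]; simp)+
     moreover have "2 * ennreal x = ennreal (2 * x)" if "x \<ge> 0" for x using ennreal_mult[of 2 x] that by simp
     ultimately have "2 * (ennreal \<epsilon> + 2 * (ennreal \<epsilon> + ennreal \<epsilon>)) = ennreal (2 * (\<epsilon> + 2 * (\<epsilon> + \<epsilon>)))"
      using \<epsilon> by (simp only: less_imp_le add_nonneg_nonneg mult_nonneg_nonneg zero_le_numeral)
     also have "2 * (\<epsilon> + 2 * (\<epsilon> + \<epsilon>)) = 10 * \<epsilon>" by simp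
     finally show ?thesis .
    qed
    also have "... < a" using b(2) be by simp
    finally show ?case .
   qed
  qed simp
 qed
 then show ?thesis using that[OF r(1) ym _ lim lim2] by blast
qed

section \<open>Existence of a weak frame\<close>

lemma rotation_matrix_rows:
 assumes "orthonormal_pair a b"
 shows "rotation_matrix (vector [a, b, a \<times> b] :: real^3^3)"
proof -
 obtain A :: "real^3^3" where A: "rotation_matrix A" "A *v axis 1 1 = a" "A *v axis 2 1 = b"
  by (rule rotation_frame[OF assms])
 have "A *v axis 3 1 = a \<times> b"
  using cross_rotation_matrix[OF A(1), of "axis 1 1" "axis 2 1"] A(2,3) by (simp add: cross_basis)
 then have "vector [a, b, a \<times> b] = transpose A"
  using A(2,3) by (simp add: vec_eq_iff forall_3 vector_3 transpose_def matrix_vector_mult_basis column_def)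
 then show ?thesis using rotation_transpose(1)[OF A(1)] by simp
qed

lemma C_L2loc_continuous:
 fixes f :: "real \<times> real => 'b::euclidean_space"
 assumes c: "continuous_on (strip T) f" and fm: "f \<in> borel_measurable borel"
 shows "C_L2loc T f"
 unfolding C_L2loc_def
proof (intro conjI allI impI ballI)
 show "measurable_on_strip T f" unfolding measurable_on_strip_def using fm by (rule measurable_restrict_space1)
 fix r t :: real assume r: "r > 0" and t: "t \<in> {-T<..<T}"
 have bound: "L2_sq {-r<..<r} v <= ennreal (B\<^sup>2 * (2 * r))" if "!!x. x \<in> {-r<..<r} ==> norm (v x) <= B" "B \<ge> 0" for v :: "real => 'b" and B
 proof -
  have "L2_sq {-r<..<r} v <= (\<integral>\<^sup>+x. ennreal (B\<^sup>2) * indicator {-r<..<r} x \<partial>lborel)"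
   unfolding L2_sq_def using that by (intro nn_integral_mono) (auto simp: indicator_def intro!: ennreal_leI power_mono)
  also have "... = ennreal (B\<^sup>2 * (2 * r))" using r by (simp add: nn_integral_cmult_indicator ennreal_mult)
  finally show ?thesis .
 qed
 have "max \<bar>t\<bar> 0 < T" using t by auto
 then obtain c' where c': "max \<bar>t\<bar> 0 < c'" "c' < T" using dense by blast
 define Q where "Q = cbox (-c', -r) (c', r)"
 have Q: "Q <= strip T" unfolding Q_def using c' by (intro cbox_subset_strip) auto
 have cQ: "continuous_on Q f" by (rule continuous_on_subset[OF c Q])
 obtain B where "B > 0" "!!z. z \<in> Q ==> norm (f z) <= B" using bounded_on_cbox[OF c] Q unfolding Q_def by metis
 then have "L2_sq {-r<..<r} (%x. f (t, x)) <= ennreal (B\<^sup>2 * (2 * r))"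
  using c' by (intro bound) (auto simp: Q_def abs_less_iff)
 then show "L2_sq {-r<..<r} (%x. f (t, x)) < \<infinity>" by (auto intro: le_less_trans)
 have uc: "uniformly_continuous_on Q f" using cQ unfolding Q_def by (intro compact_uniformly_continuous compact_cbox)
 show "((%s. L2_sq {-r<..<r} (%x. f (s, x) - f (t, x))) \<longlongrightarrow> 0) (at t within {-T<..<T})"
 proof (rule order_tendstoI)
  fix a :: ennreal assume "0 < a"
  then obtain b where b: "0 < b" "b < a" using dense by blast
  define \<beta> where "\<beta> = enn2real b"
  have be: "b = ennreal \<beta>" using b(2) by (simp add: \<beta>_def) (metis ennreal_enn2real less_top_ennreal order_less_trans top.not_eq_extremum)
  have \<beta>: "\<beta> > 0" using b be by (cases "\<beta> > 0") (auto simp: ennreal_neg)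
  define \<epsilon> where "\<epsilon> = sqrt (\<beta> / (2 * r))"
  have \<epsilon>: "\<epsilon> > 0" "\<epsilon>\<^sup>2 * (2 * r) = \<beta>" using \<beta> r by (auto simp: \<epsilon>_def)
  obtain \<delta> where \<delta>: "\<delta> > 0" "!!z z'. z \<in> Q ==> z' \<in> Q ==> dist z' z < \<delta> ==> dist (f z') (f z) < \<epsilon>"
   using uc \<epsilon>(1) unfolding uniformly_continuous_on_def by metis
  have "\<forall>\<^sub>F s in at t within {-T<..<T}. dist s t < min \<delta> (c' - \<bar>t\<bar>)"
   unfolding eventually_at using \<delta> c' by (intro exI[of _ "min \<delta> (c' - \<bar>t\<bar>)"]) auto
  then show "\<forall>\<^sub>F s in at t within {-T<..<T}. L2_sq {-r<..<r} (%x. f (s, x) - f (t, x)) < a"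
  proof (rule eventually_mono)
   fix s assume s: "dist s t < min \<delta> (c' - \<bar>t\<bar>)"
   have "L2_sq {-r<..<r} (%x. f (s, x) - f (t, x)) <= ennreal (\<epsilon>\<^sup>2 * (2 * r))"
   proof (rule bound)
    fix x assume x: "x \<in> {-r<..<r}"
    have "(s, x) \<in> Q" "(t, x) \<in> Q" using x s c' by (auto simp: Q_def dist_real_def abs_less_iff)
    moreover have "dist (s, x) (t, x) < \<delta>" using s by (simp add: dist_Pair_Pair)
    ultimately show "norm (f (s, x) - f (t, x)) <= \<epsilon>" using \<delta>(2)[of "(t, x)" "(s, x)"] by (simp add: dist_norm)
   qed (use \<epsilon> in simp)
   then show "L2_sq {-r<..<r} (%x. f (s, x) - f (t, x)) < a" using b(2) be \<epsilon>(2) by simp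
  qed
 qed simp
qed

lemma parallel_sections_inner_const:
 assumes y: "parallel_section T q y" and z: "parallel_section T q z" and t: "t0 \<in> {-T<..<T}" "t \<in> {-T<..<T}"
 shows "y (t, x) \<bullet> z (t, x) = y (t0, 0) \<bullet> z (t0, 0)"
proof -
 have "y (t, x) \<bullet> z (t, x) = y (t, 0) \<bullet> z (t, 0)"
  by (rule cross_ode_inner_const[OF is_interval_univ, of "%x. y (t, x)" "%x. conn_x q (t, x)" "%x. z (t, x)"])
   (use y z t(2) in \<open>auto simp: parallel_section_def\<close>)
 also have "... = y (t0, 0) \<bullet> z (t0, 0)"
  by (rule cross_ode_inner_const[OF is_interval_oo, of "-T" T "%t. y (t, 0)" "%t. conn_t q (t, 0)" "%t. z (t, 0)"])
   (use y z t in \<open>auto simp: parallel_section_def\<close>)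
 finally show ?thesis .
qed

lemma cross_cross_derivative:
 fixes w y z :: "real^3"
 shows "y \<times> (w \<times> z) + (w \<times> y) \<times> z = w \<times> (y \<times> z)"
 by (simp add: vec3_eq_iff cross_nth algebra_simps)

text \<open>Cross products of sections are sections by the Jacobi identity.\<close>

lemma parallel_section_cross:
 assumes y: "parallel_section T q y" and z: "parallel_section T q z"
  and t0: "t0 \<in> {-T<..<T}" and o: "y (t0, 0) \<bullet> z (t0, 0) = 0"
 shows "parallel_section T q (%p. y p \<times> z p)"
 unfolding parallel_section_def
proof (intro conjI ballI allI)
 show "continuous_on (strip T) (%p. y p \<times> z p)"
  using y z unfolding parallel_section_def by (intro continuous_on_cross) auto
 fix t x assume t: "t \<in> {-T<..<T}"
 have d: "((%x. y (t, x)) has_vector_derivative (conn_x q (t, x) \<times> y (t, x))) (at x)"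
  "((%t. y (t, x)) has_vector_derivative (conn_t q (t, x) \<times> y (t, x))) (at t)"
  "((%x. z (t, x)) has_vector_derivative (conn_x q (t, x) \<times> z (t, x))) (at x)"
  "((%t. z (t, x)) has_vector_derivative (conn_t q (t, x) \<times> z (t, x))) (at t)"
  "norm (y (t, x)) = 1" "norm (z (t, x)) = 1"
  using y z t unfolding parallel_section_def by blast+
 show "((%x. y (t, x) \<times> z (t, x)) has_vector_derivative (conn_x q (t, x) \<times> (y (t, x) \<times> z (t, x)))) (at x)"
  using has_vector_derivative_cross[OF d(1,3)] by (simp add: cross_cross_derivative)
 show "((%t. y (t, x) \<times> z (t, x)) has_vector_derivative (conn_t q (t, x) \<times> (y (t, x) \<times> z (t, x)))) (at t)"
  using has_vector_derivative_cross[OF d(2,4)] by (simp add: cross_cross_derivative)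
 have "y (t, x) \<bullet> z (t, x) = 0" using parallel_sections_inner_const[OF y z t0 t, of x] o by simp
 then show "norm (y (t, x) \<times> z (t, x)) = 1"
  using norm_cross_dot[of "y (t, x)" "z (t, x)"] d(5,6) by (intro power2_eq_imp_eq[of _ 1]) auto
qed

text \<open>The derivatives of \<open>q\<close> in the time component of the connection are absorbed into \<open>x\<close>-derivatives of products.\<close>

lemma parallel_section_weak_equations:
 assumes q: "smooth_NLS_solution T q" and y: "parallel_section T q y" and \<phi>: "test_function (strip T) \<phi>" and T: "T > 0"
 shows "(LBINT z. dt \<phi> z * (y z $ 1) + dx \<phi> z * (Im (q z) * (y z $ 2) - Re (q z) * (y z $ 3)) + \<phi> z * 0) = 0"
  and "(LBINT z. dt \<phi> z * 0 + dx \<phi> z * (y z $ 1) + \<phi> z * (Re (q z) * (y z $ 2) + Im (q z) * (y z $ 3))) = 0"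
  and "(LBINT z. dt \<phi> z * (y z $ 2) + dx \<phi> z * (- (Im (q z) * (y z $ 1))) + \<phi> z * (- ((cmod (q z))\<^sup>2 / 2 * (y z $ 3))
    - Im (q z) * (Re (q z) * (y z $ 2) + Im (q z) * (y z $ 3)))) = 0"
  and "(LBINT z. dt \<phi> z * 0 + dx \<phi> z * (y z $ 2) + \<phi> z * (- (Re (q z) * (y z $ 1)))) = 0"
  and "(LBINT z. dt \<phi> z * 0 + dx \<phi> z * (y z $ 3) + \<phi> z * (- (Im (q z) * (y z $ 1)))) = 0"
proof -
 note s = smooth_NLS_smooth[OF q]
 note qc = smooth_on_continuous[OF s] smooth_on_continuous[OF smooth_on_dderiv[OF s]]
 have yc: "continuous_on (strip T) (%z. y z $ i)" for i
  using y unfolding parallel_section_def by (intro continuous_on_component) auto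
 define px where "px z = conn_x q z \<times> y z" for z
 define pt where "pt z = conn_t q z \<times> y z" for z
 have dx: "((%x. y (t, x) $ i) has_real_derivative px (t, x) $ i) (at x)" if "t \<in> {-T<..<T}" for t x i
  using y that unfolding parallel_section_def px_def has_real_derivative_iff_has_vector_derivative
  by (intro bounded_linear.has_vector_derivative[OF bounded_linear_vec_nth]) blast
 have dt: "((%t. y (t, x) $ i) has_real_derivative pt (t, x) $ i) (at t)" if "t \<in> {-T<..<T}" for t x i
  using y that unfolding parallel_section_def pt_def has_real_derivative_iff_has_vector_derivative
  by (intro bounded_linear.has_vector_derivative[OF bounded_linear_vec_nth]) blast
 have pc: "continuous_on (strip T) (%z. px z $ i)" "continuous_on (strip T) (%z. pt z $ i)" for i
  using y unfolding parallel_section_def px_def pt_def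
  by (intro continuous_on_component continuous_on_cross continuous_conn[OF s]; blast)+
 have pv: "px z $ 1 = Im (q z) * (y z $ 3) + Re (q z) * (y z $ 2)" "px z $ 2 = - (Re (q z) * (y z $ 1))" "px z $ 3 = - (Im (q z) * (y z $ 1))"
  "pt z $ 1 = Re (dx q z) * (y z $ 3) - Im (dx q z) * (y z $ 2)" "pt z $ 2 = Im (dx q z) * (y z $ 1) - (cmod (q z))\<^sup>2 / 2 * (y z $ 3)" for z
  by (simp_all add: px_def pt_def cross_nth conn_x_def conn_t_def)
 have dq: "((%x. Re (q (t, x))) has_real_derivative Re (dx q (t, x))) (at x)" "((%x. Im (q (t, x))) has_real_derivative Im (dx q (t, x))) (at x)"
  if "t \<in> {-T<..<T}" for t x
  using has_real_derivative_Re_Im[OF smooth_slice_derivatives(1)[OF s that]] .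
 show "(LBINT z. dt \<phi> z * (y z $ 1) + dx \<phi> z * (Im (q z) * (y z $ 2) - Re (q z) * (y z $ 3)) + \<phi> z * 0) = 0"
 proof (rule weak_conservation[OF \<phi> T, where A' = "%z. pt z $ 1" and B' = "%z. (Im (q z) * px z $ 2 + Im (dx q z) * (y z $ 2)) - (Re (q z) * px z $ 3 + Re (dx q z) * (y z $ 3))"])
  show "((%t. y (t, x) $ 1) has_real_derivative pt (t, x) $ 1) (at t)" if "t \<in> {-T<..<T}" for t x
   by (rule dt[OF that])
  show "((%x. Im (q (t, x)) * (y (t, x) $ 2) - Re (q (t, x)) * (y (t, x) $ 3)) has_real_derivative (Im (q (t, x)) * px (t, x) $ 2 + Im (dx q (t, x)) * (y (t, x) $ 2)) - (Re (q (t, x)) * px (t, x) $ 3 + Re (dx q (t, x)) * (y (t, x) $ 3))) (at x)" if "t \<in> {-T<..<T}" for t x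
   by (intro DERIV_diff DERIV_mult' dx dq that)
 qed (auto intro!: continuous_intros yc pc qc simp: pv algebra_simps)
 show "(LBINT z. dt \<phi> z * 0 + dx \<phi> z * (y z $ 1) + \<phi> z * (Re (q z) * (y z $ 2) + Im (q z) * (y z $ 3))) = 0"
 proof (rule weak_conservation[OF \<phi> T, where A' = "%z. 0" and B' = "%z. px z $ 1"])
  show "((%t. 0) has_real_derivative 0) (at t)" if "t \<in> {-T<..<T}" for t x
   by (rule DERIV_const)
  show "((%x. y (t, x) $ 1) has_real_derivative px (t, x) $ 1) (at x)" if "t \<in> {-T<..<T}" for t x
   by (rule dx[OF that])
 qed (auto intro!: continuous_intros yc pc qc simp: pv algebra_simps)
 show "(LBINT z. dt \<phi> z * (y z $ 2) + dx \<phi> z * (- (Im (q z) * (y z $ 1))) + \<phi> z * (- ((cmod (q z))\<^sup>2 / 2 * (y z $ 3))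
    - Im (q z) * (Re (q z) * (y z $ 2) + Im (q z) * (y z $ 3)))) = 0"
 proof (rule weak_conservation[OF \<phi> T, where A' = "%z. pt z $ 2" and B' = "%z. - (Im (q z) * px z $ 1 + Im (dx q z) * (y z $ 1))"])
  show "((%t. y (t, x) $ 2) has_real_derivative pt (t, x) $ 2) (at t)" if "t \<in> {-T<..<T}" for t x
   by (rule dt[OF that])
  show "((%x. - (Im (q (t, x)) * (y (t, x) $ 1))) has_real_derivative - (Im (q (t, x)) * px (t, x) $ 1 + Im (dx q (t, x)) * (y (t, x) $ 1))) (at x)" if "t \<in> {-T<..<T}" for t x
   by (intro DERIV_minus DERIV_mult' dx dq that)
 qed (auto intro!: continuous_intros yc pc qc simp: pv algebra_simps)
 show "(LBINT z. dt \<phi> z * 0 + dx \<phi> z * (y z $ 2) + \<phi> z * (- (Re (q z) * (y z $ 1)))) = 0"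
 proof (rule weak_conservation[OF \<phi> T, where A' = "%z. 0" and B' = "%z. px z $ 2"])
  show "((%t. 0) has_real_derivative 0) (at t)" if "t \<in> {-T<..<T}" for t x
   by (rule DERIV_const)
  show "((%x. y (t, x) $ 2) has_real_derivative px (t, x) $ 2) (at x)" if "t \<in> {-T<..<T}" for t x
   by (rule dx[OF that])
 qed (auto intro!: continuous_intros yc pc qc simp: pv algebra_simps)
 show "(LBINT z. dt \<phi> z * 0 + dx \<phi> z * (y z $ 3) + \<phi> z * (- (Im (q z) * (y z $ 1)))) = 0"
 proof (rule weak_conservation[OF \<phi> T, where A' = "%z. 0" and B' = "%z. px z $ 3"])
  show "((%t. 0) has_real_derivative 0) (at t)" if "t \<in> {-T<..<T}" for t x
   by (rule DERIV_const)
  show "((%x. y (t, x) $ 3) has_real_derivative px (t, x) $ 3) (at x)" if "t \<in> {-T<..<T}" for t x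
   by (rule dx[OF that])
 qed (auto intro!: continuous_intros yc pc qc simp: pv algebra_simps)
qed

text \<open>The coefficients of the row equations are of this kind; convergence in \<open>L\<^sup>2\<close> of their arguments implies their convergence in \<open>L\<^sup>1\<close>.\<close>

definition quadratic_lipschitz :: "(complex => real) => bool" where
 "quadratic_lipschitz C \<longleftrightarrow> continuous_on UNIV C \<and>
  (\<exists>K. \<forall>p p'. \<bar>C p - C p'\<bar> <= K * (cmod (p - p') * (1 + cmod p' + cmod (p - p'))))"

lemma quadratic_lipschitz_const: "quadratic_lipschitz (%_. c)"
 unfolding quadratic_lipschitz_def by (auto intro!: exI[of _ 0])

lemma quadratic_lipschitz_Re_Im: "quadratic_lipschitz Re" "quadratic_lipschitz Im"
proof -
 have "\<bar>Re p - Re p'\<bar> <= 1 * (cmod (p - p') * (1 + cmod p' + cmod (p - p')))" for p p'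
  using abs_Re_le_cmod[of "p - p'"] mult_left_mono[of 1 "1 + cmod p' + cmod (p - p')" "cmod (p - p')"] by simp
 then show "quadratic_lipschitz Re"
  unfolding quadratic_lipschitz_def by (intro conjI exI[of _ 1] allI) (auto intro!: continuous_intros)
 have "\<bar>Im p - Im p'\<bar> <= 1 * (cmod (p - p') * (1 + cmod p' + cmod (p - p')))" for p p'
  using abs_Im_le_cmod[of "p - p'"] mult_left_mono[of 1 "1 + cmod p' + cmod (p - p')" "cmod (p - p')"] by simp
 then show "quadratic_lipschitz Im"
  unfolding quadratic_lipschitz_def by (intro conjI exI[of _ 1] allI) (auto intro!: continuous_intros)
qed

lemma quadratic_lipschitz_mult:
 assumes c: "continuous_on UNIV A" "continuous_on UNIV B" and A: "!!p. \<bar>A p\<bar> <= cmod p" "!!p p'. \<bar>A p - A p'\<bar> <= cmod (p - p')"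
  and B: "!!p. \<bar>B p\<bar> <= cmod p" "!!p p'. \<bar>B p - B p'\<bar> <= cmod (p - p')"
 shows "quadratic_lipschitz (%p. c * (A p * B p))"
proof -
 have "\<bar>c * (A p * B p) - c * (A p' * B p')\<bar> <= (\<bar>c\<bar> * 2) * (cmod (p - p') * (1 + cmod p' + cmod (p - p')))" for p p'
 proof -
  have "A p * B p - A p' * B p' = (A p - A p') * B p + A p' * (B p - B p')" by (simp add: algebra_simps)
  then have "\<bar>A p * B p - A p' * B p'\<bar> <= \<bar>A p - A p'\<bar> * \<bar>B p\<bar> + \<bar>A p'\<bar> * \<bar>B p - B p'\<bar>" by (simp add: abs_mult[symmetric])
  also have "... <= cmod (p - p') * cmod p + cmod p' * cmod (p - p')" by (intro add_mono mult_mono A B) auto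
  also have "... <= cmod (p - p') * (cmod p' + cmod (p - p')) + cmod p' * cmod (p - p')"
   using norm_triangle_sub[of p p'] by (intro add_right_mono mult_left_mono) auto
  also have "... <= 2 * (cmod (p - p') * (1 + cmod p' + cmod (p - p')))" by (simp add: algebra_simps)
  finally have "\<bar>c\<bar> * \<bar>A p * B p - A p' * B p'\<bar> <= \<bar>c\<bar> * (2 * (cmod (p - p') * (1 + cmod p' + cmod (p - p'))))"
   by (intro mult_left_mono) auto
  then show ?thesis by (simp add: abs_mult[symmetric] right_diff_distrib)
 qed
 then show ?thesis
  unfolding quadratic_lipschitz_def using c by (intro conjI exI[of _ "\<bar>c\<bar> * 2"] allI) (auto intro!: continuous_intros)
qed

lemma quadratic_lipschitz_quadratic:
 "quadratic_lipschitz (%p. Im p * Re p)" "quadratic_lipschitz (%p. Im p * Im p)" "quadratic_lipschitz (%p. (cmod p)\<^sup>2 / 2)"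
proof -
 have d: "\<bar>Re p - Re p'\<bar> <= cmod (p - p')" "\<bar>Im p - Im p'\<bar> <= cmod (p - p')" "\<bar>cmod p - cmod p'\<bar> <= cmod (p - p')" for p p'
  using abs_Re_le_cmod[of "p - p'"] abs_Im_le_cmod[of "p - p'"] norm_triangle_ineq3[of p p'] by auto
 have "quadratic_lipschitz (%p. 1 * (Im p * Re p))"
  by (rule quadratic_lipschitz_mult) (auto intro!: continuous_intros d abs_Re_le_cmod abs_Im_le_cmod)
 then show "quadratic_lipschitz (%p. Im p * Re p)" by simp
 have "quadratic_lipschitz (%p. 1 * (Im p * Im p))"
  by (rule quadratic_lipschitz_mult) (auto intro!: continuous_intros d abs_Im_le_cmod)
 then show "quadratic_lipschitz (%p. Im p * Im p)" by simp
 have "quadratic_lipschitz (%p. 1/2 * (cmod p * cmod p))"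
  by (rule quadratic_lipschitz_mult) (auto intro!: continuous_intros d)
 then show "quadratic_lipschitz (%p. (cmod p)\<^sup>2 / 2)" by (simp add: power2_eq_square)
qed

text \<open>The rows are parallel and form the identity matrix at \<open>(t0, 0)\<close>; the vectors read across the rows are the frame \<open>u\<close>, \<open>e\<close>, \<open>u \<times> e\<close>.\<close>

definition frame_rows ::
 "real => (real \<times> real => complex) => real => (3 => real \<times> real => real^3) => bool" where
 "frame_rows T q t0 y \<longleftrightarrow> (\<forall>i. parallel_section T q (y i) \<and> y i (t0, 0) = axis i 1) \<and>
  (\<forall>z\<in>strip T. orthonormal_pair (\<chi> i. y i z $ 1) (\<chi> i. y i z $ 2) \<and>
   (\<chi> i. y i z $ 3) = (\<chi> i. y i z $ 1) \<times> (\<chi> i. y i z $ 2))"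

lemma smooth_NLS_frame_rows:
 assumes q: "smooth_NLS_solution T q" and t0: "t0 \<in> {-T<..<T}"
 shows "\<exists>y. frame_rows T q t0 y"
proof -
 obtain y1 where y1: "parallel_section T q y1" "y1 (t0, 0) = axis 1 1"
  by (rule smooth_NLS_parallel_section[OF q t0, of "axis 1 1"]) (simp add: norm_axis_1)
 obtain y2 where y2: "parallel_section T q y2" "y2 (t0, 0) = axis 2 1"
  by (rule smooth_NLS_parallel_section[OF q t0, of "axis 2 1"]) (simp add: norm_axis_1)
 have o: "y1 (t0, 0) \<bullet> y2 (t0, 0) = 0" by (simp add: y1(2) y2(2) inner_axis_axis)
 define N where "N z = (vector [y1 z, y2 z, y1 z \<times> y2 z] :: real^3^3)" for z
 have N: "N z $ 1 = y1 z" "N z $ 2 = y2 z" "N z $ 3 = y1 z \<times> y2 z" for z by (simp_all add: N_def vector_3)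
 have p: "parallel_section T q (%z. N z $ i)" for i
  using exhaust_3[of i] y1(1) y2(1) parallel_section_cross[OF y1(1) y2(1) t0 o] by (auto simp: N)
 have i: "N (t0, 0) $ i = axis i 1" for i
  using exhaust_3[of i] by (auto simp: N y1(2) y2(2) cross_basis)
 have r: "rotation_matrix (N z)" if z: "z \<in> strip T" for z
 proof -
  obtain t x where tx: "z = (t, x)" by (cases z)
  have t: "t \<in> {-T<..<T}" using z by (auto simp: tx strip_def)
  have "orthonormal_pair (y1 z) (y2 z)"
   using y1(1) y2(1) t o parallel_sections_inner_const[OF y1(1) y2(1) t0 t, of x]
   unfolding orthonormal_pair_def tx parallel_section_def by auto
  then show ?thesis unfolding N_def by (rule rotation_matrix_rows)
 qed
 have col: "(\<chi> i. N z $ i $ j) = N z *v axis j 1" for z j by (simp add: matrix_vector_mult_basis column_def)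
 have "frame_rows T q t0 (%i z. N z $ i)"
  unfolding frame_rows_def col
 proof (intro conjI allI ballI)
  fix z assume z: "z \<in> strip T"
  have n: "norm (N z *v w) = norm w" for w using rotation_norm[OF r[OF z]] .
  have "norm (N z *v (axis 1 1 + axis 2 1)) = norm (axis 1 1 + axis 2 1 :: real^3)" by (rule n)
  then have "(N z *v axis 1 1) \<bullet> (N z *v axis 2 1) = axis 1 1 \<bullet> (axis 2 1 :: real^3)"
   using n[of "axis 1 1"] n[of "axis 2 1"]
   by (simp add: dot_norm matrix_vector_right_distrib)
  then show "orthonormal_pair (N z *v axis 1 1) (N z *v axis 2 1)"
   by (simp add: orthonormal_pair_def n norm_axis_1 inner_axis_axis)
  show "N z *v axis 3 1 = (N z *v axis 1 1) \<times> (N z *v axis 2 1)"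
   by (simp add: cross_rotation_matrix[OF r[OF z]] cross_basis)
 qed (use p i in auto)
 then show ?thesis by blast
qed

lemma L2_null_weighted_L1_null_eventually:
 fixes d :: "nat => 'a::euclidean_space => 'b::euclidean_space" and P :: "'a => real"
 assumes K: "K \<in> sets borel" "set_integrable lborel K (%_. 1::real)"
  and dm: "!!k. d k \<in> borel_measurable borel" and P: "P \<in> borel_measurable borel" "!!x. 0 <= P x"
   "set_integrable lborel K (%x. (P x)\<^sup>2)"
  and lim: "(%k. L2_sq K (d k)) \<longlonglongrightarrow> 0"
 shows "\<forall>\<^sub>F k in sequentially. set_integrable lborel K (%x. norm (d k x) * (1 + P x + norm (d k x)))"
  and "(%k. LBINT x:K. norm (d k x) * (1 + P x + norm (d k x))) \<longlonglongrightarrow> 0"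
proof -
 obtain N where N: "!!k. k \<ge> N ==> L2_sq K (d k) < 1"
  using order_tendstoD(2)[OF lim, of 1] unfolding eventually_sequentially by auto
 have fin: "set_integrable lborel K (%x. (norm (d (k + N) x))\<^sup>2)" for k
  using N[of "k + N"] by (intro L2_sq_real(1)[OF dm K(1)]) (auto intro: less_trans)
 have lim': "(%k. L2_sq K (d (k + N))) \<longlonglongrightarrow> 0" by (rule LIMSEQ_ignore_initial_segment[OF lim])
 have 1: "set_integrable lborel K (%x. norm (d (k + N) x) * (1 + P x + norm (d (k + N) x)))" for k
  by (rule L2_null_weighted_L1_null(1)[of K "%k. d (k + N)"]) (use K dm P fin lim' in auto)
 have "set_integrable lborel K (%x. norm (d k x) * (1 + P x + norm (d k x)))" if "k \<ge> N" for k
  using 1[of "k - N"] that by simp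
 then show "\<forall>\<^sub>F k in sequentially. set_integrable lborel K (%x. norm (d k x) * (1 + P x + norm (d k x)))"
  unfolding eventually_sequentially by blast
 have "(%k. LBINT x:K. norm (d (k + N) x) * (1 + P x + norm (d (k + N) x))) \<longlonglongrightarrow> 0"
  by (rule L2_null_weighted_L1_null(2)[of K "%k. d (k + N)"]) (use K dm P fin lim' in auto)
 then show "(%k. LBINT x:K. norm (d k x) * (1 + P x + norm (d k x))) \<longlonglongrightarrow> 0"
  by (rule LIMSEQ_offset)
qed

lemma set_integral_mono_nonneg:
 fixes f g :: "'a::euclidean_space => real"
 assumes "set_integrable lborel K g" "!!x. x \<in> K ==> 0 <= f x" "!!x. x \<in> K ==> f x <= g x"
 shows "(LBINT x:K. f x) <= (LBINT x:K. g x)"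
 unfolding set_lebesgue_integral_def
 by (rule integral_mono') (use assms in \<open>auto simp: set_integrable_def indicator_def intro: order_trans\<close>)

text \<open>Both terms that bound the distance of two sections tend to zero: the one on the slice by the choice of \<open>t0\<close>, the one
  on the box by convergence of the solutions in \<open>L\<^sup>2\<close>.\<close>

lemma parallel_sections_cauchy:
 fixes qk :: "nat => real \<times> real => complex"
 assumes qm: "q \<in> borel_measurable borel"
  and q_L2: "!!a b. cbox a b <= strip T ==> set_integrable lborel (cbox a b) (%z. (cmod (q z))\<^sup>2)"
  and s: "!!k. smooth_on (strip T) (qk k)" and y: "!!k. parallel_section T (qk k) (y k)"
  and y0: "!!k. y k (t0, 0) = y0" and t0: "t0 \<in> {-T<..<T}"
  and dm: "!!k. d k \<in> borel_measurable borel" and d: "!!k z. z \<in> strip T ==> d k z = qk k z - q z"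
  and lim: "!!a b. cbox a b <= strip T ==> (%k. L2_sq (cbox a b) (d k)) \<longlonglongrightarrow> 0"
  and lim0: "!!R. (%k. L2_sq {-R..R} (%x. d k (t0, x))) \<longlonglongrightarrow> 0"
  and c: "0 < c" "c < T" and r: "0 < r" and \<epsilon>: "0 < \<epsilon>"
 shows "\<exists>N. \<forall>k\<ge>N. \<forall>l\<ge>N. \<forall>t\<in>{-c..c}. L2_sq {-r<..<r} (%x. y k (t, x) - y l (t, x)) <= ennreal \<epsilon>"
proof (rule parallel_sections_close[OF r])
 define b where "b = max c \<bar>t0\<bar>"
 have b: "-T < -b" "b < T" "t0 \<in> {-b..b}" "c <= b" using c t0 by (auto simp: b_def)
 define R where "R = r + 1"
 define Q where "Q = cbox (-b, -R) (b, R)"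
 have Q: "Q <= strip T" unfolding Q_def using b by (intro cbox_subset_strip) auto
 fix C :: real
 assume C: "C > 0" "!!T q q' y y' a b t t0.
  [|smooth_on (strip T) q; smooth_on (strip T) q'; parallel_section T q y; parallel_section T q' y';
   -T < a; b < T; t \<in> {a..b}; t0 \<in> {a..b}; y (t0, 0) = y' (t0, 0)|] ==>
  (LINT x:{-r..r}|lborel. (norm (y (t, x) - y' (t, x)))\<^sup>2) <=
   C * ((LINT \<xi>:{-(r+1)..r+1}|lborel. cmod (q (t0, \<xi>) - q' (t0, \<xi>))) +
    (LBINT z:cbox (a, -(r+1)) (b, r+1). cmod (q z - q' z) * (1 + cmod (q z) + cmod (q' z))))"
 define A where "A k x = cmod (d k (t0, x)) * (1 + 0 + cmod (d k (t0, x)))" for k x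
 define B where "B k z = cmod (d k z) * (1 + cmod (q z) + cmod (d k z))" for k z
 have A: "\<forall>\<^sub>F k in sequentially. set_integrable lborel {-R..R} (A k)" "(%k. LINT x:{-R..R}|lborel. A k x) \<longlonglongrightarrow> 0"
  unfolding A_def[abs_def]
  by (rule L2_null_weighted_L1_null_eventually[where d = "%k x. d k (t0, x)" and P = "%_. 0"];
    use dm lim0 in \<open>auto intro: borel_slice simp: set_integrable_const_Icc\<close>)+
 have B: "\<forall>\<^sub>F k in sequentially. set_integrable lborel Q (B k)" "(%k. LBINT z:Q. B k z) \<longlonglongrightarrow> 0"
  unfolding B_def[abs_def]
  by (rule L2_null_weighted_L1_null_eventually[where P = "%z. cmod (q z)"];
    use dm qm lim[of "(-b, -R)" "(b, R)"] q_L2[of "(-b, -R)" "(b, R)"] Q set_integrable_continuous_cbox[of "(-b, -R)" "(b, R)" "%_. 1::real"]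
    in \<open>auto simp: Q_def\<close>)+
 define \<eta> where "\<eta> = \<epsilon> / (8 * C)"
 have \<eta>: "\<eta> > 0" using \<epsilon> C(1) by (simp add: \<eta>_def)
 have "\<forall>\<^sub>F k in sequentially. set_integrable lborel {-R..R} (A k) \<and> (LINT x:{-R..R}|lborel. A k x) < \<eta> \<and>
   set_integrable lborel Q (B k) \<and> (LBINT z:Q. B k z) < \<eta>"
  using A(1) order_tendstoD(2)[OF A(2) \<eta>] B(1) order_tendstoD(2)[OF B(2) \<eta>] by eventually_elim simp
 then obtain N where N: "!!k. k \<ge> N ==> set_integrable lborel {-R..R} (A k) \<and> (LINT x:{-R..R}|lborel. A k x) < \<eta> \<and>
   set_integrable lborel Q (B k) \<and> (LBINT z:Q. B k z) < \<eta>"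
  unfolding eventually_sequentially by blast
 show ?thesis
 proof (intro exI[of _ N] allI impI ballI)
  fix k l t assume kl: "k \<ge> N" "l \<ge> N" and t: "t \<in> {-c..c}"
  have tT: "t \<in> {-T<..<T}" using t c by auto
  note Nk = N[OF kl(1)] and Nl = N[OF kl(2)]
  have dkl: "qk k z - qk l z = d k z - d l z" "qk k z = q z + d k z" "qk l z = q z + d l z" if "z \<in> strip T" for z
   using d[OF that, of k] d[OF that, of l] by auto
  have 1: "(LINT \<xi>:{-R..R}|lborel. cmod (qk k (t0, \<xi>) - qk l (t0, \<xi>))) <= (LINT \<xi>:{-R..R}|lborel. A k \<xi> + A l \<xi>)"
  proof (rule set_integral_mono_nonneg)
   show "set_integrable lborel {-R..R} (%\<xi>. A k \<xi> + A l \<xi>)" using Nk Nl by (intro set_integral_add) auto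
   fix \<xi>
   have "(t0, \<xi>) \<in> strip T" using t0 by (auto simp: strip_def)
   from dkl(1)[OF this] have "cmod (qk k (t0, \<xi>) - qk l (t0, \<xi>)) <= cmod (d k (t0, \<xi>)) + cmod (d l (t0, \<xi>))"
    by (simp add: norm_triangle_ineq4)
   also have "... <= A k \<xi> + A l \<xi>" unfolding A_def by (intro add_mono) (simp_all add: mult_le_cancel_left1)
   finally show "cmod (qk k (t0, \<xi>) - qk l (t0, \<xi>)) <= A k \<xi> + A l \<xi>" .
  qed simp
  have 2: "(LBINT z:Q. cmod (qk k z - qk l z) * (1 + cmod (qk k z) + cmod (qk l z))) <= (LBINT z:Q. 2 * (B k z + B l z))"
  proof (rule set_integral_mono_nonneg)
   show "set_integrable lborel Q (%z. 2 * (B k z + B l z))" using Nk Nl by (intro set_integrable_mult_right set_integral_add) auto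
   fix z assume "z \<in> Q"
   then have z: "z \<in> strip T" using Q by auto
   define m n p where "m = cmod (d k z)" and "n = cmod (d l z)" and "p = cmod (q z)"
   have "cmod (qk k z - qk l z) * (1 + cmod (qk k z) + cmod (qk l z)) <= (m + n) * (1 + (p + m) + (p + n))"
    unfolding dkl(1)[OF z] dkl(2,3)[OF z] m_def n_def p_def
    by (intro mult_mono add_mono norm_triangle_ineq) (auto intro: norm_triangle_ineq4)
   also have "... <= 2 * (m * (1 + p + m) + n * (1 + p + n))"
   proof -
    have "0 <= (m - n)\<^sup>2" "0 <= m" "0 <= n" by (simp_all add: m_def n_def)
    then show ?thesis by (simp add: power2_eq_square algebra_simps)
   qed
   finally show "cmod (qk k z - qk l z) * (1 + cmod (qk k z) + cmod (qk l z)) <= 2 * (B k z + B l z)"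
    by (simp add: B_def m_def n_def p_def)
  qed simp
  have "(LINT x:{-r..r}|lborel. (norm (y k (t, x) - y l (t, x)))\<^sup>2) <=
   C * ((LINT \<xi>:{-R..R}|lborel. cmod (qk k (t0, \<xi>) - qk l (t0, \<xi>))) +
    (LBINT z:Q. cmod (qk k z - qk l z) * (1 + cmod (qk k z) + cmod (qk l z))))"
   unfolding R_def Q_def
   by (rule C(2)[where T = T]) (use s y y0 b t in auto)
  also have "... <= C * ((\<eta> + \<eta>) + 2 * (\<eta> + \<eta>))"
  proof (intro mult_left_mono add_mono)
   show "(LINT \<xi>:{-R..R}|lborel. cmod (qk k (t0, \<xi>) - qk l (t0, \<xi>))) <= \<eta> + \<eta>"
    using 1 Nk Nl by (simp add: set_integral_add(2))
   show "(LBINT z:Q. cmod (qk k z - qk l z) * (1 + cmod (qk k z) + cmod (qk l z))) <= 2 * (\<eta> + \<eta>)"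
    using 2 Nk Nl by (simp add: set_integral_add(2))
  qed (use C in simp)
  also have "... <= \<epsilon>" using C(1) \<epsilon> by (simp add: \<eta>_def field_simps)
  finally have le: "(LINT x:{-r..r}|lborel. (norm (y k (t, x) - y l (t, x)))\<^sup>2) <= \<epsilon>" .
  have "L2_sq {-r<..<r} (%x. y k (t, x) - y l (t, x)) <= L2_sq {-r..r} (%x. y k (t, x) - y l (t, x))"
   unfolding L2_sq_def by (rule nn_integral_mono) (auto simp: indicator_def)
  also have "... = ennreal (LINT x:{-r..r}|lborel. (norm (y k (t, x) - y l (t, x)))\<^sup>2)"
  proof (rule L2_sq_of_integrable)
   have "continuous_on {-r..r} (%x. y k (t, x))" for k
    using strip_slices(1)[OF y[of k, unfolded parallel_section_def, THEN conjunct1] tT] by (rule continuous_on_subset) simp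
   then show "set_integrable lborel {-r..r} (%x. (norm (y k (t, x) - y l (t, x)))\<^sup>2)"
    unfolding set_integrable_def by (intro borel_integrable_compact compact_Icc continuous_intros) auto
  qed
  also have "... <= ennreal \<epsilon>" using le by (rule ennreal_leI)
  finally show "L2_sq {-r<..<r} (%x. y k (t, x) - y l (t, x)) <= ennreal \<epsilon>" .
 qed
qed

lemma integral_vec:
 fixes f :: "'a => real^3"
 assumes "!!i. has_bochner_integral M (%z. f z $ i) (v $ i)"
 shows "integrable M f" "(LINT z|M. f z) = v"
proof -
 have eq: "f z = (\<Sum>i\<in>UNIV. (f z $ i) *\<^sub>R axis i 1)" for z
  using basis_expansion[of "f z"] by (simp add: scalar_mult_eq_scaleR)
 have "integrable M (%z. \<Sum>i\<in>UNIV. (f z $ i) *\<^sub>R (axis i 1 :: real^3))"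
  using assms by (intro Bochner_Integration.integrable_sum integrable_scaleR_left) (auto simp: has_bochner_integral_iff)
 then show i: "integrable M f" unfolding eq[symmetric] .
 show "(LINT z|M. f z) = v"
 proof (subst vec_eq_iff, intro allI)
  fix i
  have "(LINT z|M. f z) $ i = (LINT z|M. f z $ i)"
   by (rule integral_bounded_linear[OF bounded_linear_vec_nth i, symmetric])
  then show "(LINT z|M. f z) $ i = v $ i" using assms[of i] by (simp add: has_bochner_integral_iff)
 qed
qed

text \<open>The form in which the single terms of the row equations pass to the limit.\<close>

lemma quadratic_weak_limit:
 fixes \<theta> w0 :: "real \<times> real => real" and w :: "nat => real \<times> real => real" and qs :: "nat => real \<times> real => complex"
 assumes C: "quadratic_lipschitz C"
  and \<theta>: "continuous_on UNIV \<theta>" "!!z. z \<notin> cbox a b ==> \<theta> z = 0"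
  and qm: "q \<in> borel_measurable borel" and q2: "set_integrable lborel (cbox a b) (%z. (cmod (q z))\<^sup>2)"
  and qs: "!!k. qs k \<in> borel_measurable borel" "!!k. continuous_on (cbox a b) (qs k)"
  and lim: "(%k. L2_sq (cbox a b) (%z. qs k z - q z)) \<longlonglongrightarrow> 0"
  and w: "!!k. w k \<in> borel_measurable borel" "!!k z. \<bar>w k z\<bar> <= 1" "w0 \<in> borel_measurable borel"
  and wlim: "AE z in lborel. z \<in> cbox a b --> (%k. w k z) \<longlonglongrightarrow> w0 z"
 obtains I I0 where "!!k. has_bochner_integral lborel (%z. \<theta> z * (C (qs k z) * w k z)) (I k)"
  "has_bochner_integral lborel (%z. \<theta> z * (C (q z) * w0 z)) I0" "I \<longlonglongrightarrow> I0"
proof -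
 obtain K0 where K0: "!!p p'. \<bar>C p - C p'\<bar> <= K0 * (cmod (p - p') * (1 + cmod p' + cmod (p - p')))" and Cc: "continuous_on UNIV C"
  using C unfolding quadratic_lipschitz_def by blast
 define K where "K = \<bar>K0\<bar>"
 have K: "\<bar>C p - C p'\<bar> <= K * (cmod (p - p') * (1 + cmod p' + cmod (p - p')))" for p p'
  using K0[of p p'] by (rule order_trans) (auto simp: K_def intro!: mult_right_mono)
 have Cm: "C \<in> borel_measurable borel" by (rule borel_measurable_continuous_onI[OF Cc])
 have one: "set_integrable lborel (cbox a b) (%_. 1::real)" by (rule set_integrable_continuous_cbox) simp
 define B where "B k z = cmod (qs k z - q z) * (1 + cmod (q z) + cmod (qs k z - q z))" for k z
 have B: "\<forall>\<^sub>F k in sequentially. set_integrable lborel (cbox a b) (B k)" "(%k. LBINT z:cbox a b. B k z) \<longlonglongrightarrow> 0"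
  unfolding B_def[abs_def]
  by (rule L2_null_weighted_L1_null_eventually[where d = "%k z. qs k z - q z" and P = "%z. cmod (q z)"];
    use qs qm q2 lim one in auto)+
 have ck: "set_integrable lborel (cbox a b) (%z. C (qs k z))" for k
  by (rule set_integrable_continuous_cbox, rule continuous_on_compose2[OF Cc qs(2)]) auto
 have c0: "set_integrable lborel (cbox a b) (%z. C (q z))"
  unfolding set_integrable_def
 proof (rule Bochner_Integration.integrable_bound)
  show "integrable lborel (%z. indicator (cbox a b) z *\<^sub>R ((\<bar>C 0\<bar> + K) * 1 + (2 * K) * (cmod (q z))\<^sup>2))"
   unfolding set_integrable_def[symmetric] by (intro set_integral_add set_integrable_mult_right one q2)
  show "(%z. indicator (cbox a b) z *\<^sub>R C (q z)) \<in> borel_measurable lborel"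
   using measurable_compose[OF qm Cm] by measurable
  have le: "\<bar>C p\<bar> <= (\<bar>C 0\<bar> + K) * 1 + (2 * K) * (cmod p)\<^sup>2" for p
  proof -
   have "\<bar>C p\<bar> <= \<bar>C 0\<bar> + K * (cmod p * (1 + cmod p))" using K[of p 0] by simp
   moreover have "m * (1 + m) <= 1 + 2 * m\<^sup>2" if "0 <= m" for m :: real
    using that sum_squares_bound[of 1 m] by (simp add: power2_eq_square algebra_simps)
   then have "K * (cmod p * (1 + cmod p)) <= K * (1 + 2 * (cmod p)\<^sup>2)" by (intro mult_left_mono) (auto simp: K_def)
   ultimately show ?thesis by (simp add: algebra_simps)
  qed
  show "AE z in lborel. norm (indicator (cbox a b) z *\<^sub>R C (q z)) <= norm (indicator (cbox a b) z *\<^sub>R ((\<bar>C 0\<bar> + K) * 1 + (2 * K) * (cmod (q z))\<^sup>2))"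
   by (rule AE_I2) (use le in \<open>auto simp: indicator_def intro: order_trans[OF _ abs_ge_self]\<close>)
 qed
 have clim: "(%k. LBINT z:cbox a b. \<bar>C (qs k z) - C (q z)\<bar>) \<longlonglongrightarrow> 0"
 proof (rule tendsto_sandwich[OF _ _ tendsto_const])
  show "(%k. K * (LBINT z:cbox a b. B k z)) \<longlonglongrightarrow> 0" using tendsto_mult_left[OF B(2), of K] by simp
  show "\<forall>\<^sub>F k in sequentially. 0 <= (LBINT z:cbox a b. \<bar>C (qs k z) - C (q z)\<bar>)"
   by (intro always_eventually allI) (simp add: set_lebesgue_integral_def)
  show "\<forall>\<^sub>F k in sequentially. (LBINT z:cbox a b. \<bar>C (qs k z) - C (q z)\<bar>) <= K * (LBINT z:cbox a b. B k z)"
   using B(1)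
  proof eventually_elim
   case (elim k)
   have "(LBINT z:cbox a b. \<bar>C (qs k z) - C (q z)\<bar>) <= (LBINT z:cbox a b. K * B k z)"
   proof (rule set_integral_mono_nonneg)
    show "set_integrable lborel (cbox a b) (%z. K * B k z)" using elim by (intro set_integrable_mult_right)
   qed (use K in \<open>auto simp: B_def\<close>)
   then show ?case by simp
  qed
 qed
 note L = weak_limit_product[OF \<theta> ck c0 clim w wlim]
 show ?thesis
  by (rule that[OF has_bochner_integral_integrable[OF L(2)] has_bochner_integral_integrable[OF L(3)] L(1)])
qed

lemma L2_sq_rows:
 fixes f :: "'a::euclidean_space => real^3^3"
 assumes fm: "f \<in> borel_measurable borel" and S: "S \<in> sets borel"
 shows "L2_sq S f = (\<Sum>i\<in>UNIV. L2_sq S (%x. f x $ i))"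
proof -
 have [measurable]: "(%x. f x $ i) \<in> borel_measurable borel" for i
  by (rule measurable_compose[OF fm borel_measurable_continuous_onI[OF continuous_on_component[OF continuous_on_id]]])
 have "(norm A)\<^sup>2 = (\<Sum>i\<in>UNIV. (norm (A $ i))\<^sup>2)" for A :: "real^3^3"
  by (subst norm_vec_def) (simp add: L2_set_def sum_nonneg)
 then have eq: "ennreal ((norm A)\<^sup>2) = (\<Sum>i\<in>UNIV. ennreal ((norm (A $ i))\<^sup>2))" for A :: "real^3^3" by simp
 have [measurable]: "S \<in> sets borel" by (rule S)
 have "L2_sq S f = (\<integral>\<^sup>+x. (\<Sum>i\<in>UNIV. ennreal ((norm (f x $ i))\<^sup>2) * indicator S x) \<partial>lborel)"
  unfolding L2_sq_def eq sum_distrib_right ..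
 also have "... = (\<Sum>i\<in>UNIV. L2_sq S (%x. f x $ i))"
  unfolding L2_sq_def by (intro nn_integral_sum) measurable
 finally show ?thesis .
qed

lemma norm_column_le: "norm (\<chi> i. A $ i $ j) <= norm (A :: real^3^3)"
proof -
 have "norm (\<chi> i. A $ i $ j) = L2_set (%i. norm (A $ i $ j)) UNIV" by (subst norm_vec_def) simp
 also have "... <= L2_set (%i. norm (A $ i)) UNIV" by (intro L2_set_mono) (auto intro: component_le_norm_cart)
 also have "... = norm A" by (rule norm_vec_def[symmetric])
 finally show ?thesis .
qed

lemma C_L2loc_column:
 fixes Y :: "real \<times> real => real^3^3"
 assumes Y: "C_L2loc T Y" and Ym: "Y \<in> borel_measurable borel"
 shows "(%z. \<chi> i. Y z $ i $ j) \<in> borel_measurable borel" "C_L2loc T (%z. \<chi> i. Y z $ i $ j)"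
proof -
 show m: "(%z. \<chi> i. Y z $ i $ j) \<in> borel_measurable borel"
  by (rule measurable_compose[OF Ym borel_measurable_continuous_onI])
   (intro continuous_on_vec_lambda continuous_on_component continuous_on_id)
 have diff: "(\<chi> i. A $ i $ j) - (\<chi> i. B $ i $ j) = (\<chi> i. (A - B) $ i $ j)" for A B :: "real^3^3"
  by (simp add: vec_eq_iff)
 have le: "norm ((\<chi> i. A $ i $ j) - (\<chi> i. B $ i $ j)) <= norm (A - B)" for A B :: "real^3^3"
  unfolding diff by (rule norm_column_le)
 show "C_L2loc T (%z. \<chi> i. Y z $ i $ j)"
  unfolding C_L2loc_def
 proof (intro conjI allI impI ballI)
  show "measurable_on_strip T (%z. \<chi> i. Y z $ i $ j)" unfolding measurable_on_strip_def using m by (rule measurable_restrict_space1)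
  fix r t :: real assume r: "r > 0" and t: "t \<in> {-T<..<T}"
  have "L2_sq {-r<..<r} (%x. \<chi> i. Y (t, x) $ i $ j) <= L2_sq {-r<..<r} (%x. Y (t, x))"
   by (rule L2_sq_mono_AE) (simp add: norm_column_le)
  moreover have "L2_sq {-r<..<r} (%x. Y (t, x)) < \<infinity>" using Y r t unfolding C_L2loc_def by blast
  ultimately show "L2_sq {-r<..<r} (%x. \<chi> i. Y (t, x) $ i $ j) < \<infinity>" by (rule le_less_trans)
  show "((%s. L2_sq {-r<..<r} (%x. (\<chi> i. Y (s, x) $ i $ j) - (\<chi> i. Y (t, x) $ i $ j))) \<longlongrightarrow> 0) (at t within {-T<..<T})"
  proof (rule tendsto_sandwich[OF _ _ tendsto_const])
   show "((%s. L2_sq {-r<..<r} (%x. Y (s, x) - Y (t, x))) \<longlongrightarrow> 0) (at t within {-T<..<T})"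
    using Y r t unfolding C_L2loc_def by blast
  qed (auto intro!: always_eventually L2_sq_mono_AE le)
 qed
qed

text \<open>The frames of the approximating solutions, normalised at a point of a good slice, converge along a subsequence, and
  their equations pass to the limit term by term. The equation for \<open>u \<times> e\<close> gives a meaning to its product with \<open>p\<^sub>2\<close>.\<close>

lemma weak_frame_exists:
 fixes q :: "real \<times> real => complex" and qk :: "nat => real \<times> real => complex"
 assumes T: "T > 0" and qm: "q \<in> borel_measurable borel"
  and q_L2: "!!a b. cbox a b <= strip T ==> set_integrable lborel (cbox a b) (%z. (cmod (q z))\<^sup>2)"
  and nls: "!!k. smooth_NLS_solution T (qk k)"
  and lim: "!!a b. cbox a b <= strip T ==> (%k. L2_sq (cbox a b) (%z. qk k z - q z)) \<longlonglongrightarrow> 0"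
 obtains u e where "weak_frame T q u e"
  "!!\<phi>. test_function (strip T) \<phi> ==>
   (LBINT z. dx \<phi> z *\<^sub>R (u z \<times> e z)) = - (LBINT z. \<phi> z *\<^sub>R (- Im (q z) *\<^sub>R u z))"
proof -
 note s = smooth_NLS_smooth[OF nls]
 have sb: "strip T \<in> sets borel" by (intro borel_open open_strip)
 define qh where "qh k z = (if z \<in> strip T then qk k z else 0)" for k z
 have qhm: "qh k \<in> borel_measurable borel" for k
  unfolding qh_def[abs_def] by (rule borel_measurable_continuous_on_if[OF sb smooth_on_continuous[OF s]]) simp
 have qhc: "continuous_on (cbox a b) (qh k)" if "cbox a b <= strip T" for a b k
  using continuous_on_subset[OF smooth_on_continuous[OF s, of k] that]
  by (rule continuous_on_eq) (use that in \<open>auto simp: qh_def\<close>)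
 define d where "d k z = qh k z - q z" for k z
 have dm: "d k \<in> borel_measurable borel" for k unfolding d_def[abs_def] using qhm qm by measurable
 have dlim: "(%k. L2_sq (cbox a b) (d k)) \<longlonglongrightarrow> 0" if "cbox a b <= strip T" for a b
 proof -
  have "L2_sq (cbox a b) (d k) = L2_sq (cbox a b) (%z. qk k z - q z)" for k
   unfolding L2_sq_def by (rule nn_integral_cong) (use that in \<open>auto simp: d_def qh_def indicator_def\<close>)
  then show ?thesis using lim[OF that] by simp
 qed
 obtain r1 :: "nat => nat" and t0 where r1: "strict_mono r1" and t0: "t0 \<in> {-T<..<T}"
  and slice: "!!R. (%k. L2_sq {-R..R} (%x. d (r1 k) (t0, x))) \<longlonglongrightarrow> 0"
  using L2_null_good_slice[of T d, OF T dm dlim] by blast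
 have "\<forall>k. \<exists>y. frame_rows T (qk (r1 k)) t0 y" using smooth_NLS_frame_rows[OF nls t0] by blast
 then obtain y where y: "!!k. frame_rows T (qk (r1 k)) t0 (y k)" by metis
 then have yp: "!!k i. parallel_section T (qk (r1 k)) (y k i)" and y0: "!!k i. y k i (t0, 0) = axis i 1"
  unfolding frame_rows_def by blast+
 define M where "M k z = (if z \<in> strip T then (\<chi> i. y k i z) else 0 :: real^3^3)" for k z
 have Mi: "M k z $ i = y k i z" if "z \<in> strip T" for k z i using that by (simp add: M_def)
 have yc: "continuous_on (strip T) (%z. (\<chi> i. y k i z) :: real^3^3)" for k
  by (rule continuous_on_vec_lambda) (use yp in \<open>auto simp: parallel_section_def\<close>)
 have Mm: "M k \<in> borel_measurable borel" for k
  unfolding M_def[abs_def] by (rule borel_measurable_continuous_on_if[OF sb yc]) simp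
 have MC: "C_L2loc T (M k)" for k
  by (rule C_L2loc_continuous[OF _ Mm], rule continuous_on_eq[OF yc]) (simp add: M_def)
 have M1: "\<bar>M k z $ i $ j\<bar> <= 1" for k z i j
 proof (cases "z \<in> strip T")
  case True
  obtain t x where z: "z = (t, x)" by (cases z)
  have "t \<in> {-T<..<T}" using True by (auto simp: z strip_def)
  then have "norm (y k i z) = 1" using yp[of k i] unfolding parallel_section_def z by blast
  then show ?thesis using component_le_norm_cart[of "y k i z" j] by (simp add: Mi[OF True])
 qed (simp add: M_def)
 have cauchy: "\<exists>N. \<forall>k\<ge>N. \<forall>l\<ge>N. \<forall>t\<in>{-c..c}. L2_sq {-\<rho><..<\<rho>} (%x. M k (t, x) - M l (t, x)) <= ennreal \<epsilon>"
  if c: "0 < c" "c < T" "0 < \<rho>" "0 < \<epsilon>" for c \<rho> \<epsilon>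
 proof -
  have "\<exists>N. \<forall>k\<ge>N. \<forall>l\<ge>N. \<forall>t\<in>{-c..c}. L2_sq {-\<rho><..<\<rho>} (%x. y k i (t, x) - y l i (t, x)) <= ennreal (\<epsilon> / 3)" for i
  proof (rule parallel_sections_cauchy[where q = q and T = T and qk = "%k. qk (r1 k)" and y = "%k. y k i" and d = "%k. d (r1 k)" and ?t0.0 = t0])
   show "(%k. L2_sq (cbox a b) (d (r1 k))) \<longlonglongrightarrow> 0" if "cbox a b <= strip T" for a b
    using LIMSEQ_subseq_LIMSEQ[OF dlim[OF that] r1] by (simp add: o_def)
  qed (use qm q_L2 s yp y0 t0 dm slice c in \<open>auto simp: d_def qh_def\<close>)
  then have "\<exists>N. \<forall>i. \<forall>k\<ge>N i. \<forall>l\<ge>N i. \<forall>t\<in>{-c..c}. L2_sq {-\<rho><..<\<rho>} (%x. y k i (t, x) - y l i (t, x)) <= ennreal (\<epsilon> / 3)"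
   by (intro choice allI)
  then obtain N where N: "\<forall>i. \<forall>k\<ge>N i. \<forall>l\<ge>N i. \<forall>t\<in>{-c..c}. L2_sq {-\<rho><..<\<rho>} (%x. y k i (t, x) - y l i (t, x)) <= ennreal (\<epsilon> / 3)" ..
  show ?thesis
  proof (intro exI[of _ "N 1 + N 2 + N 3"] allI impI ballI)
   fix k l t assume kl: "k \<ge> N 1 + N 2 + N 3" "l \<ge> N 1 + N 2 + N 3" and t: "t \<in> {-c..c}"
   have st: "(t, x) \<in> strip T" for x using t c by (auto simp: strip_def)
   have N': "N i <= N 1 + N 2 + N 3" for i using exhaust_3[of i] by auto
   have "(%x. M k (t, x) - M l (t, x)) \<in> borel_measurable borel"
    using borel_slice[OF Mm] by measurable
   from L2_sq_rows[OF this]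
   have "L2_sq {-\<rho><..<\<rho>} (%x. M k (t, x) - M l (t, x)) = (\<Sum>i\<in>UNIV. L2_sq {-\<rho><..<\<rho>} (%x. y k i (t, x) - y l i (t, x)))"
    by (simp add: Mi[OF st])
   also have "... <= (\<Sum>i\<in>(UNIV::3 set). ennreal (\<epsilon> / 3))"
   proof (rule sum_mono)
    fix i :: 3
    have "N i <= k" "N i <= l" using kl N'[of i] by auto
    then show "L2_sq {-\<rho><..<\<rho>} (%x. y k i (t, x) - y l i (t, x)) <= ennreal (\<epsilon> / 3)" using N t by blast
   qed
   also have "... = ennreal (\<Sum>i\<in>(UNIV::3 set). \<epsilon> / 3)" using c by (intro sum_ennreal) auto
   also have "... = ennreal \<epsilon>" by simp
   finally show "L2_sq {-\<rho><..<\<rho>} (%x. M k (t, x) - M l (t, x)) <= ennreal \<epsilon>" .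
  qed
 qed
 obtain r2 :: "nat => nat" and Y where r2: "strict_mono r2" and Ym: "Y \<in> borel_measurable borel" and YC: "C_L2loc T Y"
  and Ylim: "AE z in lborel. z \<in> strip T --> (%k. M (r2 k) z) \<longlonglongrightarrow> Y z"
 proof (rule C_L2loc_complete[of T M])
  fix r :: "nat => nat" and Y :: "real \<times> real => real^3^3"
  assume *: "strict_mono r" "Y \<in> borel_measurable borel" "C_L2loc T Y" "AE z in lborel. z \<in> strip T --> (%k. M (r k) z) \<longlonglongrightarrow> Y z"
  show thesis by (rule that[OF *])
 next
  show "\<exists>N. \<forall>k\<ge>N. \<forall>l\<ge>N. \<forall>t\<in>{-c..c}. L2_sq {-\<rho><..<\<rho>} (%x. M k (t, x) - M l (t, x)) <= ennreal \<epsilon>"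
   if "0 < c" "c < T" "0 < \<rho>" "0 < \<epsilon>" for c \<rho> \<epsilon> by (rule cauchy[OF that])
 qed (rule T Mm MC)+
 define u where "u z = (\<chi> i. Y z $ i $ 1)" for z
 define e where "e z = (\<chi> i. Y z $ i $ 2)" for z
 note um = C_L2loc_column(1)[OF YC Ym, of 1, folded u_def] and em = C_L2loc_column(1)[OF YC Ym, of 2, folded e_def]
 note uC = C_L2loc_column(2)[OF YC Ym, of 1, folded u_def] and eC = C_L2loc_column(2)[OF YC Ym, of 2, folded e_def]
 define col where "col j k z = (\<chi> i. M (r2 k) z $ i $ j)" for j k z
 have colM: "orthonormal_pair (col 1 k z) (col 2 k z)" "col 3 k z = col 1 k z \<times> col 2 k z" if "z \<in> strip T" for k z
  using y[of "r2 k"] that unfolding frame_rows_def by (auto simp: col_def Mi)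
 have lims: "AE z in lborel. z \<in> strip T -->
  (%k. col 1 k z) \<longlonglongrightarrow> u z \<and> (%k. col 2 k z) \<longlonglongrightarrow> e z \<and> (%k. col 3 k z) \<longlonglongrightarrow> u z \<times> e z"
  using Ylim
 proof (rule eventually_mono, intro impI)
  fix z assume "z \<in> strip T --> (%k. M (r2 k) z) \<longlonglongrightarrow> Y z" and z: "z \<in> strip T"
  then have L: "(%k. M (r2 k) z) \<longlonglongrightarrow> Y z" by blast
  have 1: "(%k. col 1 k z) \<longlonglongrightarrow> u z" unfolding col_def u_def by (intro tendsto_vec_lambda tendsto_vec_nth L)
  have 2: "(%k. col 2 k z) \<longlonglongrightarrow> e z" unfolding col_def e_def by (intro tendsto_vec_lambda tendsto_vec_nth L)
  have "bounded_bilinear (\<times>)" using bilinear_cross bilinear_conv_bounded_bilinear by blast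
  from bounded_bilinear.tendsto[OF this 1 2] have "(%k. col 3 k z) \<longlonglongrightarrow> u z \<times> e z"
   by (simp add: colM(2)[OF z])
  with 1 2 show "(%k. col 1 k z) \<longlonglongrightarrow> u z \<and> (%k. col 2 k z) \<longlonglongrightarrow> e z \<and> (%k. col 3 k z) \<longlonglongrightarrow> u z \<times> e z" by blast
 qed
 have onf: "AE z in lborel. z \<in> strip T --> orthonormal_pair (u z) (e z)"
  using lims
 proof (rule eventually_mono, intro impI)
  fix z assume *: "z \<in> strip T -->
   (%k. col 1 k z) \<longlonglongrightarrow> u z \<and> (%k. col 2 k z) \<longlonglongrightarrow> e z \<and> (%k. col 3 k z) \<longlonglongrightarrow> u z \<times> e z" and z: "z \<in> strip T"
  then have L: "(%k. col 1 k z) \<longlonglongrightarrow> u z" "(%k. col 2 k z) \<longlonglongrightarrow> e z" by auto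
  have "(%k. norm (col 1 k z)) \<longlonglongrightarrow> norm (u z)" "(%k. norm (col 2 k z)) \<longlonglongrightarrow> norm (e z)"
   "(%k. col 1 k z \<bullet> col 2 k z) \<longlonglongrightarrow> u z \<bullet> e z" by (intro tendsto_intros L)+
  then show "orthonormal_pair (u z) (e z)"
   using colM(1)[OF z] unfolding orthonormal_pair_def by (simp add: LIMSEQ_const_iff)
 qed
 define F where "F j z = (if j = (1::3) then u z else if j = 2 then e z else u z \<times> e z)" for j z
 have F: "F 1 = u" "F 2 = e" "F 3 = (%z. u z \<times> e z)" by (auto simp: F_def)
 have Fm: "F j \<in> borel_measurable borel" for j
  using exhaust_3[of j] um em borel_measurable_cross[OF um em] by (auto simp: F)
 have Flim: "AE z in lborel. z \<in> strip T --> (%k. M (r2 k) z $ i $ j) \<longlonglongrightarrow> F j z $ i" for i j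
  using lims
 proof (rule eventually_mono, intro impI)
  fix z assume *: "z \<in> strip T -->
   (%k. col 1 k z) \<longlonglongrightarrow> u z \<and> (%k. col 2 k z) \<longlonglongrightarrow> e z \<and> (%k. col 3 k z) \<longlonglongrightarrow> u z \<times> e z" and z: "z \<in> strip T"
  then have "(%k. col j k z) \<longlonglongrightarrow> F j z" using exhaust_3[of j] by (auto simp: F)
  from tendsto_vec_nth[OF this, of i] show "(%k. M (r2 k) z $ i $ j) \<longlonglongrightarrow> F j z $ i" by (simp add: col_def)
 qed
 define qs where "qs k = qh (r1 (r2 k))" for k
 have yW: "y (r2 k) i z = M (r2 k) z $ i" "qk (r1 (r2 k)) z = qs k z" if "z \<in> strip T" for k i z
  using that by (auto simp: Mi qs_def qh_def)
 {
  fix \<phi> assume \<phi>: "test_function (strip T) \<phi>"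
  obtain c R where cR: "0 < c" "c < T" "0 < R" and \<phi>0: "!!z. \<bar>fst z\<bar> \<ge> c \<or> \<bar>snd z\<bar> \<ge> R ==> \<phi> z = 0"
   and d0: "!!z v. z \<notin> cbox (-c, -R) (c, R) ==> dderiv v \<phi> z = 0" and \<phi>s: "smooth_on UNIV \<phi>"
   using test_function_in_box[OF \<phi> T] by metis
  have Q: "cbox (-c, -R) (c, R) <= strip T" using cR by (intro cbox_subset_strip) auto
  have \<phi>Q: "\<phi> z = 0" if "z \<notin> cbox (-c, -R) (c, R)" for z by (rule \<phi>0) (use that in \<open>cases z, auto\<close>)
  define ok where "ok \<theta> \<longleftrightarrow> continuous_on UNIV \<theta> \<and> (\<forall>z. z \<notin> cbox (-c, -R) (c, R) --> \<theta> z = (0::real))" for \<theta>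
  have ok: "ok \<phi>" "ok (dt \<phi>)" "ok (dx \<phi>)"
   unfolding ok_def using \<phi>Q d0 smooth_on_continuous[OF \<phi>s] smooth_on_continuous[OF smooth_on_dderiv[OF \<phi>s]] by auto
  define Ik where "Ik k \<theta> C j i = (LBINT z. \<theta> z * (C (qs k z) * (M (r2 k) z $ i $ j)))" for k \<theta> C j i
  define I where "I \<theta> C j i = (LBINT z. \<theta> z * (C (q z) * (F j z $ i)))" for \<theta> C j i
  have Q': "(%k. L2_sq (cbox (-c, -R) (c, R)) (%z. qs k z - q z)) \<longlonglongrightarrow> 0"
   using LIMSEQ_subseq_LIMSEQ[OF dlim[OF Q] strict_mono_o[OF r1 r2]] by (simp add: o_def qs_def d_def[abs_def])
  have weak_limit: "has_bochner_integral lborel (%z. \<theta> z * (C (qs k z) * (M (r2 k) z $ i $ j))) (Ik k \<theta> C j i) \<and>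
    has_bochner_integral lborel (%z. \<theta> z * (C (q z) * (F j z $ i))) (I \<theta> C j i) \<and> (%k. Ik k \<theta> C j i) \<longlonglongrightarrow> I \<theta> C j i"
   if \<theta>: "ok \<theta>" and C: "quadratic_lipschitz C" for \<theta> C i j k
  proof -
   have cm: "(%A. A $ i) \<in> borel_measurable borel" for i and A :: "real^3^3"
    by (intro borel_measurable_continuous_onI continuous_on_component continuous_on_id)
   obtain J J0 where J: "!!k. has_bochner_integral lborel (%z. \<theta> z * (C (qs k z) * (M (r2 k) z $ i $ j))) (J k)"
    "has_bochner_integral lborel (%z. \<theta> z * (C (q z) * (F j z $ i))) J0" "J \<longlonglongrightarrow> J0"
   proof (rule quadratic_weak_limit[OF C, of \<theta> "(-c, -R)" "(c, R)" q qs "%k z. M (r2 k) z $ i $ j" "%z. F j z $ i"])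
    show "(%z. M (r2 k) z $ i $ j) \<in> borel_measurable borel" for k
     by (rule measurable_compose[OF Mm]) (intro borel_measurable_continuous_onI continuous_on_component continuous_on_id)
    show "(%z. F j z $ i) \<in> borel_measurable borel"
     by (rule measurable_compose[OF Fm]) (intro borel_measurable_continuous_onI continuous_on_component continuous_on_id)
    show "AE z in lborel. z \<in> cbox (-c, -R) (c, R) --> (%k. M (r2 k) z $ i $ j) \<longlonglongrightarrow> F j z $ i"
     using Flim[of i j] by (rule eventually_mono) (use Q in auto)
    show "continuous_on UNIV \<theta>" "!!z. z \<notin> cbox (-c, -R) (c, R) ==> \<theta> z = 0" using \<theta> unfolding ok_def by blast+
   qed (use qm q_L2[OF Q] qhm qhc[OF Q] Q' M1 in \<open>auto simp: qs_def\<close>)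
   have "Ik k \<theta> C j i = J k" for k unfolding Ik_def using J(1) by (rule has_bochner_integral_integral_eq)
   moreover have "I \<theta> C j i = J0" unfolding I_def using J(2) by (rule has_bochner_integral_integral_eq)
   ultimately show ?thesis using J by simp
  qed
  note hk = weak_limit[THEN conjunct1] and h0 = weak_limit[THEN conjunct2, THEN conjunct1] and hlim = weak_limit[THEN conjunct2, THEN conjunct2]
  note ql = quadratic_lipschitz_const[of 1] quadratic_lipschitz_Re_Im quadratic_lipschitz_quadratic
  have zero: "v = 0" if "has_bochner_integral lborel g v" "(LBINT z. f z) = 0" "!!z. z \<in> cbox (-c, -R) (c, R) ==> f z = g z"
   "!!z. z \<notin> cbox (-c, -R) (c, R) ==> f z = 0 \<and> g z = 0" for f g :: "real \<times> real => real" and v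
  proof -
   have "f = g" by (rule ext) (metis that(3,4))
   then show ?thesis using that(1,2) by (simp add: has_bochner_integral_integral_eq)
  qed
  note W = parallel_section_weak_equations[OF nls yp \<phi> T]
  have W1: "I (dt \<phi>) (%_. 1) 1 i = I (dx \<phi>) Re 3 i - I (dx \<phi>) Im 2 i" for i
  proof -
   have "Ik k (dt \<phi>) (%_. 1) 1 i + Ik k (dx \<phi>) Im 2 i - Ik k (dx \<phi>) Re 3 i = 0" for k
    by (rule zero[OF has_bochner_integral_diff[OF has_bochner_integral_add[OF hk[OF ok(2) ql(1)] hk[OF ok(3) ql(3)]] hk[OF ok(3) ql(2)]] W(1)[of "r2 k" i]])
     (use Q in \<open>auto simp: yW d0 \<phi>Q algebra_simps dest!: subsetD\<close>)
   moreover have "(%k. Ik k (dt \<phi>) (%_. 1) 1 i + Ik k (dx \<phi>) Im 2 i - Ik k (dx \<phi>) Re 3 i) \<longlonglongrightarrow>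
     I (dt \<phi>) (%_. 1) 1 i + I (dx \<phi>) Im 2 i - I (dx \<phi>) Re 3 i"
    by (intro tendsto_add tendsto_diff hlim ok ql)
   ultimately show ?thesis by (simp add: LIMSEQ_const_iff)
  qed
  have W2: "I (dx \<phi>) (%_. 1) 1 i = - (I \<phi> Re 2 i + I \<phi> Im 3 i)" for i
  proof -
   have "Ik k (dx \<phi>) (%_. 1) 1 i + Ik k \<phi> Re 2 i + Ik k \<phi> Im 3 i = 0" for k
    by (rule zero[OF has_bochner_integral_add[OF has_bochner_integral_add[OF hk[OF ok(3) ql(1)] hk[OF ok(1) ql(2)]] hk[OF ok(1) ql(3)]] W(2)[of "r2 k" i]])
     (use Q in \<open>auto simp: yW d0 \<phi>Q algebra_simps dest!: subsetD\<close>)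
   moreover have "(%k. Ik k (dx \<phi>) (%_. 1) 1 i + Ik k \<phi> Re 2 i + Ik k \<phi> Im 3 i) \<longlonglongrightarrow>
     I (dx \<phi>) (%_. 1) 1 i + I \<phi> Re 2 i + I \<phi> Im 3 i"
    by (intro tendsto_add tendsto_diff hlim ok ql)
   ultimately show ?thesis by (simp add: LIMSEQ_const_iff)
  qed
  have W3: "I (dt \<phi>) (%_. 1) 2 i = I (dx \<phi>) Im 1 i +
    (I \<phi> (%p. Im p * Re p) 2 i + I \<phi> (%p. Im p * Im p) 3 i + I \<phi> (%p. (cmod p)\<^sup>2 / 2) 3 i)" for i
  proof -
   have "Ik k (dt \<phi>) (%_. 1) 2 i - (Ik k (dx \<phi>) Im 1 i +
    (Ik k \<phi> (%p. Im p * Re p) 2 i + Ik k \<phi> (%p. Im p * Im p) 3 i + Ik k \<phi> (%p. (cmod p)\<^sup>2 / 2) 3 i)) = 0" for k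
    by (rule zero[OF has_bochner_integral_diff[OF hk[OF ok(2) ql(1)] has_bochner_integral_add[OF hk[OF ok(3) ql(3)]
      has_bochner_integral_add[OF has_bochner_integral_add[OF hk[OF ok(1) ql(4)] hk[OF ok(1) ql(5)]] hk[OF ok(1) ql(6)]]]] W(3)[of "r2 k" i]])
     (use Q in \<open>auto simp: yW d0 \<phi>Q algebra_simps dest!: subsetD\<close>)
   moreover have "(%k. Ik k (dt \<phi>) (%_. 1) 2 i - (Ik k (dx \<phi>) Im 1 i +
    (Ik k \<phi> (%p. Im p * Re p) 2 i + Ik k \<phi> (%p. Im p * Im p) 3 i + Ik k \<phi> (%p. (cmod p)\<^sup>2 / 2) 3 i))) \<longlonglongrightarrow>
    I (dt \<phi>) (%_. 1) 2 i - (I (dx \<phi>) Im 1 i +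
    (I \<phi> (%p. Im p * Re p) 2 i + I \<phi> (%p. Im p * Im p) 3 i + I \<phi> (%p. (cmod p)\<^sup>2 / 2) 3 i))"
    by (intro tendsto_add tendsto_diff hlim ok ql)
   ultimately show ?thesis by (simp add: LIMSEQ_const_iff)
  qed
  have W4: "I (dx \<phi>) (%_. 1) 2 i = I \<phi> Re 1 i" for i
  proof -
   have "Ik k (dx \<phi>) (%_. 1) 2 i - Ik k \<phi> Re 1 i = 0" for k
    by (rule zero[OF has_bochner_integral_diff[OF hk[OF ok(3) ql(1)] hk[OF ok(1) ql(2)]] W(4)[of "r2 k" i]])
     (use Q in \<open>auto simp: yW d0 \<phi>Q algebra_simps dest!: subsetD\<close>)
   moreover have "(%k. Ik k (dx \<phi>) (%_. 1) 2 i - Ik k \<phi> Re 1 i) \<longlonglongrightarrow> I (dx \<phi>) (%_. 1) 2 i - I \<phi> Re 1 i"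
    by (intro tendsto_add tendsto_diff hlim ok ql)
   ultimately show ?thesis by (simp add: LIMSEQ_const_iff)
  qed
  have W5: "I (dx \<phi>) (%_. 1) 3 i = I \<phi> Im 1 i" for i
  proof -
   have "Ik k (dx \<phi>) (%_. 1) 3 i - Ik k \<phi> Im 1 i = 0" for k
    by (rule zero[OF has_bochner_integral_diff[OF hk[OF ok(3) ql(1)] hk[OF ok(1) ql(3)]] W(5)[of "r2 k" i]])
     (use Q in \<open>auto simp: yW d0 \<phi>Q algebra_simps dest!: subsetD\<close>)
   moreover have "(%k. Ik k (dx \<phi>) (%_. 1) 3 i - Ik k \<phi> Im 1 i) \<longlonglongrightarrow> I (dx \<phi>) (%_. 1) 3 i - I \<phi> Im 1 i"
    by (intro tendsto_add tendsto_diff hlim ok ql)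
   ultimately show ?thesis by (simp add: LIMSEQ_const_iff)
  qed
  have vec: "(LBINT z. f z) = v" if "!!i. has_bochner_integral lborel (g i) (v $ i)" "!!z i. f z $ i = g i z"
   for f :: "real \<times> real => real^3" and g v
   by (rule integral_vec(2)) (use that in simp)
  have "(LBINT z. dt \<phi> z *\<^sub>R u z) = (\<chi> i. I (dt \<phi>) (%_. 1) 1 i)"
   by (rule vec, simp only: vec_lambda_beta, rule h0[OF ok(2) ql(1)]) (simp add: F)
  moreover have "(LBINT z. dx \<phi> z *\<^sub>R (Re (q z) *\<^sub>R (u z \<times> e z) - Im (q z) *\<^sub>R e z)) = (\<chi> i. I (dx \<phi>) Re 3 i - I (dx \<phi>) Im 2 i)"
   by (rule vec, simp only: vec_lambda_beta, rule has_bochner_integral_diff[OF h0[OF ok(3) ql(2)] h0[OF ok(3) ql(3)]]) (simp add: F algebra_simps)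
  ultimately have E1: "(LBINT z. dt \<phi> z *\<^sub>R u z) = (LBINT z. dx \<phi> z *\<^sub>R (Re (q z) *\<^sub>R (u z \<times> e z) - Im (q z) *\<^sub>R e z))"
   by (simp add: W1)
  have dx_u: "(LBINT z. dx \<phi> z *\<^sub>R u z) = (\<chi> i. I (dx \<phi>) (%_. 1) 1 i)"
   by (rule vec, simp only: vec_lambda_beta, rule h0[OF ok(3) ql(1)]) (simp add: F)
  have "(LBINT z. \<phi> z *\<^sub>R (Re (q z) *\<^sub>R e z + Im (q z) *\<^sub>R (u z \<times> e z))) = (\<chi> i. I \<phi> Re 2 i + I \<phi> Im 3 i)"
   by (rule vec, simp only: vec_lambda_beta, rule has_bochner_integral_add[OF h0[OF ok(1) ql(2)] h0[OF ok(1) ql(3)]]) (simp add: F algebra_simps)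
  with dx_u have E2: "(LBINT z. dx \<phi> z *\<^sub>R u z) = - (LBINT z. \<phi> z *\<^sub>R (Re (q z) *\<^sub>R e z + Im (q z) *\<^sub>R (u z \<times> e z)))"
   by (simp add: W2 vec_eq_iff)
  have "(LBINT z. dt \<phi> z *\<^sub>R e z) = (\<chi> i. I (dt \<phi>) (%_. 1) 2 i)"
   by (rule vec, simp only: vec_lambda_beta, rule h0[OF ok(2) ql(1)]) (simp add: F)
  moreover have "(LBINT z. dx \<phi> z *\<^sub>R (Im (q z) *\<^sub>R u z)) = (\<chi> i. I (dx \<phi>) Im 1 i)"
   by (rule vec, simp only: vec_lambda_beta, rule h0[OF ok(3) ql(3)]) (simp add: F)
  moreover have "(LBINT z. \<phi> z *\<^sub>R (Im (q z) *\<^sub>R (Re (q z) *\<^sub>R e z + Im (q z) *\<^sub>R (u z \<times> e z)) + ((cmod (q z))\<^sup>2 / 2) *\<^sub>R (u z \<times> e z)))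
    = (\<chi> i. I \<phi> (%p. Im p * Re p) 2 i + I \<phi> (%p. Im p * Im p) 3 i + I \<phi> (%p. (cmod p)\<^sup>2 / 2) 3 i)"
   by (rule vec, simp only: vec_lambda_beta, rule has_bochner_integral_add[OF has_bochner_integral_add[OF h0[OF ok(1) ql(4)] h0[OF ok(1) ql(5)]] h0[OF ok(1) ql(6)]])
    (simp add: F algebra_simps)
  ultimately have E3: "(LBINT z. dt \<phi> z *\<^sub>R e z) = (LBINT z. dx \<phi> z *\<^sub>R (Im (q z) *\<^sub>R u z)) +
   (LBINT z. \<phi> z *\<^sub>R (Im (q z) *\<^sub>R (Re (q z) *\<^sub>R e z + Im (q z) *\<^sub>R (u z \<times> e z)) + ((cmod (q z))\<^sup>2 / 2) *\<^sub>R (u z \<times> e z)))"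
   by (simp add: W3 vec_eq_iff)
  have "(LBINT z. dx \<phi> z *\<^sub>R e z) = (\<chi> i. I (dx \<phi>) (%_. 1) 2 i)"
   by (rule vec, simp only: vec_lambda_beta, rule h0[OF ok(3) ql(1)]) (simp add: F)
  moreover have "(LBINT z. \<phi> z *\<^sub>R (- Re (q z) *\<^sub>R u z)) = (\<chi> i. - I \<phi> Re 1 i)"
   by (rule vec, simp only: vec_lambda_beta, rule has_bochner_integral_minus[OF h0[OF ok(1) ql(2)]]) (simp add: F)
  ultimately have E4: "(LBINT z. dx \<phi> z *\<^sub>R e z) = - (LBINT z. \<phi> z *\<^sub>R (- Re (q z) *\<^sub>R u z))"
   by (simp add: W4 vec_eq_iff)
  have "(LBINT z. dx \<phi> z *\<^sub>R (u z \<times> e z)) = (\<chi> i. I (dx \<phi>) (%_. 1) 3 i)"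
   by (rule vec, simp only: vec_lambda_beta, rule h0[OF ok(3) ql(1)]) (simp add: F)
  moreover have "(LBINT z. \<phi> z *\<^sub>R (- Im (q z) *\<^sub>R u z)) = (\<chi> i. - I \<phi> Im 1 i)"
   by (rule vec, simp only: vec_lambda_beta, rule has_bochner_integral_minus[OF h0[OF ok(1) ql(3)]]) (simp add: F)
  ultimately have E5: "(LBINT z. dx \<phi> z *\<^sub>R (u z \<times> e z)) = - (LBINT z. \<phi> z *\<^sub>R (- Im (q z) *\<^sub>R u z))"
   by (simp add: W5 vec_eq_iff)
  note E1 E2 E3 E4 E5
 }
 note E = this
 have "weak_frame T q u e"
 proof unfold_locales
  show "frame_equations T q u e" unfolding frame_equations_def using E(1-4) by blast
 qed (use qm um em q_L2 onf uC eC in auto)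
 then show ?thesis using E(5) by (rule that)
qed

section \<open>Weak frames and solution pairs\<close>

lemma strip_borel: "strip T \<in> sets borel" by (intro borel_open open_strip)

lemma locally_integrable_on_strip:
 fixes f :: "real \<times> real => 'b::euclidean_space"
 assumes T: "T > 0"
 shows "locally_integrable_on (strip T) f \<longleftrightarrow> (\<forall>a b. cbox a b <= strip T --> set_integrable lborel (cbox a b) f)"
proof
 assume f: "\<forall>a b. cbox a b <= strip T --> set_integrable lborel (cbox a b) f"
 show "locally_integrable_on (strip T) f"
  unfolding locally_integrable_on_def
 proof (intro allI impI)
  fix K :: "(real \<times> real) set" assume K: "compact K \<and> K <= strip T"
  obtain c R where c: "0 < c" "c < T" "0 < R" "\<forall>z\<in>K. \<bar>fst z\<bar> < c \<and> \<bar>snd z\<bar> < R"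
   using compact_strip_box[of K T] K T by metis
  have "K <= cbox (-c, -R) (c, R)"
  proof
   fix z assume "z \<in> K"
   then show "z \<in> cbox (-c, -R) (c, R)" using c(4) by (cases z) (force simp: abs_less_iff)
  qed
  moreover have "K \<in> sets lborel" using K by (auto intro: borel_closed compact_imp_closed)
  moreover have "set_integrable lborel (cbox (-c, -R) (c, R)) f"
   using f cbox_subset_strip[of T "-c" c "-R" R] c by auto
  ultimately show "set_integrable lborel K f"
   by (intro set_integrable_subset[of lborel "cbox (-c, -R) (c, R)" f K])
 qed
qed (auto simp: locally_integrable_on_def)

lemma test_function_outside:
 assumes \<phi>: "test_function (strip T) \<phi>" and z: "z \<notin> strip T"
 shows "\<phi> z = 0" "dderiv v \<phi> z = 0"
proof -
 have *: "\<phi> x = 0" if "x \<notin> closure {z. \<phi> z \<noteq> 0}" for x using that closure_subset[of "{z. \<phi> z \<noteq> 0}"] by auto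
 have z: "z \<notin> closure {z. \<phi> z \<noteq> 0}" using \<phi> z by (auto simp: test_function_def)
 then show "\<phi> z = 0" by (rule *)
 show "dderiv v \<phi> z = 0" by (rule dderiv_support[OF closed_closure * z])
qed

lemma strip_integral:
 assumes "test_function (strip T) \<phi>"
 shows "(LBINT z:strip T. \<phi> z *\<^sub>R f z) = (LBINT z. \<phi> z *\<^sub>R f z)"
  and "(LBINT z:strip T. dderiv v \<phi> z *\<^sub>R f z) = (LBINT z. dderiv v \<phi> z *\<^sub>R f z)"
proof -
 have "indicator (strip T) z *\<^sub>R (\<phi> z *\<^sub>R f z) = \<phi> z *\<^sub>R f z"
  "indicator (strip T) z *\<^sub>R (dderiv v \<phi> z *\<^sub>R f z) = dderiv v \<phi> z *\<^sub>R f z" for z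
  by (cases "z \<in> strip T"; simp add: test_function_outside[OF assms])+
 then show "(LBINT z:strip T. \<phi> z *\<^sub>R f z) = (LBINT z. \<phi> z *\<^sub>R f z)"
  "(LBINT z:strip T. dderiv v \<phi> z *\<^sub>R f z) = (LBINT z. dderiv v \<phi> z *\<^sub>R f z)"
  unfolding set_lebesgue_integral_def by (simp_all only:)
qed

text \<open>Weights: a test function or one of its derivatives.\<close>

definition strip_weight :: "real => (real \<times> real => real) => bool" where
 "strip_weight T w \<longleftrightarrow> continuous_on UNIV w \<and> (\<exists>a b. cbox a b <= strip T \<and> (\<forall>z. z \<notin> cbox a b --> w z = 0))"

lemma strip_weight_test_function:
 assumes "test_function (strip T) \<phi>" "T > 0"
 shows "strip_weight T \<phi>" "strip_weight T (dderiv v \<phi>)"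
proof -
 obtain c R where cR: "0 < c" "c < T" "0 < R" and \<phi>0: "!!z. \<bar>fst z\<bar> \<ge> c \<or> \<bar>snd z\<bar> \<ge> R ==> \<phi> z = 0"
  and d0: "!!z v. z \<notin> cbox (-c, -R) (c, R) ==> dderiv v \<phi> z = 0" and \<phi>s: "smooth_on UNIV \<phi>"
  using test_function_in_box[OF assms] by metis
 have Q: "cbox (-c, -R) (c, R) <= strip T" using cR by (intro cbox_subset_strip) auto
 have \<phi>Q: "\<phi> z = 0" if "z \<notin> cbox (-c, -R) (c, R)" for z by (rule \<phi>0) (use that in \<open>cases z, auto\<close>)
 show "strip_weight T \<phi>" "strip_weight T (dderiv v \<phi>)"
  unfolding strip_weight_def using Q \<phi>Q d0 smooth_on_continuous[OF \<phi>s] smooth_on_continuous[OF smooth_on_dderiv[OF \<phi>s]] by blast+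
qed

lemma strip_weight_integrable:
 fixes f :: "real \<times> real => 'b::euclidean_space"
 assumes "strip_weight T w" and f: "!!a b. cbox a b <= strip T ==> set_integrable lborel (cbox a b) f"
 shows "integrable lborel (%z. w z *\<^sub>R f z)"
proof -
 obtain a b where "cbox a b <= strip T" "!!z. z \<notin> cbox a b ==> w z = 0" "continuous_on UNIV w"
  using assms(1) by (auto simp: strip_weight_def)
 then show ?thesis using f by (intro integrable_continuous_weight[of "cbox a b"]) auto
qed

text \<open>The function \<open>f\<close> need only be measurable on boxes, as is the case for a weak derivative.\<close>

lemma strip_weight_cong_AE:
 fixes f g :: "real \<times> real => 'b::euclidean_space"
 assumes w: "strip_weight T w"
  and f: "!!a b. cbox a b <= strip T ==> (%z. indicator (cbox a b) z *\<^sub>R f z) \<in> borel_measurable borel"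
  and g: "g \<in> borel_measurable borel"
  and eq: "AE z in lborel. z \<in> strip T --> f z = g z"
 shows "(LBINT z. w z *\<^sub>R f z) = (LBINT z. w z *\<^sub>R g z)"
proof -
 obtain a b where ab: "cbox a b <= strip T" "!!z. z \<notin> cbox a b ==> w z = 0" "continuous_on UNIV w"
  using w by (auto simp: strip_weight_def)
 have wm: "w \<in> borel_measurable borel" by (rule borel_measurable_continuous_onI[OF ab(3)])
 have 1: "w z *\<^sub>R f z = w z *\<^sub>R (indicator (cbox a b) z *\<^sub>R f z)" for z by (cases "z \<in> cbox a b") (simp_all add: ab(2))
 show ?thesis
 proof (rule integral_cong_AE)
  show "(%z. w z *\<^sub>R f z) \<in> borel_measurable lborel" unfolding 1 using wm f[OF ab(1)] by measurable
  show "(%z. w z *\<^sub>R g z) \<in> borel_measurable lborel" using wm g by measurable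
  show "AE z in lborel. w z *\<^sub>R f z = w z *\<^sub>R g z"
   using eq by (rule eventually_mono) (use ab(1,2) in force)
 qed
qed

lemma has_weak_dderivD:
 assumes "has_weak_dderiv_on (strip T) v f g" "T > 0"
 shows "cbox a b <= strip T ==> set_integrable lborel (cbox a b) g"
  and "test_function (strip T) \<phi> ==> (LBINT z. dderiv v \<phi> z *\<^sub>R f z) = - (LBINT z. \<phi> z *\<^sub>R g z)"
proof -
 show "cbox a b <= strip T ==> set_integrable lborel (cbox a b) g"
  using assms by (auto simp: has_weak_dderiv_on_def locally_integrable_on_def)
 assume \<phi>: "test_function (strip T) \<phi>"
 then have "(LBINT z:strip T. dderiv v \<phi> z *\<^sub>R f z) = - (LBINT z:strip T. \<phi> z *\<^sub>R g z)"
  using assms(1) unfolding has_weak_dderiv_on_def by blast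
 then show "(LBINT z. dderiv v \<phi> z *\<^sub>R f z) = - (LBINT z. \<phi> z *\<^sub>R g z)"
  by (simp add: strip_integral[OF \<phi>])
qed

text \<open>Weak derivatives are unique by the fundamental lemma, so that the choice made in \<open>weak_dx\<close> is immaterial.\<close>

lemma weak_dx_eq:
 assumes g: "has_weak_dderiv_on (strip T) (0, 1) f g" and T: "T > 0"
 shows "has_weak_dderiv_on (strip T) (0, 1) f (weak_dx T f)"
  and "AE z in lborel. z \<in> strip T --> weak_dx T f z = g z"
proof -
 show w: "has_weak_dderiv_on (strip T) (0, 1) f (weak_dx T f)"
  unfolding weak_dx_def by (rule someI[of _ g]) (rule g)
 note wi = has_weak_dderivD(1)[OF w T] and gi = has_weak_dderivD(1)[OF g T]
 have "AE z in lborel. z \<in> strip T --> weak_dx T f z - g z = 0"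
 proof (rule fundamental_lemma_strip)
  show "set_integrable lborel (cbox a b) (%z. weak_dx T f z - g z)" if "cbox a b <= strip T" for a b
   by (rule set_integral_diff(1)[OF wi[OF that] gi[OF that]])
  fix \<eta> \<psi> :: "real => real" and a b c d :: real
  assume *: "smooth_on UNIV \<eta>" "smooth_on UNIV \<psi>" "-T < a" "b < T"
   "!!x. x \<notin> {a..b} ==> \<eta> x = 0" "!!x. x \<notin> {c..d} ==> \<psi> x = 0"
  define \<phi> where "\<phi> = (%z. \<eta> (fst z) * \<psi> (snd z))"
  have tf: "test_function (strip T) \<phi>" unfolding \<phi>_def
   by (rule test_function_tensor[OF *(1) _ *(3,4,2)]) (use *(5,6) in auto)
  note sw = strip_weight_test_function(1)[OF tf T]
  have "(LBINT z. \<phi> z *\<^sub>R (weak_dx T f z - g z)) = (LBINT z. \<phi> z *\<^sub>R weak_dx T f z) - (LBINT z. \<phi> z *\<^sub>R g z)"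
   unfolding scaleR_diff_right
   by (intro Bochner_Integration.integral_diff strip_weight_integrable[OF sw] wi gi)
  also have "... = 0" using has_weak_dderivD(2)[OF w T tf] has_weak_dderivD(2)[OF g T tf] by simp
  finally show "(LBINT z. (\<eta> (fst z) * \<psi> (snd z)) *\<^sub>R (weak_dx T f z - g z)) = 0" by (simp add: \<phi>_def)
 qed
 then show "AE z in lborel. z \<in> strip T --> weak_dx T f z = g z" by simp
qed

lemma weak_dx_borel:
 assumes g: "has_weak_dderiv_on (strip T) (0, 1) f g" and T: "T > 0" and ab: "cbox a b <= strip T"
 shows "(%z. indicator (cbox a b) z *\<^sub>R weak_dx T f z) \<in> borel_measurable borel"
 using has_weak_dderivD(1)[OF weak_dx_eq(1)[OF g T] T ab] unfolding set_integrable_def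
 by (auto dest: borel_measurable_integrable)

lemma Dx_times_eq:
 assumes g: "has_weak_dderiv_on (strip T) (0, 1) g g'" and T: "T > 0" and \<phi>: "test_function (strip T) \<phi>"
  and a: "a \<in> borel_measurable borel" and g': "g' \<in> borel_measurable borel"
 shows "Dx_times T a g \<phi> = - (LBINT z. dx \<phi> z *\<^sub>R (a z *\<^sub>R g z)) - (LBINT z. \<phi> z *\<^sub>R (a z *\<^sub>R g' z))"
proof -
 have "(LBINT z. \<phi> z *\<^sub>R (a z *\<^sub>R weak_dx T g z)) = (LBINT z. \<phi> z *\<^sub>R (a z *\<^sub>R g' z))"
 proof (rule strip_weight_cong_AE[OF strip_weight_test_function(1)[OF \<phi> T]])
  show "(%z. indicator (cbox p q) z *\<^sub>R a z *\<^sub>R weak_dx T g z) \<in> borel_measurable borel" if "cbox p q <= strip T" for p q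
  proof -
   from weak_dx_borel[OF g T that] a
   have "(%z. a z *\<^sub>R (indicator (cbox p q) z *\<^sub>R weak_dx T g z)) \<in> borel_measurable borel" by measurable
   then show ?thesis by (simp add: mult.commute)
  qed
  show "(%z. a z *\<^sub>R g' z) \<in> borel_measurable borel" using a g' by measurable
  show "AE z in lborel. z \<in> strip T --> a z *\<^sub>R weak_dx T g z = a z *\<^sub>R g' z"
   using weak_dx_eq(2)[OF g T] by (rule eventually_mono) simp
 qed
 then show ?thesis unfolding Dx_times_def Dx_def distr_of_def strip_integral[OF \<phi>] by simp
qed

context frame_data
begin

definition "g3 z = - Im (q z) *\<^sub>R u z"

abbreviation "f z \<equiv> u z \<times> e z"

lemma fm: "f \<in> borel_measurable borel" by (rule borel_measurable_cross[OF um em])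

lemma g3_borel: "g3 \<in> borel_measurable borel"
 unfolding g3_def[abs_def] using qm um by measurable

lemma frame_bounds:
 assumes "orthonormal_pair (u z) (e z)"
 shows "norm (u z) <= 1" "norm (e z) <= 1" "norm (f z) <= 1" "norm (g1 z) <= 2 * cmod (q z)" "norm (g2 z) <= cmod (q z)"
  "norm (g3 z) <= cmod (q z)"
proof -
 show 1: "norm (u z) <= 1" "norm (e z) <= 1" using assms by (auto simp: orthonormal_pair_def)
 show 2: "norm (f z) <= 1" using norm_cross_le[of "u z" "e z"] assms by (simp add: orthonormal_pair_def)
 have "norm (g1 z) <= \<bar>Re (q z)\<bar> * norm (e z) + \<bar>Im (q z)\<bar> * norm (f z)"
  unfolding g1_def by (rule order_trans[OF norm_triangle_ineq]) simp
 also have "... <= cmod (q z) * 1 + cmod (q z) * 1"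
  by (intro add_mono mult_mono abs_Re_le_cmod abs_Im_le_cmod 1 2) auto
 finally show "norm (g1 z) <= 2 * cmod (q z)" by simp
 show "norm (g2 z) <= cmod (q z)" "norm (g3 z) <= cmod (q z)"
  using assms abs_Re_le_cmod[of "q z"] abs_Im_le_cmod[of "q z"] by (auto simp: g2_def g3_def orthonormal_pair_def)
qed

lemma product_integrable:
 fixes v :: "real \<times> real => real^3"
 assumes a: "a \<in> borel_measurable borel" "!!z. \<bar>a z\<bar> <= cmod (q z)"
  and v: "v \<in> borel_measurable borel" "!!z. orthonormal_pair (u z) (e z) ==> norm (v z) <= 2 + 2 * cmod (q z)"
  and ab: "cbox p r <= strip T"
 shows "set_integrable lborel (cbox p r) (%z. a z *\<^sub>R v z)"
proof (rule locally_integrable[OF _ _ ab])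
 show "(%z. a z *\<^sub>R v z) \<in> borel_measurable borel" using a v by measurable
 fix z assume o: "orthonormal_pair (u z) (e z)"
 define m where "m = cmod (q z)"
 have "norm (a z *\<^sub>R v z) <= m * (2 + 2 * m)"
  using mult_mono[OF a(2) v(2)[OF o]] by (simp add: m_def)
 also have "... <= 3 * (1 + m\<^sup>2)" using zero_le_power2[of "m - 1"] by (simp add: power2_eq_square algebra_simps)
 finally show "norm (a z *\<^sub>R v z) <= 3 * (1 + (cmod (q z))\<^sup>2)" by (simp add: m_def)
qed

lemma coefficients_borel: "(%z. Re (q z)) \<in> borel_measurable borel" "(%z. Im (q z)) \<in> borel_measurable borel"
 "(%z. - Im (q z)) \<in> borel_measurable borel"
 using qm by measurable

lemma products_integrable:
 assumes ab: "cbox p r <= strip T"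
 shows "set_integrable lborel (cbox p r) (%z. Im (q z) *\<^sub>R e z)" "set_integrable lborel (cbox p r) (%z. Re (q z) *\<^sub>R f z)"
  "set_integrable lborel (cbox p r) (%z. Im (q z) *\<^sub>R g1 z)" "set_integrable lborel (cbox p r) (%z. ((cmod (q z))\<^sup>2 / 2) *\<^sub>R f z)"
  "set_integrable lborel (cbox p r) g3" "set_integrable lborel (cbox p r) f"
proof -
 have nn: "norm v <= 2 + 2 * cmod (q z)" if "norm v <= 1 \<or> norm v <= 2 * cmod (q z)" for v :: "real^3" and z
  using that by (auto intro: order_trans)
 show "set_integrable lborel (cbox p r) (%z. Im (q z) *\<^sub>R e z)"
  by (rule product_integrable[OF coefficients_borel(2) abs_Im_le_cmod em _ ab]) (auto intro: nn frame_bounds)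
 show "set_integrable lborel (cbox p r) (%z. Re (q z) *\<^sub>R f z)"
  by (rule product_integrable[OF coefficients_borel(1) abs_Re_le_cmod fm _ ab]) (auto intro: nn frame_bounds)
 show "set_integrable lborel (cbox p r) (%z. Im (q z) *\<^sub>R g1 z)"
  by (rule product_integrable[OF coefficients_borel(2) abs_Im_le_cmod measurable_coefficients(1) _ ab]) (auto intro: nn frame_bounds)
 have "set_integrable lborel (cbox p r) (%z. cmod (q z) *\<^sub>R ((cmod (q z) / 2) *\<^sub>R f z))"
 proof (rule product_integrable[OF _ _ _ _ ab])
  show "(%z. cmod (q z)) \<in> borel_measurable borel" "(%z. (cmod (q z) / 2) *\<^sub>R f z) \<in> borel_measurable borel"
   using qm fm by measurable
  show "norm ((cmod (q z) / 2) *\<^sub>R f z) <= 2 + 2 * cmod (q z)" if "orthonormal_pair (u z) (e z)" for z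
  proof -
   have "cmod (q z) / 2 * norm (f z) <= cmod (q z) / 2 * 1" by (intro mult_left_mono frame_bounds(3)[OF that]) simp
   moreover have "norm ((cmod (q z) / 2) *\<^sub>R f z) = cmod (q z) / 2 * norm (f z)" by simp
   ultimately show ?thesis using norm_ge_zero[of "q z"] by linarith
  qed
 qed simp
 then show "set_integrable lborel (cbox p r) (%z. ((cmod (q z))\<^sup>2 / 2) *\<^sub>R f z)" by (simp add: power2_eq_square)
 show "set_integrable lborel (cbox p r) g3"
 proof (rule locally_integrable[OF g3_borel _ ab, of 1])
  show "norm (g3 z) <= 1 * (1 + (cmod (q z))\<^sup>2)" if "orthonormal_pair (u z) (e z)" for z
   using frame_bounds(6)[OF that] sum_squares_bound[of 1 "cmod (q z)"] norm_ge_zero[of "q z"]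
   unfolding power_one mult_1 mult_1_right by linarith
 qed
 show "set_integrable lborel (cbox p r) f"
  by (rule locally_integrable[OF fm _ ab, of 1]) (auto intro!: order_trans[OF frame_bounds(3)])
qed

lemma has_weak_dxI:
 assumes T: "T > 0" and i: "!!a b. cbox a b <= strip T ==> set_integrable lborel (cbox a b) v"
  "!!a b. cbox a b <= strip T ==> set_integrable lborel (cbox a b) w"
  and eq: "!!\<phi>. test_function (strip T) \<phi> ==> (LBINT z. dx \<phi> z *\<^sub>R v z) = - (LBINT z. \<phi> z *\<^sub>R w z)"
 shows "has_weak_dderiv_on (strip T) (0, 1) v w"
 unfolding has_weak_dderiv_on_def locally_integrable_on_strip[OF T]
 using i eq by (auto simp: strip_integral)

text \<open>As \<open>u \<times> (u \<times> e) = - e\<close>, the flux \<open>u \<times> u\<^sub>x\<close> is \<open>Re q u \<times> e - Im q e\<close>.\<close>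

lemma schroedinger_flux:
 assumes u: "has_weak_dderiv_on (strip T) (0, 1) u g1" and T: "T > 0" and \<phi>: "test_function (strip T) \<phi>"
 shows "(LBINT z. dx \<phi> z *\<^sub>R (u z \<times> weak_dx T u z)) = (LBINT z. dx \<phi> z *\<^sub>R h1 z)"
proof (rule strip_weight_cong_AE[OF strip_weight_test_function(2)[OF \<phi> T]])
 show "(%z. indicator (cbox p r) z *\<^sub>R (u z \<times> weak_dx T u z)) \<in> borel_measurable borel" if "cbox p r <= strip T" for p r
  using borel_measurable_cross[OF um weak_dx_borel[OF u T that]] by (simp add: cross_mult_right)
 show "h1 \<in> borel_measurable borel" by (rule measurable_coefficients)
 show "AE z in lborel. z \<in> strip T --> u z \<times> weak_dx T u z = h1 z"
  using weak_dx_eq(2)[OF u T] orthonormal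
 proof eventually_elim
  case (elim z)
  show ?case
  proof
   assume z: "z \<in> strip T"
   then have "u z \<bullet> u z = 1" "u z \<bullet> e z = 0" using elim(2) by (auto simp: orthonormal_pair_def norm_eq_1)
   then have "u z \<times> (u z \<times> e z) = - e z" by (simp add: Lagrange)
   then show "u z \<times> weak_dx T u z = h1 z"
    using elim(1) z by (simp add: g1_def h1_def cross_add_right cross_mult_right)
  qed
 qed
qed

lemma split_k2:
 assumes T: "T > 0" and \<phi>: "test_function (strip T) \<phi>"
 shows "(LBINT z. \<phi> z *\<^sub>R k2 z) = (LBINT z. \<phi> z *\<^sub>R (Im (q z) *\<^sub>R g1 z)) + (LBINT z. \<phi> z *\<^sub>R (((cmod (q z))\<^sup>2 / 2) *\<^sub>R f z))"
 unfolding k2_def scaleR_add_right[of "\<phi> _"]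
 by (intro Bochner_Integration.integral_add strip_weight_integrable[OF strip_weight_test_function(1)[OF \<phi> T]] products_integrable)

lemma weak_dx_of_frame:
 assumes T: "T > 0"
  and "!!\<phi>. test_function (strip T) \<phi> ==> (LBINT z. dx \<phi> z *\<^sub>R u z) = - (LBINT z. \<phi> z *\<^sub>R g1 z)"
  and "!!\<phi>. test_function (strip T) \<phi> ==> (LBINT z. dx \<phi> z *\<^sub>R e z) = - (LBINT z. \<phi> z *\<^sub>R g2 z)"
 shows "has_weak_dderiv_on (strip T) (0, 1) u g1" "has_weak_dderiv_on (strip T) (0, 1) e g2"
 by (rule has_weak_dxI[OF T loc_int(6) loc_int(1) assms(2)] has_weak_dxI[OF T loc_int(7) loc_int(3) assms(3)]; assumption?)+

end

lemma distr_of_cong: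
 assumes "!!z. z \<in> strip T ==> f z = g z"
 shows "distr_of T f = distr_of T g"
 unfolding distr_of_def set_lebesgue_integral_def
 by (rule ext, rule Bochner_Integration.integral_cong) (use assms in \<open>auto simp: indicator_def\<close>)

lemma weak_dx_cong:
 assumes "!!z. z \<in> strip T ==> f z = g z"
 shows "weak_dx T f = weak_dx T g"
proof -
 have 1: "set_integrable lborel K f = set_integrable lborel K g" if "K <= strip T" for K
  unfolding set_integrable_def by (rule Bochner_Integration.integrable_cong) (use assms that in \<open>auto simp: indicator_def\<close>)
 have 2: "(LBINT z:strip T. w z *\<^sub>R f z) = (LBINT z:strip T. w z *\<^sub>R g z)" for w
  unfolding set_lebesgue_integral_def by (rule Bochner_Integration.integral_cong) (use assms in \<open>auto simp: indicator_def\<close>)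
 have 3: "locally_integrable_on (strip T) f = locally_integrable_on (strip T) g"
  unfolding locally_integrable_on_def using 1 by auto
 have "has_weak_dderiv_on (strip T) (0, 1) f h = has_weak_dderiv_on (strip T) (0, 1) g h" for h
  unfolding has_weak_dderiv_on_def 2 3 ..
 then show ?thesis by (simp add: weak_dx_def)
qed

lemma Dx_times_cong:
 assumes "!!z. z \<in> strip T ==> a z = b z" "!!z. z \<in> strip T ==> f z = g z"
 shows "Dx_times T a f = Dx_times T b g"
proof -
 have "distr_of T (%z. a z *\<^sub>R f z) = distr_of T (%z. b z *\<^sub>R g z)"
  "distr_of T (%z. a z *\<^sub>R weak_dx T g z) = distr_of T (%z. b z *\<^sub>R weak_dx T g z)"
  by (rule distr_of_cong; use assms in simp)+
 moreover have "weak_dx T f = weak_dx T g" by (rule weak_dx_cong) (rule assms(2))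
 ultimately show ?thesis by (intro ext) (simp add: Dx_times_def)
qed

lemma weak_schroedinger_map_cong:
 assumes "!!z. z \<in> strip T ==> u z = u' z"
 shows "weak_schroedinger_map T u = weak_schroedinger_map T u'"
proof -
 have "weak_dx T u = weak_dx T u'" by (rule weak_dx_cong) (rule assms)
 moreover have "distr_of T u = distr_of T u'" by (rule distr_of_cong) (rule assms)
 moreover have "distr_of T (%z. u z \<times> weak_dx T u' z) = distr_of T (%z. u' z \<times> weak_dx T u' z)"
  by (rule distr_of_cong) (simp add: assms)
 moreover have "(z \<in> strip T --> norm (u z) = 1) = (z \<in> strip T --> norm (u' z) = 1)" for z using assms by auto
 ultimately show ?thesis unfolding weak_schroedinger_map_def by simp
qed

lemma pullback_frame_cong:
 assumes "!!z. z \<in> strip T ==> u z = u' z" "!!z. z \<in> strip T ==> e z = e' z"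
 shows "pullback_frame T u e = pullback_frame T u' e'"
proof -
 have "(z \<in> strip T --> u z \<bullet> e z = 0 \<and> norm (e z) = 1) = (z \<in> strip T --> u' z \<bullet> e' z = 0 \<and> norm (e' z) = 1)" for z using assms by auto
 then show ?thesis unfolding pullback_frame_def by simp
qed

lemma frame_system_cong:
 assumes q: "!!z. z \<in> strip T ==> q z = q' z" and u: "!!z. z \<in> strip T ==> u z = u' z" and e: "!!z. z \<in> strip T ==> e z = e' z"
 shows "frame_system T q u e = frame_system T q' u' e'"
proof -
 have 1: "distr_of T u = distr_of T u'" by (rule distr_of_cong) (rule u)
 have 2: "distr_of T e = distr_of T e'" by (rule distr_of_cong) (rule e)
 have 3: "Dx_times T (%z. Re (\<i> * q z)) e = Dx_times T (%z. Re (\<i> * q' z)) e'" by (rule Dx_times_cong) (simp_all add: q e)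
 have 4: "Dx_times T (%z. Im (\<i> * q z)) (%z. u z \<times> e z) = Dx_times T (%z. Im (\<i> * q' z)) (%z. u' z \<times> e' z)"
  by (rule Dx_times_cong) (simp_all add: q e u)
 have 5: "Dx_times T (%z. Re (\<i> * q z)) u = Dx_times T (%z. Re (\<i> * q' z)) u'" by (rule Dx_times_cong) (simp_all add: q u)
 have 6: "distr_of T (%z. Re (q z) *\<^sub>R e z + Im (q z) *\<^sub>R (u z \<times> e z)) = distr_of T (%z. Re (q' z) *\<^sub>R e' z + Im (q' z) *\<^sub>R (u' z \<times> e' z))"
  by (rule distr_of_cong) (simp add: q u e)
 have 7: "distr_of T (%z. (- (1/2) * (cmod (q z))\<^sup>2) *\<^sub>R (u z \<times> e z)) = distr_of T (%z. (- (1/2) * (cmod (q' z))\<^sup>2) *\<^sub>R (u' z \<times> e' z))"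
  by (rule distr_of_cong) (simp add: q u e)
 have 8: "distr_of T (%z. Re (q z) *\<^sub>R u z) = distr_of T (%z. Re (q' z) *\<^sub>R u' z)"
  by (rule distr_of_cong) (simp add: q u)
 show ?thesis unfolding frame_system_def 1 2 3 4 5 6 7 8 ..
qed

lemma C_L2loc_cong:
 fixes u u' :: "real \<times> real => 'b::euclidean_space"
 assumes eq: "!!z. z \<in> strip T ==> u z = u' z" and u: "C_L2loc T u" and u': "measurable_on_strip T u'"
 shows "C_L2loc T u'"
 unfolding C_L2loc_def
proof (intro conjI allI impI ballI)
 fix r t :: real assume r: "r > 0" and t: "t \<in> {-T<..<T}"
 have tx: "u (t, x) = u' (t, x)" if "t \<in> {-T<..<T}" for t x using that by (intro eq) (auto simp: strip_def)
 show "L2_sq {-r<..<r} (%x. u' (t, x)) < \<infinity>" using u r t unfolding C_L2loc_def by (simp add: tx[OF t, symmetric])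
 have "((%s. L2_sq {-r<..<r} (%x. u (s, x) - u (t, x))) \<longlongrightarrow> 0) (at t within {-T<..<T})"
  using u r t unfolding C_L2loc_def by blast
 then show "((%s. L2_sq {-r<..<r} (%x. u' (s, x) - u' (t, x))) \<longlongrightarrow> 0) (at t within {-T<..<T})"
  by (rule Lim_transform_eventually) (auto simp: eventually_at_filter tx tx[OF t])
qed (rule u')

text \<open>The extension by zero is a Borel function on the plane with the same distribution on the strip.\<close>

definition strip_extension :: "real => (real \<times> real => 'b::zero) => real \<times> real => 'b" where
 "strip_extension T f z = (if z \<in> strip T then f z else 0)"

lemma strip_extension_borel:
 fixes f :: "real \<times> real => 'b::euclidean_space"
 assumes "measurable_on_strip T f"
 shows "strip_extension T f \<in> borel_measurable borel"
 using assms strip_borel[of T] measurable_restrict_space_iff[of "strip T" borel "0::'b" borel f]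
 unfolding measurable_on_strip_def strip_extension_def[abs_def] by simp

lemma strip_extension_L2:
 fixes q :: "real \<times> real => complex"
 assumes q: "L2_L2loc T q" and ab: "cbox a b <= strip T"
 shows "set_integrable lborel (cbox a b) (%z. (cmod (strip_extension T q z))\<^sup>2)"
proof -
 define Q where "Q = strip_extension T q"
 have Qm: "Q \<in> borel_measurable borel" unfolding Q_def using q by (intro strip_extension_borel) (simp add: L2_L2loc_def)
 have [measurable]: "Q \<in> borel_measurable (borel \<Otimes>\<^sub>M borel)" using Qm by (simp add: borel_prod)
 define r where "r = norm a + norm b + 1"
 have r: "r > 0" by (simp add: r_def add_nonneg_pos)
 have sub: "\<bar>snd z\<bar> < r" if "z \<in> cbox a b" for z
 proof -
  obtain a1 a2 b1 b2 z1 z2 where eqs: "a = (a1, a2)" "b = (b1, b2)" "z = (z1, z2)" by (metis prod.collapse)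
  have "\<bar>a2\<bar> <= norm a" "\<bar>b2\<bar> <= norm b" using norm_snd_le[of a2 a1] norm_snd_le[of b2 b1] by (simp_all add: eqs)
  then show ?thesis using that by (auto simp: eqs r_def)
 qed
 define f where "f z = ennreal ((norm (Q z))\<^sup>2) * indicator {-T<..<T} (fst z) * indicator {-r<..<r} (snd z)" for z
 have [measurable]: "f \<in> borel_measurable (lborel \<Otimes>\<^sub>M lborel)" unfolding f_def by measurable
 have "L2_sq (cbox a b) Q <= (\<integral>\<^sup>+z. f z \<partial>lborel)"
  unfolding L2_sq_def
 proof (rule nn_integral_mono)
  fix z show "ennreal ((norm (Q z))\<^sup>2) * indicator (cbox a b) z <= f z"
   using sub[of z] ab by (auto simp: f_def indicator_def strip_def abs_less_iff)
 qed
 also have "... = (\<integral>\<^sup>+z. f z \<partial>(lborel \<Otimes>\<^sub>M lborel))" by (simp add: lborel_prod)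
 also have "... = (\<integral>\<^sup>+t. \<integral>\<^sup>+x. f (t, x) \<partial>lborel \<partial>lborel)" by (rule lborel.nn_integral_fst[symmetric]) measurable
 also have "... = L2_time_sq {-T<..<T} (L2_sq {-r<..<r}) q"
  unfolding L2_time_sq_def L2_sq_def
 proof (rule nn_integral_cong)
  fix t :: real
  show "(\<integral>\<^sup>+x. f (t, x) \<partial>lborel) = (\<integral>\<^sup>+x\<in>{-r<..<r}. ennreal ((norm (q (t, x)))\<^sup>2) \<partial>lborel) * indicator {-T<..<T} t"
   by (cases "t \<in> {-T<..<T}") (auto simp: f_def Q_def strip_extension_def strip_def indicator_def abs_less_iff intro!: nn_integral_cong)
 qed
 also have "... < \<infinity>" using q r by (simp add: L2_L2loc_def)
 finally show ?thesis unfolding Q_def[symmetric] by (intro L2_sq_real(1)[OF Qm]) auto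
qed

text \<open>The evolution equation for \<open>u\<close> in divergence form is the Schroedinger map equation with its flux computed from the frame.\<close>

lemma solution_pair_weak_frame:
 assumes T: "T > 0" and q: "L2_L2loc T q" and sol: "solution_pair T q u e"
 shows "weak_frame T (strip_extension T q) (strip_extension T u) (strip_extension T e)"
proof -
 define q0 where "q0 = strip_extension T q"
 define u0 where "u0 = strip_extension T u"
 define e0 where "e0 = strip_extension T e"
 have eq: "q z = q0 z" "u z = u0 z" "e z = e0 z" if "z \<in> strip T" for z
  using that by (simp_all add: q0_def u0_def e0_def strip_extension_def)
 have borel: "q0 \<in> borel_measurable borel" "u0 \<in> borel_measurable borel" "e0 \<in> borel_measurable borel"
  unfolding q0_def u0_def e0_def using q sol
  by (auto intro!: strip_extension_borel simp: L2_L2loc_def solution_pair_def C_L2loc_def)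
 have cont: "C_L2loc T u0" "C_L2loc T e0"
  by (rule C_L2loc_cong[of T u] C_L2loc_cong[of T e];
    use sol borel(2,3) in \<open>simp add: eq solution_pair_def measurable_on_strip_def measurable_restrict_space1\<close>)+
 have map: "weak_schroedinger_map T u0" using sol weak_schroedinger_map_cong[of T u u0] eq(2) unfolding solution_pair_def by blast
 have pf: "pullback_frame T u0 e0" using sol pullback_frame_cong[of T u u0 e e0] eq(2,3) unfolding solution_pair_def by blast
 have sys: "frame_system T q0 u0 e0" using sol frame_system_cong[of T q q0 u u0 e e0] eq unfolding solution_pair_def by blast
 interpret frame_data T q0 u0 e0
 proof
  show "AE z in lborel. z \<in> strip T --> orthonormal_pair (u0 z) (e0 z)"
   using map pf unfolding weak_schroedinger_map_def pullback_frame_def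
   by (auto simp: orthonormal_pair_def elim: eventually_elim2)
 qed (use borel strip_extension_L2[OF q] in \<open>auto simp: q0_def\<close>)
 have W2: "(LBINT z. dx \<phi> z *\<^sub>R u0 z) = - (LBINT z. \<phi> z *\<^sub>R g1 z)"
  and W4: "(LBINT z. dx \<phi> z *\<^sub>R e0 z) = - (LBINT z. \<phi> z *\<^sub>R g2 z)" if \<phi>: "test_function (strip T) \<phi>" for \<phi>
 proof -
  have 1: "Dx (distr_of T u0) \<phi> = distr_of T (%z. Re (q0 z) *\<^sub>R e0 z + Im (q0 z) *\<^sub>R (u0 z \<times> e0 z)) \<phi>"
   and 2: "Dx (distr_of T e0) \<phi> + distr_of T (%z. Re (q0 z) *\<^sub>R u0 z) \<phi> = 0" using sys \<phi> unfolding frame_system_def by blast+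
  show "(LBINT z. dx \<phi> z *\<^sub>R u0 z) = - (LBINT z. \<phi> z *\<^sub>R g1 z)"
   using 1 unfolding Dx_def distr_of_def strip_integral[OF \<phi>] g1_def by (rule minus_equation_iff[THEN iffD1, THEN sym])
  have "(LBINT z. \<phi> z *\<^sub>R (Re (q0 z) *\<^sub>R u0 z)) = (LBINT z. dx \<phi> z *\<^sub>R e0 z)"
   using 2 unfolding Dx_def distr_of_def strip_integral[OF \<phi>] add_eq_0_iff minus_minus .
  then show "(LBINT z. dx \<phi> z *\<^sub>R e0 z) = - (LBINT z. \<phi> z *\<^sub>R g2 z)"
   by (simp add: g2_def)
 qed
 note wd = weak_dx_of_frame[OF T W2 W4]
 have "frame_equations T q0 u0 e0"
  unfolding frame_equations_def
 proof (intro allI impI conjI)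
  fix \<phi> assume \<phi>: "test_function (strip T) \<phi>"
  have "(LBINT z. dt \<phi> z *\<^sub>R u0 z) = (LBINT z. dx \<phi> z *\<^sub>R (u0 z \<times> weak_dx T u0 z))"
  proof -
   have "Dt (distr_of T u0) \<phi> = Dx (distr_of T (%z. u0 z \<times> weak_dx T u0 z)) \<phi>"
    using map \<phi> unfolding weak_schroedinger_map_def by blast
   then show ?thesis unfolding Dt_def Dx_def distr_of_def strip_integral[OF \<phi>] neg_equal_iff_equal .
  qed
  also have "... = (LBINT z. dx \<phi> z *\<^sub>R h1 z)" by (rule schroedinger_flux[OF wd(1) T \<phi>])
  finally show "(LBINT z. dt \<phi> z *\<^sub>R u0 z) = (LBINT z. dx \<phi> z *\<^sub>R (Re (q0 z) *\<^sub>R (u0 z \<times> e0 z) - Im (q0 z) *\<^sub>R e0 z))"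
   by (simp add: h1_def)
  show "(LBINT z. dx \<phi> z *\<^sub>R u0 z) = - (LBINT z. \<phi> z *\<^sub>R (Re (q0 z) *\<^sub>R e0 z + Im (q0 z) *\<^sub>R (u0 z \<times> e0 z)))"
   using W2[OF \<phi>] by (simp add: g1_def)
  show "(LBINT z. dx \<phi> z *\<^sub>R e0 z) = - (LBINT z. \<phi> z *\<^sub>R (- Re (q0 z) *\<^sub>R u0 z))"
   using W4[OF \<phi>] by (simp add: g2_def)
  have "Dt (distr_of T e0) \<phi> + Dx_times T (%z. Re (\<i> * q0 z)) u0 \<phi> =
   distr_of T (%z. (- (1/2) * (cmod (q0 z))\<^sup>2) *\<^sub>R (u0 z \<times> e0 z)) \<phi>" using sys \<phi> unfolding frame_system_def by blast
  moreover have "Dx_times T (%z. Re (\<i> * q0 z)) u0 \<phi> = - (LBINT z. dx \<phi> z *\<^sub>R (- Im (q0 z) *\<^sub>R u0 z)) - (LBINT z. \<phi> z *\<^sub>R (- Im (q0 z) *\<^sub>R g1 z))"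
   using Dx_times_eq[OF wd(1) T \<phi> coefficients_borel(3) measurable_coefficients(1)] by simp
  moreover have "distr_of T (%z. (- (1/2) * (cmod (q0 z))\<^sup>2) *\<^sub>R (u0 z \<times> e0 z)) \<phi> =
    - (LBINT z. \<phi> z *\<^sub>R (((cmod (q0 z))\<^sup>2 / 2) *\<^sub>R (u0 z \<times> e0 z)))"
   "Dt (distr_of T e0) \<phi> = - (LBINT z. dt \<phi> z *\<^sub>R e0 z)"
   unfolding Dt_def distr_of_def strip_integral[OF \<phi>] by simp_all
  ultimately have "(LBINT z. dt \<phi> z *\<^sub>R e0 z) = (LBINT z. dx \<phi> z *\<^sub>R (Im (q0 z) *\<^sub>R u0 z)) +
   ((LBINT z. \<phi> z *\<^sub>R (Im (q0 z) *\<^sub>R g1 z)) + (LBINT z. \<phi> z *\<^sub>R (((cmod (q0 z))\<^sup>2 / 2) *\<^sub>R (u0 z \<times> e0 z))))"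
   by (simp add: algebra_simps)
  then show "(LBINT z. dt \<phi> z *\<^sub>R e0 z) =
   (LBINT z. dx \<phi> z *\<^sub>R (Im (q0 z) *\<^sub>R u0 z)) +
   (LBINT z. \<phi> z *\<^sub>R (Im (q0 z) *\<^sub>R (Re (q0 z) *\<^sub>R e0 z + Im (q0 z) *\<^sub>R (u0 z \<times> e0 z))
     + ((cmod (q0 z))\<^sup>2 / 2) *\<^sub>R (u0 z \<times> e0 z)))"
   using split_k2[OF T \<phi>] by (simp add: k2_def g1_def)
 qed
 then show ?thesis
  unfolding q0_def[symmetric] u0_def[symmetric] e0_def[symmetric] using cont by unfold_locales
qed

text \<open>Being the density of a primitive, \<open>g\<close> is the weak derivative of \<open>f\<close> and takes part in the infimum.\<close>

lemma H1_sq_primitive: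
 fixes f g :: "real => 'b::euclidean_space"
 assumes fm: "f \<in> borel_measurable borel" and g: "!!R. set_integrable lborel {-R..R} g"
  and f: "AE x in lborel. f x = c + prim g x"
 shows "H1_sq {-r<..<r} f <= L2_sq {-r<..<r} f + L2_sq {-r<..<r} g"
proof -
 have cp: "continuous_on UNIV (%x. c + prim g x)" by (intro continuous_intros continuous_prim g)
 have pm: "(%x. c + prim g x) \<in> borel_measurable borel" by (rule borel_measurable_continuous_onI[OF cp])
 have "has_weak_dderiv_on {-r<..<r} 1 f g"
  unfolding has_weak_dderiv_on_def
 proof (intro conjI allI impI)
  show "locally_integrable_on {-r<..<r} f"
   unfolding locally_integrable_on_def
  proof (intro allI impI)
   fix K :: "real set" assume K: "compact K \<and> K <= {-r<..<r}"
   then have Kb: "K \<in> sets borel" by (intro borel_closed compact_imp_closed) auto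
   have "set_integrable lborel K (%x. c + prim g x)"
    unfolding set_integrable_def using K continuous_on_subset[OF cp] by (intro borel_integrable_compact) auto
   then show "set_integrable lborel K f"
    unfolding set_integrable_def
   proof (rule integrable_cong_AE_imp)
    show "(%x. indicator K x *\<^sub>R f x) \<in> borel_measurable lborel" using fm Kb by measurable
    show "AE x in lborel. indicat_real K x *\<^sub>R (c + prim g x) = indicat_real K x *\<^sub>R f x"
     using f by (rule eventually_mono) simp
   qed
  qed
  show "locally_integrable_on {-r<..<r} g"
   unfolding locally_integrable_on_def
   using g[of r] by (auto intro!: set_integrable_subset[of lborel "{-r..r}" g] borel_closed compact_imp_closed)
  fix \<phi> assume \<phi>: "test_function {-r<..<r} \<phi>"
  have s: "smooth_on UNIV \<phi>" using \<phi> by (simp add: test_function_def)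
  have out: "x \<notin> closure {z. \<phi> z \<noteq> 0}" if "x \<notin> {-r<..<r}" for x using \<phi> that by (auto simp: test_function_def)
  have K0: "\<phi> x = 0" if "x \<notin> closure {z. \<phi> z \<noteq> 0}" for x using that closure_subset[of "{z. \<phi> z \<noteq> 0}"] by auto
  have 0: "\<phi> x = 0" if "x \<notin> {-r<..<r}" for x by (rule K0[OF out[OF that]])
  have d0: "dderiv 1 \<phi> x = 0" if "x \<notin> {-r<..<r}" for x by (rule dderiv_support[OF closed_closure K0 out[OF that]])
  note cd = smooth_on_continuous[OF smooth_on_dderiv[OF s], of 1]
  note dm = borel_measurable_continuous_onI[OF cd]
  have ex: "(LINT x:{-r<..<r}|lborel. dderiv 1 \<phi> x *\<^sub>R f x) = (LBINT x. dderiv 1 \<phi> x *\<^sub>R f x)"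
   "(LINT x:{-r<..<r}|lborel. \<phi> x *\<^sub>R g x) = (LBINT x. \<phi> x *\<^sub>R g x)"
   unfolding set_lebesgue_integral_def
   by (rule Bochner_Integration.integral_cong; use 0 d0 in \<open>auto simp: indicator_def\<close>)+
  have i: "integrable lborel (%x. dderiv 1 \<phi> x *\<^sub>R h x)" if "continuous_on UNIV h" for h :: "real => 'b"
  proof (rule integrable_continuous_weight[OF _ cd compact_Icc])
   show "set_integrable lborel {-r..r} h"
    unfolding set_integrable_def by (rule borel_integrable_compact[OF compact_Icc continuous_on_subset[OF that]]) simp
   show "dderiv 1 \<phi> x = 0" if "x \<notin> {-r..r}" for x by (rule d0) (use that in auto)
  qed
  have const: "(LBINT x. dderiv 1 \<phi> x *\<^sub>R c) = 0"
  proof -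
   define R where "R = \<bar>r\<bar> + 1"
   have "dderiv 1 \<phi> x = 0" if "x \<notin> {-R..R}" for x by (rule d0) (use that in \<open>auto simp: R_def\<close>)
   then have "(LBINT x. dderiv 1 \<phi> x) = (LINT x:{-R..R}|lborel. dderiv 1 \<phi> x)"
    unfolding set_lebesgue_integral_def by (intro Bochner_Integration.integral_cong) (auto simp: indicator_def)
   also have "... = \<phi> R - \<phi> (-R)" by (rule integral_smooth_derivative[OF s]) (simp add: R_def)
   also have "... = 0" using 0[of R] 0[of "-R"] by (auto simp: R_def abs_if split: if_splits)
   finally have "(LBINT x. dderiv 1 \<phi> x) = 0" .
   moreover have "integrable lborel (%x. dderiv 1 \<phi> x *\<^sub>R (1::real))"
    by (rule integrable_continuous_weight[OF set_integrable_const_Icc cd compact_Icc, of "-r" r]) (use d0 in auto)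
   ultimately show ?thesis by simp
  qed
  have "(LBINT x. dderiv 1 \<phi> x *\<^sub>R f x) = (LBINT x. dderiv 1 \<phi> x *\<^sub>R (c + prim g x))"
  proof (rule integral_cong_AE)
   show "(%x. dderiv 1 \<phi> x *\<^sub>R f x) \<in> borel_measurable lborel" using dm fm by measurable
   show "(%x. dderiv 1 \<phi> x *\<^sub>R (c + prim g x)) \<in> borel_measurable lborel" using dm pm by measurable
   show "AE x in lborel. dderiv 1 \<phi> x *\<^sub>R f x = dderiv 1 \<phi> x *\<^sub>R (c + prim g x)" using f by (rule eventually_mono) simp
  qed
  also have "... = (LBINT x. dderiv 1 \<phi> x *\<^sub>R c) + (LBINT x. dderiv 1 \<phi> x *\<^sub>R prim g x)"
   unfolding scaleR_add_right by (intro Bochner_Integration.integral_add i continuous_intros continuous_prim g)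
  also have "... = - (LBINT x. \<phi> x *\<^sub>R g x)" unfolding const using weak_derivative_prim[OF g s 0] by simp
  finally show "(LINT x:{-r<..<r}|lborel. dderiv 1 \<phi> x *\<^sub>R f x) = - (LINT x:{-r<..<r}|lborel. \<phi> x *\<^sub>R g x)" by (simp only: ex)
 qed
 then show ?thesis unfolding H1_sq_def by (intro INF_lower) simp
qed

lemma L2_H1locI:
 fixes f g :: "real \<times> real => real^3" and q :: "real \<times> real => complex"
 assumes fm: "f \<in> borel_measurable borel" and qm: "q \<in> borel_measurable borel"
  and s: "AE t in lborel. t \<in> {-T<..<T} --> (\<forall>R. set_integrable lborel {-R..R} (%x. g (t, x))) \<and>
   (AE x in lborel. f (t, x) = c t + prim (%y. g (t, y)) x) \<and> (AE x in lborel. norm (f (t, x)) <= 1 \<and> norm (g (t, x)) <= 2 * cmod (q (t, x)))"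
  and q: "!!r. r > 0 ==> L2_time_sq {-T<..<T} (L2_sq {-r<..<r}) q < \<infinity>"
 shows "L2_H1loc T f"
 unfolding L2_H1loc_def
proof (intro conjI allI impI)
 show "measurable_on_strip T f" unfolding measurable_on_strip_def by (rule measurable_restrict_space1[OF fm])
 fix r :: real assume r: "r > 0"
 have [measurable]: "q \<in> borel_measurable (borel \<Otimes>\<^sub>M borel)" using qm by (simp add: borel_prod)
 define S where "S = {-r<..<r}"
 have [measurable]: "S \<in> sets borel" by (simp add: S_def)
 have [measurable]: "(%t. L2_sq S (%x. q (t, x))) \<in> borel_measurable borel" unfolding L2_sq_def by measurable
 have "L2_time_sq {-T<..<T} (H1_sq S) f <= (\<integral>\<^sup>+t. (ennreal (2 * r) * indicator {-T<..<T} t + 4 * (L2_sq S (%x. q (t, x)) * indicator {-T<..<T} t)) \<partial>lborel)"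
  unfolding L2_time_sq_def
 proof (rule nn_integral_mono_AE, rule eventually_mono[OF s])
  fix t :: real
  assume *: "t \<in> {-T<..<T} --> (\<forall>R. set_integrable lborel {-R..R} (%x. g (t, x))) \<and>
   (AE x in lborel. f (t, x) = c t + prim (%y. g (t, y)) x) \<and> (AE x in lborel. norm (f (t, x)) <= 1 \<and> norm (g (t, x)) <= 2 * cmod (q (t, x)))"
  show "H1_sq S (%x. f (t, x)) * indicator {-T<..<T} t <= ennreal (2 * r) * indicator {-T<..<T} t + 4 * (L2_sq S (%x. q (t, x)) * indicator {-T<..<T} t)"
  proof (cases "t \<in> {-T<..<T}")
   case True
   note * = *[rule_format, OF True]
   have ae: "AE x in lborel. norm (f (t, x)) <= 1 \<and> norm (g (t, x)) <= 2 * cmod (q (t, x))" using * by blast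
   have "H1_sq S (%x. f (t, x)) <= L2_sq S (%x. f (t, x)) + L2_sq S (%x. g (t, x))"
    unfolding S_def by (rule H1_sq_primitive[OF borel_slice[OF fm], where c = "c t"]) (use * in auto)
   also have "L2_sq S (%x. f (t, x)) <= L2_sq S (%_. 1::real)"
    using ae by (intro L2_sq_mono_AE) (auto elim: eventually_mono)
   also have "L2_sq S (%_. 1::real) = ennreal (2 * r)" using r by (simp add: L2_sq_def S_def)
   also have "L2_sq S (%x. g (t, x)) <= L2_sq S (%x. 2 * cmod (q (t, x)))"
    using ae by (intro L2_sq_mono_AE) (auto elim: eventually_mono)
   also have "L2_sq S (%x. 2 * cmod (q (t, x))) = 4 * L2_sq S (%x. q (t, x))"
   proof -
    have [measurable]: "(%x. q (t, x)) \<in> borel_measurable borel" by (rule borel_slice[OF qm])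
    have "ennreal ((norm (2 * cmod (q (t, x))))\<^sup>2) * indicator S x = 4 * (ennreal ((norm (q (t, x)))\<^sup>2) * indicator S x)" for x
     by (simp add: power_mult_distrib ennreal_mult mult.assoc)
    then show ?thesis unfolding L2_sq_def by (simp add: nn_integral_cmult)
   qed
   finally show ?thesis using True by (simp add: add_mono)
  qed simp
 qed
 also have "... = (\<integral>\<^sup>+t. ennreal (2 * r) * indicator {-T<..<T} t \<partial>lborel) + 4 * L2_time_sq {-T<..<T} (L2_sq S) q"
  unfolding L2_time_sq_def by (subst nn_integral_add) (auto simp: nn_integral_cmult)
 also have "... < \<infinity>"
 proof -
  have "emeasure lborel {-T<..<T} < \<infinity>" by (cases "-T <= T") auto
  then show ?thesis using q[OF r] by (simp add: S_def nn_integral_cmult ennreal_mult_less_top)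
 qed
 finally show "L2_time_sq {-T<..<T} (H1_sq {-r<..<r}) f < \<infinity>" by (simp add: S_def)
qed

text \<open>In the equation for \<open>\<partial>\<^sub>t u\<close> the terms with the weak derivatives of \<open>e\<close> and \<open>u \<times> e\<close> cancel.\<close>

lemma weak_frame_solution_pair:
 assumes T: "T > 0" and F: "weak_frame T q u e"
  and q: "!!r. r > 0 ==> L2_time_sq {-T<..<T} (L2_sq {-r<..<r}) q < \<infinity>"
  and W5: "!!\<phi>. test_function (strip T) \<phi> ==>
   (LBINT z. dx \<phi> z *\<^sub>R (u z \<times> e z)) = - (LBINT z. \<phi> z *\<^sub>R (- Im (q z) *\<^sub>R u z))"
 shows "solution_pair T q u e"
proof -
 interpret weak_frame T q u e by (rule F)
 note wd = weak_dx_of_frame[OF T equations_for(2,4)]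
 have wf: "has_weak_dderiv_on (strip T) (0, 1) f g3"
  by (rule has_weak_dxI[OF T products_integrable(6,5)]) (use W5 in \<open>simp_all add: g3_def\<close>)
 obtain c d where s: "AE t in lborel. t \<in> {-T<..<T} -->
  (\<forall>R. set_integrable lborel {-R..R} (%x. g1 (t, x))) \<and> (AE x in lborel. u (t, x) = c t + prim (%y. g1 (t, y)) x) \<and>
  (\<forall>R. set_integrable lborel {-R..R} (%x. g2 (t, x))) \<and> (AE x in lborel. e (t, x) = d t + prim (%y. g2 (t, y)) x) \<and>
  (AE x in lborel. orthonormal_pair (u (t, x)) (e (t, x)))" by (rule slices)
 have bu: "AE x in lborel. norm (u (t, x)) <= 1 \<and> norm (g1 (t, x)) <= 2 * cmod (q (t, x))"
  and be: "AE x in lborel. norm (e (t, x)) <= 1 \<and> norm (g2 (t, x)) <= 2 * cmod (q (t, x))"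
  if "AE x in lborel. orthonormal_pair (u (t, x)) (e (t, x))" for t
  using that by (auto elim!: eventually_mono intro: frame_bounds order_trans[OF frame_bounds(5)])
 have "L2_H1loc T u"
 proof (rule L2_H1locI[OF um qm _ q, where g = g1 and c = c])
  show "AE t in lborel. t \<in> {-T<..<T} --> (\<forall>R. set_integrable lborel {-R..R} (%x. g1 (t, x))) \<and>
   (AE x in lborel. u (t, x) = c t + prim (%y. g1 (t, y)) x) \<and> (AE x in lborel. norm (u (t, x)) <= 1 \<and> norm (g1 (t, x)) <= 2 * cmod (q (t, x)))"
   using s by (rule eventually_mono) (blast intro: bu)
 qed
 moreover have "L2_H1loc T e"
 proof (rule L2_H1locI[OF em qm _ q, where g = g2 and c = d])
  show "AE t in lborel. t \<in> {-T<..<T} --> (\<forall>R. set_integrable lborel {-R..R} (%x. g2 (t, x))) \<and>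
   (AE x in lborel. e (t, x) = d t + prim (%y. g2 (t, y)) x) \<and> (AE x in lborel. norm (e (t, x)) <= 1 \<and> norm (g2 (t, x)) <= 2 * cmod (q (t, x)))"
   using s by (rule eventually_mono) (blast intro: be)
 qed
 moreover have "weak_schroedinger_map T u"
  unfolding weak_schroedinger_map_def
 proof (intro conjI allI impI)
  show "AE z in lborel. z \<in> strip T --> norm (u z) = 1"
   using orthonormal by (rule eventually_mono) (simp add: orthonormal_pair_def)
  fix \<phi> assume \<phi>: "test_function (strip T) \<phi>"
  show "Dt (distr_of T u) \<phi> = Dx (distr_of T (%z. u z \<times> weak_dx T u z)) \<phi>"
   using equations_for(1)[OF \<phi>] schroedinger_flux[OF wd(1) T \<phi>] by (simp add: Dt_def Dx_def distr_of_def strip_integral[OF \<phi>])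
 qed
 moreover have "pullback_frame T u e"
  unfolding pullback_frame_def using orthonormal by (rule eventually_mono) (simp add: orthonormal_pair_def)
 moreover have "frame_system T q u e"
  unfolding frame_system_def
 proof (intro allI impI conjI)
  fix \<phi> assume \<phi>: "test_function (strip T) \<phi>"
  note D = Dx_times_eq[OF wd(2) T \<phi> coefficients_borel(3) measurable_coefficients(3)]
   Dx_times_eq[OF wf T \<phi> coefficients_borel(1) g3_borel]
   Dx_times_eq[OF wd(1) T \<phi> coefficients_borel(3) measurable_coefficients(1)]
  have i: "integrable lborel (%z. dx \<phi> z *\<^sub>R (Im (q z) *\<^sub>R e z))" "integrable lborel (%z. dx \<phi> z *\<^sub>R (Re (q z) *\<^sub>R f z))"
   by (rule strip_weight_integrable[OF strip_weight_test_function(2)[OF \<phi> T]]; erule products_integrable)+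
  have "(LBINT z. dx \<phi> z *\<^sub>R h1 z) = (LBINT z. dx \<phi> z *\<^sub>R (Re (q z) *\<^sub>R f z)) - (LBINT z. dx \<phi> z *\<^sub>R (Im (q z) *\<^sub>R e z))"
   unfolding h1_def scaleR_diff_right by (rule Bochner_Integration.integral_diff[OF i(2,1)])
  moreover have "(LBINT z. \<phi> z *\<^sub>R (- Im (q z) *\<^sub>R g2 z)) = - (LBINT z. \<phi> z *\<^sub>R (Re (q z) *\<^sub>R g3 z))"
   unfolding Bochner_Integration.integral_minus[symmetric] by (simp add: g2_def g3_def mult_ac)
  ultimately show "Dt (distr_of T u) \<phi> = Dx_times T (%z. Re (\<i> * q z)) e \<phi> + Dx_times T (%z. Im (\<i> * q z)) (%z. u z \<times> e z) \<phi>"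
   using D(1,2) equations_for(1)[OF \<phi>] by (simp add: Dt_def distr_of_def strip_integral[OF \<phi>])
  show "Dx (distr_of T u) \<phi> = distr_of T (%z. Re (q z) *\<^sub>R e z + Im (q z) *\<^sub>R (u z \<times> e z)) \<phi>"
   using equations_for(2)[OF \<phi>] by (simp add: Dx_def distr_of_def strip_integral[OF \<phi>] g1_def)
  show "Dx (distr_of T e) \<phi> + distr_of T (%z. Re (q z) *\<^sub>R u z) \<phi> = 0"
   unfolding Dx_def distr_of_def strip_integral[OF \<phi>] using equations_for(4)[OF \<phi>] by (simp add: g2_def)
  have "distr_of T (%z. (- (1/2) * (cmod (q z))\<^sup>2) *\<^sub>R (u z \<times> e z)) \<phi> = - (LBINT z. \<phi> z *\<^sub>R (((cmod (q z))\<^sup>2 / 2) *\<^sub>R f z))"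
   "Dt (distr_of T e) \<phi> = - (LBINT z. dt \<phi> z *\<^sub>R e z)"
   unfolding Dt_def distr_of_def strip_integral[OF \<phi>] by simp_all
  then show "Dt (distr_of T e) \<phi> + Dx_times T (%z. Re (\<i> * q z)) u \<phi> = distr_of T (%z. (- (1/2) * (cmod (q z))\<^sup>2) *\<^sub>R (u z \<times> e z)) \<phi>"
   using D(3) equations_for(3)[OF \<phi>] split_k2[OF T \<phi>]
   by (simp add: h2_def)
 qed
 ultimately show ?thesis unfolding solution_pair_def using u_cont e_cont by blast
qed

theorem theorem3p1:
  fixes T :: real and q :: "real \<times> real \<Rightarrow> complex"
  assumes "T > 0"
    and "L2_L2loc T q"
    and "L2_Hm1 T (\<lambda>z. (cmod (q z))\<^sup>2)"
    and "limit_of_smooth_NLS_solutions T q"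
  shows "(\<exists>u e. solution_pair T q u e) \<and>
    (\<forall>u e u' e'. solution_pair T q u e \<and> solution_pair T q u' e' \<longrightarrow>
      (\<exists>R :: real^3^3. orthogonal_matrix R \<and>
        (\<forall>t\<in>{-T<..<T}. AE x in lborel.
           u' (t, x) = R *v u (t, x) \<and> e' (t, x) = R *v e (t, x))))"
proof (intro conjI allI impI)
 define q0 where "q0 = strip_extension T q"
 have eq: "q0 z = q z" if "z \<in> strip T" for z using that by (simp add: q0_def strip_extension_def)
 have q0m: "q0 \<in> borel_measurable borel"
  unfolding q0_def using assms(2) by (intro strip_extension_borel) (simp add: L2_L2loc_def)
 obtain qk where qk: "\<forall>k. smooth_NLS_solution T (qk k)"
  "\<forall>K. compact K \<and> K <= strip T --> (%k. L2_sq K (%z. qk k z - q z)) \<longlonglongrightarrow> 0"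
  using assms(4) unfolding limit_of_smooth_NLS_solutions_def by (elim exE conjE) (rule that)
 have lim: "(%k. L2_sq (cbox a b) (%z. qk k z - q0 z)) \<longlonglongrightarrow> 0" if "cbox a b <= strip T" for a b
 proof -
  have "L2_sq (cbox a b) (%z. qk k z - q0 z) = L2_sq (cbox a b) (%z. qk k z - q z)" for k
   unfolding L2_sq_def by (rule nn_integral_cong) (use that eq in \<open>auto simp: indicator_def\<close>)
  then show ?thesis using qk(2) compact_cbox that by simp
 qed
 obtain u e where F: "weak_frame T q0 u e" "!!\<phi>. test_function (strip T) \<phi> ==>
   (LBINT z. dx \<phi> z *\<^sub>R (u z \<times> e z)) = - (LBINT z. \<phi> z *\<^sub>R (- Im (q0 z) *\<^sub>R u z))"
  using weak_frame_exists[OF assms(1) q0m strip_extension_L2[OF assms(2), folded q0_def] qk(1)[rule_format] lim] by blast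
 have "solution_pair T q0 u e"
 proof (rule weak_frame_solution_pair[OF assms(1) F(1) _ F(2)])
  fix r :: real assume r: "r > 0"
  have "L2_time_sq {-T<..<T} (L2_sq {-r<..<r}) q0 = L2_time_sq {-T<..<T} (L2_sq {-r<..<r}) q"
   unfolding L2_time_sq_def
  proof (rule nn_integral_cong)
   fix t :: real
   have "q0 (t, x) = q (t, x)" if "t \<in> {-T<..<T}" for x using that by (intro eq) (auto simp: strip_def)
   then show "L2_sq {-r<..<r} (%x. q0 (t, x)) * indicator {-T<..<T} t = L2_sq {-r<..<r} (%x. q (t, x)) * indicator {-T<..<T} t"
    by (cases "t \<in> {-T<..<T}") simp_all
  qed
  then show "L2_time_sq {-T<..<T} (L2_sq {-r<..<r}) q0 < \<infinity>" using assms(2) r by (simp add: L2_L2loc_def)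
 qed
 then have "solution_pair T q u e" using frame_system_cong[of T q0 q u u e e] eq unfolding solution_pair_def by blast
 then show "\<exists>u e. solution_pair T q u e" by blast
next
 fix u e u' e' assume "solution_pair T q u e \<and> solution_pair T q u' e'"
 then have "\<exists>R :: real^3^3. rotation_matrix R \<and> (\<forall>t\<in>{-T<..<T}. AE x in lborel.
   strip_extension T u' (t, x) = R *v strip_extension T u (t, x) \<and> strip_extension T e' (t, x) = R *v strip_extension T e (t, x))"
  by (intro weak_frame_unique[where q = "strip_extension T q"] solution_pair_weak_frame assms) auto
 then obtain R :: "real^3^3" where R: "rotation_matrix R" "!!t. t \<in> {-T<..<T} ==> AE x in lborel.
   strip_extension T u' (t, x) = R *v strip_extension T u (t, x) \<and> strip_extension T e' (t, x) = R *v strip_extension T e (t, x)"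
  by blast
 have "AE x in lborel. u' (t, x) = R *v u (t, x) \<and> e' (t, x) = R *v e (t, x)" if t: "t \<in> {-T<..<T}" for t
 proof -
  have "(t, x) \<in> strip T" for x using t by (auto simp: strip_def)
  then show ?thesis using R(2)[OF t] by (simp add: strip_extension_def)
 qed
 then show "\<exists>R :: real^3^3. orthogonal_matrix R \<and> (\<forall>t\<in>{-T<..<T}. AE x in lborel. u' (t, x) = R *v u (t, x) \<and> e' (t, x) = R *v e (t, x))"
  using R(1) by (intro exI[of _ R]) (auto simp: rotation_matrix_def)
qed

end
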